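(* Suppose that $(\bm{u},p)\in \bm{H}^1_E\times M$ is the weak solution of the Herrmann mixed formulation, i.e. $a(\bm{u},\bm{v})+b(\bm{v},p)=f(\bm{v})$ for all $\bm{v}\in\bm{H}^1_{E_0}$ and $b(\bm{u},q)-c(p,q)=0$ for all $q\in M$, and that $(\bm{u}_h,p_h)\in\bm{X}^h_E\times M^h$ is a conforming mixed approximation, i.e. $a(\bm{u}_h,\bm{v}_h)+b(\bm{v}_h,p_h)=f(\bm{v}_h)$ for all $\bm{v}_h\in\bm{X}^h_0$ and $b(\bm{u}_h,q_h)-c(p_h,q_h)=0$ for all $q_h\in M^h$. Let $\eta$ be the residual error estimator and $\Theta$ the data oscillation term. Then $$|||(\bm{u}-\bm{u}_h,\,p-p_h)|||\lesssim \eta+\Theta .$$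
   Context: Setting. $\Omega\subset\mathbb{R}^2$ is a bounded Lipschitz polygon with boundary $\Gamma=\Gamma_D\cup\Gamma_N$, $\Gamma_D\cap\Gamma_N=\emptyset$. The Lamé coefficients are constants $\mu,\lambda$ with $0<\mu_1<\mu<\mu_2<\infty$ and $0<\lambda<\infty$. $\bm{f}\in L^2(\Omega)^2$, and the boundary datum $\bm{g}$ on $\Gamma_D$ is the trace of an $\bm{H}^1(\Omega)$ function and a polynomial of degree at most two in each component. Put $\bm{H}^1_E=\{\bm{v}\in H^1(\Omega)^2:\bm{v}|_{\Gamma_D}=\bm{g}\}$, $\bm{H}^1_{E_0}=\{\bm{v}\in H^1(\Omega)^2:\bm{v}|_{\Gamma_D}=\bm{0}\}$, $M=L^2(\Omega)$, $\bm{\varepsilon}(\bm{u})=\frac12(\nabla\bm{u}+(\nabla\bm{u})^\top)$, and $$a(\bm{u},\bm{v})=2\mu\int_\Omega\bm{\varepsilon}(\bm{u}):\bm{\varepsilon}(\bm{v}),\quad b(\bm{v},p)=-\int_\Omega p\,\nabla\cdot\bm{v},\quad c(p,q)=\frac1\lambda\int_\Omega pq,\quad f(\bm{v})=\int_\Omega\bm{f}\cdot\bm{v}.$$ Standing estimates: there are constants $C_K,C_\Omega>0$ (independent of $\mu,\lambda$) such that $a(\bm{v},\bm{v})\ge C_K\,2\mu\|\nabla\bm{v}\|_0^2$ for all $\bm{v}\in\bm{H}^1_{E_0}$ (Korn) and $\inf_{0\ne q\in M}\sup_{0\ne\bm{v}\in\bm{H}^1_{E_0}} \frac{b(\bm{v},q)}{\|\nabla\bm{v}\|_0\|q\|_0}\ge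 C_\Omega$ (inf-sup). Discretization. $\{\mathcal{T}_h\}$ is a family of shape-regular conforming meshes of $\bar\Omega$ into rectangles $K$ of diameter $h_K$, with $\Gamma_D$ and $\Gamma_N$ unions of element edges; $\mathcal{E}_h$ is the set of edges and $h_E$ is the length of $E\in\mathcal{E}_h$. $\bm{X}^h_E\subset\bm{H}^1_E$, $\bm{X}^h_0\subset\bm{H}^1_{E_0}$ and $M^h\subset M$ are finite element sets of piecewise polynomial functions on $\mathcal{T}_h$ of fixed degree, where $\bm{X}^h_0$ is a linear space, $M^h$ is a linear space, and $\bm{X}^h_E$ consists of the functions in $\bm{X}^h_0$ shifted by a fixed finite element interpolant of the boundary data $\bm{g}$. $\bm{X}^h_0$ contains the continuous piecewise bilinear vector fields vanishing on $\Gamma_D$ (so that Clément quasi-interpolation into $\bm{X}^h_0$ is available). Energy norm: $|||(\bm{u},p)|||^2=2\mu\|\nabla\bm{u}\|_0^2+(2\mu)^{-1}\|p\|_0^2+\lambda^{-1}\|p\|_0^2$, where $\|\cdot\|_{0,\omega}$ is the $L^2(\omega)$ norm and $\|\cdot\|_0=\|\cdot\|_{0,\Omega}$. Estimator. Let $\bm{f}_h$ be a (possibly discontinuous) piecewise polynomial approximation of $\bm{f}$ on $\mathcal{T}_h$ (of fixed degree). Let $\rho_K=\frac12h_K(2\mu)^{-1/2}$, $\rho_E=\frac12h_E(2\mu)^{-1}$, $\rho_d=(\lambda^{-1}+(2\mu)^{-1})^{-1}$. Element residuals: the vector $\bm{R}_K=\{\bm{f}_h+\nabla\cdot(2\mu\bm{\varepsilon}(\bm{u}_h))-\nabla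 p_h\}|_K$ and the scalar $R_K=\{\nabla\cdot\bm{u}_h+\frac1\lambda p_h\}|_K$. Edge residual: $\bm{R}_E=\frac12[\![(p_h\bm{I}-2\mu\bm{\varepsilon}(\bm{u}_h))\bm{n}]\!]_E$ for edges $E$ not on $\Gamma$, $\bm{R}_E=((p_h\bm{I}-2\mu\bm{\varepsilon}(\bm{u}_h))\bm{n})|_E$ for $E\subset\Gamma_N$, and $\bm{R}_E=\bm{0}$ for $E\subset\Gamma_D$; here $\bm{I}$ is the $2\times2$ identity, $\bm{n}$ is the unit normal (outward on $\Gamma$) and $[\![\cdot\,\bm{n}]\!]_E$ is the jump of the normal component across $E$ (sum over the two adjacent elements using their outward normals). Then $$\eta_K^2=\rho_K^2\|\bm{R}_K\|_{0,K}^2+\rho_d\|R_K\|_{0,K}^2+\sum_{E\in\partial K}\rho_E\|\bm{R}_E\|_{0,E}^2,\qquad \Theta_K^2=\rho_K^2\|\bm{f}-\bm{f}_h\|_{0,K}^2,$$ $$\eta=\Big(\sum_{K\in\mathcal{T}_h}\eta_K^2\Big)^{1/2},\qquad \Theta=\Big(\sum_{K\in\mathcal{T}_h}\Theta_K^2\Big)^{1/2}.$$ Convention: $A\lesssim B$ means $A\le CB$ with a constant $C>0$ independent of the mesh parameters $h_K,h_E$ and of the Lamé coefficients $\mu,\lambda$ (it may depend on $\Omega$, $\Gamma_D$, $\Gamma_N$, the constants $C_K,C_\Omega$, shape regularity, and the fixed polynomial degrees). *)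

theory Defs
  imports "HOL-Analysis.Analysis" "HOL-Library.Extended_Real"
begin

type_synonym R2 = "real^2"
type_synonym vfield = "R2 \<Rightarrow> R2"
type_synonym sfield = "R2 \<Rightarrow> real"
type_synonym mfield = "R2 \<Rightarrow> real^2^2"

section \<open>Lebesgue and Sobolev spaces\<close>

text \<open>Elements of function spaces are represented by functions on the whole plane; only their
  values on the domain matter, up to null sets.\<close>

definition in_L2 :: "'m measure \<Rightarrow> ('m \<Rightarrow> 'b::{real_normed_vector}) \<Rightarrow> bool" where
  "in_L2 M f \<longleftrightarrow> f \<in> borel_measurable M \<and> integrable M (\<lambda>x. (norm (f x))\<^sup>2)"

definition L2_norm :: "'m measure \<Rightarrow> ('m \<Rightarrow> 'b::real_normed_vector) \<Rightarrow> real" where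
  "L2_norm M f = sqrt (\<integral>x. (norm (f x))\<^sup>2 \<partial>M)"

primrec Ck :: "nat \<Rightarrow> ('a::euclidean_space \<Rightarrow> 'b::real_normed_vector) \<Rightarrow> bool" where
  "Ck 0 = (\<lambda>f. continuous_on UNIV f)"
| "Ck (Suc k) = (\<lambda>f. (\<forall>x. f differentiable (at x)) \<and>
      (\<forall>b\<in>Basis. Ck k (\<lambda>x. frechet_derivative f (at x) b)))"

definition smooth :: "('a::euclidean_space \<Rightarrow> 'b::real_normed_vector) \<Rightarrow> bool" where
  "smooth f \<longleftrightarrow> (\<forall>k. Ck k f)"

definition test_function :: "R2 set \<Rightarrow> sfield \<Rightarrow> bool" where
  "test_function \<Omega> \<phi> \<longleftrightarrow> smooth \<phi> \<and> compact (closure {x. \<phi> x \<noteq> 0}) \<and> closure {x. \<phi> x \<noteq> 0} \<subseteq> \<Omega>"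

text \<open>The gradient of a vector field is the matrix with entry \<open>\<partial>\<^sub>j u\<^sub>i\<close> in row \<open>i\<close>, column \<open>j\<close>
  (as in \<open>jacobian\<close>); norm and inner product on \<open>real^2^2\<close> are those of Frobenius.\<close>

definition has_weak_grad :: "R2 set \<Rightarrow> vfield \<Rightarrow> mfield \<Rightarrow> bool" where
  "has_weak_grad \<Omega> u G \<longleftrightarrow> in_L2 (lebesgue_on \<Omega>) G \<and>
     (\<forall>\<phi> i j. test_function \<Omega> \<phi> \<longrightarrow>
        (\<integral>x. u x $ i * frechet_derivative \<phi> (at x) (axis j 1) \<partial>lebesgue_on \<Omega>)
          = - (\<integral>x. G x $ i $ j * \<phi> x \<partial>lebesgue_on \<Omega>))"

definition H1 :: "R2 set \<Rightarrow> vfield set" where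
  "H1 \<Omega> = {u. in_L2 (lebesgue_on \<Omega>) u \<and> (\<exists>G. has_weak_grad \<Omega> u G)}"

definition wgrad :: "R2 set \<Rightarrow> vfield \<Rightarrow> mfield" where
  "wgrad \<Omega> u = (SOME G. has_weak_grad \<Omega> u G)"

definition H1_norm :: "R2 set \<Rightarrow> vfield \<Rightarrow> real" where
  "H1_norm \<Omega> u =
     sqrt ((L2_norm (lebesgue_on \<Omega>) u)\<^sup>2 + (L2_norm (lebesgue_on \<Omega>) (wgrad \<Omega> u))\<^sup>2)"

section \<open>Polygons and boundary traces\<close>

definition lipschitz_domain :: "R2 set \<Rightarrow> bool" where
  "lipschitz_domain \<Omega> \<longleftrightarrow> open \<Omega> \<and> connected \<Omega> \<and> \<Omega> \<noteq> {} \<and>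
     (\<forall>x\<in>frontier \<Omega>. \<exists>e e' :: R2. \<exists>r>0. \<exists>L. \<exists>\<phi> :: real \<Rightarrow> real.
        norm e = 1 \<and> norm e' = 1 \<and> e \<bullet> e' = 0 \<and> lipschitz_on L UNIV \<phi> \<and>
        \<Omega> \<inter> ball x r = {y \<in> ball x r. \<phi> (y \<bullet> e) < y \<bullet> e'})"

definition bounded_lipschitz_polygon :: "R2 set \<Rightarrow> bool" where
  "bounded_lipschitz_polygon \<Omega> \<longleftrightarrow> bounded \<Omega> \<and> lipschitz_domain \<Omega> \<and>
     (\<exists>S :: (R2 \<times> R2) set. finite S \<and> frontier \<Omega> = (\<Union>(a, b)\<in>S. closed_segment a b))"

text \<open>Arc length on a segment.\<close>

definition segment_measure :: "R2 \<Rightarrow> R2 \<Rightarrow> R2 measure" where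
  "segment_measure a b = distr (lebesgue_on {0..dist a b}) (restrict_space borel (closed_segment a b))
     (\<lambda>s. a + (s / dist a b) *\<^sub>R (b - a))"

text \<open>The two possible orderings of the endpoints give the same measure.\<close>

definition edge_measure :: "R2 set \<Rightarrow> R2 measure" where
  "edge_measure E = (SOME M. \<exists>a b. E = closed_segment a b \<and> M = segment_measure a b)"

text \<open>The trace operator is the continuous extension to \<open>H1\<close> of the restriction of smooth
  functions to the boundary.  The boundary being a finite union of segments, convergence in
  \<open>L\<^sup>2\<close> of the boundary is convergence in \<open>L\<^sup>2\<close> of every segment contained in it.\<close>

definition has_trace :: "R2 set \<Rightarrow> vfield \<Rightarrow> vfield \<Rightarrow> bool" where
  "has_trace \<Omega> v w \<longleftrightarrow>
     (\<forall>a b. closed_segment a b \<subseteq> frontier \<Omega> \<longrightarrow> in_L2 (segment_measure a b) w) \<and>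
     (\<exists>\<phi> :: nat \<Rightarrow> vfield. (\<forall>n. smooth (\<phi> n)) \<and>
        (\<lambda>n. H1_norm \<Omega> (\<lambda>x. \<phi> n x - v x)) \<longlonglongrightarrow> 0 \<and>
        (\<forall>a b. closed_segment a b \<subseteq> frontier \<Omega> \<longrightarrow>
           (\<lambda>n. L2_norm (segment_measure a b) (\<lambda>x. \<phi> n x - w x)) \<longlonglongrightarrow> 0))"

text \<open>\<open>v = g\<close> on the part \<open>\<Gamma>D\<close> of the boundary, in the sense of traces.\<close>

definition trace_eq_on :: "R2 set \<Rightarrow> R2 set \<Rightarrow> vfield \<Rightarrow> vfield \<Rightarrow> bool" where
  "trace_eq_on \<Omega> \<Gamma>D v g \<longleftrightarrow> (\<exists>w. has_trace \<Omega> v w \<and>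
     (\<forall>a b. closed_segment a b \<subseteq> frontier \<Omega> \<longrightarrow>
        (AE x in segment_measure a b. x \<in> \<Gamma>D \<longrightarrow> w x = g x)))"

definition H1_E :: "R2 set \<Rightarrow> R2 set \<Rightarrow> vfield \<Rightarrow> vfield set" where
  "H1_E \<Omega> \<Gamma>D g = {v \<in> H1 \<Omega>. trace_eq_on \<Omega> \<Gamma>D v g}"

abbreviation H1_E0 :: "R2 set \<Rightarrow> R2 set \<Rightarrow> vfield set" where
  "H1_E0 \<Omega> \<Gamma>D \<equiv> H1_E \<Omega> \<Gamma>D (\<lambda>x. 0)"

text \<open>Polynomials in two variables of total degree at most \<open>k\<close>, with scalar or vector coefficients.\<close>

definition poly2 :: "nat \<Rightarrow> (R2 \<Rightarrow> 'b::real_vector) \<Rightarrow> bool" where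
  "poly2 k P \<longleftrightarrow> (\<exists>c :: nat \<Rightarrow> nat \<Rightarrow> 'b.
     \<forall>x. P x = (\<Sum>i\<le>k. \<Sum>j\<le>k - i. ((x $ 1) ^ i * (x $ 2) ^ j) *\<^sub>R c i j))"

text \<open>The datum only needs to be quadratic along each straight piece of the Dirichlet boundary;
  this includes the case of a single quadratic polynomial on all of it.\<close>

definition boundary_datum :: "R2 set \<Rightarrow> R2 set \<Rightarrow> vfield \<Rightarrow> bool" where
  "boundary_datum \<Omega> \<Gamma>D g \<longleftrightarrow> (\<exists>G\<in>H1 \<Omega>. trace_eq_on \<Omega> \<Gamma>D G g) \<and>
     (\<forall>a b. open_segment a b \<subseteq> \<Gamma>D \<longrightarrow> (\<exists>P. poly2 2 P \<and> (\<forall>x\<in>open_segment a b. g x = P x)))"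

section \<open>The Herrmann mixed formulation\<close>

definition sym_part :: "real^2^2 \<Rightarrow> real^2^2" where
  "sym_part A = (1/2) *\<^sub>R (A + transpose A)"

definition strain :: "R2 set \<Rightarrow> vfield \<Rightarrow> mfield" where
  "strain \<Omega> u = (\<lambda>x. sym_part (wgrad \<Omega> u x))"

definition wdiv :: "R2 set \<Rightarrow> vfield \<Rightarrow> sfield" where
  "wdiv \<Omega> u = (\<lambda>x. trace (wgrad \<Omega> u x))"

definition form_a :: "R2 set \<Rightarrow> real \<Rightarrow> vfield \<Rightarrow> vfield \<Rightarrow> real" where
  "form_a \<Omega> \<mu> u v = 2 * \<mu> * (\<integral>x. strain \<Omega> u x \<bullet> strain \<Omega> v x \<partial>lebesgue_on \<Omega>)"

definition form_b :: "R2 set \<Rightarrow> vfield \<Rightarrow> sfield \<Rightarrow> real" where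
  "form_b \<Omega> v p = - (\<integral>x. p x * wdiv \<Omega> v x \<partial>lebesgue_on \<Omega>)"

definition form_c :: "R2 set \<Rightarrow> real \<Rightarrow> sfield \<Rightarrow> sfield \<Rightarrow> real" where
  "form_c \<Omega> lam p q = (1 / lam) * (\<integral>x. p x * q x \<partial>lebesgue_on \<Omega>)"

definition load :: "R2 set \<Rightarrow> vfield \<Rightarrow> vfield \<Rightarrow> real" where
  "load \<Omega> f v = (\<integral>x. f x \<bullet> v x \<partial>lebesgue_on \<Omega>)"

definition weak_solution ::
  "R2 set \<Rightarrow> R2 set \<Rightarrow> real \<Rightarrow> real \<Rightarrow> vfield \<Rightarrow> vfield \<Rightarrow> vfield \<Rightarrow> sfield \<Rightarrow> bool" where
  "weak_solution \<Omega> \<Gamma>D \<mu> lam f g u p \<longleftrightarrow>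
     u \<in> H1_E \<Omega> \<Gamma>D g \<and> in_L2 (lebesgue_on \<Omega>) p \<and>
     (\<forall>v\<in>H1_E0 \<Omega> \<Gamma>D. form_a \<Omega> \<mu> u v + form_b \<Omega> v p = load \<Omega> f v) \<and>
     (\<forall>q. in_L2 (lebesgue_on \<Omega>) q \<longrightarrow> form_b \<Omega> u q - form_c \<Omega> lam p q = 0)"

definition mixed_approximation ::
  "R2 set \<Rightarrow> real \<Rightarrow> real \<Rightarrow> vfield \<Rightarrow> vfield set \<Rightarrow> vfield set \<Rightarrow> sfield set \<Rightarrow> vfield \<Rightarrow> sfield \<Rightarrow> bool"
  where
  "mixed_approximation \<Omega> \<mu> lam f XE X0 Mh uh ph \<longleftrightarrow>
     uh \<in> XE \<and> ph \<in> Mh \<and>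
     (\<forall>v\<in>X0. form_a \<Omega> \<mu> uh v + form_b \<Omega> v ph = load \<Omega> f v) \<and>
     (\<forall>q\<in>Mh. form_b \<Omega> uh q - form_c \<Omega> lam ph q = 0)"

definition korn_estimate :: "R2 set \<Rightarrow> R2 set \<Rightarrow> real \<Rightarrow> bool" where
  "korn_estimate \<Omega> \<Gamma>D CK \<longleftrightarrow> (\<forall>\<mu>>0. \<forall>v\<in>H1_E0 \<Omega> \<Gamma>D.
     form_a \<Omega> \<mu> v v \<ge> CK * (2 * \<mu>) * (L2_norm (lebesgue_on \<Omega>) (wgrad \<Omega> v))\<^sup>2)"

definition inf_sup_estimate :: "R2 set \<Rightarrow> R2 set \<Rightarrow> real \<Rightarrow> bool" where
  "inf_sup_estimate \<Omega> \<Gamma>D C\<Omega> \<longleftrightarrow>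
     (INF q \<in> {q. in_L2 (lebesgue_on \<Omega>) q \<and> L2_norm (lebesgue_on \<Omega>) q \<noteq> 0}.
      SUP v \<in> {v \<in> H1_E0 \<Omega> \<Gamma>D. L2_norm (lebesgue_on \<Omega>) v \<noteq> 0}.
        ereal (form_b \<Omega> v q /
          (L2_norm (lebesgue_on \<Omega>) (wgrad \<Omega> v) * L2_norm (lebesgue_on \<Omega>) q))) \<ge> ereal C\<Omega>"

definition energy_norm :: "R2 set \<Rightarrow> real \<Rightarrow> real \<Rightarrow> vfield \<Rightarrow> sfield \<Rightarrow> real" where
  "energy_norm \<Omega> \<mu> lam u p = sqrt
     (2 * \<mu> * (L2_norm (lebesgue_on \<Omega>) (wgrad \<Omega> u))\<^sup>2
      + inverse (2 * \<mu>) * (L2_norm (lebesgue_on \<Omega>) p)\<^sup>2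
      + inverse lam * (L2_norm (lebesgue_on \<Omega>) p)\<^sup>2)"

section \<open>Meshes and finite element spaces\<close>

text \<open>Closed nondegenerate rectangles, of arbitrary orientation.\<close>

definition rectangle :: "R2 \<Rightarrow> R2 \<Rightarrow> R2 \<Rightarrow> R2 set" where
  "rectangle a d e = convex hull {a, a + d, a + e, a + d + e}"

definition is_rectangle :: "R2 set \<Rightarrow> bool" where
  "is_rectangle K \<longleftrightarrow> (\<exists>a d e. d \<noteq> 0 \<and> e \<noteq> 0 \<and> d \<bullet> e = 0 \<and> K = rectangle a d e)"

definition conforming_mesh :: "R2 set \<Rightarrow> R2 set set \<Rightarrow> bool" where
  "conforming_mesh \<Omega> T \<longleftrightarrow> finite T \<and> (\<forall>K\<in>T. is_rectangle K) \<and> \<Union>T = closure \<Omega> \<and>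
     (\<forall>K\<in>T. \<forall>K'\<in>T. (K \<inter> K') face_of K \<and> (K \<inter> K') face_of K')"

definition shape_regular :: "real \<Rightarrow> R2 set set \<Rightarrow> bool" where
  "shape_regular \<kappa> T \<longleftrightarrow> (\<forall>K\<in>T. \<exists>x. \<exists>r>0. cball x r \<subseteq> K \<and> diameter K \<le> \<kappa> * r)"

text \<open>\<open>\<Gamma>D\<close> and \<open>\<Gamma>N\<close> are disjoint, so they can be unions of edges only up to edge endpoints: every
  boundary edge belongs, without its endpoints, to one of them, and each of them is covered by
  the closed edges that belong to it.\<close>

definition boundary_edges :: "R2 set \<Rightarrow> R2 set set \<Rightarrow> R2 set set" where
  "boundary_edges \<Omega> T = {E. E \<subseteq> frontier \<Omega> \<and> (\<exists>K\<in>T. E edge_of K)}"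

definition boundary_fitted :: "R2 set \<Rightarrow> R2 set \<Rightarrow> R2 set \<Rightarrow> R2 set set \<Rightarrow> bool" where
  "boundary_fitted \<Omega> \<Gamma>D \<Gamma>N T \<longleftrightarrow>
     (\<forall>E\<in>boundary_edges \<Omega> T. rel_interior E \<subseteq> \<Gamma>D \<or> rel_interior E \<subseteq> \<Gamma>N) \<and>
     \<Gamma>D \<subseteq> \<Union>{E \<in> boundary_edges \<Omega> T. rel_interior E \<subseteq> \<Gamma>D} \<and>
     \<Gamma>N \<subseteq> \<Union>{E \<in> boundary_edges \<Omega> T. rel_interior E \<subseteq> \<Gamma>N}"

definition pw_poly :: "R2 set set \<Rightarrow> nat \<Rightarrow> (R2 \<Rightarrow> 'b::real_vector) \<Rightarrow> bool" where
  "pw_poly T k v \<longleftrightarrow> (\<forall>K\<in>T. \<exists>P. poly2 k P \<and> (\<forall>x\<in>interior K. v x = P x))"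

text \<open>Bilinear in the coordinates along the sides of the rectangle.\<close>

definition bilinear_on_rectangle :: "R2 set \<Rightarrow> (R2 \<Rightarrow> 'b::real_vector) \<Rightarrow> bool" where
  "bilinear_on_rectangle K w \<longleftrightarrow> (\<exists>a d e. d \<noteq> 0 \<and> e \<noteq> 0 \<and> d \<bullet> e = 0 \<and> K = rectangle a d e \<and>
     (\<exists>c0 c1 c2 c3. \<forall>s\<in>{0..1}. \<forall>t\<in>{0..1}.
        w (a + s *\<^sub>R d + t *\<^sub>R e) = c0 + s *\<^sub>R c1 + t *\<^sub>R c2 + (s * t) *\<^sub>R c3))"

definition linear_space :: "(R2 \<Rightarrow> 'b::real_vector) set \<Rightarrow> bool" where
  "linear_space V \<longleftrightarrow> (\<lambda>x. 0) \<in> V \<and> (\<forall>v\<in>V. \<forall>w\<in>V. (\<lambda>x. v x + w x) \<in> V) \<and>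
     (\<forall>c. \<forall>v\<in>V. (\<lambda>x. c *\<^sub>R v x) \<in> V)"

definition fe_spaces ::
  "R2 set \<Rightarrow> R2 set \<Rightarrow> R2 set set \<Rightarrow> nat \<Rightarrow> nat \<Rightarrow> vfield \<Rightarrow> vfield set \<Rightarrow> vfield set \<Rightarrow> sfield set \<Rightarrow> bool"
  where
  "fe_spaces \<Omega> \<Gamma>D T kX kM g XE X0 Mh \<longleftrightarrow>
     linear_space X0 \<and> X0 \<subseteq> H1_E0 \<Omega> \<Gamma>D \<and> (\<forall>v\<in>X0. pw_poly T kX v) \<and>
     (\<forall>w. continuous_on (closure \<Omega>) w \<and> (\<forall>K\<in>T. bilinear_on_rectangle K w) \<and> (\<forall>x\<in>\<Gamma>D. w x = 0)
        \<longrightarrow> (\<exists>v\<in>X0. AE x in lebesgue_on \<Omega>. v x = w x)) \<and>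
     linear_space Mh \<and> (\<forall>q\<in>Mh. in_L2 (lebesgue_on \<Omega>) q \<and> pw_poly T kM q) \<and>
     XE \<subseteq> H1_E \<Omega> \<Gamma>D g \<and>
     (\<exists>gh. pw_poly T kX gh \<and> XE = (\<lambda>v x. gh x + v x) ` X0)"

section \<open>The residual error estimator\<close>

text \<open>Derivatives of finite element functions are taken elementwise, in the classical sense, in
  the interior of an element; boundary values are limits from the interior of that element.\<close>

definition cstrain :: "vfield \<Rightarrow> mfield" where
  "cstrain u = (\<lambda>x. sym_part (jacobian u (at x)))"

definition cdiv :: "vfield \<Rightarrow> sfield" where
  "cdiv u = (\<lambda>x. trace (jacobian u (at x)))"

definition cgrad :: "sfield \<Rightarrow> vfield" where
  "cgrad p = (\<lambda>x. \<chi> j. frechet_derivative p (at x) (axis j 1))"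

definition cdiv_mat :: "mfield \<Rightarrow> vfield" where
  "cdiv_mat \<sigma> = (\<lambda>x. \<chi> i. \<Sum>j\<in>UNIV. frechet_derivative \<sigma> (at x) (axis j 1) $ i $ j)"

definition value_from :: "R2 set \<Rightarrow> (R2 \<Rightarrow> 'b::t2_space) \<Rightarrow> R2 \<Rightarrow> 'b" where
  "value_from K F x = Lim (at x within interior K) F"

definition outward_normal :: "R2 set \<Rightarrow> R2 set \<Rightarrow> R2" where
  "outward_normal K E = (THE n. norm n = 1 \<and> (\<forall>x\<in>E. \<forall>y\<in>K. n \<bullet> (y - x) \<le> 0))"

definition elem_residual :: "real \<Rightarrow> vfield \<Rightarrow> vfield \<Rightarrow> sfield \<Rightarrow> vfield" where
  "elem_residual \<mu> fh uh ph =
     (\<lambda>x. fh x + cdiv_mat (\<lambda>y. (2 * \<mu>) *\<^sub>R cstrain uh y) x - cgrad ph x)"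

definition div_residual :: "real \<Rightarrow> vfield \<Rightarrow> sfield \<Rightarrow> sfield" where
  "div_residual lam uh ph = (\<lambda>x. cdiv uh x + (1 / lam) * ph x)"

definition normal_flux :: "real \<Rightarrow> vfield \<Rightarrow> sfield \<Rightarrow> R2 set \<Rightarrow> R2 set \<Rightarrow> vfield" where
  "normal_flux \<mu> uh ph K E =
     (\<lambda>x. value_from K (\<lambda>y. mat (ph y) - (2 * \<mu>) *\<^sub>R cstrain uh y) x *v outward_normal K E)"

text \<open>The sum runs over two elements for an interior edge and over a single one for a boundary edge.\<close>

definition edge_residual ::
  "R2 set \<Rightarrow> R2 set \<Rightarrow> R2 set set \<Rightarrow> real \<Rightarrow> vfield \<Rightarrow> sfield \<Rightarrow> R2 set \<Rightarrow> vfield" where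
  "edge_residual \<Omega> \<Gamma>N T \<mu> uh ph E = (\<lambda>x.
     (if \<not> E \<subseteq> frontier \<Omega> then 1/2 else if rel_interior E \<subseteq> \<Gamma>N then 1 else 0) *\<^sub>R
     (\<Sum>K\<in>{K\<in>T. E edge_of K}. normal_flux \<mu> uh ph K E x))"

definition rho_K :: "real \<Rightarrow> R2 set \<Rightarrow> real" where
  "rho_K \<mu> K = (1/2) * diameter K / sqrt (2 * \<mu>)"

definition rho_E :: "real \<Rightarrow> R2 set \<Rightarrow> real" where
  "rho_E \<mu> E = (1/2) * diameter E / (2 * \<mu>)"

definition rho_d :: "real \<Rightarrow> real \<Rightarrow> real" where
  "rho_d \<mu> lam = inverse (inverse lam + inverse (2 * \<mu>))"

definition eta_K_sq :: "R2 set \<Rightarrow> R2 set \<Rightarrow> R2 set set \<Rightarrow> real \<Rightarrow> real \<Rightarrow> vfield \<Rightarrow> vfield \<Rightarrow> sfield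
    \<Rightarrow> R2 set \<Rightarrow> real" where
  "eta_K_sq \<Omega> \<Gamma>N T \<mu> lam fh uh ph K =
     (rho_K \<mu> K)\<^sup>2 * (L2_norm (lebesgue_on K) (elem_residual \<mu> fh uh ph))\<^sup>2
     + rho_d \<mu> lam * (L2_norm (lebesgue_on K) (div_residual lam uh ph))\<^sup>2
     + (\<Sum>E\<in>{E. E edge_of K}.
          rho_E \<mu> E * (L2_norm (edge_measure E) (edge_residual \<Omega> \<Gamma>N T \<mu> uh ph E))\<^sup>2)"

definition Theta_K_sq :: "real \<Rightarrow> vfield \<Rightarrow> vfield \<Rightarrow> R2 set \<Rightarrow> real" where
  "Theta_K_sq \<mu> f fh K = (rho_K \<mu> K)\<^sup>2 * (L2_norm (lebesgue_on K) (\<lambda>x. f x - fh x))\<^sup>2"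

definition eta :: "R2 set \<Rightarrow> R2 set \<Rightarrow> R2 set set \<Rightarrow> real \<Rightarrow> real \<Rightarrow> vfield \<Rightarrow> vfield \<Rightarrow> sfield \<Rightarrow> real"
  where
  "eta \<Omega> \<Gamma>N T \<mu> lam fh uh ph = sqrt (\<Sum>K\<in>T. eta_K_sq \<Omega> \<Gamma>N T \<mu> lam fh uh ph K)"

definition Theta :: "R2 set set \<Rightarrow> real \<Rightarrow> vfield \<Rightarrow> vfield \<Rightarrow> real" where
  "Theta T \<mu> f fh = sqrt (\<Sum>K\<in>T. Theta_K_sq \<mu> f fh K)"

end

theory Submission
  imports Defs
begin

text \<open>
  Testing the error equations with the error itself and using Korn's inequality and the inf-sup
  condition bounds the energy norm by the dual norm of the momentum residual and by the divergence
  residual; Young's inequality absorbs the error terms, and all weights are such that \<open>\<mu>\<close> and \<open>\<lambda>\<close>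
  cancel. The divergence residual is a part of \<open>\<eta>\<close>. For the momentum residual, Galerkin
  orthogonality allows subtracting a bilinear quasi-interpolant, and elementwise integration by parts
  produces the element and edge residuals.

  The quasi-interpolant is built for smooth fields only: every function in \<open>H1_E0\<close> is by definition of
  the trace a limit of smooth fields with small traces on \<open>\<Gamma>D\<close>, so the residual is estimated for these
  and the bound passes to the limit. Poincare and trace inequalities on single rectangles then suffice,
  with element means compared along chains of elements that share an edge.
\<close>

section \<open>Square-integrable functions\<close>

text \<open>Robustness for large \<lambda>, where the pressure form loses its coercivity, comes from
  bounding the pressure error through the momentum equation: the inf-sup condition estimates it by
  the velocity error and the residual. The weight \<open>rho_d\<close> is the inverse of 1/\<lambda>
  + 1/(2\<mu>), which is what the product of divergence residual and pressure error needs when the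
  pressure error is measured in both parts of the energy norm. The smooth fields that approximate a
  function of \<open>H1_E0\<close> violate the boundary condition. Interpolating them on a fixed
  mesh produces extra terms containing \<open>card T\<close>, the jumps on Dirichlet edges and norms
  of the discrete solution. None of these is uniform in the mesh, but each multiplies a null
  sequence and disappears in the limit before the constant is read off. Patches around a vertex come
  in no fixed shape, so no reference patch is available for a Poincare inequality. What replaces it
  is a bound on the number of elements at a vertex, obtained by comparing areas, and the existence
  of chains of edge neighbours, obtained from the local graph property of the boundary.\<close>

lemma in_L2_measurable [measurable_dest]: "in_L2 M f \<Longrightarrow> f \<in> borel_measurable M"
  and in_L2_integrable: "in_L2 M f \<Longrightarrow> integrable M (\<lambda>x. (norm (f x))\<^sup>2)"
  by (simp_all add: in_L2_def)

lemma L2_norm_nonneg [simp]: "0 \<le> L2_norm M f"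
  by (simp add: L2_norm_def)

lemma L2_norm_sq: "(L2_norm M f)\<^sup>2 = (\<integral>x. (norm (f x))\<^sup>2 \<partial>M)"
  by (simp add: L2_norm_def)

lemma L2_norm_cong: "(\<And>x. x \<in> space M \<Longrightarrow> norm (f x) = norm (g x)) \<Longrightarrow> L2_norm M f = L2_norm M g"
  unfolding L2_norm_def by (metis (mono_tags, lifting) Bochner_Integration.integral_cong)

lemma in_L2_dominated:
  fixes f :: "'m \<Rightarrow> 'b::euclidean_space" and g :: "'m \<Rightarrow> 'c::euclidean_space"
  assumes g: "in_L2 M g" and f: "f \<in> borel_measurable M"
    and le: "AE x in M. norm (f x) \<le> c * norm (g x)"
  shows "in_L2 M f"
  unfolding in_L2_def
proof (intro conjI f)
  show "integrable M (\<lambda>x. (norm (f x))\<^sup>2)"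
  proof (rule Bochner_Integration.integrable_bound)
    show "integrable M (\<lambda>x. c\<^sup>2 * (norm (g x))\<^sup>2)"
      using in_L2_integrable[OF g] by simp
    show "AE x in M. norm ((norm (f x))\<^sup>2) \<le> norm (c\<^sup>2 * (norm (g x))\<^sup>2)"
      using le by eventually_elim (simp flip: power_mult_distrib add: power_mono)
  qed (use f in measurable)
qed

text \<open>If the squared norm of \<open>f\<close> is not integrable, the left-hand side is 0 by
  the convention for the Bochner integral, so the comparison of integrals covers that case as
  well.\<close>

lemma L2_norm_dominated:
  fixes f :: "'m \<Rightarrow> 'b::real_normed_vector" and g :: "'m \<Rightarrow> 'c::euclidean_space"
  assumes g: "in_L2 M g" and c: "0 \<le> c" and le: "AE x in M. norm (f x) \<le> c * norm (g x)"
  shows "L2_norm M f \<le> c * L2_norm M g"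
proof -
  have "(\<integral>x. (norm (f x))\<^sup>2 \<partial>M) \<le> (\<integral>x. c\<^sup>2 * (norm (g x))\<^sup>2 \<partial>M)"
  proof (rule integral_mono_AE')
    show "integrable M (\<lambda>x. c\<^sup>2 * (norm (g x))\<^sup>2)"
      using in_L2_integrable[OF g] by simp
    show "AE x in M. (norm (f x))\<^sup>2 \<le> c\<^sup>2 * (norm (g x))\<^sup>2"
      using le by eventually_elim (simp flip: power_mult_distrib add: power_mono)
  qed simp
  then have "(L2_norm M f)\<^sup>2 \<le> (c * L2_norm M g)\<^sup>2"
    by (simp add: L2_norm_sq power_mult_distrib)
  then show ?thesis
    using c by (meson L2_norm_nonneg mult_nonneg_nonneg power2_le_imp_le)
qed

lemma in_L2_scaleR:
  fixes f :: "'m \<Rightarrow> 'b::euclidean_space"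
  shows "in_L2 M f \<Longrightarrow> in_L2 M (\<lambda>x. c *\<^sub>R f x)"
  by (rule in_L2_dominated[where c="\<bar>c\<bar>" and g=f]) (auto dest: in_L2_measurable)

lemma in_L2_minus:
  fixes f :: "'m \<Rightarrow> 'b::euclidean_space"
  shows "in_L2 M f \<Longrightarrow> in_L2 M (\<lambda>x. - f x)"
  by (rule in_L2_dominated[where c=1 and g=f]) (auto dest: in_L2_measurable)

lemma in_L2_linear:
  fixes f :: "'m \<Rightarrow> 'b::euclidean_space" and L :: "'b \<Rightarrow> 'c::euclidean_space"
  assumes "bounded_linear L" "in_L2 M f"
  shows "in_L2 M (\<lambda>x. L (f x))"
proof -
  interpret L: bounded_linear L by fact
  obtain K where K: "\<And>x. norm (L x) \<le> K * norm x"
    using L.bounded by (metis mult.commute)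
  show ?thesis
  proof (rule in_L2_dominated[OF assms(2)])
    show "(\<lambda>x. L (f x)) \<in> borel_measurable M"
      using in_L2_measurable[OF assms(2)] borel_measurable_continuous_onI[OF L.continuous_on[OF continuous_on_id]]
      by (rule measurable_compose)
  qed (use K in auto)
qed

lemma in_L2_inner_integrable:
  fixes f g :: "'m \<Rightarrow> 'b::euclidean_space"
  assumes f: "in_L2 M f" and g: "in_L2 M g"
  shows "integrable M (\<lambda>x. f x \<bullet> g x)"
proof (rule Bochner_Integration.integrable_bound)
  show "integrable M (\<lambda>x. (norm (f x))\<^sup>2 + (norm (g x))\<^sup>2)"
    using f g by (auto intro: in_L2_integrable)
  show "AE x in M. norm (f x \<bullet> g x) \<le> norm ((norm (f x))\<^sup>2 + (norm (g x))\<^sup>2)"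
  proof (rule AE_I2)
    fix x
    have "\<bar>f x \<bullet> g x\<bar> \<le> norm (f x) * norm (g x)"
      by (rule Cauchy_Schwarz_ineq2)
    also have "\<dots> \<le> (norm (f x))\<^sup>2 + (norm (g x))\<^sup>2"
      using sum_squares_bound[of "norm (f x)" "norm (g x)"] mult_nonneg_nonneg[OF norm_ge_zero[of "f x"] norm_ge_zero[of "g x"]]
      by linarith
    finally show "norm (f x \<bullet> g x) \<le> norm ((norm (f x))\<^sup>2 + (norm (g x))\<^sup>2)"
      by simp
  qed
qed (use f g in measurable)

lemma in_L2_mult_integrable:
  fixes f g :: "'m \<Rightarrow> real"
  shows "in_L2 M f \<Longrightarrow> in_L2 M g \<Longrightarrow> integrable M (\<lambda>x. f x * g x)"
  using in_L2_inner_integrable[of M f g] by simp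

lemma norm_add_sq: "(norm (a + b))\<^sup>2 = (norm a)\<^sup>2 + 2 * (a \<bullet> b) + (norm b)\<^sup>2"
  for a b :: "'a::real_inner"
  by (simp add: power2_norm_eq_inner inner_add inner_commute)

lemma in_L2_add:
  fixes f g :: "'m \<Rightarrow> 'b::euclidean_space"
  assumes f: "in_L2 M f" and g: "in_L2 M g"
  shows "in_L2 M (\<lambda>x. f x + g x)"
  unfolding in_L2_def norm_add_sq
  using in_L2_inner_integrable[OF f g] in_L2_measurable[OF f] in_L2_measurable[OF g]
    in_L2_integrable[OF f] in_L2_integrable[OF g] by simp

lemma in_L2_diff:
  fixes f g :: "'m \<Rightarrow> 'b::euclidean_space"
  shows "in_L2 M f \<Longrightarrow> in_L2 M g \<Longrightarrow> in_L2 M (\<lambda>x. f x - g x)"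
  using in_L2_add[of M f "\<lambda>x. - g x"] in_L2_minus[of M g] by simp

lemma L2_norm_scaleR: "L2_norm M (\<lambda>x. c *\<^sub>R f x) = \<bar>c\<bar> * L2_norm M f"
  by (simp add: L2_norm_def power_mult_distrib real_sqrt_mult)

lemma L2_norm_minus: "L2_norm M (\<lambda>x. - f x) = L2_norm M f"
  by (simp add: L2_norm_def)

lemma L2_norm_add_sq:
  fixes f g :: "'m \<Rightarrow> 'b::euclidean_space"
  assumes f: "in_L2 M f" and g: "in_L2 M g"
  shows "(L2_norm M (\<lambda>x. f x + g x))\<^sup>2 = (L2_norm M f)\<^sup>2 + 2 * (\<integral>x. f x \<bullet> g x \<partial>M) + (L2_norm M g)\<^sup>2"
  unfolding L2_norm_sq norm_add_sq
  using in_L2_inner_integrable[OF f g] f g by (simp add: in_L2_integrable)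

text \<open>The squared norm of \<open>s f + t g\<close> is a nonnegative quadratic form in
  \<open>s\<close> and \<open>t\<close>; evaluating it at suitable pairs bounds its mixed
  coefficient. No normalisation by the norms is made, since these may be 0.\<close>

lemma L2_Cauchy_Schwarz:
  fixes f g :: "'m \<Rightarrow> 'b::euclidean_space"
  assumes f: "in_L2 M f" and g: "in_L2 M g"
  shows "\<bar>\<integral>x. f x \<bullet> g x \<partial>M\<bar> \<le> L2_norm M f * L2_norm M g"
proof -
  define A B C where "A = (L2_norm M f)\<^sup>2" and "B = (\<integral>x. f x \<bullet> g x \<partial>M)" and "C = (L2_norm M g)\<^sup>2"
  have q: "0 \<le> s\<^sup>2 * A + 2 * (s * t * B) + t\<^sup>2 * C" for s t
    using L2_norm_add_sq[OF in_L2_scaleR[OF f, of s] in_L2_scaleR[OF g, of t]]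
      zero_le_power2[of "L2_norm M (\<lambda>x. s *\<^sub>R f x + t *\<^sub>R g x)"]
    by (simp add: A_def B_def C_def L2_norm_scaleR power_mult_distrib mult_ac)
  have "B\<^sup>2 \<le> A * C"
  proof (cases "C = 0")
    case False
    then have "C > 0" by (simp add: C_def)
    \<comment> \<open>The form at \<open>s = C\<close>, \<open>t = -B\<close> is \<open>C\<close>
      times the discriminant expression.\<close>
    moreover have "0 \<le> C * (A * C - B\<^sup>2)"
      using q[of C "-B"] by (simp add: power2_eq_square algebra_simps)
    ultimately show ?thesis by (simp add: zero_le_mult_iff)
  next
    case True
    have "B = 0"
    proof (rule ccontr)
      assume "B \<noteq> 0"
      \<comment> \<open>For \<open>C = 0\<close> and \<open>s = 1\<close> the form is affine in
        \<open>t\<close>; this \<open>t\<close> makes its value -1.\<close>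
      then have "2 * (- (A + 1) / (2 * B) * B) = - (A + 1)" by simp
      then show False using q[of 1 "- (A + 1) / (2 * B)"] True by simp
    qed
    then show ?thesis using True by simp
  qed
  then have "sqrt (B\<^sup>2) \<le> sqrt (A * C)" by (rule real_sqrt_le_mono)
  then show ?thesis by (simp add: A_def B_def C_def real_sqrt_mult)
qed

lemma L2_norm_triangle:
  fixes f g :: "'m \<Rightarrow> 'b::euclidean_space"
  assumes f: "in_L2 M f" and g: "in_L2 M g"
  shows "L2_norm M (\<lambda>x. f x + g x) \<le> L2_norm M f + L2_norm M g"
proof (rule power2_le_imp_le)
  show "(L2_norm M (\<lambda>x. f x + g x))\<^sup>2 \<le> (L2_norm M f + L2_norm M g)\<^sup>2"
    unfolding L2_norm_add_sq[OF f g] power2_sum using L2_Cauchy_Schwarz[OF f g] by (simp add: abs_le_iff mult.assoc)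
qed simp

lemma L2_norm_triangle_diff:
  fixes f g :: "'m \<Rightarrow> 'b::euclidean_space"
  assumes f: "in_L2 M f" and g: "in_L2 M g"
  shows "L2_norm M (\<lambda>x. f x - g x) \<le> L2_norm M f + L2_norm M g"
  using L2_norm_triangle[OF f in_L2_minus[OF g]] by (simp add: L2_norm_minus)

lemma L2_norm_cong_AE:
  fixes f g :: "'m \<Rightarrow> 'b::euclidean_space"
  assumes "f \<in> borel_measurable M" "g \<in> borel_measurable M" "AE x in M. f x = g x"
  shows "L2_norm M f = L2_norm M g"
  unfolding L2_norm_def
  using assms by (intro arg_cong[where f=sqrt] integral_cong_AE) auto

lemma in_L2_const: "finite_measure M \<Longrightarrow> in_L2 M (\<lambda>x. c)" for c :: "'b::euclidean_space"
  by (simp add: in_L2_def finite_measure.integrable_const)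

section \<open>Square-integrable functions with respect to Lebesgue measure\<close>

text \<open>Lebesgue measure is complete, so almost everywhere equality transfers measurability; the
  restricted measure is treated by extending both functions by 0. This allows representatives to be
  exchanged later.\<close>

lemma measurable_lebesgue_on_AE:
  fixes f :: "'a::euclidean_space \<Rightarrow> 'b::euclidean_space"
  assumes S: "S \<in> sets lebesgue" and f: "f \<in> borel_measurable (lebesgue_on S)"
    and ae: "AE x in lebesgue_on S. f x = g x"
  shows "g \<in> borel_measurable (lebesgue_on S)"
proof -
  have "AE x in lebesgue. x \<in> S \<longrightarrow> f x = g x"
    using ae S by (simp add: AE_restrict_space_iff)
  then have "AE x in lebesgue. (if x \<in> S then f x else 0) = (if x \<in> S then g x else 0)"
    by eventually_elim auto
  then show ?thesis
    using borel_measurable_AE f by (simp flip: borel_measurable_if[OF S])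
qed

lemma in_L2_AE:
  fixes f :: "'a::euclidean_space \<Rightarrow> 'b::euclidean_space"
  assumes S: "S \<in> sets lebesgue" and f: "in_L2 (lebesgue_on S) f"
    and ae: "AE x in lebesgue_on S. f x = g x"
  shows "in_L2 (lebesgue_on S) g"
  by (rule in_L2_dominated[OF f measurable_lebesgue_on_AE[OF S in_L2_measurable[OF f] ae], where c=1])
    (use ae in \<open>auto elim!: eventually_mono\<close>)

lemma L2_norm_AE:
  fixes f :: "'a::euclidean_space \<Rightarrow> 'b::euclidean_space"
  assumes S: "S \<in> sets lebesgue" and f: "in_L2 (lebesgue_on S) f"
    and ae: "AE x in lebesgue_on S. f x = g x"
  shows "L2_norm (lebesgue_on S) f = L2_norm (lebesgue_on S) g"
  by (rule L2_norm_cong_AE[OF in_L2_measurable[OF f] in_L2_measurable[OF in_L2_AE[OF S f ae]] ae])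

lemma in_L2_subset:
  fixes f :: "'a::euclidean_space \<Rightarrow> 'b::euclidean_space"
  assumes f: "in_L2 (lebesgue_on S) f" and T: "T \<subseteq> S" "T \<in> sets lebesgue" and S: "S \<in> sets lebesgue"
  shows "in_L2 (lebesgue_on T) f"
proof -
  have "integrable lebesgue (\<lambda>x. indicator S x *\<^sub>R (norm (f x))\<^sup>2)"
    using in_L2_integrable[OF f] S by (simp add: integrable_restrict_space)
  then have "integrable lebesgue (\<lambda>x. indicator T x *\<^sub>R (indicator S x *\<^sub>R (norm (f x))\<^sup>2))"
    by (rule integrable_mult_indicator[OF T(2)])
  moreover have "(\<lambda>x. indicator T x *\<^sub>R (indicator S x *\<^sub>R (norm (f x))\<^sup>2)) = (\<lambda>x. indicator T x *\<^sub>R (norm (f x))\<^sup>2)"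
    using T by (auto simp: indicator_def fun_eq_iff)
  ultimately have "integrable (lebesgue_on T) (\<lambda>x. (norm (f x))\<^sup>2)"
    using T by (simp add: integrable_restrict_space)
  then show ?thesis
    using f T unfolding in_L2_def by (meson measurable_restrict_mono)
qed

lemma integrable_lebesgue_on_subset:
  fixes f :: "'a::euclidean_space \<Rightarrow> 'b::euclidean_space"
  assumes f: "integrable (lebesgue_on S) f" and T: "T \<subseteq> S" "T \<in> sets lebesgue" and S: "S \<in> sets lebesgue"
  shows "integrable (lebesgue_on T) f"
proof -
  have "integrable lebesgue (\<lambda>x. indicator S x *\<^sub>R f x)"
    using f S by (simp add: integrable_restrict_space)
  then have "integrable lebesgue (\<lambda>x. indicator T x *\<^sub>R (indicator S x *\<^sub>R f x))"
    by (rule integrable_mult_indicator[OF T(2)])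
  moreover have "(\<lambda>x. indicator T x *\<^sub>R (indicator S x *\<^sub>R f x)) = (\<lambda>x. indicator T x *\<^sub>R f x)"
    using T by (auto simp: indicator_def fun_eq_iff)
  ultimately show ?thesis
    using T by (simp add: integrable_restrict_space)
qed

lemma AE_lebesgue_on_subset:
  assumes "AE x in lebesgue_on S. P x" "T \<subseteq> S" "T \<in> sets lebesgue" "S \<in> sets lebesgue"
  shows "AE x in lebesgue_on T. P x"
  using assms by (auto simp: AE_restrict_space_iff elim!: eventually_mono)

lemma continuous_integrable_compact:
  fixes f :: "'a::euclidean_space \<Rightarrow> 'b::euclidean_space"
  assumes "continuous_on S f" "compact S"
  shows "integrable (lebesgue_on S) f"
proof -
  have S: "S \<in> sets lborel" using assms by (simp add: borel_compact)
  have "integrable lborel (\<lambda>x. indicator S x *\<^sub>R f x)"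
    using borel_integrable_compact[OF assms(2,1)] by simp
  then have "integrable lebesgue (\<lambda>x. indicator S x *\<^sub>R f x)"
    by (simp add: integrable_completion borel_measurable_integrable)
  then show ?thesis
    using S by (simp add: integrable_restrict_space)
qed

lemma continuous_in_L2_compact:
  fixes f :: "'a::euclidean_space \<Rightarrow> 'b::euclidean_space"
  assumes "continuous_on S f" "compact S"
  shows "in_L2 (lebesgue_on S) f"
  unfolding in_L2_def
  using assms by (intro conjI borel_measurable_integrable continuous_integrable_compact continuous_intros)

lemma continuous_in_L2_bounded:
  fixes f :: "'a::euclidean_space \<Rightarrow> 'b::euclidean_space"
  assumes "continuous_on UNIV f" "bounded S" "S \<in> sets lebesgue"
  shows "in_L2 (lebesgue_on S) f"
proof (rule in_L2_subset)
  show "in_L2 (lebesgue_on (closure S)) f"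
    using assms by (intro continuous_in_L2_compact) (auto intro: continuous_on_subset)
qed (use assms closure_subset in auto)

section \<open>Calculus of smooth functions\<close>

text \<open>\<open>Ck\<close> refers to the chosen \<open>frechet_derivative\<close>; by uniqueness
  of derivatives it suffices to exhibit one with the usual differentiation rules.\<close>

lemma Ck_SucI:
  assumes "\<And>x. (f has_derivative f' x) (at x)" "\<And>b. b \<in> Basis \<Longrightarrow> Ck k (\<lambda>x. f' x b)"
  shows "Ck (Suc k) f"
proof -
  have "frechet_derivative f (at x) = f' x" for x
    using frechet_derivative_at[OF assms(1)[of x]] by simp
  then show ?thesis
    using assms by (auto simp: differentiable_def)
qed

lemma Ck_SucD:
  assumes "Ck (Suc k) f"
  shows "(f has_derivative frechet_derivative f (at x)) (at x)"
    and "b \<in> Basis \<Longrightarrow> Ck k (\<lambda>x. frechet_derivative f (at x) b)"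
  using assms by (auto simp: frechet_derivative_works)

lemma Ck_continuous: "Ck k f \<Longrightarrow> continuous_on UNIV f"
  by (cases k) (auto simp: continuous_on_eq_continuous_at intro: differentiable_imp_continuous_within)

lemma Ck_Suc_imp: "Ck (Suc k) f \<Longrightarrow> Ck k f"
proof (induction k arbitrary: f)
  case 0
  then show ?case using Ck_continuous by fastforce
next
  case (Suc k)
  show ?case
    by (rule Ck_SucI[OF Ck_SucD(1)[OF Suc.prems]]) (rule Suc.IH[OF Ck_SucD(2)[OF Suc.prems]])
qed

lemma Ck_linear_comp:
  assumes L: "bounded_linear L" and "Ck k f"
  shows "Ck k (\<lambda>x. L (f x))"
  using assms(2)
proof (induction k arbitrary: f)
  case 0
  then show ?case
    using bounded_linear.continuous_on[OF L] by auto
next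
  case (Suc k)
  show ?case
  proof (rule Ck_SucI)
    show "((\<lambda>x. L (f x)) has_derivative (\<lambda>h. L (frechet_derivative f (at x) h))) (at x)" for x
      by (rule bounded_linear.has_derivative[OF L Ck_SucD(1)[OF Suc.prems]])
  qed (rule Suc.IH[OF Ck_SucD(2)[OF Suc.prems]])
qed

lemma Ck_add:
  assumes "Ck k f" "Ck k g"
  shows "Ck k (\<lambda>x. f x + g x)"
  using assms
proof (induction k arbitrary: f g)
  case 0
  then show ?case by (auto intro: continuous_intros)
next
  case (Suc k)
  show ?case
    by (rule Ck_SucI[OF has_derivative_add[OF Ck_SucD(1)[OF Suc.prems(1)] Ck_SucD(1)[OF Suc.prems(2)]]])
      (rule Suc.IH[OF Ck_SucD(2)[OF Suc.prems(1)] Ck_SucD(2)[OF Suc.prems(2)]])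
qed

lemma Ck_const: "Ck k (\<lambda>x. c)"
proof (induction k arbitrary: c)
  case (Suc k)
  show ?case by (rule Ck_SucI[OF has_derivative_const]) (rule Suc.IH)
qed simp

lemma Ck_id: "Ck k (\<lambda>x. x)"
proof (cases k)
  case (Suc k)
  show ?thesis unfolding Suc by (rule Ck_SucI[OF has_derivative_ident]) (rule Ck_const)
qed simp

text \<open>One induction serves products, scalar multiples and inner products. The product rule
  keeps undifferentiated factors, which must be lowered from order \<open>Suc k\<close> to
  \<open>k\<close> by \<open>Ck_Suc_imp\<close>.\<close>

lemma Ck_bilinear:
  assumes P: "bounded_bilinear P" and "Ck k f" "Ck k g"
  shows "Ck k (\<lambda>x. P (f x) (g x))"
  using assms(2,3)
proof (induction k arbitrary: f g)
  case 0
  then show ?case using bounded_bilinear.continuous_on[OF P] by auto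
next
  case (Suc k)
  show ?case
  proof (rule Ck_SucI[OF bounded_bilinear.FDERIV[OF P Ck_SucD(1)[OF Suc.prems(1)] Ck_SucD(1)[OF Suc.prems(2)]]])
    show "Ck k (\<lambda>x. P (f x) (frechet_derivative g (at x) b) + P (frechet_derivative f (at x) b) (g x))" if b: "b \<in> Basis" for b
      by (rule Ck_add[OF Suc.IH[OF Ck_Suc_imp[OF Suc.prems(1)] Ck_SucD(2)[OF Suc.prems(2) b]]
            Suc.IH[OF Ck_SucD(2)[OF Suc.prems(1) b] Ck_Suc_imp[OF Suc.prems(2)]]])
  qed
qed

text \<open>The derivative of the composition in direction \<open>h\<close> is the number
  \<open>l h\<close> times the derivative of \<open>g\<close> composed with the same affine map, so
  the induction hypothesis applies to it.\<close>

lemma Ck_compose_affine: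
  fixes g :: "real \<Rightarrow> 'b::real_normed_vector" and l :: "'a::euclidean_space \<Rightarrow> real"
  assumes l: "bounded_linear l" and "Ck k g"
  shows "Ck k (\<lambda>x. g (l x + c))"
  using assms(2)
proof (induction k arbitrary: g)
  case 0
  have "continuous_on UNIV (\<lambda>x. l x + c)"
    using bounded_linear.continuous_on[OF l continuous_on_id] by (intro continuous_intros)
  with 0 show ?case by (auto intro: continuous_on_compose2)
next
  case (Suc k)
  show ?case
  proof (rule Ck_SucI)
    fix x
    have "((\<lambda>x. l x + c) has_derivative (\<lambda>h. l h + 0)) (at x)"
      by (rule has_derivative_add[OF bounded_linear_imp_has_derivative[OF l] has_derivative_const])
    then have "((\<lambda>x. g (l x + c)) has_derivative (\<lambda>h. frechet_derivative g (at (l x + c)) (l h))) (at x)"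
      using has_derivative_compose[OF _ Ck_SucD(1)[OF Suc.prems], of "\<lambda>x. l x + c" l x UNIV] by simp
    moreover have "frechet_derivative g (at y) (l h) = l h *\<^sub>R frechet_derivative g (at y) 1" for y h
      using linear_scale[OF has_derivative_linear[OF Ck_SucD(1)[OF Suc.prems]], of y "l h" 1] by simp
    ultimately show "((\<lambda>x. g (l x + c)) has_derivative (\<lambda>h. l h *\<^sub>R frechet_derivative g (at (l x + c)) 1)) (at x)"
      by (simp only:)
  next
    show "Ck k (\<lambda>x. l b *\<^sub>R frechet_derivative g (at (l x + c)) 1)" for b
      by (rule Ck_linear_comp[OF bounded_linear_scaleR_right Suc.IH[OF Ck_SucD(2)[OF Suc.prems]]]) simp
  qed
qed

lemma smooth_SucD: "smooth f \<Longrightarrow> b \<in> Basis \<Longrightarrow> smooth (\<lambda>x. frechet_derivative f (at x) b)"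
  using Ck_SucD(2) unfolding smooth_def by blast

lemma smooth_has_derivative: "smooth f \<Longrightarrow> (f has_derivative frechet_derivative f (at x)) (at x)"
  using Ck_SucD(1) unfolding smooth_def by blast

lemma smooth_continuous_on: "smooth f \<Longrightarrow> continuous_on S f"
  using Ck_continuous continuous_on_subset unfolding smooth_def by blast

lemma smooth_const: "smooth (\<lambda>x. c)"
  by (simp add: smooth_def Ck_const)

lemma smooth_id: "smooth (\<lambda>x. x)"
  by (simp add: smooth_def Ck_id)

lemma smooth_add: "smooth f \<Longrightarrow> smooth g \<Longrightarrow> smooth (\<lambda>x. f x + g x)"
  by (simp add: smooth_def Ck_add)

lemma smooth_linear_comp: "bounded_linear L \<Longrightarrow> smooth f \<Longrightarrow> smooth (\<lambda>x. L (f x))"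
  by (simp add: smooth_def Ck_linear_comp)

lemma smooth_bilinear: "bounded_bilinear P \<Longrightarrow> smooth f \<Longrightarrow> smooth g \<Longrightarrow> smooth (\<lambda>x. P (f x) (g x))"
  by (simp add: smooth_def Ck_bilinear)

lemma smooth_compose_affine:
  fixes g :: "real \<Rightarrow> 'b::real_normed_vector" and l :: "'a::euclidean_space \<Rightarrow> real"
  shows "bounded_linear l \<Longrightarrow> smooth g \<Longrightarrow> smooth (\<lambda>x. g (l x + c))"
  by (simp add: smooth_def Ck_compose_affine)

lemmas smooth_scaleR = smooth_bilinear[OF bounded_bilinear_scaleR]
  and smooth_mult = smooth_bilinear[OF bounded_bilinear_mult]
  and smooth_inner = smooth_bilinear[OF bounded_bilinear_inner]
  and smooth_nth = smooth_linear_comp[OF bounded_linear_vec_nth]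
  and smooth_minus = smooth_linear_comp[OF bounded_linear_minus[OF bounded_linear_ident]]

lemma smooth_diff: "smooth f \<Longrightarrow> smooth g \<Longrightarrow> smooth (\<lambda>x. f x - g x)"
  using smooth_add[of f "\<lambda>x. - g x"] smooth_minus[of g] by simp

lemma smooth_sum: "(\<And>i. i \<in> I \<Longrightarrow> smooth (f i)) \<Longrightarrow> smooth (\<lambda>x. \<Sum>i\<in>I. f i x)"
  by (induction I rule: infinite_finite_induct) (auto simp: smooth_const intro: smooth_add)

lemma smooth_power: "smooth f \<Longrightarrow> smooth (\<lambda>x. (f x :: 'a::real_normed_algebra_1) ^ n)"
  by (induction n) (auto simp: smooth_const intro: smooth_mult)

lemma smooth_poly2:
  fixes P :: "R2 \<Rightarrow> 'b::real_normed_vector"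
  assumes "poly2 k P" shows "smooth P"
proof -
  obtain c where "\<And>x. P x = (\<Sum>i\<le>k. \<Sum>j\<le>k - i. ((x $ 1) ^ i * (x $ 2) ^ j) *\<^sub>R c i j)"
    using assms unfolding poly2_def by blast
  then have "P = (\<lambda>x. \<Sum>i\<le>k. \<Sum>j\<le>k - i. ((x $ 1) ^ i * (x $ 2) ^ j) *\<^sub>R c i j)" by blast
  then show ?thesis
    by (auto intro!: smooth_sum smooth_scaleR smooth_mult smooth_power smooth_nth smooth_id smooth_const)
qed

text \<open>\<open>Ck\<close> controls basis directions; a general direction is expanded in the
  basis by linearity of the derivative.\<close>

lemma frechet_derivative_continuous_on:
  assumes "smooth f"
  shows "continuous_on S (\<lambda>x. frechet_derivative f (at x) v)"
proof -
  have "frechet_derivative f (at x) v = (\<Sum>b\<in>Basis. (v \<bullet> b) *\<^sub>R frechet_derivative f (at x) b)" for x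
  proof -
    have "linear (frechet_derivative f (at x))"
      by (rule has_derivative_linear[OF smooth_has_derivative[OF assms]])
    then have "(\<Sum>b\<in>Basis. (v \<bullet> b) *\<^sub>R frechet_derivative f (at x) b) = frechet_derivative f (at x) (\<Sum>b\<in>Basis. (v \<bullet> b) *\<^sub>R b)"
      by (simp add: linear_sum linear_cmul)
    then show ?thesis by (simp add: euclidean_representation)
  qed
  then show ?thesis
    using smooth_continuous_on[OF smooth_SucD[OF assms]] by (auto intro!: continuous_intros)
qed

section \<open>Test functions\<close>

text \<open>The powers \<open>t ^ k\<close> in the denominator make the family closed under differentiation.\<close>

definition flat :: "real \<Rightarrow> nat \<Rightarrow> real \<Rightarrow> real" where
  "flat c k t = (if 0 < t then exp (- c / t) / t ^ k else 0)"

lemma flat_at_0: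
  assumes "0 < c"
  shows "(flat c k \<longlongrightarrow> 0) (at 0)"
proof -
  have "filterlim (\<lambda>t. c * inverse t) at_top (at_right 0)"
    using assms by (intro filterlim_tendsto_pos_mult_at_top[OF tendsto_const] filterlim_inverse_at_top_right)
  \<comment> \<open>With y = c/t the function is y^k / (c^k exp y), which tends to 0 as y tends to
    infinity.\<close>
  then have "((\<lambda>t. inverse (c ^ k) * ((c * inverse t) ^ k / exp (c * inverse t))) \<longlongrightarrow> inverse (c ^ k) * 0) (at_right 0)"
    by (intro tendsto_mult tendsto_const filterlim_compose[OF tendsto_power_div_exp_0])
  moreover have "\<forall>\<^sub>F t in at_right 0. inverse (c ^ k) * ((c * inverse t) ^ k / exp (c * inverse t)) = flat c k t"
    unfolding eventually_at_right_field
    using assms by (intro exI[of _ 1]) (auto simp: flat_def field_simps exp_minus power_mult_distrib)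
  ultimately have 1: "(flat c k \<longlongrightarrow> 0) (at_right 0)"
    using tendsto_cong by force
  have "\<forall>\<^sub>F t in at_left 0. 0 = flat c k t"
    unfolding eventually_at_left_field by (intro exI[of _ "-1"]) (auto simp: flat_def)
  then have "(flat c k \<longlongrightarrow> 0) (at_left 0)"
    by (rule tendsto_eventually[OF eventually_mono]) auto
  with 1 show ?thesis by (simp add: filterlim_split_at)
qed

lemma flat_has_derivative:
  assumes "0 < c"
  shows "(flat c k has_real_derivative (c * flat c (k + 2) t - k * flat c (k + 1) t)) (at t)"
proof (cases t "0::real" rule: linorder_cases)
  case less
  have "((\<lambda>t. 0) has_real_derivative 0) (at t)" by simp
  then have "(flat c k has_real_derivative 0) (at t)"
    by (rule has_field_derivative_transform_within_open[of _ _ _ "{..<0}"]) (use less in \<open>auto simp: flat_def\<close>)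
  then show ?thesis using less by (simp add: flat_def)
next
  case equal
  \<comment> \<open>The difference quotient of \<open>flat c k\<close> at 0 is
    \<open>flat c (k + 1)\<close>, whose limit is known.\<close>
  have "((\<lambda>h. (flat c k (0 + h) - flat c k 0) / h) \<longlongrightarrow> 0) (at 0)"
  proof (rule Lim_transform_eventually[OF flat_at_0[OF assms, of "k + 1"]])
    show "\<forall>\<^sub>F t in at 0. flat c (k + 1) t = (flat c k (0 + t) - flat c k 0) / t"
      unfolding eventually_at_filter by (auto simp: flat_def field_simps)
  qed
  then show ?thesis using equal by (simp add: DERIV_def flat_def)
next
  case greater
  have "((\<lambda>t. exp (- c / t) / t ^ k) has_real_derivative
     (c * (exp (- c / t) / t ^ (k + 2)) - k * (exp (- c / t) / t ^ (k + 1)))) (at t)"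
  proof (cases k)
    case 0
    then show ?thesis using greater
      by (auto intro!: derivative_eq_intros simp: field_simps power2_eq_square)
  next
    case (Suc m)
    \<comment> \<open>Differentiating a power produces the truncated exponent
      \<open>m - Suc 0\<close>; the case \<open>m = 0\<close> is split off.\<close>
    have "m = 0 \<or> t * t ^ (m - Suc 0) = t ^ m"
      by (cases m) auto
    then show ?thesis using greater Suc
      by (auto intro!: derivative_eq_intros simp: field_simps power2_eq_square power_add)
  qed
  then have "(flat c k has_real_derivative (c * (exp (- c / t) / t ^ (k + 2)) - k * (exp (- c / t) / t ^ (k + 1)))) (at t)"
    by (rule has_field_derivative_transform_within_open[of _ _ _ "{0<..}"]) (use greater in \<open>auto simp: flat_def\<close>)
  then show ?thesis using greater by (simp add: flat_def)
qed

lemma smooth_flat: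
  assumes "0 < c" shows "smooth (flat c k)"
proof -
  have "Ck m (flat c k)" for m
  proof (induction m arbitrary: k)
    case 0
    then show ?case
      by (auto simp: continuous_on_eq_continuous_at intro: DERIV_isCont[OF flat_has_derivative[OF assms]])
  next
    case (Suc m)
    show ?case
    proof (rule Ck_SucI)
      show "(flat c k has_derivative (*) (c * flat c (k + 2) t - k * flat c (k + 1) t)) (at t)" for t
        using flat_has_derivative[OF assms] by (simp add: has_field_derivative_def)
      have "Ck m (\<lambda>t. c * flat c (k + 2) t + (- real k) * flat c (k + 1) t)"
        by (intro Ck_add Ck_linear_comp[OF bounded_linear_mult_right] Suc.IH)
      then show "Ck m (\<lambda>t. (c * flat c (k + 2) t - k * flat c (k + 1) t) * b)" if "b \<in> Basis" for b
        using that by simp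
    qed
  qed
  then show ?thesis by (simp add: smooth_def)
qed

text \<open>The exponents are scaled by \<open>1 / Suc n\<close>, so that the functions increase
  with \<open>n\<close> to the indicator of the open box while their supports stay in the closed
  box. They take the place of mollified indicators.\<close>

definition box_bump :: "R2 \<Rightarrow> R2 \<Rightarrow> nat \<Rightarrow> sfield" where
  "box_bump a b n x = (\<Prod>i\<in>UNIV. flat (1 / Suc n) 0 (x $ i - a $ i) * flat (1 / Suc n) 0 (b $ i - x $ i))"

lemma flat_bounds: "0 < c \<Longrightarrow> 0 \<le> flat c 0 t \<and> flat c 0 t \<le> 1"
  by (simp add: flat_def)

lemma box_bump_nonzero_iff: "box_bump a b n x \<noteq> 0 \<longleftrightarrow> x \<in> box a b"
  by (auto simp: box_bump_def flat_def mem_box_cart)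

lemma box_bump_bounds: "0 \<le> box_bump a b n x \<and> box_bump a b n x \<le> 1"
  unfolding box_bump_def
  using flat_bounds[of "1 / Suc n"] by (auto intro!: prod_nonneg prod_le_1 mult_le_one)

lemma test_function_box_bump:
  assumes "cbox a b \<subseteq> U"
  shows "test_function U (box_bump a b n)"
proof -
  have "smooth (\<lambda>x::R2. flat (1 / Suc n) 0 (1 * x $ i + (- a $ i)))"
       "smooth (\<lambda>x::R2. flat (1 / Suc n) 0 (- (x $ i) + b $ i))" for i
    by (rule smooth_compose_affine; auto intro!: smooth_flat bounded_linear_intros simp: bounded_linear_vec_nth bounded_linear_minus)+
  then have *: "smooth (\<lambda>x::R2. flat (1 / Suc n) 0 (x $ i - a $ i) * flat (1 / Suc n) 0 (b $ i - x $ i))" for i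
    by (intro smooth_mult) (simp_all add: algebra_simps)
  have "smooth (box_bump a b n)"
    unfolding box_bump_def[abs_def] UNIV_2 using smooth_mult[OF *[of 1] *[of 2]] by simp
  moreover have "closure {x. box_bump a b n x \<noteq> 0} \<subseteq> cbox a b"
    unfolding box_bump_nonzero_iff by (intro closure_minimal) (auto simp: box_subset_cbox)
  moreover from this have "compact (closure {x. box_bump a b n x \<noteq> 0})"
    by (meson bounded_cbox bounded_subset closed_closure compact_eq_bounded_closed)
  ultimately show ?thesis
    using assms unfolding test_function_def by blast
qed

lemma box_bump_tendsto: "(\<lambda>n. box_bump a b n x) \<longlonglongrightarrow> indicator (box a b) x"
proof (cases "x \<in> box a b")
  case True
  have "(\<lambda>n. flat (1 / Suc n) 0 t) \<longlonglongrightarrow> 1" if "t > 0" for t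
  proof -
    have "(\<lambda>n. exp (- (1 / Suc n) / t)) \<longlonglongrightarrow> exp (- 0 / t)"
      using LIMSEQ_inverse_real_of_nat that
      by (intro tendsto_intros) (auto simp: inverse_eq_divide)
    then show ?thesis using that by (simp add: flat_def)
  qed
  then have "(\<lambda>n. box_bump a b n x) \<longlonglongrightarrow> (\<Prod>i\<in>(UNIV::2 set). 1 * 1)"
    unfolding box_bump_def using True by (intro tendsto_intros) (auto simp: mem_box_cart)
  then show ?thesis using True by simp
next
  case False
  then have "box_bump a b n x = 0" for n using box_bump_nonzero_iff by blast
  then show ?thesis using False by simp
qed

text \<open>Box bumps and dominated convergence show that \<open>g\<close> has integral 0 over every
  box inside \<open>U\<close>; Lebesgue's differentiation theorem then recovers the values of
  \<open>g\<close> almost everywhere.\<close>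

lemma fundamental_lemma:
  fixes g :: sfield
  assumes U: "open U" and g: "in_L2 (lebesgue_on U) g"
    and z: "\<And>\<phi>. test_function U \<phi> \<Longrightarrow> (\<integral>x. g x * \<phi> x \<partial>lebesgue_on U) = 0"
  shows "AE x in lebesgue_on U. g x = 0"
proof -
  define h where "h x = (if x \<in> U then g x else 0)" for x
  have Um: "U \<in> sets lebesgue" using U by simp
  have h2: "in_L2 (lebesgue_on UNIV) h"
  proof -
    have "h \<in> borel_measurable lebesgue"
      unfolding h_def using borel_measurable_if_I[OF in_L2_measurable[OF g] Um] .
    moreover have "(\<lambda>x. (norm (h x))\<^sup>2) = (\<lambda>x. if x \<in> U then (norm (g x))\<^sup>2 else 0)"
      by (auto simp: h_def)
    ultimately show ?thesis
      using in_L2_integrable[OF g] by (simp add: in_L2_def lebesgue_on_UNIV_eq Lebesgue_Measure.integrable_restrict_UNIV[OF Um])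
  qed
  have hi: "integrable (lebesgue_on (cbox a b)) h" for a b
    using in_L2_mult_integrable[OF in_L2_subset[OF h2] in_L2_const[OF finite_measure_lebesgue_on, of "cbox a b" "1::real"]]
    by simp
  have int0: "integral (cbox a b) h = 0" if ab: "cbox a b \<subseteq> U" for a b
  proof -
    have "(\<lambda>n. \<integral>x. h x * box_bump a b n x \<partial>lebesgue_on (cbox a b)) \<longlonglongrightarrow> (\<integral>x. h x * indicator (box a b) x \<partial>lebesgue_on (cbox a b))"
    proof (rule integral_dominated_convergence)
      show "integrable (lebesgue_on (cbox a b)) (\<lambda>x. norm (h x))" using hi by simp
      have m: "box_bump a b n \<in> borel_measurable (lebesgue_on (cbox a b))" for n
        using test_function_box_bump[OF ab, of n]
        by (auto simp: test_function_def intro!: continuous_imp_measurable_on_sets_lebesgue smooth_continuous_on)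
      then show "(\<lambda>x. h x * box_bump a b n x) \<in> borel_measurable (lebesgue_on (cbox a b))" for n
        using borel_measurable_integrable[OF hi[of a b]] by measurable
      show "(\<lambda>x. h x * indicator (box a b) x) \<in> borel_measurable (lebesgue_on (cbox a b))"
        using borel_measurable_integrable[OF hi[of a b]] borel_measurable_LIMSEQ_real[OF box_bump_tendsto m] by measurable
      show "AE x in lebesgue_on (cbox a b). (\<lambda>n. h x * box_bump a b n x) \<longlonglongrightarrow> h x * indicator (box a b) x"
        by (intro AE_I2 tendsto_mult tendsto_const box_bump_tendsto)
      show "AE x in lebesgue_on (cbox a b). norm (h x * box_bump a b n x) \<le> norm (h x)" for n
        using box_bump_bounds by (intro AE_I2) (simp add: abs_mult mult_left_le)
    qed
    moreover have "(\<integral>x. h x * box_bump a b n x \<partial>lebesgue_on (cbox a b)) = 0" for n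
    proof -
      have "(\<integral>x. h x * box_bump a b n x \<partial>lebesgue_on (cbox a b)) = (\<integral>x. (if x \<in> cbox a b then h x * box_bump a b n x else 0) \<partial>lebesgue)"
        by (simp add: Lebesgue_Measure.integral_restrict_UNIV)
      also have "(\<lambda>x. if x \<in> cbox a b then h x * box_bump a b n x else 0) = (\<lambda>x. if x \<in> U then g x * box_bump a b n x else 0)"
        using box_bump_nonzero_iff[of a b n] ab box_subset_cbox[of a b] by (fastforce simp: h_def)
      also have "(\<integral>x. (if x \<in> U then g x * box_bump a b n x else 0) \<partial>lebesgue) = 0"
        using z[OF test_function_box_bump[OF ab]] by (simp add: Lebesgue_Measure.integral_restrict_UNIV[OF Um])
      finally show ?thesis .
    qed
    ultimately have "(\<integral>x. h x * indicator (box a b) x \<partial>lebesgue_on (cbox a b)) = 0"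
      by (simp add: LIMSEQ_const_iff)
    moreover have "(\<integral>x. h x * indicator (box a b) x \<partial>lebesgue_on (cbox a b)) = integral (cbox a b) h"
    proof -
      have "(\<integral>x. h x * indicator (box a b) x \<partial>lebesgue_on (cbox a b)) = (\<integral>x. (if x \<in> box a b then h x else 0) \<partial>lebesgue_on (cbox a b))"
        by (intro Bochner_Integration.integral_cong) (auto simp: indicator_def)
      also have "\<dots> = (\<integral>x. h x \<partial>lebesgue_on (box a b))"
        by (rule Lebesgue_Measure.integral_restrict) (auto simp: box_subset_cbox)
      also have "\<dots> = integral (box a b) h"
        by (rule lebesgue_integral_eq_integral) (simp_all add: integrable_lebesgue_on_subset[OF hi[of a b]] box_subset_cbox)
      finally show ?thesis by (simp add: integral_open_interval)
    qed
    ultimately show ?thesis by simp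
  qed
  have "h integrable_on cbox a b" for a b
    by (rule integrable_on_lebesgue_on[OF hi]) simp
  \<comment> \<open>Lebesgue differentiation in explicit form: off the null set \<open>N\<close> the
    averages of \<open>h\<close> over small cubes with lower corner \<open>x\<close> approach
    \<open>h x\<close>.\<close>
  then obtain N where N: "negligible N" and Nd: "\<And>x e. \<lbrakk>x \<notin> N; 0 < e\<rbrakk> \<Longrightarrow>
      \<exists>d>0. \<forall>r. 0 < r \<and> r < d \<longrightarrow> norm (integral (cbox x (x + r *\<^sub>R One)) h /\<^sub>R r ^ DIM(R2) - h x) < e"
    using integrable_ccontinuous_explicit[of h] by metis
  have "g x = 0" if xU: "x \<in> U" and xN: "x \<notin> N" for x
  proof (rule ccontr)
    assume "g x \<noteq> 0"
    then obtain d where d: "d > 0" and dd: "\<And>r. 0 < r \<Longrightarrow> r < d \<Longrightarrow>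
        norm (integral (cbox x (x + r *\<^sub>R One)) h /\<^sub>R r ^ DIM(R2) - h x) < \<bar>g x\<bar>"
      using Nd[OF xN, of "\<bar>g x\<bar>"] by auto
    obtain e where e: "e > 0" "cball x e \<subseteq> U"
      using U xU open_contains_cball by blast
    \<comment> \<open>Small enough for the averages to be within \<open>\<bar>g x\<bar>\<close> of
      \<open>h x\<close>, and for the cube to lie in the ball of radius \<open>e\<close>. The
      average over such a cube is 0, which is the contradiction.\<close>
    define r where "r = min (d / 2) (e / (norm (One::R2) + 1))"
    have r: "0 < r" "r < d" using d e by (auto simp: r_def add_pos_nonneg min_less_iff_disj)
    have "cbox x (x + r *\<^sub>R One) \<subseteq> cball x e"
    proof
      fix y :: R2 assume y: "y \<in> cbox x (x + r *\<^sub>R One)"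
      have "norm (y - x) \<le> norm (r *\<^sub>R (One::R2))"
        using y by (intro norm_le_componentwise) (auto simp: mem_box inner_diff_left inner_add_left abs_le_iff algebra_simps)
      also have "\<dots> = r * norm (One::R2)"
        using r by simp
      also have "\<dots> \<le> (e / (norm (One::R2) + 1)) * norm (One::R2)"
        by (intro mult_right_mono) (simp_all add: r_def)
      also have "\<dots> \<le> e"
        using e by (simp add: field_simps add_pos_nonneg)
      finally show "y \<in> cball x e" by (simp add: dist_norm norm_minus_commute)
    qed
    then show False
      using dd[OF r] int0[of x "x + r *\<^sub>R One"] e xU by (simp add: h_def)
  qed
  then have "AE x in lebesgue. x \<in> U \<longrightarrow> g x = 0"
    using N by (intro AE_I'[of N]) (auto simp: negligible_iff_null_sets)
  then show ?thesis
    by (simp add: AE_restrict_space_iff Um)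
qed

section \<open>Poincare inequalities on the unit square\<close>

abbreviation I01 :: "(real \<Rightarrow> 'a::real_normed_vector) \<Rightarrow> 'a" where "I01 \<equiv> integral {0..1}"

lemma cont_integrable_01: "continuous_on UNIV f \<Longrightarrow> f integrable_on {0..1::real}" for f :: "real \<Rightarrow> 'a::banach"
  by (rule integrable_continuous_real) (rule continuous_on_subset, auto)

lemma I01_mono:
  fixes f g :: "real \<Rightarrow> real"
  assumes "continuous_on UNIV f" "continuous_on UNIV g" "\<And>x. x \<in> {0..1} \<Longrightarrow> f x \<le> g x"
  shows "I01 f \<le> I01 g"
  by (rule integral_le) (use assms cont_integrable_01 in auto)

lemma I01_nonneg: "(\<And>x. x \<in> {0..1} \<Longrightarrow> 0 \<le> f x) \<Longrightarrow> 0 \<le> I01 (f :: real \<Rightarrow> real)"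
  by (cases "f integrable_on {0..1}") (auto intro: integral_nonneg simp: not_integrable_integral)

lemma I01_add:
  fixes f g :: "real \<Rightarrow> 'a::banach"
  shows "continuous_on UNIV f \<Longrightarrow> continuous_on UNIV g \<Longrightarrow> I01 (\<lambda>x. f x + g x) = I01 f + I01 g"
  by (intro Henstock_Kurzweil_Integration.integral_add cont_integrable_01)

lemma I01_diff:
  fixes f g :: "real \<Rightarrow> 'a::banach"
  shows "continuous_on UNIV f \<Longrightarrow> continuous_on UNIV g \<Longrightarrow> I01 (\<lambda>x. f x - g x) = I01 f - I01 g"
  by (intro Henstock_Kurzweil_Integration.integral_diff cont_integrable_01)

lemma I01_affine:
  fixes f :: "real \<Rightarrow> real"
  shows "continuous_on UNIV f \<Longrightarrow> I01 (\<lambda>x. c + k * f x) = c + k * I01 f"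
  by (subst I01_add) (auto intro: continuous_intros)

text \<open>The variance of \<open>f\<close> on the unit interval is nonnegative.\<close>

lemma I01_sq_le:
  fixes f :: "real \<Rightarrow> real"
  assumes f: "continuous_on UNIV f"
  shows "(I01 f)\<^sup>2 \<le> I01 (\<lambda>x. (f x)\<^sup>2)"
proof -
  define c where "c = I01 f"
  have "0 \<le> I01 (\<lambda>x. (f x - c)\<^sup>2)"
    by (rule I01_nonneg) simp
  also have "(\<lambda>x. (f x - c)\<^sup>2) = (\<lambda>x. (f x)\<^sup>2 + (c\<^sup>2 + (- 2 * c) * f x))"
    by (auto simp: power2_eq_square algebra_simps)
  also have "I01 \<dots> = I01 (\<lambda>x. (f x)\<^sup>2) + (c\<^sup>2 + (- 2 * c) * I01 f)"
    by (subst I01_add) (auto intro!: continuous_intros f simp only: I01_affine[OF f])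
  finally show ?thesis by (simp add: c_def power2_eq_square)
qed

lemma I01_norm_sq_le:
  fixes f :: "real \<Rightarrow> 'a::euclidean_space"
  assumes f: "continuous_on UNIV f"
  shows "(norm (I01 f))\<^sup>2 \<le> I01 (\<lambda>x. (norm (f x))\<^sup>2)"
proof -
  have "norm (I01 f) \<le> I01 (\<lambda>x. norm (f x))"
    by (intro integral_norm_bound_integral cont_integrable_01 continuous_intros f) auto
  then have "(norm (I01 f))\<^sup>2 \<le> (I01 (\<lambda>x. norm (f x)))\<^sup>2"
    by (intro power_mono) auto
  also have "\<dots> \<le> I01 (\<lambda>x. (norm (f x))\<^sup>2)"
    by (intro I01_sq_le continuous_intros f)
  finally show ?thesis .
qed

text \<open>The fundamental theorem gives the difference as an integral between \<open>t\<close> and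
  \<open>s\<close>; enlarging it to the whole interval makes the bound independent of the two
  points.\<close>

lemma norm_diff_sq_le_I01:
  fixes f :: "real \<Rightarrow> 'a::euclidean_space"
  assumes d: "\<And>x. (f has_vector_derivative f' x) (at x)" and c: "continuous_on UNIV f'"
    and "s \<in> {0..1}" "t \<in> {0..1}"
  shows "(norm (f s - f t))\<^sup>2 \<le> I01 (\<lambda>x. (norm (f' x))\<^sup>2)"
proof -
  have *: "norm (f s - f t) \<le> I01 (\<lambda>x. norm (f' x))" if "0 \<le> t" "t \<le> s" "s \<le> 1" for s t
  proof -
    have "(f' has_integral (f s - f t)) {t..s}"
      by (rule fundamental_theorem_of_calculus) (use that in \<open>auto intro: has_vector_derivative_at_within[OF d]\<close>)
    then have "f s - f t = integral {t..s} f'" by (simp add: integral_unique)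
    also have "norm \<dots> \<le> integral {t..s} (\<lambda>x. norm (f' x))"
      by (rule integral_norm_bound_integral)
        (auto intro!: integrable_continuous_real continuous_intros continuous_on_subset[OF c])
    also have "\<dots> \<le> I01 (\<lambda>x. norm (f' x))"
      by (rule integral_subset_le)
        (use that in \<open>auto intro!: integrable_continuous_real continuous_intros continuous_on_subset[OF c]\<close>)
    finally show ?thesis .
  qed
  have "norm (f s - f t) \<le> I01 (\<lambda>x. norm (f' x))"
    using *[of t s] *[of s t] assms(3,4) by (cases "t \<le> s") (auto simp: norm_minus_commute)
  then have "(norm (f s - f t))\<^sup>2 \<le> (I01 (\<lambda>x. norm (f' x)))\<^sup>2"
    by (intro power_mono) auto
  also have "\<dots> \<le> I01 (\<lambda>x. (norm (f' x))\<^sup>2)"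
    by (intro I01_sq_le continuous_intros c)
  finally show ?thesis .
qed

lemma cont_slice:
  assumes "continuous_on UNIV (\<lambda>p. f (fst p) (snd p))"
  shows "continuous_on UNIV (f s)" "continuous_on UNIV (\<lambda>s. f s t)"
proof -
  have "continuous_on UNIV (\<lambda>t. (s, t))" "continuous_on UNIV (\<lambda>s. (s, t))"
    by (auto intro!: continuous_on_Pair)
  from this[THEN continuous_on_compose2[OF assms]]
  show "continuous_on UNIV (f s)" "continuous_on UNIV (\<lambda>s. f s t)" by auto
qed

lemma cont_I01:
  fixes f :: "real \<Rightarrow> real \<Rightarrow> 'a::banach"
  assumes "continuous_on UNIV (\<lambda>p. f (fst p) (snd p))"
  shows "continuous_on UNIV (\<lambda>s. I01 (f s))"
  using integral_continuous_on_param[of UNIV 0 "1::real" f] assms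
  by (simp add: case_prod_unfold) (meson continuous_on_subset subset_UNIV)

lemma cont_swap:
  assumes "continuous_on UNIV (\<lambda>p. f (fst p) (snd p))"
  shows "continuous_on UNIV (\<lambda>p. f (snd p) (fst p))"
proof -
  have "continuous_on UNIV (\<lambda>p. (snd p, fst p))"
    by (auto intro!: continuous_on_Pair continuous_on_fst continuous_on_snd)
  from continuous_on_compose2[OF assms this] show ?thesis by auto
qed

lemma I01_swap:
  fixes f :: "real \<Rightarrow> real \<Rightarrow> 'a::banach"
  assumes "continuous_on UNIV (\<lambda>p. f (fst p) (snd p))"
  shows "I01 (\<lambda>s. I01 (\<lambda>t. f s t)) = I01 (\<lambda>t. I01 (\<lambda>s. f s t))"
  using integral_swap_continuous[of 0 0 1 1 f] assms
  by (simp add: case_prod_unfold) (meson continuous_on_subset subset_UNIV)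

lemma norm_sum3_sq: "(norm (a + b + c))\<^sup>2 \<le> 3 * ((norm a)\<^sup>2 + (norm b)\<^sup>2 + (norm c)\<^sup>2)"
proof -
  have "(norm (a + b + c))\<^sup>2 \<le> (norm a + norm b + norm c)\<^sup>2"
    by (intro power_mono) (auto intro: norm_triangle_le add_mono norm_triangle_ineq)
  also have "\<dots> \<le> 3 * ((norm a)\<^sup>2 + (norm b)\<^sup>2 + (norm c)\<^sup>2)"
    using sum_squares_bound[of "norm a" "norm b"] sum_squares_bound[of "norm a" "norm c"]
      sum_squares_bound[of "norm b" "norm c"]
    by (simp add: power2_eq_square algebra_simps)
  finally show ?thesis .
qed

text \<open>\<open>A\<close> and \<open>B\<close> are the two partial derivatives; the integrals over single lines provide the trace
  inequality for the edges of an element.\<close>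

lemma square_Poincare_horizontal:
  fixes \<phi> A B :: "real \<Rightarrow> real \<Rightarrow> 'a::euclidean_space"
  assumes c\<phi>: "continuous_on UNIV (\<lambda>p. \<phi> (fst p) (snd p))"
    and cA: "continuous_on UNIV (\<lambda>p. A (fst p) (snd p))"
    and cB: "continuous_on UNIV (\<lambda>p. B (fst p) (snd p))"
    and dA: "\<And>s t. ((\<lambda>s. \<phi> s t) has_vector_derivative A s t) (at s)"
    and dB: "\<And>s t. (\<phi> s has_vector_derivative B s t) (at t)"
    and t: "t \<in> {0..1}"
  shows "I01 (\<lambda>s. (norm (\<phi> s t - I01 (\<lambda>s. I01 (\<phi> s))))\<^sup>2)
     \<le> 3 * I01 (\<lambda>s. I01 (\<lambda>t. (norm (A s t))\<^sup>2)) + 6 * I01 (\<lambda>s. I01 (\<lambda>t. (norm (B s t))\<^sup>2))"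
proof -
  define \<alpha> where "\<alpha> t = I01 (\<lambda>s. (norm (A s t))\<^sup>2)" for t
  define \<beta> where "\<beta> s = I01 (\<lambda>t. (norm (B s t))\<^sup>2)" for s
  define M where "M = I01 (\<lambda>s. I01 (\<phi> s))"
  define a2 where "a2 = I01 \<alpha>"
  define b2 where "b2 = I01 \<beta>"
  have a2: "a2 = I01 (\<lambda>s. I01 (\<lambda>t. (norm (A s t))\<^sup>2))"
    unfolding a2_def \<alpha>_def by (rule I01_swap[symmetric]) (intro continuous_intros cA)
  have c\<alpha>: "continuous_on UNIV \<alpha>"
    unfolding \<alpha>_def by (rule cont_I01) (intro continuous_intros cont_swap[OF cA])
  have c\<beta>: "continuous_on UNIV \<beta>"
    unfolding \<beta>_def by (rule cont_I01) (intro continuous_intros cB)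
  have \<alpha>: "(norm (\<phi> s t - \<phi> s' t))\<^sup>2 \<le> \<alpha> t" if "s \<in> {0..1}" "s' \<in> {0..1}" for s s' t
    unfolding \<alpha>_def by (rule norm_diff_sq_le_I01[OF dA cont_slice(2)[OF cA] that])
  have \<beta>: "(norm (\<phi> s t - \<phi> s t'))\<^sup>2 \<le> \<beta> s" if "t \<in> {0..1}" "t' \<in> {0..1}" for s t t'
    unfolding \<beta>_def by (rule norm_diff_sq_le_I01[OF dB cont_slice(1)[OF cB] that])
  \<comment> \<open>The two points are joined by a vertical, a horizontal and a vertical segment,
    with the horizontal one at height \<tau>. A single height would leave the energy
    \<open>\<alpha> \<tau>\<close> of one line, which the area integral does not control; averaging
    over \<tau> replaces it by \<open>a2\<close>.\<close>
  have two: "(norm (\<phi> s t - \<phi> s' t'))\<^sup>2 \<le> 3 * (\<beta> s + a2 + \<beta> s')"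
    if st: "s \<in> {0..1}" "s' \<in> {0..1}" "t \<in> {0..1}" "t' \<in> {0..1}" for s s' t t'
  proof -
    have "I01 (\<lambda>\<tau>. (norm (\<phi> s t - \<phi> s' t'))\<^sup>2) \<le> I01 (\<lambda>\<tau>. 3 * (\<beta> s + \<alpha> \<tau> + \<beta> s'))"
    proof (rule I01_mono)
      fix \<tau> :: real assume \<tau>: "\<tau> \<in> {0..1}"
      have "\<phi> s t - \<phi> s' t' = (\<phi> s t - \<phi> s \<tau>) + (\<phi> s \<tau> - \<phi> s' \<tau>) + (\<phi> s' \<tau> - \<phi> s' t')" by simp
      then have "(norm (\<phi> s t - \<phi> s' t'))\<^sup>2
        \<le> 3 * ((norm (\<phi> s t - \<phi> s \<tau>))\<^sup>2 + (norm (\<phi> s \<tau> - \<phi> s' \<tau>))\<^sup>2 + (norm (\<phi> s' \<tau> - \<phi> s' t'))\<^sup>2)"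
        using norm_sum3_sq[of "\<phi> s t - \<phi> s \<tau>"] by metis
      also have "\<dots> \<le> 3 * (\<beta> s + \<alpha> \<tau> + \<beta> s')"
        using \<alpha>[OF st(1,2)] \<beta>[OF st(3) \<tau>] \<beta>[OF \<tau> st(4)] by (intro mult_left_mono add_mono) auto
      finally show "(norm (\<phi> s t - \<phi> s' t'))\<^sup>2 \<le> 3 * (\<beta> s + \<alpha> \<tau> + \<beta> s')" .
    qed (intro continuous_intros c\<alpha>)+
    also have "(\<lambda>\<tau>. 3 * (\<beta> s + \<alpha> \<tau> + \<beta> s')) = (\<lambda>\<tau>. (3 * \<beta> s + 3 * \<beta> s') + 3 * \<alpha> \<tau>)" by auto
    also have "I01 \<dots> = 3 * (\<beta> s + a2 + \<beta> s')"
      unfolding I01_affine[OF c\<alpha>] by (simp add: a2_def)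
    finally show ?thesis by simp
  qed
  \<comment> \<open>Averaging over the second point replaces its value by the mean \<open>M\<close>
    and \<open>\<beta> s'\<close> by \<open>b2\<close>. The final integration over \<open>s\<close>
    turns \<open>\<beta> s\<close> into another \<open>b2\<close>, hence the coefficient 6 = 3 * 2
    of the vertical derivative.\<close>
  have M: "(norm (\<phi> s t - M))\<^sup>2 \<le> 3 * (\<beta> s + a2 + b2)" if "s \<in> {0..1}" for s
  proof -
    have diff: "\<phi> s t - M = I01 (\<lambda>s'. I01 (\<lambda>t'. \<phi> s t - \<phi> s' t'))"
    proof -
      have "I01 (\<lambda>t'. \<phi> s t - \<phi> s' t') = \<phi> s t - I01 (\<phi> s')" for s'
        using I01_diff[OF continuous_on_const cont_slice(1)[OF c\<phi>], of "\<phi> s t" s'] by simp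
      then show ?thesis
        using I01_diff[OF continuous_on_const cont_I01[OF c\<phi>], of "\<phi> s t"] by (simp add: M_def)
    qed
    have "(norm (\<phi> s t - M))\<^sup>2 \<le> I01 (\<lambda>s'. (norm (I01 (\<lambda>t'. \<phi> s t - \<phi> s' t')))\<^sup>2)"
      unfolding diff by (intro I01_norm_sq_le cont_I01 continuous_intros c\<phi>)
    also have "\<dots> \<le> I01 (\<lambda>s'. 3 * (\<beta> s + a2 + \<beta> s'))"
    proof (rule I01_mono)
      fix s' :: real assume s': "s' \<in> {0..1}"
      have "(norm (I01 (\<lambda>t'. \<phi> s t - \<phi> s' t')))\<^sup>2 \<le> I01 (\<lambda>t'. (norm (\<phi> s t - \<phi> s' t'))\<^sup>2)"
        by (intro I01_norm_sq_le continuous_intros cont_slice(1)[OF c\<phi>])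
      also have "\<dots> \<le> I01 (\<lambda>t'. 3 * (\<beta> s + a2 + \<beta> s'))"
        by (intro I01_mono continuous_intros cont_slice(1)[OF c\<phi>] two s' t that)
      finally show "(norm (I01 (\<lambda>t'. \<phi> s t - \<phi> s' t')))\<^sup>2 \<le> 3 * (\<beta> s + a2 + \<beta> s')" by simp
    qed (intro continuous_intros cont_I01 c\<beta> c\<phi>)+
    also have "(\<lambda>s'. 3 * (\<beta> s + a2 + \<beta> s')) = (\<lambda>s'. (3 * \<beta> s + 3 * a2) + 3 * \<beta> s')" by auto
    also have "I01 \<dots> = 3 * (\<beta> s + a2 + b2)"
      unfolding I01_affine[OF c\<beta>] by (simp add: b2_def)
    finally show ?thesis .
  qed
  have "I01 (\<lambda>s. (norm (\<phi> s t - M))\<^sup>2) \<le> I01 (\<lambda>s. 3 * (\<beta> s + (a2 + b2)))"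
    using M by (intro I01_mono continuous_intros c\<beta> cont_slice(2)[OF c\<phi>]) (auto simp: add.assoc)
  also have "(\<lambda>s. 3 * (\<beta> s + (a2 + b2))) = (\<lambda>s. 3 * (a2 + b2) + 3 * \<beta> s)" by auto
  also have "I01 \<dots> = 3 * (b2 + (a2 + b2))"
    unfolding I01_affine[OF c\<beta>] by (simp add: b2_def)
  finally show ?thesis
    unfolding a2[symmetric] M_def[symmetric] b2_def \<beta>_def by (simp add: algebra_simps)
qed

text \<open>The point is that a single constant \<open>M\<close> serves the area and all horizontal
  and vertical lines, so that edge and element estimates can later be compared. The vertical case
  exchanges the variables; by Fubini the mean value is the same.\<close>

lemma square_Poincare:
  fixes \<phi> A B :: "real \<Rightarrow> real \<Rightarrow> 'a::euclidean_space"
  assumes c\<phi>: "continuous_on UNIV (\<lambda>p. \<phi> (fst p) (snd p))"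
    and cA: "continuous_on UNIV (\<lambda>p. A (fst p) (snd p))"
    and cB: "continuous_on UNIV (\<lambda>p. B (fst p) (snd p))"
    and dA: "\<And>s t. ((\<lambda>s. \<phi> s t) has_vector_derivative A s t) (at s)"
    and dB: "\<And>s t. (\<phi> s has_vector_derivative B s t) (at t)"
  obtains M where
    "\<And>t. t \<in> {0..1} \<Longrightarrow> I01 (\<lambda>s. (norm (\<phi> s t - M))\<^sup>2) \<le> 6 * I01 (\<lambda>s. I01 (\<lambda>t. (norm (A s t))\<^sup>2 + (norm (B s t))\<^sup>2))"
    "\<And>s. s \<in> {0..1} \<Longrightarrow> I01 (\<lambda>t. (norm (\<phi> s t - M))\<^sup>2) \<le> 6 * I01 (\<lambda>s. I01 (\<lambda>t. (norm (A s t))\<^sup>2 + (norm (B s t))\<^sup>2))"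
    "I01 (\<lambda>s. I01 (\<lambda>t. (norm (\<phi> s t - M))\<^sup>2)) \<le> 6 * I01 (\<lambda>s. I01 (\<lambda>t. (norm (A s t))\<^sup>2 + (norm (B s t))\<^sup>2))"
proof -
  define M where "M = I01 (\<lambda>s. I01 (\<phi> s))"
  define a2 where "a2 = I01 (\<lambda>s. I01 (\<lambda>t. (norm (A s t))\<^sup>2))"
  define b2 where "b2 = I01 (\<lambda>s. I01 (\<lambda>t. (norm (B s t))\<^sup>2))"
  have nn: "0 \<le> a2" "0 \<le> b2" unfolding a2_def b2_def by (intro I01_nonneg zero_le_power2)+
  have cA2: "continuous_on UNIV (\<lambda>p. (norm (A (fst p) (snd p)))\<^sup>2)"
    and cB2: "continuous_on UNIV (\<lambda>p. (norm (B (fst p) (snd p)))\<^sup>2)"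
    by (intro continuous_intros cA cB)+
  have D: "I01 (\<lambda>s. I01 (\<lambda>t. (norm (A s t))\<^sup>2 + (norm (B s t))\<^sup>2)) = a2 + b2"
    unfolding a2_def b2_def
    using cont_integrable_01[OF cont_slice(1)[OF cA2]] cont_integrable_01[OF cont_slice(1)[OF cB2]]
      cont_integrable_01[OF cont_I01[OF cA2]] cont_integrable_01[OF cont_I01[OF cB2]]
    by (simp add: Henstock_Kurzweil_Integration.integral_add)
  have h: "I01 (\<lambda>s. (norm (\<phi> s t - M))\<^sup>2) \<le> 6 * (a2 + b2)" if "t \<in> {0..1}" for t
    using square_Poincare_horizontal[OF c\<phi> cA cB dA dB that] nn
    unfolding M_def[symmetric] a2_def[symmetric] b2_def[symmetric] by argo
  have v: "I01 (\<lambda>t. (norm (\<phi> s t - M))\<^sup>2) \<le> 6 * (a2 + b2)" if "s \<in> {0..1}" for s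
    using square_Poincare_horizontal[of "\<lambda>t s. \<phi> s t" "\<lambda>t s. B s t" "\<lambda>t s. A s t", OF cont_swap[OF c\<phi>]
        cont_swap[OF cB] cont_swap[OF cA] dB dA that] nn
    unfolding M_def[symmetric] a2_def[symmetric] b2_def[symmetric] I01_swap[OF c\<phi>, symmetric]
      I01_swap[OF cA2, symmetric] I01_swap[OF cB2, symmetric] by argo
  have "I01 (\<lambda>s. I01 (\<lambda>t. (norm (\<phi> s t - M))\<^sup>2)) \<le> I01 (\<lambda>s::real. 6 * (a2 + b2))"
    by (intro I01_mono cont_I01 continuous_intros c\<phi> v)
  then have i: "I01 (\<lambda>s. I01 (\<lambda>t. (norm (\<phi> s t - M))\<^sup>2)) \<le> 6 * (a2 + b2)" by simp
  show thesis
    by (rule that[of M]) (use h v i D in auto)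
qed

section \<open>Integration over rectangles\<close>

lemma rectangle_eq_image: "rectangle a d e = (\<lambda>(s, t). a + s *\<^sub>R d + t *\<^sub>R e) ` ({0..1} \<times> {0..1})"
proof
  let ?f = "\<lambda>(s, t). a + s *\<^sub>R d + t *\<^sub>R e"
  have lin: "linear (\<lambda>(s, t). s *\<^sub>R d + t *\<^sub>R e)"
    by (auto simp: linear_iff algebra_simps)
  have "?f ` ({0..1} \<times> {0..1}) = (+) a ` (\<lambda>(s, t). s *\<^sub>R d + t *\<^sub>R e) ` ({0..1} \<times> {0..1})"
    unfolding image_image by (intro image_cong) (auto simp: algebra_simps)
  then have "convex (?f ` ({0..1} \<times> {0..1}))"
    by (simp add: convex_translation convex_linear_image[OF lin] convex_Times convex_real_interval)
  moreover have "{a, a + d, a + e, a + d + e} \<subseteq> ?f ` ({0..1} \<times> {0..1})"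
    using image_eqI[of a ?f "(0,0)"] image_eqI[of "a + d" ?f "(1,0)"] image_eqI[of "a + e" ?f "(0,1)"]
      image_eqI[of "a + d + e" ?f "(1,1)"] by simp
  ultimately show "rectangle a d e \<subseteq> ?f ` ({0..1} \<times> {0..1})"
    unfolding rectangle_def by (rule hull_minimal[rotated])
  show "?f ` ({0..1} \<times> {0..1}) \<subseteq> rectangle a d e"
  proof clarify
    fix s t :: real assume st: "s \<in> {0..1}" "t \<in> {0..1}"
    have cv: "convex (rectangle a d e)" by (simp add: rectangle_def convex_convex_hull)
    have v: "a \<in> rectangle a d e" "a + d \<in> rectangle a d e" "a + e \<in> rectangle a d e" "a + d + e \<in> rectangle a d e"
      by (auto simp: rectangle_def intro!: hull_inc)
    have 1: "(1 - s) *\<^sub>R a + s *\<^sub>R (a + d) \<in> rectangle a d e"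
      and 2: "(1 - s) *\<^sub>R (a + e) + s *\<^sub>R (a + d + e) \<in> rectangle a d e"
      using st by (auto intro!: convexD_alt[OF cv] v)
    have "(1 - t) *\<^sub>R ((1 - s) *\<^sub>R a + s *\<^sub>R (a + d)) + t *\<^sub>R ((1 - s) *\<^sub>R (a + e) + s *\<^sub>R (a + d + e)) \<in> rectangle a d e"
      using st by (intro convexD_alt[OF cv 1 2]) auto
    also have "(1 - t) *\<^sub>R ((1 - s) *\<^sub>R a + s *\<^sub>R (a + d)) + t *\<^sub>R ((1 - s) *\<^sub>R (a + e) + s *\<^sub>R (a + d + e)) = a + s *\<^sub>R d + t *\<^sub>R e"
      by (simp add: algebra_simps)
    finally show "a + s *\<^sub>R d + t *\<^sub>R e \<in> rectangle a d e" .
  qed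
qed

lemma rectangle_memI: "s \<in> {0..1} \<Longrightarrow> t \<in> {0..1} \<Longrightarrow> a + s *\<^sub>R d + t *\<^sub>R e \<in> rectangle a d e"
  by (auto simp: rectangle_eq_image)

lemma compact_rectangle: "compact (rectangle a d e)"
  by (simp add: rectangle_def compact_convex_hull finite_imp_compact)

lemma convex_rectangle: "convex (rectangle a d e)"
  by (simp add: rectangle_def convex_convex_hull)

lemma rectangle_lebesgue [simp]: "rectangle a d e \<in> sets lebesgue"
  by (simp add: lmeasurable_compact compact_rectangle fmeasurableD)

lemma norm_R2_sq: "(norm x)\<^sup>2 = (x $ 1)\<^sup>2 + (x $ 2)\<^sup>2" for x :: R2
  by (simp add: norm_vec_def L2_set_def sum_2)

lemma inner_R2: "x \<bullet> y = x $ 1 * y $ 1 + x $ 2 * y $ 2" for x y :: R2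
  by (simp add: inner_vec_def sum_2)

text \<open>Fubini's theorem speaks of pairs; the identification \<open>g\<close> of
  \<open>R2\<close> with pairs maps boxes to boxes of equal content, so it preserves
  integrals.\<close>

lemma unit_square_integral:
  fixes F :: "R2 \<Rightarrow> real"
  assumes "continuous_on UNIV F"
  shows "integral (cbox 0 1) F = I01 (\<lambda>s. I01 (\<lambda>t. F (vector [s, t])))"
proof -
  define g where "g x = (x $ 1, x $ 2)" for x :: R2
  define h where "h p = (vector [fst p, snd p] :: R2)" for p :: "real \<times> real"
  define f where "f p = F (h p)" for p
  have hg: "h (g x) = x" and gh: "g (h p) = p" for x p
    by (auto simp: h_def g_def vec_eq_iff forall_2)
  have ch: "continuous_on UNIV h"
  proof -
    have "h = (\<lambda>p. \<chi> i. if i = 1 then fst p else snd p)"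
      by (auto simp: h_def vec_eq_iff forall_2)
    moreover have "continuous_on UNIV (\<lambda>p. if i = 1 then fst p else snd p :: real)" for i :: 2
      by (cases "i = 1") (auto intro!: continuous_intros)
    ultimately show ?thesis by (simp add: continuous_on_vec_lambda)
  qed
  have boxg: "g ` cbox u v = cbox (g u) (g v)" for u v
  proof -
    have "p \<in> g ` cbox u v \<longleftrightarrow> h p \<in> cbox u v" for p
    proof
      assume "h p \<in> cbox u v"
      then have "g (h p) \<in> g ` cbox u v" by (rule imageI)
      then show "p \<in> g ` cbox u v" by (simp only: gh)
    qed (auto simp: hg)
    then show ?thesis
      by (auto simp: h_def g_def mem_box_cart forall_2 cbox_Pair_eq)
  qed
  have boxh: "h ` cbox u v = cbox (h u) (h v)" for u v
  proof -
    have "h ` g ` cbox (h u) (h v) = cbox (h u) (h v)" by (simp add: image_image hg)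
    then show ?thesis by (simp only: boxg gh)
  qed
  have cont: "measure lborel (g ` cbox u v) = 1 * measure lborel (cbox u v)" for u v
  proof (cases "cbox u v = {}")
    case False
    then have "\<forall>i. u $ i \<le> v $ i" by (auto simp: interval_ne_empty_cart)
    with False show ?thesis
      unfolding boxg by (simp add: g_def content_Pair content_cbox_cart UNIV_2)
  qed simp
  have fc: "continuous_on UNIV f"
    unfolding f_def using continuous_on_compose2[OF assms ch] by auto
  have "(f has_integral integral (cbox (0, 0) (1, 1)) f) (cbox (0, 0) (1, 1))"
    using integrable_continuous[OF continuous_on_subset[OF fc]] by (simp add: integrable_integral)
  note hi = this
  have "isCont g x" for x
    unfolding g_def by (intro continuous_intros)
  moreover have "\<exists>w z. g ` cbox u v = cbox w z" for u v using boxg by blast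
  moreover have "\<exists>w z. h ` cbox u v = cbox w z" for u v using boxh by blast
  ultimately have "((\<lambda>x. f (g x)) has_integral (1 / 1) *\<^sub>R integral (cbox (0, 0) (1, 1)) f) (h ` cbox (0, 0) (1, 1))"
    by (intro has_integral_twiddle[OF _ hg gh _ _ _ cont hi]) simp_all
  moreover have "h ` cbox (0, 0) (1, 1) = cbox 0 1"
    unfolding boxh by (rule arg_cong2[where f=cbox]) (auto simp: h_def vec_eq_iff forall_2)
  ultimately have "integral (cbox 0 1) F = integral (cbox (0, 0) (1, 1)) f"
    by (simp add: f_def hg integral_unique)
  also have "\<dots> = I01 (\<lambda>s. I01 (\<lambda>t. f (s, t)))"
    using integral_prod_continuous[OF continuous_on_subset[OF fc]] by simp
  finally show ?thesis by (simp add: f_def h_def)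
qed


text \<open>Lagrange's identity: the squared determinant is the product of the squared lengths minus
  the squared inner product.\<close>

lemma det_columns_sq:
  fixes d e :: R2
  assumes "d \<bullet> e = 0"
  shows "\<bar>det (matrix (\<lambda>x::R2. x $ 1 *\<^sub>R d + x $ 2 *\<^sub>R e))\<bar> = norm d * norm e"
proof -
  have "(det (matrix (\<lambda>x::R2. x $ 1 *\<^sub>R d + x $ 2 *\<^sub>R e)))\<^sup>2 = (d $ 1 * e $ 2 - e $ 1 * d $ 2)\<^sup>2"
    by (simp add: det_2 matrix_def axis_def)
  also have "\<dots> = (norm d)\<^sup>2 * (norm e)\<^sup>2 - (d \<bullet> e)\<^sup>2"
    unfolding norm_R2_sq inner_R2 by (simp add: power2_eq_square algebra_simps)
  also have "\<dots> = (norm d * norm e)\<^sup>2" using assms by (simp add: power_mult_distrib)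
  finally show ?thesis
    unfolding power2_eq_iff by auto
qed

lemma orthogonal_coords:
  fixes d e x :: R2
  assumes "d \<bullet> e = 0" "d \<noteq> 0" "e \<noteq> 0" "x = s *\<^sub>R d + t *\<^sub>R e"
  shows "s = (x \<bullet> d) / (d \<bullet> d)" "t = (x \<bullet> e) / (e \<bullet> e)"
  using assms by (simp_all add: inner_add_left inner_commute[of e d])

lemma rectangle_integral:
  fixes F :: "R2 \<Rightarrow> real"
  assumes F: "continuous_on UNIV F" and de: "d \<bullet> e = 0" "d \<noteq> 0" "e \<noteq> 0"
  shows "(\<integral>x. F x \<partial>lebesgue_on (rectangle a d e))
    = norm d * norm e * I01 (\<lambda>s. I01 (\<lambda>t. F (a + s *\<^sub>R d + t *\<^sub>R e)))"
proof -
  define L where "L x = x $ 1 *\<^sub>R d + x $ 2 *\<^sub>R e" for x :: R2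
  define g where "g x = a + L x" for x :: R2
  \<comment> \<open>The change of variables theorem is about vector-valued functions, so the scalar
    integrand becomes a vector with one component.\<close>
  define f :: "R2 \<Rightarrow> real^1" where "f x = (\<chi> i. F x)" for x
  have lin: "linear L"
    by (auto simp: L_def linear_iff algebra_simps)
  have cg: "continuous_on UNIV g"
    unfolding g_def L_def by (intro continuous_intros)
  have img: "g ` cbox 0 1 = rectangle a d e"
  proof (intro set_eqI iffI)
    fix p assume "p \<in> g ` cbox 0 1"
    then obtain x :: R2 where x: "x \<in> cbox 0 1" "p = a + x $ 1 *\<^sub>R d + x $ 2 *\<^sub>R e"
      by (auto simp: g_def L_def add.assoc)
    then show "p \<in> rectangle a d e"
      unfolding x(2) by (intro rectangle_memI) (auto simp: mem_box_cart)
  next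
    fix p assume "p \<in> rectangle a d e"
    then obtain s t where st: "s \<in> {0..1}" "t \<in> {0..1}" and p: "p = a + s *\<^sub>R d + t *\<^sub>R e"
      by (auto simp: rectangle_eq_image)
    have "p = g (vector [s, t])" by (simp add: p g_def L_def add.assoc)
    moreover have "vector [s, t] \<in> (cbox 0 1 :: R2 set)" using st by (simp add: mem_box_cart forall_2)
    ultimately show "p \<in> g ` cbox 0 1" by blast
  qed
  have inj: "inj_on g (cbox 0 1)"
  proof (rule inj_onI)
    fix x y assume "g x = g y"
    then have "L x = y $ 1 *\<^sub>R d + y $ 2 *\<^sub>R e" "L x = x $ 1 *\<^sub>R d + x $ 2 *\<^sub>R e" by (simp_all add: g_def L_def)
    from orthogonal_coords[OF de this(1)] orthogonal_coords[OF de this(2)]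
    show "x = y" by (simp add: vec_eq_iff forall_2)
  qed
  have der: "(g has_derivative L) (at x within cbox 0 1)" for x
    unfolding g_def using has_derivative_add[OF has_derivative_const linear_imp_has_derivative[OF lin]] by simp
  have det: "\<bar>det (matrix L)\<bar> = norm d * norm e"
    using det_columns_sq[OF de(1)] by (simp add: L_def[abs_def])
  have cFg: "continuous_on UNIV (\<lambda>x. F (g x))"
    using continuous_on_compose2[OF F cg] by simp
  have cf: "continuous_on UNIV (\<lambda>x. (norm d * norm e) *\<^sub>R f (g x))"
    unfolding f_def by (intro continuous_intros continuous_on_vec_lambda cFg)
  have "(\<lambda>x. \<bar>det (matrix L)\<bar> *\<^sub>R f (g x)) absolutely_integrable_on cbox 0 1"
    unfolding det by (rule absolutely_integrable_continuous) (rule continuous_on_subset[OF cf], simp)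
  then have "f absolutely_integrable_on (rectangle a d e)"
    and *: "integral (rectangle a d e) f = integral (cbox 0 1) (\<lambda>x. \<bar>det (matrix L)\<bar> *\<^sub>R f (g x))"
    using has_absolute_integral_change_of_variables[OF _ der inj, of f] by (auto simp: img)
  then have "f integrable_on (rectangle a d e)"
    by (simp add: absolutely_integrable_on_def)
  have "(\<integral>x. F x \<partial>lebesgue_on (rectangle a d e)) = integral (rectangle a d e) F"
    by (intro lebesgue_integral_eq_integral continuous_integrable_compact compact_rectangle continuous_on_subset[OF F]) auto
  also have "\<dots> = integral (rectangle a d e) (\<lambda>x. f x $ 1)" by (simp add: f_def)
  also have "\<dots> = integral (rectangle a d e) f $ 1"
    by (rule integral_component_eq_cart) fact
  also have "\<dots> = integral (cbox 0 1) (\<lambda>x. (norm d * norm e) *\<^sub>R f (g x)) $ 1"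
    unfolding * det ..
  also have "\<dots> = integral (cbox 0 1) (\<lambda>x. ((norm d * norm e) *\<^sub>R f (g x)) $ 1)"
    by (rule integral_component_eq_cart[symmetric]) (rule integrable_continuous[OF continuous_on_subset[OF cf]], simp)
  also have "\<dots> = norm d * norm e * integral (cbox 0 1) (\<lambda>x. F (g x))"
    by (simp add: f_def)
  also have "integral (cbox 0 1) (\<lambda>x. F (g x)) = I01 (\<lambda>s. I01 (\<lambda>t. F (g (vector [s, t]))))"
    by (rule unit_square_integral[OF cFg])
  finally show ?thesis by (simp add: g_def L_def add.assoc)
qed

lemma cont_rectangle_param:
  fixes F :: "'v::real_normed_vector \<Rightarrow> 'c::topological_space"
  assumes "continuous_on UNIV F"
  shows "continuous_on UNIV (\<lambda>p. F (a + fst p *\<^sub>R d + snd p *\<^sub>R e))"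
  by (rule continuous_on_compose2[OF assms]) (auto intro!: continuous_intros)

lemma vector_derivative_along:
  assumes "smooth F"
  shows "((\<lambda>s. F (x + s *\<^sub>R v)) has_vector_derivative frechet_derivative F (at (x + s *\<^sub>R v)) v) (at s)"
proof -
  have "((\<lambda>s. x + s *\<^sub>R v) has_derivative (\<lambda>h. h *\<^sub>R v)) (at s)"
    by (auto intro!: derivative_eq_intros)
  from has_derivative_compose[OF this smooth_has_derivative[OF assms]]
  show ?thesis
    unfolding has_vector_derivative_def
    by (simp add: linear_cmul[OF has_derivative_linear[OF smooth_has_derivative[OF assms]]])
qed

lemma rectangle_swap: "rectangle a d e = rectangle a e d"
  by (simp add: rectangle_def insert_commute add_ac)

lemma rectangle_FTC:
  fixes F :: sfield
  assumes F: "smooth F" and de: "d \<bullet> e = 0" "d \<noteq> 0" "e \<noteq> 0"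
  shows "(\<integral>x. frechet_derivative F (at x) e \<partial>lebesgue_on (rectangle a d e))
    = norm d * norm e * (I01 (\<lambda>s. F (a + e + s *\<^sub>R d)) - I01 (\<lambda>s. F (a + s *\<^sub>R d)))"
proof -
  have c: "continuous_on UNIV (\<lambda>s. F (x + s *\<^sub>R d))" for x
    by (rule continuous_on_compose2[OF smooth_continuous_on[OF F, of UNIV]]) (auto intro!: continuous_intros)
  have "I01 (\<lambda>t. frechet_derivative F (at (a + s *\<^sub>R d + t *\<^sub>R e)) e) = F (a + e + s *\<^sub>R d) - F (a + s *\<^sub>R d)" for s
    using fundamental_theorem_of_calculus[of 0 1 "\<lambda>t. F (a + s *\<^sub>R d + t *\<^sub>R e)",
        OF _ has_vector_derivative_at_within[OF vector_derivative_along[OF F]]]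
    by (simp add: integral_unique algebra_simps)
  then show ?thesis
    unfolding rectangle_integral[OF frechet_derivative_continuous_on[OF F] de]
    by (simp add: I01_diff[OF c c])
qed

section \<open>Edges of rectangles\<close>

lemma rectangle_memE:
  assumes "x \<in> rectangle a d e"
  obtains s t where "s \<in> {0..1}" "t \<in> {0..1}" "x = a + s *\<^sub>R d + t *\<^sub>R e"
  using assms by (auto simp: rectangle_eq_image)

lemma segment_memE:
  fixes a d :: "'v::real_vector"
  assumes "x \<in> closed_segment a (a + d)"
  obtains s where "s \<in> {0..1}" "x = a + s *\<^sub>R d"
  using assms by (auto simp: in_segment algebra_simps)

lemma rectangle_flip: "rectangle (a + d) (- d) e = rectangle a d e"
  by (simp add: rectangle_def insert_commute add_ac)

lemma rectangle_flip': "rectangle (a + e) d (- e) = rectangle a d e"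
  by (simp add: rectangle_def insert_commute add_ac)

locale rect =
  fixes a d e :: R2
  assumes nz: "d \<noteq> 0" "e \<noteq> 0" and orth: "d \<bullet> e = 0"
begin

lemma orth': "e \<bullet> d = 0"
  using orth by (simp add: inner_commute)

lemma swap: "rect e d"
  by unfold_locales (use nz orth' in auto)

lemma flip: "rect (- d) e"
  by unfold_locales (use nz orth in auto)

lemma measure_rectangle: "measure lebesgue (rectangle a d e) = norm d * norm e"
  using rectangle_integral[OF continuous_on_const[of UNIV "1::real"] orth nz, of a]
  by (simp add: measure_restrict_space)

text \<open>With empty interior the rectangle would be contained in its own frontier, which is a
  null set by convexity; but its area is positive.\<close>

lemma interior_rectangle_nonempty: "interior (rectangle a d e) \<noteq> {}"
proof
  assume "interior (rectangle a d e) = {}"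
  then have "rectangle a d e \<subseteq> frontier (rectangle a d e)"
    using compact_rectangle[of a d e] by (auto simp: frontier_def compact_imp_closed closure_closed)
  then have "negligible (rectangle a d e)"
    using negligible_convex_frontier[OF convex_rectangle] negligible_subset by blast
  then have "measure lebesgue (rectangle a d e) = 0"
    by (simp add: negligible_iff_null_sets measure_eq_0_null_sets)
  then show False using nz by (simp add: measure_rectangle)
qed

lemma aff_dim_rectangle: "aff_dim (rectangle a d e) = 2"
  using aff_dim_nonempty_interior[OF interior_rectangle_nonempty] by simp

lemma corner_distinct: "d \<noteq> e" "d + e \<noteq> 0" "d \<noteq> - e"
  using nz orth by (auto simp: add_eq_0_iff)

lemma inner_corner: "d \<bullet> d > 0" "e \<bullet> e > 0"
  using nz by auto

text \<open>The line through this side is a supporting hyperplane with normal \<open>e\<close>,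
  since the \<open>e\<close>-coordinate is smallest there.\<close>

lemma edge_first: "closed_segment a (a + d) edge_of rectangle a d e"
proof -
  have le: "a \<bullet> e \<le> x \<bullet> e" if x: "x \<in> rectangle a d e" for x
    using x inner_corner by (auto simp: rectangle_eq_image inner_add_left orth)
  have "rectangle a d e \<inter> {x. e \<bullet> x = a \<bullet> e} = closed_segment a (a + d)"
  proof (intro set_eqI iffI)
    fix x assume "x \<in> rectangle a d e \<inter> {x. e \<bullet> x = a \<bullet> e}"
    then have x: "x \<in> rectangle a d e" "x \<bullet> e = a \<bullet> e" by (simp_all add: inner_commute)
    obtain s t where st: "s \<in> {0..1}" "x = a + s *\<^sub>R d + t *\<^sub>R e" "x \<bullet> e = a \<bullet> e"
      using rectangle_memE[OF x(1)] x(2) by metis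
    then have "t = 0" using inner_corner by (simp add: inner_add_left orth)
    then show "x \<in> closed_segment a (a + d)"
      using st by (auto simp: in_segment algebra_simps intro!: exI[of _ s])
  next
    fix x assume "x \<in> closed_segment a (a + d)"
    then obtain s where s: "s \<in> {0..1}" "x = a + s *\<^sub>R d"
      by (rule segment_memE)
    then show "x \<in> rectangle a d e \<inter> {x. e \<bullet> x = a \<bullet> e}"
      using rectangle_memI[of s 0 a d e] by (simp add: inner_add_right orth orth' inner_commute)
  qed
  moreover have "(rectangle a d e \<inter> {x. e \<bullet> x = a \<bullet> e}) face_of rectangle a d e"
    by (rule face_of_Int_supporting_hyperplane_ge[OF convex_rectangle]) (use le in \<open>simp add: inner_commute\<close>)
  moreover have "aff_dim (closed_segment a (a + d)) = 1"
    using nz by (simp add: segment_convex_hull aff_dim_convex_hull)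
  ultimately show ?thesis by (simp add: edge_of_def)
qed

end

text \<open>A face is the hull of a subset of the corners. Dimension 1 forces two of them, and a
  diagonal is excluded because it contains the centre.\<close>

lemma (in rect) edges:
  "E edge_of rectangle a d e \<longleftrightarrow> E \<in> {closed_segment a (a + d), closed_segment (a + e) (a + e + d),
     closed_segment a (a + e), closed_segment (a + d) (a + d + e)}"
proof
  \<comment> \<open>Reflections of the rectangle carry the first side to each of the other
    three.\<close>
  interpret s: rect a e d by (rule swap)
  interpret f: rect "a + d" "- d" e by (rule flip)
  interpret sf: rect "a + e" "- e" d by (rule rect.flip[OF swap])
  interpret fs: rect "a + d" e "- d" by (rule f.swap)
  assume "E \<in> {closed_segment a (a + d), closed_segment (a + e) (a + e + d),
     closed_segment a (a + e), closed_segment (a + d) (a + d + e)}"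
  moreover have "closed_segment a (a + e) edge_of rectangle a d e"
    using s.edge_first by (simp add: rectangle_swap[of a d])
  moreover have "closed_segment (a + e) (a + e + d) edge_of rectangle a d e"
    using rect.edge_first[OF sf.swap, of "a + e"] by (simp add: rectangle_flip')
  moreover have "closed_segment (a + d) (a + d + e) edge_of rectangle a d e"
    using fs.edge_first by (simp add: rectangle_flip' rectangle_swap[of a d])
  ultimately show "E edge_of rectangle a d e" using edge_first by auto
next
  assume E: "E edge_of rectangle a d e"
  let ?V = "{a, a + d, a + e, a + d + e}"
  have F: "E face_of rectangle a d e" and dim: "aff_dim E = 1" using E by (auto simp: edge_of_def)
  obtain S where S: "S \<subseteq> ?V" "E = convex hull S"
    using face_of_convex_hull_subset[OF _ F[unfolded rectangle_def]] by (metis finite.emptyI finite.insertI finite_imp_compact)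
  have SE: "S \<subseteq> E" using S by (simp add: hull_subset)
  have no: False if "E = rectangle a d e" using that dim aff_dim_rectangle by simp
  have sub: "E \<noteq> rectangle a d e \<Longrightarrow> \<not> ?V \<subseteq> E"
  proof
    assume "?V \<subseteq> E" "E \<noteq> rectangle a d e"
    then have "rectangle a d e \<subseteq> E"
      unfolding rectangle_def using S(2) by (intro hull_minimal) auto
    then show False using F \<open>E \<noteq> _\<close> face_of_imp_subset by blast
  qed
  have v: "?V \<subseteq> rectangle a d e"
    by (auto simp: rectangle_def intro!: hull_inc)
  \<comment> \<open>The centre lies in both open diagonals; a face that contains it contains the
    ends of both, hence the whole rectangle.\<close>
  have mid: "a + (1/2) *\<^sub>R (d + e) \<in> open_segment a (a + d + e)" "a + (1/2) *\<^sub>R (d + e) \<in> open_segment (a + d) (a + e)"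
  proof -
    have "a + (1/2) *\<^sub>R (d + e) = midpoint a (a + d + e)" "a + (1/2) *\<^sub>R (d + e) = midpoint (a + d) (a + e)"
      by (simp_all add: midpoint_def vec_eq_iff field_simps)
    moreover have "a \<noteq> a + d + e" "a + d \<noteq> a + e"
      using corner_distinct by (auto simp: add.assoc)
    ultimately show "a + (1/2) *\<^sub>R (d + e) \<in> open_segment a (a + d + e)" "a + (1/2) *\<^sub>R (d + e) \<in> open_segment (a + d) (a + e)"
      by (metis midpoint_in_open_segment)+
  qed
  have midE: "a + (1/2) *\<^sub>R (d + e) \<in> E \<Longrightarrow> False"
  proof -
    assume "a + (1/2) *\<^sub>R (d + e) \<in> E"
    then have "?V \<subseteq> E"
      using face_ofD[OF F mid(1)] face_ofD[OF F mid(2)] v by auto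
    then show False using no sub by blast
  qed
  have cv: "convex E" using S by simp
  have 1: "\<not> (a \<in> S \<and> a + d + e \<in> S)"
    using midE mid(1) SE closed_segment_subset[OF _ _ cv] segment_open_subset_closed by blast
  have 2: "\<not> (a + d \<in> S \<and> a + e \<in> S)"
    using midE mid(2) SE closed_segment_subset[OF _ _ cv] segment_open_subset_closed by blast
  have two: "S = {x, y}" if "S \<subseteq> {x, y}" for x y
  proof (rule ccontr)
    assume "S \<noteq> {x, y}"
    then have "S \<subseteq> {x} \<or> S \<subseteq> {y}" using that by auto
    then have "aff_dim S \<le> 0" using aff_dim_subset[of S "{x}"] aff_dim_subset[of S "{y}"] by auto
    then show False using dim S by (simp add: aff_dim_convex_hull)
  qed
  have "S \<subseteq> {a, a + d} \<or> S \<subseteq> {a + e, a + e + d} \<or> S \<subseteq> {a, a + e} \<or> S \<subseteq> {a + d, a + d + e}"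
  proof -
    have eq: "a + e + d = a + d + e" by simp
    show ?thesis unfolding eq using S(1) 1 2 by blast
  qed
  then show "E \<in> {closed_segment a (a + d), closed_segment (a + e) (a + e + d),
     closed_segment a (a + e), closed_segment (a + d) (a + d + e)}"
    using two S(2) by (auto simp: segment_convex_hull)
qed

lemma (in rect) edges_distinct:
  "closed_segment a (a + d) \<noteq> closed_segment (a + e) (a + e + d)"
  "closed_segment a (a + d) \<noteq> closed_segment a (a + e)"
  "closed_segment a (a + d) \<noteq> closed_segment (a + d) (a + d + e)"
  "closed_segment (a + e) (a + e + d) \<noteq> closed_segment a (a + e)"
  "closed_segment (a + e) (a + e + d) \<noteq> closed_segment (a + d) (a + d + e)"
  "closed_segment a (a + e) \<noteq> closed_segment (a + d) (a + d + e)"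
  using nz corner_distinct by (auto simp: doubleton_eq_iff add_eq_0_iff)

lemma is_rectangle_iff: "is_rectangle K \<longleftrightarrow> (\<exists>a d e. rect d e \<and> K = rectangle a d e)"
  by (auto simp: is_rectangle_def rect_def)

text \<open>By choosing the corner and the order of the sides suitably, a statement about an edge
  reduces to the side from \<open>a\<close> along \<open>d\<close>.\<close>

lemma edge_wlog:
  assumes K: "is_rectangle K" and E: "E edge_of K"
  obtains a d e where "rect d e" "K = rectangle a d e" "E = closed_segment a (a + d)"
proof -
  obtain a d e where r: "rect d e" and Keq: "K = rectangle a d e"
    using K by (auto simp: is_rectangle_iff)
  consider "E = closed_segment a (a + d)" | "E = closed_segment (a + e) (a + e + d)"
    | "E = closed_segment a (a + e)" | "E = closed_segment (a + d) (a + d + e)"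
    using E rect.edges[OF r] Keq by auto
  then show thesis
  proof cases
    case 1 then show ?thesis using that r Keq by blast
  next
    case 2
    show ?thesis
    proof (rule that[of d "- e" "a + e"])
      show "rect d (- e)" using rect.swap[OF rect.flip[OF rect.swap[OF r]]] .
      show "K = rectangle (a + e) d (- e)"
        unfolding Keq by (simp add: rectangle_flip')
    qed (simp add: 2)
  next
    case 3
    then show ?thesis using that[of e d a] rect.swap[OF r] Keq rectangle_swap by metis
  next
    case 4
    show ?thesis
    proof (rule that[of e "- d" "a + d"])
      show "rect e (- d)" using rect.swap[OF rect.flip[OF r]] .
      show "K = rectangle (a + d) e (- d)"
        unfolding Keq by (simp add: rectangle_flip' rectangle_swap[of a d])
    qed (simp add: 4)
  qed
qed

text \<open>Taking both ends of the edge for \<open>x\<close> and \<open>y\<close> shows that a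
  candidate \<open>n\<close> is orthogonal to \<open>d\<close>, so it is a multiple of
  \<open>e\<close>; the point \<open>a + e\<close> fixes the sign and the norm fixes the
  length.\<close>

lemma outward_normal_first:
  assumes "rect d e"
  shows "outward_normal (rectangle a d e) (closed_segment a (a + d)) = - (1 / norm e) *\<^sub>R e"
proof -
  interpret rect a d e by fact
  show ?thesis
    unfolding outward_normal_def
  proof (rule the_equality, intro conjI ballI)
    show "norm (- (1 / norm e) *\<^sub>R e) = 1" using nz by simp
    fix x y assume x: "x \<in> closed_segment a (a + d)" and y: "y \<in> rectangle a d e"
    obtain s s' t where "x = a + s *\<^sub>R d" "y = a + s' *\<^sub>R d + t *\<^sub>R e" "t \<in> {0..1}"
      using segment_memE[OF x] rectangle_memE[OF y] by metis
    then show "(- (1 / norm e) *\<^sub>R e) \<bullet> (y - x) \<le> 0"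
      using inner_corner by (simp add: inner_simps orth' zero_le_divide_iff divide_nonneg_nonneg)
  next
    fix n assume n: "norm n = 1 \<and> (\<forall>x\<in>closed_segment a (a + d). \<forall>y\<in>rectangle a d e. n \<bullet> (y - x) \<le> 0)"
    have v: "a \<in> rectangle a d e" "a + d \<in> rectangle a d e" "a + e \<in> rectangle a d e"
      by (auto simp: rectangle_def intro!: hull_inc)
    have "n \<bullet> d \<le> 0" "- (n \<bullet> d) \<le> 0" and ne: "n \<bullet> e \<le> 0"
    proof -
      have le: "n \<bullet> (y - x) \<le> 0" if "x \<in> {a, a + d}" "y \<in> rectangle a d e" for x y
        using n that by auto
      show "n \<bullet> d \<le> 0" "- (n \<bullet> d) \<le> 0" "n \<bullet> e \<le> 0"
        using le[of a "a + d"] le[of "a + d" a] le[of a "a + e"] v by (simp_all add: inner_simps)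
    qed
    then have nd: "n \<bullet> d = 0" by simp
    define c where "c = (n \<bullet> e) / (e \<bullet> e)"
    have "n = c *\<^sub>R e"
    proof -
      define m where "m = n - c *\<^sub>R e"
      have "m \<bullet> e = 0" "m \<bullet> d = 0" using inner_corner nd orth' by (auto simp: m_def c_def inner_diff_left)
      \<comment> \<open>In the plane two nonzero orthogonal vectors span: Cramer's rule, with a
        determinant that is nonzero by Lagrange's identity.\<close>
      moreover have "m = 0" if "m \<bullet> e = 0" "m \<bullet> d = 0"
      proof -
        have "(m $ 1 * e $ 1 + m $ 2 * e $ 2 = 0)" "(m $ 1 * d $ 1 + m $ 2 * d $ 2 = 0)" "d $ 1 * e $ 1 + d $ 2 * e $ 2 = 0"
          using that orth by (simp_all add: inner_R2)
        then have "m $ 1 * (e $ 1 * d $ 2 - e $ 2 * d $ 1) = 0" "m $ 2 * (e $ 1 * d $ 2 - e $ 2 * d $ 1) = 0"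
          by algebra+
        moreover have "(e $ 1 * d $ 2 - e $ 2 * d $ 1)\<^sup>2 = (d \<bullet> d) * (e \<bullet> e) - (d \<bullet> e)\<^sup>2"
          by (simp add: inner_R2 power2_eq_square algebra_simps)
        then have "e $ 1 * d $ 2 - e $ 2 * d $ 1 \<noteq> 0" using inner_corner orth by auto
        ultimately show ?thesis by (simp add: vec_eq_iff forall_2)
      qed
      ultimately show ?thesis by (simp add: m_def)
    qed
    moreover have "c \<le> 0" using ne inner_corner by (simp add: c_def divide_nonpos_pos)
    ultimately have "1 = - c * norm e" using n by simp
    then have "c = - (1 / norm e)" using nz by (simp add: field_simps)
    then show "n = - (1 / norm e) *\<^sub>R e" using \<open>n = c *\<^sub>R e\<close> by simp
  qed
qed

lemma (in rect) outward_normals: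
  "outward_normal (rectangle a d e) (closed_segment a (a + d)) = - (1 / norm e) *\<^sub>R e"
  "outward_normal (rectangle a d e) (closed_segment (a + e) (a + e + d)) = (1 / norm e) *\<^sub>R e"
  "outward_normal (rectangle a d e) (closed_segment a (a + e)) = - (1 / norm d) *\<^sub>R d"
  "outward_normal (rectangle a d e) (closed_segment (a + d) (a + d + e)) = (1 / norm d) *\<^sub>R d"
proof -
  have r: "rect d e" by unfold_locales
  show "outward_normal (rectangle a d e) (closed_segment a (a + d)) = - (1 / norm e) *\<^sub>R e"
    by (rule outward_normal_first[OF r])
  show "outward_normal (rectangle a d e) (closed_segment (a + e) (a + e + d)) = (1 / norm e) *\<^sub>R e"
    using outward_normal_first[OF rect.swap[OF rect.flip[OF swap]], of "a + e"]
    by (simp add: rectangle_flip')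
  show "outward_normal (rectangle a d e) (closed_segment a (a + e)) = - (1 / norm d) *\<^sub>R d"
    using outward_normal_first[OF swap, of a] by (simp add: rectangle_swap[of a d])
  show "outward_normal (rectangle a d e) (closed_segment (a + d) (a + d + e)) = (1 / norm d) *\<^sub>R d"
    using outward_normal_first[OF rect.swap[OF flip], of "a + d"]
    by (simp add: rectangle_flip' rectangle_swap[of a d])
qed

section \<open>Integrals over segments\<close>

lemma space_segment_measure [simp]: "space (segment_measure a b) = closed_segment a b"
  by (simp add: segment_measure_def space_restrict_space)

lemma segment_param_measurable:
  fixes p q :: R2
  shows "(\<lambda>s. p + (s / dist p q) *\<^sub>R (q - p)) \<in> measurable (lebesgue_on {0..dist p q}) (restrict_space borel (closed_segment p q))"
proof (rule measurable_restrict_space2)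
  show "(\<lambda>s. p + (s / dist p q) *\<^sub>R (q - p)) \<in> space (lebesgue_on {0..dist p q}) \<rightarrow> closed_segment p q"
  proof
    fix s assume "s \<in> space (lebesgue_on {0..dist p q})"
    then have "s / dist p q \<in> {0..1}" by (cases "p = q") (auto simp: divide_le_eq_1)
    then show "p + (s / dist p q) *\<^sub>R (q - p) \<in> closed_segment p q"
      unfolding in_segment by (intro exI[of _ "s / dist p q"]) (simp add: algebra_simps)
  qed
  show "(\<lambda>s. p + (s / dist p q) *\<^sub>R (q - p)) \<in> borel_measurable (lebesgue_on {0..dist p q})"
  proof (rule continuous_imp_measurable_on_sets_lebesgue)
    show "continuous_on {0..dist p q} (\<lambda>s. p + (s / dist p q) *\<^sub>R (q - p))"
      unfolding divide_inverse by (intro continuous_intros)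
  qed auto
qed

lemma segment_integrable:
  fixes F :: "R2 \<Rightarrow> 'c::euclidean_space"
  assumes F: "continuous_on UNIV F"
  shows "integrable (segment_measure p q) F"
  unfolding segment_measure_def
proof (subst integrable_distr_eq)
  show "(\<lambda>s. p + (s / dist p q) *\<^sub>R (q - p)) \<in> measurable (lebesgue_on {0..dist p q}) (restrict_space borel (closed_segment p q))"
    by (rule segment_param_measurable)
  show "F \<in> borel_measurable (restrict_space borel (closed_segment p q))"
    by (rule borel_measurable_continuous_on_restrict) (rule continuous_on_subset[OF F], simp)
  show "integrable (lebesgue_on {0..dist p q}) (\<lambda>s. F (p + (s / dist p q) *\<^sub>R (q - p)))"
    unfolding divide_inverse
    by (intro continuous_integrable_compact continuous_on_compose2[OF F] continuous_intros) auto
qed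

lemma segment_integral:
  fixes F :: "R2 \<Rightarrow> 'c::euclidean_space"
  assumes pq: "p \<noteq> q" and F: "continuous_on UNIV F"
  shows "(\<integral>x. F x \<partial>segment_measure p q) = dist p q *\<^sub>R I01 (\<lambda>s. F (p + s *\<^sub>R (q - p)))"
proof -
  define l where "l = dist p q"
  have l: "l > 0" using pq by (simp add: l_def)
  have c: "continuous_on S (\<lambda>s. F (p + (s / l) *\<^sub>R (q - p)))" "continuous_on S (\<lambda>s. F (p + s *\<^sub>R (q - p)))" for S
    by (intro continuous_on_compose2[OF F] continuous_intros; use l in auto)+
  have "(\<integral>x. F x \<partial>segment_measure p q) = (\<integral>s. F (p + (s / l) *\<^sub>R (q - p)) \<partial>lebesgue_on {0..l})"
    unfolding segment_measure_def l_def
    by (rule integral_distr[OF segment_param_measurable])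
      (rule borel_measurable_continuous_on_restrict, rule continuous_on_subset[OF F], simp)
  also have "\<dots> = integral {0..l} (\<lambda>s. F (p + (s / l) *\<^sub>R (q - p)))"
    by (intro lebesgue_integral_eq_integral continuous_integrable_compact c) auto
  also have "\<dots> = l *\<^sub>R I01 (\<lambda>s. F (p + s *\<^sub>R (q - p)))"
  proof -
    have "((\<lambda>s. F (p + s *\<^sub>R (q - p))) has_integral I01 (\<lambda>s. F (p + s *\<^sub>R (q - p)))) {0..1}"
      by (intro integrable_integral integrable_continuous_real c)
    from has_integral_stretch_real[OF this, of "1 / l"] l
    have "((\<lambda>s. F (p + (s / l) *\<^sub>R (q - p))) has_integral l *\<^sub>R I01 (\<lambda>s. F (p + s *\<^sub>R (q - p)))) ((\<lambda>x. x * l) ` {0..1})"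
      by simp
    moreover have "(\<lambda>x. x * l) ` {0..1} = {0..l}"
      using l image_mult_atLeastAtMost[of l 0 1] by (simp add: mult.commute)
    ultimately show ?thesis by (simp add: integral_unique)
  qed
  finally show ?thesis by (simp add: l_def)
qed

lemma I01_reverse:
  fixes f :: "real \<Rightarrow> 'c::euclidean_space"
  assumes "continuous_on UNIV f"
  shows "I01 (\<lambda>s. f (1 - s)) = I01 f"
proof -
  have "(f has_integral I01 f) (cbox 0 1)"
    using integrable_integral[OF cont_integrable_01[OF assms]] by simp
  from has_integral_affinity[OF this, of "-1" 1]
  have "((\<lambda>s. f (1 - s)) has_integral I01 f) ((\<lambda>x. 1 - x) ` {0..1})"
    by simp
  moreover have "(\<lambda>x. 1 - x) ` {0..1} = {0..1::real}"
    by (auto intro: image_eqI[of _ _ "1 - _"])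
  ultimately show ?thesis by (simp add: integral_unique)
qed

text \<open>The choice in \<open>edge_measure\<close> ranges over all ways to write the set as a
  segment, and a segment determines its endpoints up to order. Integrals agree for both orders by
  \<open>I01_reverse\<close>.\<close>

lemma edge_measure_cases:
  "edge_measure (closed_segment p q) = segment_measure p q \<or> edge_measure (closed_segment p q) = segment_measure q p"
proof -
  have "\<exists>M a b. closed_segment p q = closed_segment a b \<and> M = segment_measure a b" by blast
  then have "\<exists>a b. closed_segment p q = closed_segment a b \<and> edge_measure (closed_segment p q) = segment_measure a b"
    unfolding edge_measure_def by (rule someI_ex)
  then show ?thesis by (auto simp: doubleton_eq_iff)
qed

lemma edge_integral:
  fixes F :: "R2 \<Rightarrow> 'c::euclidean_space"
  assumes pq: "p \<noteq> q" and F: "continuous_on UNIV F"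
  shows "(\<integral>x. F x \<partial>edge_measure (closed_segment p q)) = dist p q *\<^sub>R I01 (\<lambda>s. F (p + s *\<^sub>R (q - p)))"
proof -
  have "I01 (\<lambda>s. F (q + s *\<^sub>R (p - q))) = I01 (\<lambda>s. F (p + (1 - s) *\<^sub>R (q - p)))"
    by (simp add: algebra_simps)
  also have "\<dots> = I01 (\<lambda>s. F (p + s *\<^sub>R (q - p)))"
    by (rule I01_reverse) (auto intro!: continuous_on_compose2[OF F] continuous_intros)
  finally show ?thesis
    using edge_measure_cases[of p q] segment_integral[OF pq F] segment_integral[OF pq[symmetric] F]
    by (auto simp: dist_commute)
qed

lemma space_edge_measure [simp]: "space (edge_measure (closed_segment p q)) = closed_segment p q"
  using edge_measure_cases[of p q] by (auto simp: closed_segment_commute)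

lemma edge_integrable:
  fixes F :: "R2 \<Rightarrow> 'c::euclidean_space"
  assumes "continuous_on UNIV F"
  shows "integrable (edge_measure (closed_segment p q)) F"
  using edge_measure_cases[of p q] segment_integrable[of F p q] segment_integrable[of F q p] assms by auto

lemma edge_in_L2:
  fixes F :: "R2 \<Rightarrow> 'c::euclidean_space"
  assumes F: "continuous_on UNIV F"
  shows "in_L2 (edge_measure (closed_segment p q)) F" "in_L2 (segment_measure p q) F"
proof -
  have F2: "continuous_on UNIV (\<lambda>x. (norm (F x))\<^sup>2)" by (intro continuous_intros F)
  show "in_L2 (edge_measure (closed_segment p q)) F" "in_L2 (segment_measure p q) F"
    unfolding in_L2_def using edge_integrable[OF F] edge_integrable[OF F2] segment_integrable[OF F] segment_integrable[OF F2]
    by (simp_all add: borel_measurable_integrable)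
qed

lemma edge_L2_sq:
  fixes F :: "R2 \<Rightarrow> 'c::euclidean_space"
  assumes pq: "p \<noteq> q" and F: "continuous_on UNIV F"
  shows "(L2_norm (edge_measure (closed_segment p q)) F)\<^sup>2 = dist p q * I01 (\<lambda>s. (norm (F (p + s *\<^sub>R (q - p))))\<^sup>2)"
    and "L2_norm (segment_measure p q) F = L2_norm (edge_measure (closed_segment p q)) F"
proof -
  have F2: "continuous_on UNIV (\<lambda>x. (norm (F x))\<^sup>2)" by (intro continuous_intros F)
  show "(L2_norm (edge_measure (closed_segment p q)) F)\<^sup>2 = dist p q * I01 (\<lambda>s. (norm (F (p + s *\<^sub>R (q - p))))\<^sup>2)"
    unfolding L2_norm_sq using edge_integral[OF pq F2] by simp
  show "L2_norm (segment_measure p q) F = L2_norm (edge_measure (closed_segment p q)) F"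
    unfolding L2_norm_def edge_integral[OF pq F2] segment_integral[OF pq F2] ..
qed

text \<open>The endpoints have arc length 0. They have to be discarded because a Dirichlet edge is
  known to lie in \<Gamma>D only without its endpoints.\<close>

lemma AE_segment_open:
  assumes pq: "p \<noteq> q"
  shows "AE x in segment_measure p q. x \<in> open_segment p q"
proof -
  define l where "l = dist p q"
  have l: "l > 0" using pq by (simp add: l_def)
  have op: "open_segment p q \<in> sets (restrict_space borel (closed_segment p q))"
  proof -
    have "open_segment p q = closed_segment p q \<inter> - {p, q}" by (auto simp: open_segment_def)
    moreover have "- {p, q} \<in> sets borel" by (simp add: finite_imp_closed)
    ultimately show ?thesis by (auto simp: sets_restrict_space)
  qed
  have "AE s in lebesgue. s \<in> {0..l} \<longrightarrow> p + (s / l) *\<^sub>R (q - p) \<in> open_segment p q"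
  proof (rule AE_I'[of "{0, l}"])
    show "{0, l} \<in> null_sets lebesgue" by (simp add: finite_imp_null_set_lborel null_sets_completionI)
    show "{s \<in> space lebesgue. \<not> (s \<in> {0..l} \<longrightarrow> p + (s / l) *\<^sub>R (q - p) \<in> open_segment p q)} \<subseteq> {0, l}"
    proof
      fix s assume "s \<in> {s \<in> space lebesgue. \<not> (s \<in> {0..l} \<longrightarrow> p + (s / l) *\<^sub>R (q - p) \<in> open_segment p q)}"
      then have s: "s \<in> {0..l}" "p + (s / l) *\<^sub>R (q - p) \<notin> open_segment p q" by auto
      show "s \<in> {0, l}"
      proof (rule ccontr)
        assume "s \<notin> {0, l}"
        then have "0 < s / l" "s / l < 1" using s l by auto
        then have "p + (s / l) *\<^sub>R (q - p) \<in> open_segment p q"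
          unfolding in_segment using pq by (intro conjI exI[of _ "s / l"]) (auto simp: algebra_simps)
        then show False using s by blast
      qed
    qed
  qed
  then have "AE s in lebesgue_on {0..l}. p + (s / l) *\<^sub>R (q - p) \<in> open_segment p q"
    by (simp add: AE_restrict_space_iff)
  then show ?thesis
    unfolding segment_measure_def l_def
    using op segment_open_subset_closed[of p q]
    by (subst AE_distr_iff[OF segment_param_measurable])
      (auto simp: space_restrict_space Collect_conj_eq Int_absorb1)
qed

section \<open>Green's formula on rectangles\<close>

lemma (in rect) decompose: "b = ((b \<bullet> d) / (d \<bullet> d)) *\<^sub>R d + ((b \<bullet> e) / (e \<bullet> e)) *\<^sub>R e"
proof -
  define m where "m = b - (((b \<bullet> d) / (d \<bullet> d)) *\<^sub>R d + ((b \<bullet> e) / (e \<bullet> e)) *\<^sub>R e)"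
  have "m \<bullet> e = 0" "m \<bullet> d = 0"
    using inner_corner by (simp_all add: m_def inner_diff_left inner_add_left orth orth')
  then have "(m $ 1 * e $ 1 + m $ 2 * e $ 2 = 0)" "(m $ 1 * d $ 1 + m $ 2 * d $ 2 = 0)"
    by (simp_all add: inner_R2)
  then have "m $ 1 * (e $ 1 * d $ 2 - e $ 2 * d $ 1) = 0" "m $ 2 * (e $ 1 * d $ 2 - e $ 2 * d $ 1) = 0"
    by algebra+
  moreover have "(e $ 1 * d $ 2 - e $ 2 * d $ 1)\<^sup>2 = (d \<bullet> d) * (e \<bullet> e) - (d \<bullet> e)\<^sup>2"
    by (simp add: inner_R2 power2_eq_square algebra_simps)
  then have "e $ 1 * d $ 2 - e $ 2 * d $ 1 \<noteq> 0" using inner_corner orth by auto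
  ultimately have "m = 0" by (simp add: vec_eq_iff forall_2)
  then show ?thesis by (simp add: m_def)
qed

text \<open>The direction \<open>b\<close> is split along the two sides. For each side the
  fundamental theorem leaves the values on the two opposite edges, and the quotient of area and
  squared side length combines with \<open>b\<close> to the normal component times the length of the
  edge.\<close>

lemma (in rect) Green:
  fixes F :: sfield
  assumes F: "smooth F"
  shows "(\<integral>x. frechet_derivative F (at x) b \<partial>lebesgue_on (rectangle a d e))
    = (\<Sum>E | E edge_of rectangle a d e. (outward_normal (rectangle a d e) E \<bullet> b) * (\<integral>x. F x \<partial>edge_measure E))"
proof -
  let ?K = "rectangle a d e"
  have cF: "continuous_on UNIV F" by (rule smooth_continuous_on[OF F])
  have ie: "integrable (lebesgue_on ?K) (\<lambda>x. frechet_derivative F (at x) v)" for v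
    by (intro continuous_integrable_compact compact_rectangle frechet_derivative_continuous_on F)
  have "frechet_derivative F (at x) b = ((b \<bullet> d) / (d \<bullet> d)) * frechet_derivative F (at x) d
      + ((b \<bullet> e) / (e \<bullet> e)) * frechet_derivative F (at x) e" for x
    using has_derivative_linear[OF smooth_has_derivative[OF F, of x]]
    by (subst decompose[of b]) (simp add: linear_add linear_cmul)
  then have "(\<integral>x. frechet_derivative F (at x) b \<partial>lebesgue_on ?K) =
      ((b \<bullet> d) / (d \<bullet> d)) * (\<integral>x. frechet_derivative F (at x) d \<partial>lebesgue_on ?K)
      + ((b \<bullet> e) / (e \<bullet> e)) * (\<integral>x. frechet_derivative F (at x) e \<partial>lebesgue_on ?K)"
    using ie by simp
  also have "(\<integral>x. frechet_derivative F (at x) d \<partial>lebesgue_on ?K)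
      = norm e * norm d * (I01 (\<lambda>s. F (a + d + s *\<^sub>R e)) - I01 (\<lambda>s. F (a + s *\<^sub>R e)))"
    unfolding rectangle_swap[of a d e] by (rule rectangle_FTC[OF F orth' nz(2,1)])
  also have "(\<integral>x. frechet_derivative F (at x) e \<partial>lebesgue_on ?K)
      = norm d * norm e * (I01 (\<lambda>s. F (a + e + s *\<^sub>R d)) - I01 (\<lambda>s. F (a + s *\<^sub>R d)))"
    by (rule rectangle_FTC[OF F orth nz])
  also have "((b \<bullet> d) / (d \<bullet> d)) * (norm e * norm d * (I01 (\<lambda>s. F (a + d + s *\<^sub>R e)) - I01 (\<lambda>s. F (a + s *\<^sub>R e))))
    + ((b \<bullet> e) / (e \<bullet> e)) * (norm d * norm e * (I01 (\<lambda>s. F (a + e + s *\<^sub>R d)) - I01 (\<lambda>s. F (a + s *\<^sub>R d))))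
    = ((- (1 / norm e) *\<^sub>R e) \<bullet> b) * (norm d * I01 (\<lambda>s. F (a + s *\<^sub>R d)))
    + ((1 / norm e) *\<^sub>R e \<bullet> b) * (norm d * I01 (\<lambda>s. F (a + e + s *\<^sub>R d)))
    + ((- (1 / norm d) *\<^sub>R d) \<bullet> b) * (norm e * I01 (\<lambda>s. F (a + s *\<^sub>R e)))
    + ((1 / norm d) *\<^sub>R d \<bullet> b) * (norm e * I01 (\<lambda>s. F (a + d + s *\<^sub>R e)))"
    using nz by (simp add: inner_commute[of b] dot_square_norm power2_eq_square field_simps)
  also have "\<dots> = (\<Sum>E\<in>{closed_segment a (a + d), closed_segment (a + e) (a + e + d),
     closed_segment a (a + e), closed_segment (a + d) (a + d + e)}. (outward_normal ?K E \<bullet> b) * (\<integral>x. F x \<partial>edge_measure E))"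
    using edges_distinct nz
    by (simp add: outward_normals edge_integral[OF _ cF] dist_norm)
  also have "{closed_segment a (a + d), closed_segment (a + e) (a + e + d),
     closed_segment a (a + e), closed_segment (a + d) (a + d + e)} = {E. E edge_of ?K}"
    using edges by blast
  finally show ?thesis .
qed

section \<open>Interpolation on a rectangle\<close>

lemma jacobian_mult: "smooth (\<phi> :: vfield) \<Longrightarrow> jacobian \<phi> (at x) *v v = frechet_derivative \<phi> (at x) v"
  using smooth_has_derivative[of \<phi> x] by (simp add: jacobian_def has_derivative_linear)

lemma jacobian_nth: "jacobian (\<phi> :: vfield) (at x) $ i $ j = frechet_derivative \<phi> (at x) (axis j 1) $ i"
  by (simp add: jacobian_def matrix_def)

lemma continuous_on_matrix:
  fixes A :: "'a::topological_space \<Rightarrow> real^2^2"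
  assumes "\<And>i j. continuous_on S (\<lambda>x. A x $ i $ j)"
  shows "continuous_on S A"
proof -
  have "continuous_on S (\<lambda>x. \<chi> i. \<chi> j. A x $ i $ j)"
    by (intro continuous_on_vec_lambda assms)
  then show ?thesis by simp
qed

lemma continuous_on_jacobian:
  assumes "smooth (\<phi> :: vfield)" shows "continuous_on S (\<lambda>x. jacobian \<phi> (at x))"
  by (rule continuous_on_matrix)
    (simp add: jacobian_nth continuous_on_component frechet_derivative_continuous_on[OF assms])

lemma norm_matrix_sq: "(norm A)\<^sup>2 = (A$1$1)\<^sup>2 + (A$1$2)\<^sup>2 + (A$2$1)\<^sup>2 + (A$2$2)\<^sup>2" for A :: "real^2^2"
  by (simp add: norm_vec_def L2_set_def sum_2)

text \<open>After division by the squared side lengths this says that the Frobenius norm can be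
  computed from the images of any orthonormal basis.\<close>

lemma (in rect) norm_matrix_orth:
  fixes A :: "real^2^2"
  shows "(norm (A *v d))\<^sup>2 * (norm e)\<^sup>2 + (norm (A *v e))\<^sup>2 * (norm d)\<^sup>2 = (norm A)\<^sup>2 * (norm d)\<^sup>2 * (norm e)\<^sup>2"
proof -
  \<comment> \<open>In the plane \<open>e\<close> is \<open>k\<close> times the quarter turn of
    \<open>d\<close>.\<close>
  define k where "k = (e $ 2 * d $ 1 - e $ 1 * d $ 2) / (norm d)\<^sup>2"
  have o: "d $ 1 * e $ 1 + d $ 2 * e $ 2 = 0" using orth by (simp add: inner_R2)
  have n: "(norm d)\<^sup>2 = d $ 1 * d $ 1 + d $ 2 * d $ 2" "(norm d)\<^sup>2 \<noteq> 0"
    subgoal unfolding norm_R2_sq by (simp add: power2_eq_square)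
    subgoal using nz by simp
    done
  have "e $ 1 * (norm d)\<^sup>2 = - (e $ 2 * d $ 1 - e $ 1 * d $ 2) * d $ 2"
    "e $ 2 * (norm d)\<^sup>2 = (e $ 2 * d $ 1 - e $ 1 * d $ 2) * d $ 1"
    unfolding n using o by algebra+
  then have e: "e $ 1 = - k * d $ 2" "e $ 2 = k * d $ 1"
    using n(2) by (simp_all add: k_def field_simps)
  show ?thesis
    unfolding norm_matrix_sq norm_R2_sq matrix_vector_mult_def
    by (simp add: sum_2 e power2_eq_square algebra_simps)
qed

text \<open>Pulled back to the unit square, the derivatives are those of \<phi> along
  \<open>d\<close> and \<open>e\<close>. In two dimensions the resulting energy is scale invariant,
  so only the aspect ratio \<open>R\<close> enters; the edge integrals are taken over the unit
  parameter and carry no length factor.\<close>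

lemma (in rect) rect_Poincare:
  fixes \<phi> :: vfield
  assumes \<phi>: "smooth \<phi>" and R: "norm d \<le> R * norm e" "norm e \<le> R * norm d"
  obtains M where
    "(L2_norm (lebesgue_on (rectangle a d e)) (\<lambda>x. \<phi> x - M))\<^sup>2
      \<le> 6 * R * (norm d * norm e) * (L2_norm (lebesgue_on (rectangle a d e)) (\<lambda>x. jacobian \<phi> (at x)))\<^sup>2"
    "\<And>E p q. E edge_of rectangle a d e \<Longrightarrow> E = closed_segment p q \<Longrightarrow>
      I01 (\<lambda>s. (norm (\<phi> (p + s *\<^sub>R (q - p)) - M))\<^sup>2)
        \<le> 6 * R * (L2_norm (lebesgue_on (rectangle a d e)) (\<lambda>x. jacobian \<phi> (at x)))\<^sup>2"
proof -
  let ?K = "rectangle a d e"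
  define G where "G = (L2_norm (lebesgue_on ?K) (\<lambda>x. jacobian \<phi> (at x)))\<^sup>2"
  define f where "f s t = \<phi> (a + s *\<^sub>R d + t *\<^sub>R e)" for s t
  define A where "A s t = frechet_derivative \<phi> (at (a + s *\<^sub>R d + t *\<^sub>R e)) d" for s t
  define B where "B s t = frechet_derivative \<phi> (at (a + s *\<^sub>R d + t *\<^sub>R e)) e" for s t
  define J where "J s t = (norm (jacobian \<phi> (at (a + s *\<^sub>R d + t *\<^sub>R e))))\<^sup>2" for s t
  have c\<phi>: "continuous_on UNIV \<phi>" by (rule smooth_continuous_on[OF \<phi>])
  have cf: "continuous_on UNIV (\<lambda>p. f (fst p) (snd p))"
    unfolding f_def by (rule cont_rectangle_param[OF c\<phi>])
  have cA: "continuous_on UNIV (\<lambda>p. A (fst p) (snd p))" and cB: "continuous_on UNIV (\<lambda>p. B (fst p) (snd p))"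
    unfolding A_def B_def by (rule cont_rectangle_param[OF frechet_derivative_continuous_on[OF \<phi>]])+
  have cjj: "continuous_on UNIV (\<lambda>x. (norm (jacobian \<phi> (at x)))\<^sup>2)"
    by (intro continuous_intros continuous_on_jacobian[OF \<phi>])
  have cJ: "continuous_on UNIV (\<lambda>p. J (fst p) (snd p))"
    unfolding J_def by (rule cont_rectangle_param[OF cjj])
  have dA: "((\<lambda>s. f s t) has_vector_derivative A s t) (at s)" for s t
    using vector_derivative_along[OF \<phi>, of "a + t *\<^sub>R e" d s] by (simp add: f_def A_def add_ac)
  have dB: "(f s has_vector_derivative B s t) (at t)" for s t
    using vector_derivative_along[OF \<phi>, of "a + s *\<^sub>R d" e t] by (simp add: f_def[abs_def] B_def)
  have G: "G = norm d * norm e * I01 (\<lambda>s. I01 (J s))"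
    unfolding G_def L2_norm_sq rectangle_integral[OF cjj orth nz] J_def ..
  \<comment> \<open>\<open>norm_matrix_orth\<close> weights each derivative by the square of the
    other side length; the aspect ratio turns both weights into the product of the side
    lengths.\<close>
  have pw: "(norm (A s t))\<^sup>2 + (norm (B s t))\<^sup>2 \<le> R * (norm d * norm e) * J s t" for s t
  proof -
    define j where "j = jacobian \<phi> (at (a + s *\<^sub>R d + t *\<^sub>R e))"
    have AB: "A s t = j *v d" "B s t = j *v e" by (simp_all add: A_def B_def j_def jacobian_mult[OF \<phi>])
    define nd ne where "nd = norm d" and "ne = norm e"
    have pos: "nd > 0" "ne > 0" using nz by (simp_all add: nd_def ne_def)
    have id: "(norm (A s t))\<^sup>2 * ne\<^sup>2 + (norm (B s t))\<^sup>2 * nd\<^sup>2 = (norm j)\<^sup>2 * nd\<^sup>2 * ne\<^sup>2"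
      unfolding AB nd_def ne_def by (rule norm_matrix_orth)
    have "((norm (A s t))\<^sup>2 + (norm (B s t))\<^sup>2) * (nd * ne)
        = (norm (A s t))\<^sup>2 * ne * nd + (norm (B s t))\<^sup>2 * nd * ne" by (simp add: algebra_simps)
    also have "\<dots> \<le> (norm (A s t))\<^sup>2 * ne * (R * ne) + (norm (B s t))\<^sup>2 * nd * (R * nd)"
      using R pos by (intro add_mono mult_left_mono) (simp_all add: nd_def ne_def)
    also have "\<dots> = R * ((norm (A s t))\<^sup>2 * ne\<^sup>2 + (norm (B s t))\<^sup>2 * nd\<^sup>2)"
      by (simp add: power2_eq_square algebra_simps)
    also have "\<dots> = (R * (nd * ne) * (norm j)\<^sup>2) * (nd * ne)"
      unfolding id by (simp add: power2_eq_square algebra_simps)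
    finally have "(norm (A s t))\<^sup>2 + (norm (B s t))\<^sup>2 \<le> R * (nd * ne) * (norm j)\<^sup>2"
      using pos by (simp only: mult_le_cancel_right) auto
    then show ?thesis by (simp add: nd_def ne_def J_def j_def)
  qed
  have D: "I01 (\<lambda>s. I01 (\<lambda>t. (norm (A s t))\<^sup>2 + (norm (B s t))\<^sup>2)) \<le> R * G"
  proof -
    have "I01 (\<lambda>s. I01 (\<lambda>t. (norm (A s t))\<^sup>2 + (norm (B s t))\<^sup>2)) \<le> I01 (\<lambda>s. I01 (\<lambda>t. R * (norm d * norm e) * J s t))"
      by (intro I01_mono cont_I01 continuous_intros cA cB cJ pw cont_slice(1)[OF cA] cont_slice(1)[OF cB] cont_slice(1)[OF cJ])
    then show ?thesis by (simp add: G algebra_simps)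
  qed
  obtain M where
    M1: "\<And>t. t \<in> {0..1} \<Longrightarrow> I01 (\<lambda>s. (norm (f s t - M))\<^sup>2) \<le> 6 * I01 (\<lambda>s. I01 (\<lambda>t. (norm (A s t))\<^sup>2 + (norm (B s t))\<^sup>2))"
    and M2: "\<And>s. s \<in> {0..1} \<Longrightarrow> I01 (\<lambda>t. (norm (f s t - M))\<^sup>2) \<le> 6 * I01 (\<lambda>s. I01 (\<lambda>t. (norm (A s t))\<^sup>2 + (norm (B s t))\<^sup>2))"
    and M3: "I01 (\<lambda>s. I01 (\<lambda>t. (norm (f s t - M))\<^sup>2)) \<le> 6 * I01 (\<lambda>s. I01 (\<lambda>t. (norm (A s t))\<^sup>2 + (norm (B s t))\<^sup>2))"
    using square_Poincare[OF cf cA cB dA dB] by blast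
  have fin: "x \<le> 6 * R * G" if "x \<le> 6 * I01 (\<lambda>s. I01 (\<lambda>t. (norm (A s t))\<^sup>2 + (norm (B s t))\<^sup>2))" for x
    using that D by linarith
  show thesis
  proof (rule that[of M])
    have "continuous_on UNIV (\<lambda>x. (norm (\<phi> x - M))\<^sup>2)" by (intro continuous_intros c\<phi>)
    then have "(L2_norm (lebesgue_on ?K) (\<lambda>x. \<phi> x - M))\<^sup>2 = norm d * norm e * I01 (\<lambda>s. I01 (\<lambda>t. (norm (f s t - M))\<^sup>2))"
      unfolding L2_norm_sq f_def by (rule rectangle_integral[OF _ orth nz])
    also have "\<dots> \<le> norm d * norm e * (6 * R * G)"
      by (intro mult_left_mono fin[OF M3]) auto
    finally show "(L2_norm (lebesgue_on ?K) (\<lambda>x. \<phi> x - M))\<^sup>2 \<le> 6 * R * (norm d * norm e) * (L2_norm (lebesgue_on ?K) (\<lambda>x. jacobian \<phi> (at x)))\<^sup>2"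
      by (simp add: G_def algebra_simps)
  next
    fix E p q assume "E edge_of ?K" and Epq: "E = closed_segment p q"
    then obtain x y where xy: "E = closed_segment x y" and "(x, y) \<in> {(a, a + d), (a + e, a + e + d), (a, a + e), (a + d, a + d + e)}"
      unfolding edges by blast
    then have le: "I01 (\<lambda>s. (norm (\<phi> (x + s *\<^sub>R (y - x)) - M))\<^sup>2) \<le> 6 * R * G"
      using fin[OF M1[of 0]] fin[OF M1[of 1]] fin[OF M2[of 0]] fin[OF M2[of 1]]
      by (auto simp: f_def add_ac)
    have c: "continuous_on UNIV (\<lambda>s. (norm (\<phi> (x + s *\<^sub>R (y - x)) - M))\<^sup>2)"
      by (intro continuous_intros continuous_on_compose2[OF c\<phi>]) auto
    have "p = x \<and> q = y \<or> p = y \<and> q = x"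
      using Epq xy by (auto simp: doubleton_eq_iff)
    then show "I01 (\<lambda>s. (norm (\<phi> (p + s *\<^sub>R (q - p)) - M))\<^sup>2) \<le> 6 * R * (L2_norm (lebesgue_on ?K) (\<lambda>x. jacobian \<phi> (at x)))\<^sup>2"
    proof
      assume "p = y \<and> q = x"
      then have "(\<lambda>s. (norm (\<phi> (p + s *\<^sub>R (q - p)) - M))\<^sup>2) = (\<lambda>s. (norm (\<phi> (x + (1 - s) *\<^sub>R (y - x)) - M))\<^sup>2)"
        by (auto simp: algebra_simps)
      then show ?thesis using I01_reverse[OF c] le by (simp add: G_def)
    qed (use le in \<open>simp add: G_def\<close>)
  qed
qed

definition corners :: "R2 \<Rightarrow> R2 \<Rightarrow> R2 \<Rightarrow> R2 set" where
  "corners a d e = {a, a + d, a + e, a + d + e}"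

text \<open>The formula makes sense on the whole plane and is therefore smooth there. Nodal values
  are read from a function \<open>c\<close> of the point, so elements with a common vertex
  automatically use the same value.\<close>

definition bilin :: "R2 \<Rightarrow> R2 \<Rightarrow> R2 \<Rightarrow> (R2 \<Rightarrow> 'b::real_normed_vector) \<Rightarrow> R2 \<Rightarrow> 'b" where
  "bilin a d e c x = (let s = ((x - a) \<bullet> d) / (d \<bullet> d); t = ((x - a) \<bullet> e) / (e \<bullet> e) in
     ((1 - s) * (1 - t)) *\<^sub>R c a + (s * (1 - t)) *\<^sub>R c (a + d) + ((1 - s) * t) *\<^sub>R c (a + e) + (s * t) *\<^sub>R c (a + d + e))"

lemma smooth_bilin: "smooth (bilin a d e c)"
proof -
  have "smooth (\<lambda>x::R2. ((x - a) \<bullet> v) / r)" for v and r :: real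
    using smooth_mult[OF smooth_inner[OF smooth_diff[OF smooth_id smooth_const] smooth_const] smooth_const, of a v "1 / r"] by simp
  then show ?thesis
    unfolding bilin_def[abs_def] Let_def
    by (intro smooth_add smooth_scaleR smooth_mult smooth_diff smooth_const)
qed

context rect
begin

lemma bilin_param:
  "bilin a d e c (a + s *\<^sub>R d + t *\<^sub>R e) = ((1 - s) * (1 - t)) *\<^sub>R c a + (s * (1 - t)) *\<^sub>R c (a + d)
      + ((1 - s) * t) *\<^sub>R c (a + e) + (s * t) *\<^sub>R c (a + d + e)"
proof -
  have "((a + s *\<^sub>R d + t *\<^sub>R e - a) \<bullet> d) / (d \<bullet> d) = s" "((a + s *\<^sub>R d + t *\<^sub>R e - a) \<bullet> e) / (e \<bullet> e) = t"
    using inner_corner by (simp_all add: inner_add_left orth orth')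
  then show ?thesis by (simp add: bilin_def)
qed

lemma bilin_rectangle: "bilinear_on_rectangle (rectangle a d e) (bilin a d e c)"
  unfolding bilinear_on_rectangle_def
proof (intro exI conjI ballI)
  show "d \<noteq> 0" "e \<noteq> 0" "d \<bullet> e = 0" "rectangle a d e = rectangle a d e" using nz orth by auto
  show "bilin a d e c (a + s *\<^sub>R d + t *\<^sub>R e)
    = c a + s *\<^sub>R (c (a + d) - c a) + t *\<^sub>R (c (a + e) - c a) + (s * t) *\<^sub>R (c a - c (a + d) - c (a + e) + c (a + d + e))" for s t
    unfolding bilin_param by (simp add: algebra_simps)
qed

lemma bilin_corner: "z \<in> corners a d e \<Longrightarrow> bilin a d e c z = c z"
  using bilin_param[of c 0 0] bilin_param[of c 1 0] bilin_param[of c 0 1] bilin_param[of c 1 1]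
  by (auto simp: corners_def)

text \<open>On an edge one of the two coordinates is frozen at 0 or 1, so only the nodal values at
  its ends survive. Either order of the ends may occur.\<close>

lemma bilin_edge:
  assumes E: "closed_segment p q edge_of rectangle a d e"
  shows "bilin a d e c (p + u *\<^sub>R (q - p)) = (1 - u) *\<^sub>R c p + u *\<^sub>R c q"
    and "p \<in> corners a d e" "q \<in> corners a d e" "p \<noteq> q"
proof -
  have h: "bilin a d e c (x + u *\<^sub>R (y - x)) = (1 - u) *\<^sub>R c x + u *\<^sub>R c y"
    if "(x, y) \<in> {(a, a + d), (a + e, a + e + d), (a, a + e), (a + d, a + d + e)}" for x y u
    using that bilin_param[of c u 0] bilin_param[of c u 1] bilin_param[of c 0 u] bilin_param[of c 1 u]
    by (auto simp: add_ac)
  obtain x y where "closed_segment p q = closed_segment x y"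
    and xy: "(x, y) \<in> {(a, a + d), (a + e, a + e + d), (a, a + e), (a + d, a + d + e)}"
    using E unfolding edges by blast
  then have "p = x \<and> q = y \<or> p = y \<and> q = x" by (auto simp: doubleton_eq_iff)
  then show "bilin a d e c (p + u *\<^sub>R (q - p)) = (1 - u) *\<^sub>R c p + u *\<^sub>R c q"
  proof
    assume "p = y \<and> q = x"
    then show ?thesis using h[OF xy, of "1 - u"] by (simp add: algebra_simps)
  qed (use h[OF xy] in simp)
  show "p \<in> corners a d e" "q \<in> corners a d e" "p \<noteq> q"
    using \<open>p = x \<and> q = y \<or> p = y \<and> q = x\<close> xy nz by (auto simp: corners_def add_ac)
qed

text \<open>Corners are given through a parametrization; this identifies them with the extreme
  points, which depend on the rectangle as a set.\<close>

lemma face_corner_iff: "{z} face_of rectangle a d e \<longleftrightarrow> z \<in> corners a d e"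
proof
  assume "{z} face_of rectangle a d e"
  then have "z extreme_point_of convex hull {a, a + d, a + e, a + d + e}"
    by (simp add: face_of_singleton rectangle_def)
  then show "z \<in> corners a d e"
    using extreme_point_of_convex_hull by (auto simp: corners_def)
next
  assume z: "z \<in> corners a d e"
  have "\<exists>q. closed_segment z q edge_of rectangle a d e"
  proof -
    have "closed_segment a (a + d) edge_of rectangle a d e" "closed_segment (a + d) a edge_of rectangle a d e"
      "closed_segment (a + e) a edge_of rectangle a d e" "closed_segment (a + d + e) (a + d) edge_of rectangle a d e"
      unfolding edges by (simp_all add: doubleton_eq_iff)
    then show ?thesis using z unfolding corners_def by blast
  qed
  then obtain q where "closed_segment z q edge_of rectangle a d e" by blast
  moreover have "{z} face_of closed_segment z q"
    by (simp add: face_of_singleton extreme_point_of_segment)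
  ultimately show "{z} face_of rectangle a d e"
    using face_of_trans by (auto simp: edge_of_def)
qed

text \<open>The four weights are nonnegative with sum 1, so \<open>bilin a d e c x - M\<close> is a
  convex combination of the nodal deviations from \<open>M\<close>; the factors 2 come from squaring
  a sum of two terms.\<close>

lemma bilin_diff_bound:
  fixes c :: "R2 \<Rightarrow> 'b::euclidean_space"
  assumes x: "x \<in> rectangle a d e" and S: "\<And>z. z \<in> corners a d e \<Longrightarrow> (norm (c z - M))\<^sup>2 \<le> S"
  shows "(norm (v - bilin a d e c x))\<^sup>2 \<le> 2 * (norm (v - M))\<^sup>2 + 2 * S"
proof -
  obtain s t where st: "s \<in> {0..1}" "t \<in> {0..1}" and xst: "x = a + s *\<^sub>R d + t *\<^sub>R e"
    using rectangle_memE[OF x] by metis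
  have S0: "S \<ge> 0" using S[of a] order_trans[OF zero_le_power2[of "norm (c a - M)"]] by (simp add: corners_def)
  have le: "norm (c z - M) \<le> sqrt S" if "z \<in> corners a d e" for z
    using S[OF that] real_le_rsqrt by blast
  have "bilin a d e c x - M = ((1 - s) * (1 - t)) *\<^sub>R (c a - M) + (s * (1 - t)) *\<^sub>R (c (a + d) - M)
      + ((1 - s) * t) *\<^sub>R (c (a + e) - M) + (s * t) *\<^sub>R (c (a + d + e) - M)"
    unfolding xst bilin_param by (simp add: algebra_simps)
  also have "norm \<dots> \<le> ((1 - s) * (1 - t)) * sqrt S + (s * (1 - t)) * sqrt S + ((1 - s) * t) * sqrt S + (s * t) * sqrt S"
    using st by (intro norm_triangle_le add_mono) (auto intro!: mult_left_mono le simp: corners_def)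
  also have "\<dots> = sqrt S" by (simp add: algebra_simps)
  finally have b: "(norm (bilin a d e c x - M))\<^sup>2 \<le> S"
    using power_mono[of "norm (bilin a d e c x - M)" "sqrt S" 2] S0 by simp
  have "(norm (v - bilin a d e c x))\<^sup>2 \<le> (norm (v - M) + norm (bilin a d e c x - M))\<^sup>2"
    using norm_triangle_ineq4[of "v - M" "bilin a d e c x - M"] by (intro power_mono) auto
  also have "\<dots> \<le> 2 * (norm (v - M))\<^sup>2 + 2 * (norm (bilin a d e c x - M))\<^sup>2"
    using sum_squares_bound[of "norm (v - M)" "norm (bilin a d e c x - M)"] by (simp add: power2_sum)
  finally show ?thesis using b by linarith
qed

end

section \<open>Geometry of meshes\<close>

lemma lipschitz_chart:
  assumes "lipschitz_domain \<Omega>" "x \<in> frontier \<Omega>"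
  obtains e e' :: R2 and r L \<phi> where "norm e = 1" "norm e' = 1" "e \<bullet> e' = 0" "r > 0" "lipschitz_on L UNIV \<phi>"
    "\<And>y. y \<in> ball x r \<Longrightarrow> y \<in> \<Omega> \<longleftrightarrow> \<phi> (y \<bullet> e) < y \<bullet> e'"
proof -
  obtain e e' :: R2 and r L \<phi> where *: "norm e = 1" "norm e' = 1" "e \<bullet> e' = 0" "r > 0" "lipschitz_on L UNIV \<phi>"
    and eq: "\<Omega> \<inter> ball x r = {y \<in> ball x r. \<phi> (y \<bullet> e) < y \<bullet> e'}"
    using assms unfolding lipschitz_domain_def by blast
  have "y \<in> \<Omega> \<longleftrightarrow> \<phi> (y \<bullet> e) < y \<bullet> e'" if "y \<in> ball x r" for y
    using eq that by blast
  with * show thesis by (rule that)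
qed

text \<open>Near a boundary point the set strictly below the graph is open and misses
  \<open>\<Omega>\<close>, so the boundary point is not interior to the closure: the domain has no
  slits. This puts the interiors of mesh elements into \<open>\<Omega>\<close>.\<close>

lemma interior_closure_lipschitz:
  assumes \<Omega>: "lipschitz_domain \<Omega>"
  shows "interior (closure \<Omega>) \<subseteq> \<Omega>"
proof (rule ccontr)
  assume "\<not> interior (closure \<Omega>) \<subseteq> \<Omega>"
  then obtain x where x: "x \<in> interior (closure \<Omega>)" "x \<notin> \<Omega>" by blast
  then have "x \<in> frontier \<Omega>"
    using interior_subset[of \<Omega>] interior_subset[of "closure \<Omega>"] by (auto simp: frontier_def)
  from lipschitz_chart[OF \<Omega> this] obtain e e' :: R2 and r L \<phi> where
    c: "norm e = 1" "norm e' = 1" "e \<bullet> e' = 0" "r > 0" "lipschitz_on L UNIV \<phi>"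
    and iff: "\<And>y. y \<in> ball x r \<Longrightarrow> y \<in> \<Omega> \<longleftrightarrow> \<phi> (y \<bullet> e) < y \<bullet> e'" by metis
  obtain \<epsilon> where \<epsilon>: "\<epsilon> > 0" "ball x \<epsilon> \<subseteq> closure \<Omega>"
    using x(1) by (auto simp: mem_interior)
  define t where "t = min r \<epsilon> / 2"
  have t: "0 < t" "t < r" "t < \<epsilon>" using c(4) \<epsilon>(1) by (auto simp: t_def)
  \<comment> \<open>A point just below \<open>x\<close> in the chart, inside both balls and strictly
    under the graph.\<close>
  define y where "y = x - t *\<^sub>R e'"
  have "dist x y = t" using c t by (simp add: y_def dist_norm)
  then have yb: "y \<in> ball x r" "y \<in> ball x \<epsilon>" using t by auto
  have cont: "continuous_on UNIV (\<lambda>z. \<phi> (z \<bullet> e))"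
    by (rule continuous_on_compose2[OF lipschitz_on_continuous_on[OF c(5)]]) (auto intro!: continuous_intros)
  define W where "W = ball x r \<inter> {z. z \<bullet> e' < \<phi> (z \<bullet> e)}"
  have "open W"
    unfolding W_def by (intro open_Int open_ball open_Collect_less cont continuous_intros)
  moreover have "y \<in> W"
  proof -
    have "y \<bullet> e = x \<bullet> e" "y \<bullet> e' = x \<bullet> e' - t"
      using c by (simp_all add: y_def inner_diff_left inner_commute[of e'] dot_square_norm)
    moreover have "x \<bullet> e' \<le> \<phi> (x \<bullet> e)" using iff[of x] x(2) c(4) by auto
    ultimately show ?thesis using yb t by (simp add: W_def)
  qed
  moreover have "W \<inter> \<Omega> = {}" using iff by (auto simp: W_def)
  ultimately have "y \<notin> closure \<Omega>"
    by (metis disjoint_iff open_Int_closure_eq_empty)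
  then show False using \<epsilon>(2) yb(2) by blast
qed

lemma norm_orthonormal_le:
  fixes e e' y :: R2
  assumes "norm e = 1" "norm e' = 1" "e \<bullet> e' = 0"
  shows "norm y \<le> \<bar>y \<bullet> e\<bar> + \<bar>y \<bullet> e'\<bar>"
proof -
  interpret rect y e e' by unfold_locales (use assms in auto)
  have "y = (y \<bullet> e) *\<^sub>R e + (y \<bullet> e') *\<^sub>R e'"
    using decompose[of y] assms by (simp add: dot_square_norm)
  then have "norm y \<le> norm ((y \<bullet> e) *\<^sub>R e) + norm ((y \<bullet> e') *\<^sub>R e')"
    using norm_triangle_ineq[of "(y \<bullet> e) *\<^sub>R e" "(y \<bullet> e') *\<^sub>R e'"] by simp
  then show ?thesis using assms by simp
qed

text \<open>At an interior point this is the connectedness of a punctured disc in the plane. At a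
  boundary point removing \<open>z\<close> changes nothing, and in a sufficiently flat chart box
  each point of the domain can be pushed upwards to a common horizontal slice.\<close>

lemma punctured_nbhd_connected:
  assumes \<Omega>: "lipschitz_domain \<Omega>" and z: "z \<in> closure \<Omega>" and \<epsilon>: "\<epsilon> > 0"
  obtains N where "open N" "z \<in> N" "N \<subseteq> ball z \<epsilon>" "connected (\<Omega> \<inter> N - {z})"
proof (cases "z \<in> \<Omega>")
  case True
  then obtain \<delta> where \<delta>: "\<delta> > 0" "ball z \<delta> \<subseteq> \<Omega>"
    using \<Omega> openE[of \<Omega> z] by (metis lipschitz_domain_def)
  have "\<Omega> \<inter> ball z (min \<delta> \<epsilon>) = ball z (min \<delta> \<epsilon>)" using \<delta> by auto
  then have "connected (\<Omega> \<inter> ball z (min \<delta> \<epsilon>) - {z})"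
    by (simp add: connected_punctured_ball)
  then show ?thesis using \<delta> \<epsilon> by (intro that[of "ball z (min \<delta> \<epsilon>)"]) auto
next
  case False
  then have "z \<in> frontier \<Omega>"
    using z interior_subset[of \<Omega>] by (auto simp: frontier_def)
  from lipschitz_chart[OF \<Omega> this] obtain e e' :: R2 and r L \<phi> where
    c: "norm e = 1" "norm e' = 1" "e \<bullet> e' = 0" "r > 0" "lipschitz_on L UNIV \<phi>"
    and iff: "\<And>y. y \<in> ball z r \<Longrightarrow> y \<in> \<Omega> \<longleftrightarrow> \<phi> (y \<bullet> e) < y \<bullet> e'" by metis
  have e1: "e \<bullet> e = 1" "e' \<bullet> e' = 1" "e' \<bullet> e = 0" using c by (simp_all add: dot_square_norm inner_commute)
  have L: "L \<ge> 0" using c(5) by (rule lipschitz_on_nonneg)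
  \<comment> \<open>\<open>N\<close> will have half-width \<delta> in direction \<open>e\<close> and
    half-height \<eta> in direction \<open>e'\<close>. The quarter keeps it inside both balls, and
    \<delta> is chosen so that the graph rises by less than half of \<eta> over the box.\<close>
  define \<eta> where "\<eta> = min r \<epsilon> / 4"
  define \<delta> where "\<delta> = \<eta> / (2 * (L + 1))"
  have \<eta>: "\<eta> > 0" using c \<epsilon> by (simp add: \<eta>_def)
  have \<delta>: "\<delta> > 0" "\<delta> \<le> \<eta>" "L * \<delta> < \<eta> / 2"
    using \<eta> L by (auto simp: \<delta>_def field_simps)
  define N where "N = {y. \<bar>(y - z) \<bullet> e\<bar> < \<delta> \<and> \<bar>(y - z) \<bullet> e'\<bar> < \<eta>}"
  have Nball: "N \<subseteq> ball z r" "N \<subseteq> ball z \<epsilon>"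
  proof -
    have "dist z y < min r \<epsilon>" if "y \<in> N" for y
    proof -
      have "norm (y - z) \<le> \<bar>(y - z) \<bullet> e\<bar> + \<bar>(y - z) \<bullet> e'\<bar>"
        by (rule norm_orthonormal_le[OF c(1-3)])
      also have "\<dots> < \<eta> + \<eta>" using that \<delta> by (auto simp: N_def)
      also have "\<dots> \<le> min r \<epsilon>" using c(4) \<epsilon> by (auto simp: \<eta>_def min_def)
      finally show ?thesis by (simp add: dist_norm norm_minus_commute)
    qed
    then show "N \<subseteq> ball z r" "N \<subseteq> ball z \<epsilon>" by auto
  qed
  have oN: "open N"
    unfolding N_def by (intro open_Collect_conj open_Collect_less continuous_intros)
  have zN: "z \<in> N" using \<delta> \<eta> by (simp add: N_def)
  have \<phi>z: "\<phi> (z \<bullet> e) \<le> z \<bullet> e'"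
  proof (rule ccontr)
    assume nle: "\<not> \<phi> (z \<bullet> e) \<le> z \<bullet> e'"
    have cont: "continuous_on UNIV (\<lambda>z. \<phi> (z \<bullet> e))"
      by (rule continuous_on_compose2[OF lipschitz_on_continuous_on[OF c(5)]]) (auto intro!: continuous_intros)
    define W where "W = ball z r \<inter> {y. y \<bullet> e' < \<phi> (y \<bullet> e)}"
    have "open W"
      unfolding W_def by (intro open_Int open_ball open_Collect_less cont continuous_intros)
    moreover have "z \<in> W" using nle c(4) by (simp add: W_def)
    moreover have "W \<inter> \<Omega> = {}" using iff by (auto simp: W_def)
    ultimately have "z \<notin> closure \<Omega>"
      by (metis disjoint_iff open_Int_closure_eq_empty)
    then show False using z by blast
  qed
  have low: "\<phi> (y \<bullet> e) < z \<bullet> e' + \<eta> / 2" if "\<bar>(y - z) \<bullet> e\<bar> < \<delta>" for y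
  proof -
    have "\<bar>\<phi> (y \<bullet> e) - \<phi> (z \<bullet> e)\<bar> \<le> L * \<bar>y \<bullet> e - z \<bullet> e\<bar>"
      using lipschitz_onD[OF c(5)] by (simp add: dist_real_def)
    also have "\<dots> \<le> L * \<delta>" using that L by (intro mult_left_mono) (auto simp: inner_diff_left)
    finally show ?thesis using \<phi>z \<delta> by linarith
  qed
  define S where "S = \<Omega> \<inter> N"
  define H where "H = {y. \<bar>(y - z) \<bullet> e\<bar> < \<delta> \<and> (y - z) \<bullet> e' = \<eta> / 2}"
  define up where "up y = y + (z \<bullet> e' + \<eta> / 2 - y \<bullet> e') *\<^sub>R e'" for y
  have memS: "y \<in> S \<longleftrightarrow> y \<in> N \<and> \<phi> (y \<bullet> e) < y \<bullet> e'" for y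
    using iff Nball by (auto simp: S_def)
  have HS: "H \<subseteq> S"
  proof
    fix y assume y: "y \<in> H"
    then have "\<phi> (y \<bullet> e) < z \<bullet> e' + \<eta> / 2" by (intro low) (simp add: H_def)
    moreover have "y \<bullet> e' = z \<bullet> e' + \<eta> / 2" using y by (simp add: H_def inner_diff_left)
    ultimately show "y \<in> S" using y \<eta> by (simp add: memS N_def H_def)
  qed
  have upH: "up y \<in> H" if "y \<in> S" for y
    using that e1 by (simp add: memS N_def H_def up_def inner_diff_left inner_add_left)
  have seg: "closed_segment y (up y) \<subseteq> S" if "y \<in> S" for y
  proof
    fix x assume "x \<in> closed_segment y (up y)"
    then obtain u where u: "0 \<le> u" "u \<le> 1" and x: "x = (1 - u) *\<^sub>R y + u *\<^sub>R up y"
      by (auto simp: in_segment)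
    have xe: "x \<bullet> e = y \<bullet> e" using e1 by (simp add: x up_def inner_add_left algebra_simps)
    have xe': "x \<bullet> e' = (1 - u) * (y \<bullet> e') + u * (z \<bullet> e' + \<eta> / 2)"
      using e1 by (simp add: x up_def inner_add_left algebra_simps)
    have y: "\<bar>(y - z) \<bullet> e\<bar> < \<delta>" "\<bar>y \<bullet> e' - z \<bullet> e'\<bar> < \<eta>" "\<phi> (y \<bullet> e) < y \<bullet> e'"
      using that by (auto simp: memS N_def inner_diff_left)
    have cvx: "(1 - u) * p + u * q < M" if "p < M" "q < M" for p q M :: real
      using convex_bound_lt[of p M q "1 - u" u] that u by simp
    have "x \<bullet> e' < z \<bullet> e' + \<eta>" unfolding xe' by (rule cvx) (use y \<eta> in auto)
    moreover have "- (x \<bullet> e') < - (z \<bullet> e') + \<eta>"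
      using cvx[of "- (y \<bullet> e')" "- (z \<bullet> e') + \<eta>" "- (z \<bullet> e' + \<eta> / 2)"] y \<eta> unfolding xe' by (simp add: algebra_simps)
    moreover have "- (x \<bullet> e') < - \<phi> (y \<bullet> e)"
      using cvx[of "- (y \<bullet> e')" "- \<phi> (y \<bullet> e)" "- (z \<bullet> e' + \<eta> / 2)"] y low[OF y(1)] unfolding xe' by (simp add: algebra_simps)
    ultimately show "x \<in> S"
      using y(1) xe by (simp add: memS N_def inner_diff_left abs_less_iff)
  qed
  have cH: "convex H"
  proof -
    have "H = {y. (- e) \<bullet> y > - (z \<bullet> e) - \<delta>} \<inter> {y. e \<bullet> y > z \<bullet> e - \<delta>} \<inter> {y. e' \<bullet> y = z \<bullet> e' + \<eta> / 2}"
      by (auto simp: H_def inner_diff_left inner_commute[of e] inner_commute[of e'] abs_less_iff diff_divide_distrib)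
    then show ?thesis
      by (simp add: convex_Int convex_halfspace_gt convex_hyperplane del: inner_minus_left)
  qed
  \<comment> \<open>Each member of the union is a vertical segment together with the convex slice
    \<open>H\<close>, in which the segment ends; \<open>H\<close> is common to all of them.\<close>
  have "S = (\<Union>y\<in>S. closed_segment y (up y) \<union> H)"
    using seg HS by auto
  moreover have "connected (\<Union>y\<in>S. closed_segment y (up y) \<union> H)"
  proof (cases "S = {}")
    case False
    show ?thesis
    proof (rule connected_Union)
      fix s assume "s \<in> (\<lambda>y. closed_segment y (up y) \<union> H) ` S"
      then obtain y where y: "y \<in> S" and s: "s = closed_segment y (up y) \<union> H" by blast
      show "connected s"
        unfolding s by (rule connected_Un) (use upH[OF y] convex_connected[OF cH] in auto)
    next
      have "H \<noteq> {}" using False upH by blast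
      then show "\<Inter> ((\<lambda>y. closed_segment y (up y) \<union> H) ` S) \<noteq> {}" using False by blast
    qed
  qed simp
  ultimately have "connected S" by simp
  moreover have "\<Omega> \<inter> N - {z} = S" using False by (auto simp: S_def)
  ultimately show ?thesis using that[of N] oN zN Nball by simp
qed

text \<open>By completeness the two restricted integrands are both measurable or both not; in the
  latter case both integrals are 0. Arbitrary \<open>f\<close> have to be covered because
  elementwise residuals are unspecified on the boundary of an element.\<close>

lemma integral_lebesgue_on_AE_eq:
  fixes f :: "'a::euclidean_space \<Rightarrow> real"
  assumes S: "S \<in> sets lebesgue" "T \<in> sets lebesgue" and n: "negligible ((S - T) \<union> (T - S))"
  shows "(\<integral>x. f x \<partial>lebesgue_on S) = (\<integral>x. f x \<partial>lebesgue_on T)"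
proof -
  have ae: "AE x in lebesgue. indicator S x *\<^sub>R f x = indicator T x *\<^sub>R f x"
    by (rule AE_I'[of "(S - T) \<union> (T - S)"]) (use n in \<open>auto simp: negligible_iff_null_sets indicator_def\<close>)
  have "(\<integral>x. indicator S x *\<^sub>R f x \<partial>lebesgue) = (\<integral>x. indicator T x *\<^sub>R f x \<partial>lebesgue)"
  proof (cases "(\<lambda>x. indicator S x *\<^sub>R f x) \<in> borel_measurable lebesgue")
    case True
    then show ?thesis using borel_measurable_AE[OF True ae] ae by (intro integral_cong_AE)
  next
    case False
    have ae': "AE x in lebesgue. indicator T x *\<^sub>R f x = indicator S x *\<^sub>R f x" using ae by (auto elim: eventually_mono)
    have "(\<lambda>x. indicator T x *\<^sub>R f x) \<notin> borel_measurable lebesgue"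
      using False borel_measurable_AE[OF _ ae'] by blast
    then have "\<not> integrable lebesgue (\<lambda>x. indicator T x *\<^sub>R f x)" "\<not> integrable lebesgue (\<lambda>x. indicator S x *\<^sub>R f x)"
      using False borel_measurable_integrable by blast+
    then show ?thesis by (simp add: not_integrable_integral_eq)
  qed
  then show ?thesis using S by (simp add: integral_restrict_space)
qed

text \<open>The estimator integrates over closed elements, whereas finite element functions are
  known on open ones; a convex set has a negligible frontier.\<close>

lemma L2_norm_interior:
  assumes "convex K" "K \<in> sets lebesgue"
  shows "L2_norm (lebesgue_on K) F = L2_norm (lebesgue_on (interior K)) F"
proof -
  have "negligible ((K - interior K) \<union> (interior K - K))"
    by (rule negligible_subset[OF negligible_convex_frontier[OF assms(1)]])
      (use interior_subset closure_subset in \<open>auto simp: frontier_def\<close>)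
  then show ?thesis
    unfolding L2_norm_def using assms by (subst integral_lebesgue_on_AE_eq[of K "interior K"]) auto
qed

section \<open>Conforming meshes: elements, vertices, patches and their connectedness\<close>

locale mesh =
  fixes \<Omega> :: "R2 set" and T :: "R2 set set"
  assumes polygon: "bounded_lipschitz_polygon \<Omega>" and conf: "conforming_mesh \<Omega> T"
begin

lemma lipschitz: "lipschitz_domain \<Omega>"
  and bounded_\<Omega>: "bounded \<Omega>"
  using polygon by (auto simp: bounded_lipschitz_polygon_def)

lemma open_\<Omega>: "open \<Omega>"
  using lipschitz by (simp add: lipschitz_domain_def)

lemma finite_T [simp]: "finite T"
  and Union_T: "\<Union>T = closure \<Omega>"
  using conf by (auto simp: conforming_mesh_def)

lemma Int_face_of: "K \<in> T \<Longrightarrow> K' \<in> T \<Longrightarrow> (K \<inter> K') face_of K"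
  "K \<in> T \<Longrightarrow> K' \<in> T \<Longrightarrow> (K \<inter> K') face_of K'"
  using conf unfolding conforming_mesh_def by blast+

text \<open>A corner and the two sides issuing from it.\<close>

definition params :: "R2 set \<Rightarrow> R2 \<times> R2 \<times> R2" where
  "params K = (SOME (a, d, e). rect d e \<and> K = rectangle a d e)"

definition "pa K = fst (params K)"
definition "pd K = fst (snd (params K))"
definition "pe K = snd (snd (params K))"

lemma param:
  assumes "K \<in> T"
  shows "rect (pd K) (pe K)" "rectangle (pa K) (pd K) (pe K) = K"
proof -
  have "is_rectangle K" using assms conf by (auto simp: conforming_mesh_def)
  then have "\<exists>x. case x of (a, d, e) \<Rightarrow> rect d e \<and> K = rectangle a d e"
    by (auto simp: is_rectangle_iff)
  then have "case params K of (a, d, e) \<Rightarrow> rect d e \<and> K = rectangle a d e"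
    unfolding params_def by (rule someI_ex)
  then show "rect (pd K) (pe K)" "rectangle (pa K) (pd K) (pe K) = K"
    by (auto simp: pa_def pd_def pe_def case_prod_beta)
qed

lemma is_rectangle: "K \<in> T \<Longrightarrow> is_rectangle K"
  using param is_rectangle_iff by metis

lemma compact_K: "K \<in> T \<Longrightarrow> compact K"
  and convex_K: "K \<in> T \<Longrightarrow> convex K"
  and lebesgue_K: "K \<in> T \<Longrightarrow> K \<in> sets lebesgue"
  using compact_rectangle convex_rectangle rectangle_lebesgue param(2) by metis+

lemma closed_K: "K \<in> T \<Longrightarrow> closed K"
  using compact_K compact_imp_closed by blast

lemma interior_K: "K \<in> T \<Longrightarrow> interior K \<noteq> {}"
  using rect.interior_rectangle_nonempty param by metis

lemma negligible_frontier_K: "K \<in> T \<Longrightarrow> negligible (frontier K)"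
  using convex_K negligible_convex_frontier by blast

lemma K_subset: "K \<in> T \<Longrightarrow> K \<subseteq> closure \<Omega>"
  using Union_T by blast

lemma interior_subset_\<Omega>: "K \<in> T \<Longrightarrow> interior K \<subseteq> \<Omega>"
  using interior_mono[OF K_subset] interior_closure_lipschitz[OF lipschitz] by blast

lemma closure_interior_K: "K \<in> T \<Longrightarrow> closure (interior K) = K"
  using convex_closure_interior[OF convex_K interior_K] closed_K by (simp add: closure_closed)

text \<open>A face that meets the interior of a convex set is the whole set; applied to the common
  face this makes the two elements equal.\<close>

lemma interiors_disjoint:
  assumes "K \<in> T" "K' \<in> T" "K \<noteq> K'"
  shows "interior K \<inter> interior K' = {}"
proof (rule ccontr)
  assume ne: "interior K \<inter> interior K' \<noteq> {}"
  then have "(K \<inter> K') \<inter> interior K \<noteq> {}" "(K \<inter> K') \<inter> interior K' \<noteq> {}"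
    using interior_subset by blast+
  then have "K \<inter> K' = K" "K \<inter> K' = K'"
    using face_of_disjoint_interior[OF Int_face_of(1)[OF assms(1,2)]]
      face_of_disjoint_interior[OF Int_face_of(2)[OF assms(1,2)]] by blast+
  then show False using assms(3) by blast
qed

lemma negligible_Int:
  assumes "K \<in> T" "K' \<in> T" "K \<noteq> K'"
  shows "negligible (K \<inter> K')"
proof (rule negligible_subset)
  show "negligible (frontier K \<union> frontier K')"
    using assms by (simp add: negligible_frontier_K)
  show "K \<inter> K' \<subseteq> frontier K \<union> frontier K'"
    using interiors_disjoint[OF assms] closure_subset by (force simp: frontier_def)
qed

lemma AE_in_interior: "AE x in lebesgue. x \<in> \<Omega> \<longrightarrow> (\<exists>K\<in>T. x \<in> interior K)"
proof (rule AE_I'[of "\<Union>K\<in>T. frontier K"])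
  show "(\<Union>K\<in>T. frontier K) \<in> null_sets lebesgue"
    using negligible_frontier_K by (intro null_sets.finite_UN) (auto simp: negligible_iff_null_sets)
  show "{x \<in> space lebesgue. \<not> (x \<in> \<Omega> \<longrightarrow> (\<exists>K\<in>T. x \<in> interior K))} \<subseteq> (\<Union>K\<in>T. frontier K)"
  proof
    fix x assume "x \<in> {x \<in> space lebesgue. \<not> (x \<in> \<Omega> \<longrightarrow> (\<exists>K\<in>T. x \<in> interior K))}"
    then have x: "x \<in> \<Omega>" "\<And>K. K \<in> T \<Longrightarrow> x \<notin> interior K" by auto
    then obtain K where K: "K \<in> T" "x \<in> K" using Union_T closure_subset[of \<Omega>] by blast
    then have "x \<in> frontier K"
      using x(2)[OF K(1)] closure_subset[of K] by (auto simp: frontier_def)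
    then show "x \<in> (\<Union>K\<in>T. frontier K)" using K(1) by blast
  qed
qed

lemma sets_\<Omega>: "\<Omega> \<in> sets lebesgue"
  using open_\<Omega> by simp

text \<open>The open elements are disjoint and cover \<open>\<Omega>\<close> up to a null set, so
  their indicators add up to that of \<open>\<Omega>\<close> almost everywhere.\<close>

lemma integral_\<Omega>:
  fixes F :: sfield
  assumes F: "integrable (lebesgue_on \<Omega>) F"
  shows "(\<integral>x. F x \<partial>lebesgue_on \<Omega>) = (\<Sum>K\<in>T. \<integral>x. F x \<partial>lebesgue_on (interior K))"
proof -
  have i: "integrable lebesgue (\<lambda>x. indicator (interior K) x *\<^sub>R F x)" if "K \<in> T" for K
    using integrable_lebesgue_on_subset[OF F interior_subset_\<Omega>[OF that] _ sets_\<Omega>]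
    by (simp add: integrable_restrict_space)
  have "AE x in lebesgue. indicator \<Omega> x *\<^sub>R F x = (\<Sum>K\<in>T. indicator (interior K) x *\<^sub>R F x)"
    using AE_in_interior
  proof eventually_elim
    case (elim x)
    show ?case
    proof (cases "x \<in> \<Omega>")
      case True
      then obtain K where K: "K \<in> T" "x \<in> interior K" using elim by blast
      then have "(\<Sum>K\<in>T. indicator (interior K) x *\<^sub>R F x) = (\<Sum>K'\<in>T. if K' = K then F x else 0)"
        using interiors_disjoint by (intro sum.cong) (auto simp: indicator_def)
      then show ?thesis using K True by simp
    next
      case False
      then have "x \<notin> interior K" if "K \<in> T" for K
        using interior_subset_\<Omega>[OF that] by blast
      then show ?thesis using False by simp
    qed
  qed
  then have "(\<integral>x. indicator \<Omega> x *\<^sub>R F x \<partial>lebesgue) = (\<integral>x. (\<Sum>K\<in>T. indicator (interior K) x *\<^sub>R F x) \<partial>lebesgue)"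
    using F sets_\<Omega> by (intro integral_cong_AE borel_measurable_sum borel_measurable_integrable[OF i])
      (simp_all add: integrable_restrict_space borel_measurable_integrable)
  also have "\<dots> = (\<Sum>K\<in>T. \<integral>x. indicator (interior K) x *\<^sub>R F x \<partial>lebesgue)"
    by (rule Bochner_Integration.integral_sum[OF i])
  finally show ?thesis
    using sets_\<Omega> by (simp add: integral_restrict_space)
qed

text \<open>As zero-dimensional faces, vertices do not depend on the parametrization picked by
  \<open>params\<close>, and transitivity of faces moves them from one element to another.\<close>

definition verts :: "R2 set \<Rightarrow> R2 set" where "verts K = {z. {z} face_of K}"

lemma verts_corners: "K \<in> T \<Longrightarrow> verts K = corners (pa K) (pd K) (pe K)"
  using rect.face_corner_iff[OF param(1)[of K], where a = "pa K"] param(2)[of K] by (auto simp: verts_def)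

lemma finite_verts: "K \<in> T \<Longrightarrow> finite (verts K)" and card_verts: "K \<in> T \<Longrightarrow> card (verts K) \<le> 4"
  by (auto simp: verts_corners corners_def card_insert_if)

lemma verts_subset: "z \<in> verts K \<Longrightarrow> z \<in> K"
  by (auto simp: verts_def dest: face_of_imp_subset)

text \<open>Absence of hanging nodes: a vertex of \<open>K\<close> that lies in \<open>K'\<close> is
  a face of the common face, hence a face of \<open>K'\<close>.\<close>

lemma verts_common:
  assumes "K \<in> T" "K' \<in> T" "z \<in> verts K" "z \<in> K'"
  shows "z \<in> verts K'"
proof -
  have "{z} face_of (K \<inter> K')"
    by (rule face_of_subset[of "{z}" K]) (use assms verts_subset[OF assms(3)] in \<open>auto simp: verts_def\<close>)
  then show ?thesis
    using face_of_trans[OF _ Int_face_of(2)[OF assms(1,2)]] by (simp add: verts_def)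
qed

definition patch :: "R2 \<Rightarrow> R2 set set" where "patch z = {K\<in>T. z \<in> verts K}"

lemma finite_patch [simp]: "finite (patch z)"
  by (simp add: patch_def)

lemma finite_edges: "K \<in> T \<Longrightarrow> finite {E. E edge_of K}"
  using rect.edges[OF param(1)[of K], where a = "pa K"] param(2)[of K] by simp

lemma edge_segment:
  assumes "K \<in> T" "E edge_of K"
  obtains p q where "E = closed_segment p q" "p \<noteq> q" "p \<in> verts K" "q \<in> verts K"
proof -
  obtain a d e where r: "rect d e" and K: "K = rectangle a d e" and E: "E = closed_segment a (a + d)"
    using edge_wlog[OF is_rectangle[OF assms(1)] assms(2)] .
  show thesis
    using rect.bilin_edge(2-4)[OF r, of a "a + d" a] assms(2) rect.face_corner_iff[OF r, of _ a]
    by (intro that[OF E]) (auto simp: E K verts_def)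
qed

definition neighbours :: "R2 \<Rightarrow> (R2 set \<times> R2 set) set" where
  "neighbours z = {(K, K'). K \<in> patch z \<and> K' \<in> patch z \<and> (\<exists>E. E edge_of K \<and> E edge_of K')}"

text \<open>A count of the dimension of the common face: 2 would make the elements equal, 1 would
  make them neighbours, and emptiness is excluded by \<open>z\<close>.\<close>

lemma Int_patch:
  assumes K: "K \<in> patch z" "K' \<in> patch z" and ne: "K \<noteq> K'" and no: "(K, K') \<notin> neighbours z"
  shows "K \<inter> K' = {z}"
proof -
  have T: "K \<in> T" "K' \<in> T" and z: "z \<in> K" "z \<in> K'" using K verts_subset by (auto simp: patch_def)
  have "\<not> (K \<inter> K' = K \<and> K \<inter> K' = K')" using ne by blast
  then have "aff_dim (K \<inter> K') < 2"
  proof -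
    have d: "aff_dim K = 2" "aff_dim K' = 2"
      using rect.aff_dim_rectangle param T by metis+
    have "K \<inter> K' \<noteq> K \<or> K \<inter> K' \<noteq> K'" using ne by blast
    then show ?thesis
      using face_of_aff_dim_lt[OF convex_K[OF T(1)] Int_face_of(1)[OF T]]
        face_of_aff_dim_lt[OF convex_K[OF T(2)] Int_face_of(2)[OF T]] d by auto
  qed
  moreover have "aff_dim (K \<inter> K') \<noteq> 1"
    using no K Int_face_of[OF T] by (auto simp: neighbours_def edge_of_def)
  moreover have "aff_dim (K \<inter> K') \<noteq> -1" using z aff_dim_empty[of "K \<inter> K'"] by auto
  moreover have "aff_dim (K \<inter> K') \<ge> -1" by (rule aff_dim_geq)
  ultimately have "aff_dim (K \<inter> K') = 0" by linarith
  then obtain x where x: "K \<inter> K' = {x}" using aff_dim_eq_0 by blast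
  moreover have "z \<in> K \<inter> K'" using z by blast
  ultimately show ?thesis by simp
qed

text \<open>This is where the Lipschitz property of the boundary enters: if the elements at \<open>z\<close> fell into
  two classes without a common edge, they would meet only in \<open>z\<close> and disconnect a punctured
  neighbourhood of \<open>z\<close> in \<open>\<Omega>\<close>.\<close>

lemma patch_connected:
  assumes "K0 \<in> patch z" "K1 \<in> patch z"
  shows "(K0, K1) \<in> (neighbours z)\<^sup>*"
proof (rule ccontr)
  assume nc: "(K0, K1) \<notin> (neighbours z)\<^sup>*"
  define A where "A = {K \<in> patch z. (K0, K) \<in> (neighbours z)\<^sup>*}"
  define B where "B = patch z - A"
  have K0: "K0 \<in> A" using assms by (simp add: A_def)
  have K1: "K1 \<in> B" using assms nc by (simp add: B_def A_def)
  have AT: "K \<in> T" "z \<in> K" if "K \<in> A \<or> K \<in> B" for K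
    using that verts_subset by (auto simp: A_def B_def patch_def)
  have AB: "K \<inter> K' = {z}" if K: "K \<in> A" "K' \<in> B" for K K'
  proof (rule Int_patch)
    show "K \<in> patch z" "K' \<in> patch z" "K \<noteq> K'" using K by (auto simp: A_def B_def)
    show "(K, K') \<notin> neighbours z"
      using K by (auto simp: A_def B_def intro: rtrancl_into_rtrancl)
  qed
  have zc: "z \<in> closure \<Omega>" using AT K0 K_subset by blast
  have "closed (\<Union>{K\<in>T. z \<notin> K})" using closed_K by (intro closed_Union) auto
  \<comment> \<open>Within this radius only elements that contain \<open>z\<close> are seen.\<close>
  then obtain \<epsilon> where \<epsilon>: "\<epsilon> > 0" "ball z \<epsilon> \<subseteq> - \<Union>{K\<in>T. z \<notin> K}"
    using openE[of "- \<Union>{K\<in>T. z \<notin> K}" z] by (auto simp: open_Compl)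
  obtain N where N: "open N" "z \<in> N" "N \<subseteq> ball z \<epsilon>" and conn: "connected (\<Omega> \<inter> N - {z})"
    using punctured_nbhd_connected[OF lipschitz zc \<epsilon>(1)] .
  have cl: "closed (\<Union>A)" "closed (\<Union>B)"
    using AT closed_K finite_patch[of z] by (auto intro!: closed_Union simp: A_def B_def)
  \<comment> \<open>\<open>z\<close> is a limit of interior points of each of its elements, and
    \<open>z\<close> itself is not interior, so both classes reach into the punctured
    neighbourhood.\<close>
  have meets: "\<exists>x. x \<in> K \<and> x \<in> \<Omega> \<inter> N - {z}" if "K \<in> A \<or> K \<in> B" for K
  proof -
    have "z \<in> closure (interior K)" using AT[OF that] closure_interior_K by simp
    then obtain x where x: "x \<in> interior K" "x \<in> N"
      using N(1,2) open_Int_closure_eq_empty[OF N(1), of "interior K"] by blast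
    have "{z} face_of K" using that by (auto simp: A_def B_def patch_def verts_def)
    moreover have "{z} \<noteq> K" using interior_K[OF AT(1)[OF that]] by auto
    ultimately have "z \<notin> interior K" using face_of_disjoint_interior by blast
    then show ?thesis using x interior_subset_\<Omega>[OF AT(1)[OF that]] interior_subset[of K] by blast
  qed
  have cover: "\<Omega> \<inter> N - {z} \<subseteq> \<Union>A \<union> \<Union>B"
  proof
    fix x assume x: "x \<in> \<Omega> \<inter> N - {z}"
    then obtain K where K: "K \<in> T" "x \<in> K" using Union_T closure_subset[of \<Omega>] by blast
    then have "z \<in> K" using x N(3) \<epsilon>(2) by blast
    then have "K \<in> patch z"
      using verts_common[of K0 K z] K AT[of K0] K0 assms by (auto simp: patch_def)
    then show "x \<in> \<Union>A \<union> \<Union>B" using K by (auto simp: B_def)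
  qed
  have "\<Union>A \<inter> \<Union>B \<inter> (\<Omega> \<inter> N - {z}) = {}" using AB by blast
  then have "\<Union>A \<inter> (\<Omega> \<inter> N - {z}) = {} \<or> \<Union>B \<inter> (\<Omega> \<inter> N - {z}) = {}"
    using conn cl cover unfolding connected_closed by blast
  then show False using meets[of K0] meets[of K1] K0 K1 by blast
qed

end

section \<open>Quasi-interpolation\<close>

lemma corner_wlog:
  assumes r: "rect d e" and z: "z \<in> corners a d e"
  obtains d' e' where "rect d' e'" "rectangle a d e = rectangle z d' e'"
proof -
  consider "z = a" | "z = a + d" | "z = a + e" | "z = a + d + e" using z by (auto simp: corners_def)
  then show thesis
  proof cases
    case 1 then show ?thesis using that r by blast
  next
    case 2
    then show ?thesis
      using that[of "- d" e] rect.flip[OF r] by (simp add: rectangle_flip)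
  next
    case 3
    then show ?thesis
      using that[of d "- e"] rect.swap[OF rect.flip[OF rect.swap[OF r]]] by (simp add: rectangle_flip')
  next
    case 4
    have "rect (- d) (- e)" using rect.swap[OF rect.flip[OF rect.swap[OF rect.flip[OF r]]]] .
    moreover have "rectangle (a + d + e) (- d) (- e) = rectangle a d e"
      using rectangle_flip'[of "a + d" e "- d"] rectangle_flip[of a d e] by simp
    ultimately show ?thesis using that 4 by metis
  qed
qed

lemma bilinear_on_rectangle_cong:
  assumes "bilinear_on_rectangle K w" "\<And>x. x \<in> K \<Longrightarrow> w' x = w x"
  shows "bilinear_on_rectangle K w'"
proof -
  obtain a d e c0 c1 c2 c3 where *: "d \<noteq> 0" "e \<noteq> 0" "d \<bullet> e = 0" "K = rectangle a d e"
    and w: "\<And>s t. s \<in> {0..1} \<Longrightarrow> t \<in> {0..1} \<Longrightarrow>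
        w (a + s *\<^sub>R d + t *\<^sub>R e) = c0 + s *\<^sub>R c1 + t *\<^sub>R c2 + (s * t) *\<^sub>R c3"
    using assms(1) unfolding bilinear_on_rectangle_def by blast
  show ?thesis
    unfolding bilinear_on_rectangle_def
    by (rule exI[of _ a], rule exI[of _ d], rule exI[of _ e], intro conjI *, rule exI[of _ c0], rule exI[of _ c1],
        rule exI[of _ c2], rule exI[of _ c3]) (simp add: assms(2) w rectangle_memI *(4))
qed

lemma (in rect) scaled_subset:
  assumes "0 \<le> u" "u \<le> 1" "0 \<le> v" "v \<le> 1"
  shows "rectangle a (u *\<^sub>R d) (v *\<^sub>R e) \<subseteq> rectangle a d e"
proof
  fix x assume "x \<in> rectangle a (u *\<^sub>R d) (v *\<^sub>R e)"
  then obtain s t where "s \<in> {0..1}" "t \<in> {0..1}" "x = a + s *\<^sub>R u *\<^sub>R d + t *\<^sub>R v *\<^sub>R e"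
    by (rule rectangle_memE)
  then show "x \<in> rectangle a d e"
    using assms rectangle_memI[of "s * u" "t * v" a d e] by (simp add: mult_le_one)
qed

text \<open>Two opposite points of the ball in direction \<open>e\<close> are \<open>2 * r\<close>
  apart, while the coordinate along \<open>e\<close> varies by at most 1 in the rectangle.\<close>

lemma (in rect) cball_subset_side:
  assumes "cball x r \<subseteq> rectangle a d e" "0 \<le> r"
  shows "2 * r \<le> norm e"
proof -
  let ?n = "(r / norm e) *\<^sub>R e"
  have "x + ?n \<in> rectangle a d e" "x - ?n \<in> rectangle a d e"
    using assms nz by (auto intro!: subsetD[OF assms(1)] simp: dist_norm)
  then obtain s t s' t' where st: "t \<in> {0..1}" "t' \<in> {0..1}"
    "x + ?n = a + s *\<^sub>R d + t *\<^sub>R e" "x - ?n = a + s' *\<^sub>R d + t' *\<^sub>R e"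
    by (metis rectangle_memE)
  have "(2 * (r / norm e)) *\<^sub>R e = ?n + ?n" by (simp only: mult_2 scaleR_left_distrib)
  also have "\<dots> = (x + ?n) - (x - ?n)" by simp
  also have "\<dots> = (s - s') *\<^sub>R d + (t - t') *\<^sub>R e" unfolding st by (simp add: algebra_simps)
  finally have "((2 * (r / norm e)) *\<^sub>R e) \<bullet> e = ((s - s') *\<^sub>R d + (t - t') *\<^sub>R e) \<bullet> e" by simp
  then have "(2 * (r / norm e)) * (e \<bullet> e) = (t - t') * (e \<bullet> e)"
    by (simp add: inner_add_left orth)
  then have "2 * (r / norm e) = t - t'"
    using inner_corner by (simp only: mult_cancel_right) auto
  then have "2 * (r / norm e) \<le> 1" using st by simp
  then show ?thesis using nz by (simp add: field_simps)
qed

lemma (in rect) diameter_ge: "norm d \<le> diameter (rectangle a d e)" "norm e \<le> diameter (rectangle a d e)"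
proof -
  have b: "bounded (rectangle a d e)" by (simp add: compact_rectangle compact_imp_bounded)
  have v: "a \<in> rectangle a d e" "a + d \<in> rectangle a d e" "a + e \<in> rectangle a d e"
    by (auto simp: rectangle_def intro!: hull_inc)
  show "norm d \<le> diameter (rectangle a d e)" "norm e \<le> diameter (rectangle a d e)"
    using diameter_bounded_bound[OF b v(1,2)] diameter_bounded_bound[OF b v(1,3)] by (simp_all add: dist_norm)
qed

lemma dist_le_diameter_segment: "dist p q \<le> diameter (closed_segment p q)" for p q :: R2
  by (rule diameter_bounded_bound) (auto intro: compact_imp_bounded compact_segment)

context mesh
begin

text \<open>Shape regularity bounds the aspect ratio: a side is at most the diameter, which is at
  most \<kappa> times the inscribed radius, and that radius is at most the other side.\<close>

lemma aspect:
  assumes sh: "shape_regular \<kappa> T" and K: "K \<in> T" and r: "rect d e" and eq: "K = rectangle a d e"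
  shows "norm d \<le> \<kappa> * norm e" "norm e \<le> \<kappa> * norm d" "0 < \<kappa>"
proof -
  interpret rect a d e by fact
  interpret s: rect a e d by (rule swap)
  obtain x r where x: "r > 0" "cball x r \<subseteq> K" "diameter K \<le> \<kappa> * r"
    using sh K by (auto simp: shape_regular_def)
  have e: "2 * r \<le> norm e" and d: "2 * r \<le> norm d"
    using cball_subset_side s.cball_subset_side x eq by (auto simp: rectangle_swap[of a d])
  have "0 < diameter K" using less_le_trans[OF _ diameter_ge(1), of 0] nz eq by simp
  then have "0 < \<kappa> * r" using x by linarith
  then show \<kappa>: "0 < \<kappa>" using x by (simp add: zero_less_mult_iff)
  have "\<kappa> * r \<le> \<kappa> * norm e" "\<kappa> * r \<le> \<kappa> * norm d"
    using e d x \<kappa> by (auto intro!: mult_left_mono)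
  then show "norm d \<le> \<kappa> * norm e" "norm e \<le> \<kappa> * norm d"
    using diameter_ge x(3) eq by auto
qed

text \<open>The squares with corner \<open>z\<close> and side the minimal side length \<open>\<rho>\<close> of the patch have disjoint
  interiors, area \<open>\<rho>\<^sup>2\<close> each, and lie in a box of area \<open>16 \<rho>\<^sup>2\<close>.\<close>

lemma card_patch: "card (patch z) \<le> 16"
proof (cases "patch z = {}")
  case False
  have "\<exists>d e. rect d e \<and> K = rectangle z d e" if "K \<in> patch z" for K
  proof -
    have K: "K \<in> T" and z: "z \<in> corners (pa K) (pd K) (pe K)"
      using that verts_corners[of K] by (auto simp: patch_def)
    obtain d' e' where "rect d' e'" "rectangle (pa K) (pd K) (pe K) = rectangle z d' e'"
      using corner_wlog[OF param(1)[OF K] z] .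
    then show ?thesis using param(2)[OF K] by auto
  qed
  then obtain d e where de: "\<And>K. K \<in> patch z \<Longrightarrow> rect (d K) (e K)" "\<And>K. K \<in> patch z \<Longrightarrow> K = rectangle z (d K) (e K)"
    by metis
  define \<rho> where "\<rho> = Min ((\<lambda>K. min (norm (d K)) (norm (e K))) ` patch z)"
  have \<rho>: "0 < \<rho>"
    unfolding \<rho>_def using False de(1) by (subst Min_gr_iff) (auto simp: rect_def)
  have \<rho>le: "\<rho> \<le> norm (d K)" "\<rho> \<le> norm (e K)" if "K \<in> patch z" for K
  proof -
    have "\<rho> \<le> min (norm (d K)) (norm (e K))" unfolding \<rho>_def using that by (intro Min_le) auto
    then show "\<rho> \<le> norm (d K)" "\<rho> \<le> norm (e K)" by auto
  qed
  define Q where "Q K = rectangle z ((\<rho> / norm (d K)) *\<^sub>R d K) ((\<rho> / norm (e K)) *\<^sub>R e K)" for K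
  have Q: "Q K \<subseteq> K" "measure lebesgue (Q K) = \<rho>\<^sup>2" "Q K \<subseteq> cbox (z - (2 * \<rho>) *\<^sub>R One) (z + (2 * \<rho>) *\<^sub>R One)"
    "Q K \<in> lmeasurable" if K: "K \<in> patch z" for K
  proof -
    interpret rect z "d K" "e K" by (rule de(1)[OF K])
    have "Q K \<subseteq> rectangle z (d K) (e K)"
      unfolding Q_def using \<rho> \<rho>le[OF K] nz by (intro scaled_subset) auto
    then show "Q K \<subseteq> K" using de(2)[OF K] by simp
    have r: "rect ((\<rho> / norm (d K)) *\<^sub>R d K) ((\<rho> / norm (e K)) *\<^sub>R e K)"
      using nz orth \<rho> by unfold_locales auto
    show "measure lebesgue (Q K) = \<rho>\<^sup>2"
      unfolding Q_def rect.measure_rectangle[OF r] using nz \<rho> by (simp add: power2_eq_square)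
    show "Q K \<in> lmeasurable" by (simp add: Q_def lmeasurable_compact compact_rectangle)
    show "Q K \<subseteq> cbox (z - (2 * \<rho>) *\<^sub>R One) (z + (2 * \<rho>) *\<^sub>R One)"
    proof
      fix x assume "x \<in> Q K"
      then obtain s t where st: "s \<in> {0..1}" "t \<in> {0..1}"
        and x: "x = z + s *\<^sub>R (\<rho> / norm (d K)) *\<^sub>R d K + t *\<^sub>R (\<rho> / norm (e K)) *\<^sub>R e K"
        unfolding Q_def by (rule rectangle_memE)
      have "norm (x - z) \<le> norm (s *\<^sub>R (\<rho> / norm (d K)) *\<^sub>R d K) + norm (t *\<^sub>R (\<rho> / norm (e K)) *\<^sub>R e K)"
        unfolding x by (rule order_trans[OF eq_refl norm_triangle_ineq]) (simp add: add.assoc)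
      also have "\<dots> = s * \<rho> + t * \<rho>" using st \<rho> nz by simp
      also have "\<dots> \<le> 1 * \<rho> + 1 * \<rho>" using st \<rho> by (intro add_mono mult_right_mono) auto
      finally have n: "norm (x - z) \<le> 2 * \<rho>" by simp
      have "\<bar>(x - z) \<bullet> b\<bar> \<le> 2 * \<rho>" if "b \<in> Basis" for b
        using Basis_le_norm[OF that, of "x - z"] n by linarith
      then show "x \<in> cbox (z - (2 * \<rho>) *\<^sub>R One) (z + (2 * \<rho>) *\<^sub>R One)"
        by (auto simp: mem_box inner_diff_left inner_add_left abs_le_iff algebra_simps)
    qed
  qed
  have "measure lebesgue (\<Union> (Q ` patch z)) = (\<Sum>K\<in>patch z. measure lebesgue (Q K))"
  proof (rule measure_negligible_finite_Union_image)
    show "pairwise (\<lambda>K K'. negligible (Q K \<inter> Q K')) (patch z)"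
    proof (rule pairwiseI)
      fix K K' assume K: "K \<in> patch z" "K' \<in> patch z" "K \<noteq> K'"
      then have "negligible (K \<inter> K')" by (intro negligible_Int) (auto simp: patch_def)
      then show "negligible (Q K \<inter> Q K')"
        by (rule negligible_subset) (use Q(1) K in blast)
    qed
  qed (use Q in auto)
  also have "\<dots> = card (patch z) * \<rho>\<^sup>2" using Q by simp
  finally have "card (patch z) * \<rho>\<^sup>2 = measure lebesgue (\<Union> (Q ` patch z))" by simp
  also have "\<dots> \<le> measure lebesgue (cbox (z - (2 * \<rho>) *\<^sub>R One) (z + (2 * \<rho>) *\<^sub>R One))"
  proof (rule measure_mono_fmeasurable[OF UN_least[OF Q(3)]])
    show "\<Union> (Q ` patch z) \<in> sets lebesgue"
      using Q(4) by (intro sets.finite_UN) (auto intro: fmeasurableD)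
  qed auto
  also have "\<dots> = 16 * \<rho>\<^sup>2"
  proof -
    have "measure lborel (cbox (z - (2 * \<rho>) *\<^sub>R One) (z + (2 * \<rho>) *\<^sub>R One)) = (\<Prod>b\<in>(Basis::R2 set). 4 * \<rho>)"
      using \<rho> by (subst content_cbox_cases) (auto simp: inner_diff_left inner_add_left intro!: prod.cong)
    then show ?thesis by (simp add: power2_eq_square power_mult_distrib)
  qed
  finally have "real (card (patch z)) \<le> 16" using \<rho> by simp
  then show ?thesis by linarith
qed simp

text \<open>On shared vertices and edges the element is picked arbitrarily;
  \<open>bilin_consistent\<close> makes the choice irrelevant.\<close>

definition interp :: "(R2 \<Rightarrow> R2) \<Rightarrow> vfield" where
  "interp c x = (let K = SOME K. K \<in> T \<and> x \<in> K in bilin (pa K) (pd K) (pe K) c x)"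

text \<open>Two different elements meet in a vertex, where both sides are the nodal value, or in an
  edge, where both are the affine function between the nodal values at its ends.\<close>

lemma bilin_consistent:
  assumes K: "K \<in> T" "x \<in> K" and K': "K' \<in> T" "x \<in> K'"
  shows "bilin (pa K) (pd K) (pe K) c x = bilin (pa K') (pd K') (pe K') c x"
proof (cases "K = K'")
  case False
  note r = param(1)[OF K(1)] and r' = param(1)[OF K'(1)]
  note F = Int_face_of[OF K(1) K'(1)]
  have d: "aff_dim K = 2" "aff_dim K' = 2"
    using rect.aff_dim_rectangle param K K' by metis+
  have "K \<inter> K' \<noteq> K \<or> K \<inter> K' \<noteq> K'" using False by blast
  then have "aff_dim (K \<inter> K') < 2"
    using face_of_aff_dim_lt[OF convex_K[OF K(1)] F(1)] face_of_aff_dim_lt[OF convex_K[OF K'(1)] F(2)] d by auto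
  moreover have "aff_dim (K \<inter> K') \<noteq> -1" using K K' aff_dim_empty[of "K \<inter> K'"] by auto
  moreover have "aff_dim (K \<inter> K') \<ge> -1" by (rule aff_dim_geq)
  ultimately consider "aff_dim (K \<inter> K') = 0" | "aff_dim (K \<inter> K') = 1" by linarith
  then show ?thesis
  proof cases
    case 1
    then obtain y where y: "K \<inter> K' = {y}" using aff_dim_eq_0 by blast
    moreover have "x \<in> K \<inter> K'" using K K' by blast
    ultimately have "K \<inter> K' = {x}" by simp
    then have "x \<in> verts K" "x \<in> verts K'" using F by (simp_all add: verts_def)
    then show ?thesis
      using rect.bilin_corner[OF r, of x "pa K" c] rect.bilin_corner[OF r', of x "pa K'" c]
        verts_corners[OF K(1)] verts_corners[OF K'(1)] by simp
  next
    case 2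
    then have E: "(K \<inter> K') edge_of K" "(K \<inter> K') edge_of K'" using F by (auto simp: edge_of_def)
    obtain p q where pq: "K \<inter> K' = closed_segment p q" using edge_segment[OF K(1) E(1)] by metis
    have "x \<in> closed_segment p (p + (q - p))" using K K' pq by auto
    then obtain u where u: "x = p + u *\<^sub>R (q - p)" by (rule segment_memE)
    have "closed_segment p q edge_of rectangle (pa K) (pd K) (pe K)"
      "closed_segment p q edge_of rectangle (pa K') (pd K') (pe K')"
      using E pq param(2) K(1) K'(1) by auto
    then show ?thesis
      unfolding u using rect.bilin_edge(1)[OF r] rect.bilin_edge(1)[OF r'] by metis
  qed
qed simp

lemma interp_eq:
  assumes "K \<in> T" "x \<in> K"
  shows "interp c x = bilin (pa K) (pd K) (pe K) c x"
proof -
  have "(SOME K. K \<in> T \<and> x \<in> K) \<in> T \<and> x \<in> (SOME K. K \<in> T \<and> x \<in> K)"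
    using assms by (intro someI[of "\<lambda>K. K \<in> T \<and> x \<in> K" K]) simp
  then show ?thesis
    unfolding interp_def Let_def using bilin_consistent assms by blast
qed

lemma continuous_interp: "continuous_on (closure \<Omega>) (interp c)"
proof -
  have "continuous_on (\<Union>K\<in>T. K) (interp c)"
  proof (rule continuous_on_closed_Union)
    show "continuous_on K (interp c)" if "K \<in> T" for K
      using continuous_on_cong[OF refl interp_eq[OF that], of K c] smooth_continuous_on[OF smooth_bilin, of K]
      by (metis (no_types, lifting) continuous_on_cong interp_eq that)
  qed (use closed_K in auto)
  then show ?thesis using Union_T by simp
qed

lemma bilinear_interp: "K \<in> T \<Longrightarrow> bilinear_on_rectangle K (interp c)"
  using rect.bilin_rectangle[OF param(1), where a = "pa K" and c = c] param(2)[of K] interp_eq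
  by (metis bilinear_on_rectangle_cong)

lemma interp_edge_zero:
  assumes K: "K \<in> T" and E: "closed_segment p q edge_of K" and c: "c p = 0" "c q = 0" and x: "x \<in> closed_segment p q"
  shows "interp c x = 0"
proof -
  have "x \<in> closed_segment p (p + (q - p))" using x by simp
  then obtain u where u: "x = p + u *\<^sub>R (q - p)" by (rule segment_memE)
  have "x \<in> K" using x E face_of_imp_subset by (auto simp: edge_of_def)
  then show ?thesis
    using interp_eq[OF K] rect.bilin_edge(1)[OF param(1)[OF K], of p q "pa K" c u] E param(2)[OF K] c u by simp
qed

end

text \<open>\<open>256 = 16 * 16\<close> bounds the length of a chain of neighbours in a patch, a step in the chain costs
  \<open>2 * sqrt (6 * \<kappa>)\<close>, and comparing with an edge mean costs one more \<open>sqrt (6 * \<kappa>)\<close>. The outer factor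
  \<open>256 = 4 * 64\<close> contains the overlap of the patches.\<close>

definition interp_const :: "real \<Rightarrow> real" where
  "interp_const \<kappa> = 12 * \<kappa> + 256 * (513 * sqrt (6 * \<kappa>))\<^sup>2"

lemma edge_mean_le:
  fixes \<phi> :: vfield
  assumes "smooth \<phi>" "I01 (\<lambda>s. (norm (\<phi> (p + s *\<^sub>R (q - p)) - M))\<^sup>2) \<le> b\<^sup>2" "0 \<le> b"
  shows "norm (I01 (\<lambda>s. \<phi> (p + s *\<^sub>R (q - p))) - M) \<le> b"
proof -
  have c: "continuous_on UNIV (\<lambda>s. \<phi> (p + s *\<^sub>R (q - p)))"
    by (rule continuous_on_compose2[OF smooth_continuous_on[OF assms(1), of UNIV]]) (auto intro!: continuous_intros)
  have "I01 (\<lambda>s. \<phi> (p + s *\<^sub>R (q - p))) - M = I01 (\<lambda>s. \<phi> (p + s *\<^sub>R (q - p)) - M)"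
    using I01_diff[OF c continuous_on_const, of M] by simp
  then have "(norm (I01 (\<lambda>s. \<phi> (p + s *\<^sub>R (q - p))) - M))\<^sup>2 \<le> I01 (\<lambda>s. (norm (\<phi> (p + s *\<^sub>R (q - p)) - M))\<^sup>2)"
    by (simp only: I01_norm_sq_le[OF continuous_on_diff[OF c continuous_on_const]])
  then have "(norm (I01 (\<lambda>s. \<phi> (p + s *\<^sub>R (q - p))) - M))\<^sup>2 \<le> b\<^sup>2"
    using assms(2) by (rule order_trans)
  then show ?thesis by (rule power2_le_imp_le[OF _ assms(3)])
qed

context mesh
begin

lemma relpow_neighbours_diff:
  fixes M :: "R2 set \<Rightarrow> R2"
  assumes step: "\<And>K K'. (K, K') \<in> neighbours z \<Longrightarrow> norm (M K - M K') \<le> b"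
  shows "(K, K') \<in> neighbours z ^^ n \<Longrightarrow> norm (M K - M K') \<le> n * b"
proof (induction n arbitrary: K')
  case (Suc n)
  then obtain L where L: "(K, L) \<in> neighbours z ^^ n" "(L, K') \<in> neighbours z" by auto
  have "norm (M K - M K') \<le> norm (M K - M L) + norm (M L - M K')"
    using norm_triangle_ineq[of "M K - M L" "M L - M K'"] by simp
  also have "\<dots> \<le> n * b + b" using Suc.IH[OF L(1)] step[OF L(2)] by (rule add_mono)
  finally show ?case by (simp add: algebra_simps)
qed auto

text \<open>A chain can be chosen no longer than the number of neighbour pairs, which is at most 16
  * 16; each link costs at most \<open>b\<close>.\<close>

lemma patch_diff:
  fixes M :: "R2 set \<Rightarrow> R2"
  assumes step: "\<And>K K'. (K, K') \<in> neighbours z \<Longrightarrow> norm (M K - M K') \<le> b" and b: "0 \<le> b"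
    and K: "K \<in> patch z" "K' \<in> patch z"
  shows "norm (M K - M K') \<le> 256 * b"
proof -
  have sub: "neighbours z \<subseteq> patch z \<times> patch z" by (auto simp: neighbours_def)
  then have fin: "finite (neighbours z)" by (rule finite_subset) simp
  have "card (neighbours z) \<le> card (patch z \<times> patch z)" by (rule card_mono) (use sub in auto)
  also have "\<dots> = card (patch z) * card (patch z)" by (simp add: card_cartesian_product)
  also have "\<dots> \<le> 16 * 16" by (intro mult_le_mono card_patch)
  finally have c: "card (neighbours z) \<le> 256" by simp
  obtain n where n: "n \<le> card (neighbours z)" "(K, K') \<in> neighbours z ^^ n"
    using patch_connected[OF K] by (auto simp: rtrancl_finite_eq_relpow[OF fin])
  have "norm (M K - M K') \<le> n * b" by (rule relpow_neighbours_diff[OF step n(2)])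
  also have "\<dots> \<le> 256 * b" using n c b by (intro mult_right_mono) auto
  finally show ?thesis .
qed

text \<open>An element is counted once for each of its at most 4 vertices and each of the at most 16
  elements at that vertex.\<close>

lemma sum_patches:
  fixes g :: "R2 set \<Rightarrow> real"
  assumes g: "\<And>K. 0 \<le> g K"
  shows "(\<Sum>K\<in>T. \<Sum>z\<in>verts K. \<Sum>K'\<in>patch z. g K') \<le> 64 * (\<Sum>K\<in>T. g K)"
proof -
  define Z where "Z = (\<Union>K\<in>T. verts K)"
  have fZ: "finite Z" by (simp add: Z_def finite_verts)
  have v: "verts K = {z \<in> Z. z \<in> verts K}" if "K \<in> T" for K using that by (auto simp: Z_def)
  have swap: "(\<Sum>K\<in>T. \<Sum>z\<in>verts K. h z K) = (\<Sum>z\<in>Z. \<Sum>K\<in>patch z. h z K)" for h :: "R2 \<Rightarrow> R2 set \<Rightarrow> real"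
  proof -
    have "(\<Sum>K\<in>T. \<Sum>z\<in>verts K. h z K) = (\<Sum>K\<in>T. \<Sum>z\<in>{z \<in> Z. z \<in> verts K}. h z K)"
      using v by (intro sum.cong) auto
    also have "\<dots> = (\<Sum>z\<in>Z. \<Sum>K\<in>{K \<in> T. z \<in> verts K}. h z K)"
      by (rule sum.swap_restrict) (use fZ in auto)
    finally show ?thesis by (simp add: patch_def)
  qed
  have "(\<Sum>K\<in>T. \<Sum>z\<in>verts K. \<Sum>K'\<in>patch z. g K') = (\<Sum>z\<in>Z. card (patch z) * (\<Sum>K'\<in>patch z. g K'))"
    unfolding swap by simp
  also have "\<dots> \<le> (\<Sum>z\<in>Z. 16 * (\<Sum>K'\<in>patch z. g K'))"
    using card_patch g by (intro sum_mono mult_right_mono sum_nonneg) auto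
  also have "\<dots> = 16 * (\<Sum>K\<in>T. card (verts K) * g K)"
    by (simp flip: swap sum_distrib_left)
  also have "\<dots> \<le> 16 * (\<Sum>K\<in>T. 4 * g K)"
    using card_verts g by (intro mult_left_mono sum_mono mult_right_mono) auto
  finally show ?thesis by (simp add: sum_distrib_left)
qed

text \<open>Nodal values of Clement type: zero at the points of \<open>VD\<close> (the Dirichlet vertices), elsewhere the mean
  value constant of some adjacent element. The parameter \<open>\<delta>\<close> is needed since the estimate is applied
  to smooth approximations of functions that vanish on \<open>\<Gamma>D\<close>, whose edge means are small but not zero.\<close>

lemma quasi_interpolation:
  fixes \<phi> :: vfield and \<delta> :: real
  assumes sh: "shape_regular \<kappa> T" and \<phi>: "smooth \<phi>" and \<delta>: "0 \<le> \<delta>"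
    and VD: "\<And>z. z \<in> VD \<Longrightarrow> z \<in> (\<Union>K\<in>T. verts K) \<Longrightarrow> \<exists>K p q. K \<in> patch z \<and> closed_segment p q edge_of K \<and>
        norm (I01 (\<lambda>s. \<phi> (p + s *\<^sub>R (q - p)))) \<le> \<delta>"
  obtains c W where "\<And>z. z \<in> VD \<Longrightarrow> c z = 0" "\<And>K. K \<in> T \<Longrightarrow> 0 \<le> W K"
    "\<And>K. K \<in> T \<Longrightarrow> (L2_norm (lebesgue_on K) (\<lambda>x. \<phi> x - bilin (pa K) (pd K) (pe K) c x))\<^sup>2 \<le> (diameter K)\<^sup>2 * W K"
    "\<And>K E. K \<in> T \<Longrightarrow> E edge_of K \<Longrightarrow>
      (L2_norm (edge_measure E) (\<lambda>x. \<phi> x - bilin (pa K) (pd K) (pe K) c x))\<^sup>2 \<le> diameter E * W K"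
    "(\<Sum>K\<in>T. W K) \<le> interp_const \<kappa> * (\<Sum>K\<in>T. (L2_norm (lebesgue_on K) (\<lambda>x. jacobian \<phi> (at x)))\<^sup>2) + 4 * real (card T) * \<delta>\<^sup>2"
proof (cases "T = {}")
  case True
  then show ?thesis by (intro that[of "\<lambda>_. 0" "\<lambda>_. 0"]) auto
next
  case ne: False
  have \<kappa>: "0 < \<kappa>" using aspect(3)[OF sh _ param(1)] param(2) ne by (metis ex_in_conv)
  define g where "g K = L2_norm (lebesgue_on K) (\<lambda>x. jacobian \<phi> (at x))" for K
  have g0: "0 \<le> g K" for K by (simp add: g_def)
  have "\<exists>M. (L2_norm (lebesgue_on K) (\<lambda>x. \<phi> x - M))\<^sup>2 \<le> 6 * \<kappa> * (norm (pd K) * norm (pe K)) * (g K)\<^sup>2 \<and>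
      (\<forall>p q. closed_segment p q edge_of K \<longrightarrow> I01 (\<lambda>s. (norm (\<phi> (p + s *\<^sub>R (q - p)) - M))\<^sup>2) \<le> 6 * \<kappa> * (g K)\<^sup>2)"
    if K: "K \<in> T" for K
  proof -
    interpret rect "pa K" "pd K" "pe K" by (rule param(1)[OF K])
    note asp = aspect[OF sh K param(1)[OF K] param(2)[OF K, symmetric]]
    obtain M where "(L2_norm (lebesgue_on (rectangle (pa K) (pd K) (pe K))) (\<lambda>x. \<phi> x - M))\<^sup>2
      \<le> 6 * \<kappa> * (norm (pd K) * norm (pe K)) * (L2_norm (lebesgue_on (rectangle (pa K) (pd K) (pe K))) (\<lambda>x. jacobian \<phi> (at x)))\<^sup>2"
    and "\<And>E p q. E edge_of rectangle (pa K) (pd K) (pe K) \<Longrightarrow> E = closed_segment p q \<Longrightarrow>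
      I01 (\<lambda>s. (norm (\<phi> (p + s *\<^sub>R (q - p)) - M))\<^sup>2)
        \<le> 6 * \<kappa> * (L2_norm (lebesgue_on (rectangle (pa K) (pd K) (pe K))) (\<lambda>x. jacobian \<phi> (at x)))\<^sup>2"
      using rect_Poincare[OF \<phi> asp(1,2)] by metis
    then show ?thesis
      unfolding param(2)[OF K] g_def[symmetric] by (intro exI[of _ M]) auto
  qed
  then obtain M where
    Mi: "\<And>K. K \<in> T \<Longrightarrow> (L2_norm (lebesgue_on K) (\<lambda>x. \<phi> x - M K))\<^sup>2 \<le> 6 * \<kappa> * (norm (pd K) * norm (pe K)) * (g K)\<^sup>2"
    and Me: "\<And>K p q. K \<in> T \<Longrightarrow> closed_segment p q edge_of K \<Longrightarrow>
        I01 (\<lambda>s. (norm (\<phi> (p + s *\<^sub>R (q - p)) - M K))\<^sup>2) \<le> 6 * \<kappa> * (g K)\<^sup>2" by metis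
  define k where "k = sqrt (6 * \<kappa>)"
  have k: "0 < k" "k\<^sup>2 = 6 * \<kappa>" using \<kappa> by (simp_all add: k_def)
  define G where "G z = sqrt (\<Sum>K\<in>patch z. (g K)\<^sup>2)" for z
  have G0: "0 \<le> G z" for z by (simp add: G_def sum_nonneg)
  have gG: "g K \<le> G z" if "K \<in> patch z" for K z
    unfolding G_def using that by (intro real_le_rsqrt member_le_sum) auto
  have mean: "norm (I01 (\<lambda>s. \<phi> (p + s *\<^sub>R (q - p))) - M K) \<le> k * g K"
    if "K \<in> T" "closed_segment p q edge_of K" for K p q
    by (rule edge_mean_le[OF \<phi>]) (use Me[OF that] k g0 in \<open>simp_all add: power_mult_distrib\<close>)
  \<comment> \<open>Both constants are compared with the mean of \<phi> over the common
    edge.\<close>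
  have step: "norm (M K - M K') \<le> 2 * k * G z" if nb: "(K, K') \<in> neighbours z" for K K' z
  proof -
    obtain E where K: "K \<in> patch z" "K' \<in> patch z" and E: "E edge_of K" "E edge_of K'"
      using nb by (auto simp: neighbours_def)
    then have KT: "K \<in> T" "K' \<in> T" by (auto simp: patch_def)
    obtain p q where pq: "E = closed_segment p q" using edge_segment[OF KT(1) E(1)] by metis
    have "norm (M K - M K') \<le> norm (I01 (\<lambda>s. \<phi> (p + s *\<^sub>R (q - p))) - M K') + norm (I01 (\<lambda>s. \<phi> (p + s *\<^sub>R (q - p))) - M K)"
      using norm_triangle_ineq4[of "I01 (\<lambda>s. \<phi> (p + s *\<^sub>R (q - p))) - M K'" "I01 (\<lambda>s. \<phi> (p + s *\<^sub>R (q - p))) - M K"] by simp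
    also have "\<dots> \<le> k * g K' + k * g K"
      using mean KT E pq by (intro add_mono) auto
    also have "\<dots> \<le> k * G z + k * G z"
      using gG K k by (intro add_mono mult_left_mono) auto
    finally show ?thesis by simp
  qed
  have diff: "norm (M K - M K') \<le> 512 * k * G z" if "K \<in> patch z" "K' \<in> patch z" for K K' z
    using patch_diff[of z M "2 * k * G z", OF step _ that] k G0[of z] by simp
  \<comment> \<open>At a free node any element of the patch will do, since all constants of a patch
    are within \<open>512 * k * G z\<close> of each other.\<close>
  define c where "c z = (if z \<in> VD then 0 else M (SOME K. K \<in> patch z))" for z
  have cM: "norm (c z - M K) \<le> 513 * k * G z + \<delta>" if K: "K \<in> patch z" for K z
  proof (cases "z \<in> VD")
    case False
    have "(SOME K. K \<in> patch z) \<in> patch z" using K by (rule someI)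
    then have "norm (c z - M K) \<le> 512 * k * G z"
      using False diff[OF _ K] by (simp add: c_def)
    also have "\<dots> \<le> 513 * k * G z" using k G0[of z] by (simp add: mult_right_mono)
    finally show ?thesis using \<delta> by simp
  next
    case True
    have "z \<in> (\<Union>K\<in>T. verts K)" using K by (auto simp: patch_def)
    \<comment> \<open>The nodal value 0 is compared with \<open>M K\<close> through an edge mean of
      size at most \<delta>. The comparison of that mean with \<open>M K'\<close> costs one more
      \<open>k * G z\<close>, which makes 513.\<close>
    then obtain K' p q where K': "K' \<in> patch z" and pq: "closed_segment p q edge_of K'"
      and m: "norm (I01 (\<lambda>s. \<phi> (p + s *\<^sub>R (q - p)))) \<le> \<delta>" using VD[OF True] by blast
    have K'T: "K' \<in> T" using K' by (simp add: patch_def)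
    have "norm (c z - M K) = norm (M K)" using True by (simp add: c_def)
    also have "M K = (M K - M K') + (- (I01 (\<lambda>s. \<phi> (p + s *\<^sub>R (q - p))) - M K')) + I01 (\<lambda>s. \<phi> (p + s *\<^sub>R (q - p)))" by simp
    also have "norm \<dots> \<le> norm (M K - M K') + norm (- (I01 (\<lambda>s. \<phi> (p + s *\<^sub>R (q - p))) - M K')) + norm (I01 (\<lambda>s. \<phi> (p + s *\<^sub>R (q - p))))"
      by (intro norm_triangle_le add_mono norm_triangle_ineq order_refl)
    also have "\<dots> \<le> 512 * k * G z + k * G z + \<delta>"
    proof (intro add_mono m diff K K')
      have "k * g K' \<le> k * G z" using gG[OF K'] k by simp
      then show "norm (- (I01 (\<lambda>s. \<phi> (p + s *\<^sub>R (q - p))) - M K')) \<le> k * G z"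
        using mean[OF K'T pq] by (simp add: norm_minus_commute)
    qed
    finally show ?thesis by (simp add: algebra_simps)
  qed
  define A where "A = 513 * k"
  define S where "S K = (\<Sum>z\<in>verts K. 2 * A\<^sup>2 * (G z)\<^sup>2) + 2 * \<delta>\<^sup>2" for K
  have S: "(norm (c z - M K))\<^sup>2 \<le> S K" if K: "K \<in> T" and z: "z \<in> verts K" for K z
  proof -
    have "(norm (c z - M K))\<^sup>2 \<le> (A * G z + \<delta>)\<^sup>2"
      using cM[of K z] K z by (intro power_mono) (auto simp: patch_def A_def)
    also have "\<dots> \<le> 2 * A\<^sup>2 * (G z)\<^sup>2 + 2 * \<delta>\<^sup>2"
      using sum_squares_bound[of "A * G z" \<delta>] by (simp add: power2_sum power_mult_distrib)
    also have "2 * A\<^sup>2 * (G z)\<^sup>2 \<le> (\<Sum>z\<in>verts K. 2 * A\<^sup>2 * (G z)\<^sup>2)"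
      by (rule member_le_sum[OF z]) (use finite_verts[OF K] in auto)
    finally show ?thesis by (simp add: S_def)
  qed
  have S0: "0 \<le> S K" for K by (simp add: S_def sum_nonneg)
  \<comment> \<open>Twice the Poincare bound plus twice the nodal bound, in accordance with
    \<open>bilin_diff_bound\<close>. The same number serves elements and edges: the remaining factor
    is the area, at most the squared diameter, or the edge length.\<close>
  define W where "W K = 12 * \<kappa> * (g K)\<^sup>2 + 2 * S K" for K
  have W0: "0 \<le> W K" for K using \<kappa> S0 by (simp add: W_def)
  have c\<phi>: "continuous_on S \<phi>" for S by (rule smooth_continuous_on[OF \<phi>])
  have pt: "(norm (\<phi> x - bilin (pa K) (pd K) (pe K) c x))\<^sup>2 \<le> 2 * (norm (\<phi> x - M K))\<^sup>2 + 2 * S K"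
    if K: "K \<in> T" and x: "x \<in> K" for K x
    using rect.bilin_diff_bound[OF param(1)[OF K], of x "pa K" c "M K" "S K" "\<phi> x"] param(2)[OF K] x S[OF K]
      verts_corners[OF K] by auto
  show thesis
  proof (rule that[of c W])
    fix K assume K: "K \<in> T"
    interpret rect "pa K" "pd K" "pe K" by (rule param(1)[OF K])
    let ?Q = "bilin (pa K) (pd K) (pe K) c"
    have cQ: "continuous_on S ?Q" for S by (rule smooth_continuous_on[OF smooth_bilin])
    have int: "integrable (lebesgue_on K) (\<lambda>x. (norm (\<phi> x - M K))\<^sup>2)" "integrable (lebesgue_on K) (\<lambda>x. (norm (\<phi> x - ?Q x))\<^sup>2)"
      by (intro continuous_integrable_compact compact_K[OF K] continuous_intros c\<phi> cQ)+
    have meas: "measure (lebesgue_on K) K = norm (pd K) * norm (pe K)"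
      using measure_rectangle param(2)[OF K] lebesgue_K[OF K] by (simp add: measure_restrict_space)
    have fm: "finite_measure (lebesgue_on K)"
      by (rule finite_measure_lebesgue_on[OF lmeasurable_compact[OF compact_K[OF K]]])
    have "(L2_norm (lebesgue_on K) (\<lambda>x. \<phi> x - ?Q x))\<^sup>2 \<le> (\<integral>x. 2 * (norm (\<phi> x - M K))\<^sup>2 + 2 * S K \<partial>lebesgue_on K)"
      unfolding L2_norm_sq using pt[OF K]
      by (intro integral_mono Bochner_Integration.integrable_add Bochner_Integration.integrable_mult_right int
          finite_measure.integrable_const[OF fm]) auto
    also have "\<dots> = 2 * (L2_norm (lebesgue_on K) (\<lambda>x. \<phi> x - M K))\<^sup>2 + (norm (pd K) * norm (pe K)) * (2 * S K)"
      unfolding L2_norm_sq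
      by (subst Bochner_Integration.integral_add)
        (use meas in \<open>auto intro!: int finite_measure.integrable_const[OF fm] simp: lebesgue_integral_const\<close>)
    also have "\<dots> \<le> 2 * (6 * \<kappa> * (norm (pd K) * norm (pe K)) * (g K)\<^sup>2) + (norm (pd K) * norm (pe K)) * (2 * S K)"
      using Mi[OF K] by simp
    also have "\<dots> = (norm (pd K) * norm (pe K)) * W K"
      by (simp add: W_def algebra_simps)
    also have "\<dots> \<le> (diameter K)\<^sup>2 * W K"
      using diameter_ge param(2)[OF K] W0 unfolding power2_eq_square
      by (intro mult_right_mono mult_mono) (auto intro: order_trans[OF norm_ge_zero])
    finally show "(L2_norm (lebesgue_on K) (\<lambda>x. \<phi> x - ?Q x))\<^sup>2 \<le> (diameter K)\<^sup>2 * W K" .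
    fix E assume E: "E edge_of K"
    obtain p q where pq: "E = closed_segment p q" "p \<noteq> q" using edge_segment[OF K E] by metis
    have EK: "p + s *\<^sub>R (q - p) \<in> K" if "s \<in> {0..1}" for s
    proof -
      have "p + s *\<^sub>R (q - p) \<in> E" using that unfolding pq in_segment by (intro exI[of _ s]) (auto simp: algebra_simps)
      then show ?thesis using E face_of_imp_subset by (auto simp: edge_of_def)
    qed
    have cE: "continuous_on UNIV (\<lambda>s. F (p + s *\<^sub>R (q - p)))" if "continuous_on UNIV F" for F :: "R2 \<Rightarrow> R2"
      by (rule continuous_on_compose2[OF that]) (auto intro!: continuous_intros)
    have "(L2_norm (edge_measure E) (\<lambda>x. \<phi> x - ?Q x))\<^sup>2 = dist p q * I01 (\<lambda>s. (norm (\<phi> (p + s *\<^sub>R (q - p)) - ?Q (p + s *\<^sub>R (q - p))))\<^sup>2)"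
      unfolding pq(1) by (rule edge_L2_sq(1)[OF pq(2)]) (intro continuous_intros c\<phi> cQ)
    also have "\<dots> \<le> dist p q * I01 (\<lambda>s. 2 * S K + 2 * (norm (\<phi> (p + s *\<^sub>R (q - p)) - M K))\<^sup>2)"
      using pt[OF K EK] by (intro mult_left_mono I01_mono continuous_intros cE[OF c\<phi>] cE[OF cQ]) (auto simp: add.commute)
    also have "\<dots> = dist p q * (2 * S K + 2 * I01 (\<lambda>s. (norm (\<phi> (p + s *\<^sub>R (q - p)) - M K))\<^sup>2))"
      by (subst I01_affine) (intro continuous_intros cE[OF c\<phi>], simp)
    also have "\<dots> \<le> dist p q * (2 * S K + 2 * (6 * \<kappa> * (g K)\<^sup>2))"
      using Me[OF K, of p q] E pq by (intro mult_left_mono add_left_mono) auto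
    also have "\<dots> = dist p q * W K" by (simp add: W_def)
    also have "\<dots> \<le> diameter E * W K"
      unfolding pq(1) by (intro mult_right_mono dist_le_diameter_segment W0)
    finally show "(L2_norm (edge_measure E) (\<lambda>x. \<phi> x - ?Q x))\<^sup>2 \<le> diameter E * W K" .
  next
    have "(\<Sum>K\<in>T. W K) = 12 * \<kappa> * (\<Sum>K\<in>T. (g K)\<^sup>2) + 4 * A\<^sup>2 * (\<Sum>K\<in>T. \<Sum>z\<in>verts K. \<Sum>K'\<in>patch z. (g K')\<^sup>2) + 4 * real (card T) * \<delta>\<^sup>2"
      by (simp add: W_def S_def G_def sum.distrib sum_distrib_left sum_nonneg algebra_simps)
    also have "\<dots> \<le> 12 * \<kappa> * (\<Sum>K\<in>T. (g K)\<^sup>2) + 4 * A\<^sup>2 * (64 * (\<Sum>K\<in>T. (g K)\<^sup>2)) + 4 * real (card T) * \<delta>\<^sup>2"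
      by (intro add_mono mult_left_mono sum_patches order_refl) auto
    also have "\<dots> = interp_const \<kappa> * (\<Sum>K\<in>T. (g K)\<^sup>2) + 4 * real (card T) * \<delta>\<^sup>2"
      by (simp add: interp_const_def A_def k_def algebra_simps)
    finally show "(\<Sum>K\<in>T. W K) \<le> interp_const \<kappa> * (\<Sum>K\<in>T. (L2_norm (lebesgue_on K) (\<lambda>x. jacobian \<phi> (at x)))\<^sup>2) + 4 * real (card T) * \<delta>\<^sup>2"
      by (simp add: g_def)
  qed (use W0 in \<open>auto simp: c_def\<close>)
qed

end

section \<open>Weak gradients and traces\<close>

lemma integral_lebesgue_on_support:
  fixes f :: "'a::euclidean_space \<Rightarrow> real"
  assumes "S \<in> sets lebesgue" "S' \<in> sets lebesgue" "\<And>x. x \<notin> S \<inter> S' \<Longrightarrow> f x = 0"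
  shows "(\<integral>x. f x \<partial>lebesgue_on S) = (\<integral>x. f x \<partial>lebesgue_on S')"
proof -
  have eq: "(\<lambda>x. indicator S x *\<^sub>R f x) = (\<lambda>x. indicator S' x *\<^sub>R f x)"
  proof
    show "indicator S x *\<^sub>R f x = indicator S' x *\<^sub>R f x" for x
      using assms(3)[of x] by (cases "x \<in> S \<inter> S'") auto
  qed
  have "(\<integral>x. f x \<partial>lebesgue_on S) = (\<integral>x. indicator S x *\<^sub>R f x \<partial>lebesgue)"
    by (rule integral_restrict_space) (use assms in auto)
  also have "\<dots> = (\<integral>x. f x \<partial>lebesgue_on S')"
    unfolding eq by (rule integral_restrict_space[symmetric]) (use assms in auto)
  finally show ?thesis .
qed

lemma frechet_derivative_outside:
  assumes "x \<notin> closure {x. \<phi> x \<noteq> 0}"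
  shows "frechet_derivative \<phi> (at x) = (\<lambda>h. 0)"
proof -
  have "((\<lambda>x. 0) has_derivative (\<lambda>h. 0)) (at x)" by simp
  then have "(\<phi> has_derivative (\<lambda>h. 0)) (at x)"
    by (rule has_derivative_transform_within_open[of _ _ _ _ "- closure {x. \<phi> x \<noteq> 0}"])
      (use assms closure_subset[of "{x. \<phi> x \<noteq> 0}"] in auto)
  then show ?thesis by (rule frechet_derivative_at[symmetric])
qed

text \<open>The support is enclosed in a large axis-parallel square; there the fundamental theorem
  leaves only values on the sides, which vanish.\<close>

lemma integral_derivative_compact_support:
  fixes F :: sfield
  assumes F: "smooth F" and C: "compact C" "\<And>x. x \<notin> C \<Longrightarrow> F x = 0" and S: "S \<in> sets lebesgue" "C \<subseteq> S"
  shows "(\<integral>x. frechet_derivative F (at x) (axis j 1) \<partial>lebesgue_on S) = 0"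
proof -
  obtain B where B: "B > 0" "\<And>x. x \<in> C \<Longrightarrow> norm x < B"
    using compact_imp_bounded[OF C(1)] by (meson bounded_pos_less)
  \<comment> \<open>Lower left corner of the square of side \<open>2 * B\<close> centred at the
    origin; its sides avoid \<open>C\<close> because points of \<open>C\<close> have norm below
    \<open>B\<close>.\<close>
  define a :: R2 where "a = (- B) *\<^sub>R axis 1 1 - B *\<^sub>R axis 2 1"
  define d e :: R2 where "d = (2 * B) *\<^sub>R axis 1 1" and "e = (2 * B) *\<^sub>R axis 2 1"
  have ax: "(axis 1 1 :: R2) $ 1 = 1" "(axis 1 1 :: R2) $ 2 = 0" "(axis 2 1 :: R2) $ 1 = 0" "(axis 2 1 :: R2) $ 2 = 1"
    by (simp_all add: axis_def)
  interpret rect a d e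
    by unfold_locales (use B(1) in \<open>auto simp: d_def e_def inner_R2 vec_eq_iff forall_2 ax\<close>)
  have out: "F x = 0" if "\<bar>x $ i\<bar> \<ge> B" for x i
    using C(2)[of x] B(2)[of x] component_le_norm_cart[of x i] that by force
  have z: "F (a + e + s *\<^sub>R d) = 0" "F (a + s *\<^sub>R d) = 0" "F (a + d + s *\<^sub>R e) = 0" "F (a + s *\<^sub>R e) = 0" for s
    using out[of "a + e + s *\<^sub>R d" 2] out[of "a + s *\<^sub>R d" 2] out[of "a + d + s *\<^sub>R e" 1] out[of "a + s *\<^sub>R e" 1] B(1)
    by (simp_all add: a_def d_def e_def ax)
  have R: "(\<integral>x. frechet_derivative F (at x) e \<partial>lebesgue_on (rectangle a d e)) = 0"
    "(\<integral>x. frechet_derivative F (at x) d \<partial>lebesgue_on (rectangle a d e)) = 0"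
    using rectangle_FTC[OF F orth nz, of a] rectangle_FTC[OF F orth' nz(2,1), of a] by (simp_all add: z rectangle_swap[of a d])
  have j: "j = 1 \<or> j = 2" by (rule exhaust_2)
  have lin: "linear (frechet_derivative F (at x))" for x
    by (rule has_derivative_linear[OF smooth_has_derivative[OF F]])
  have "frechet_derivative F (at x) d = 2 * B * frechet_derivative F (at x) (axis 1 1)"
    "frechet_derivative F (at x) e = 2 * B * frechet_derivative F (at x) (axis 2 1)" for x
    using linear_cmul[OF lin] by (simp_all add: d_def e_def)
  then have R': "(\<integral>x. frechet_derivative F (at x) (axis j 1) \<partial>lebesgue_on (rectangle a d e)) = 0"
    using R B(1) j by auto
  have supp: "closure {x. F x \<noteq> 0} \<subseteq> C"
    by (rule closure_minimal) (use C compact_imp_closed in auto)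
  have CR: "C \<subseteq> rectangle a d e"
  proof
    fix x assume "x \<in> C"
    then have "\<bar>x $ 1\<bar> < B" "\<bar>x $ 2\<bar> < B"
      using B(2)[of x] component_le_norm_cart[of x 1] component_le_norm_cart[of x 2] by linarith+
    moreover have "x = a + ((x $ 1 + B) / (2 * B)) *\<^sub>R d + ((x $ 2 + B) / (2 * B)) *\<^sub>R e"
      using B(1) by (simp add: vec_eq_iff forall_2 a_def d_def e_def ax)
    ultimately show "x \<in> rectangle a d e"
      using B(1) rectangle_memI[of "(x $ 1 + B) / (2 * B)" "(x $ 2 + B) / (2 * B)" a d e] by auto
  qed
  have "(\<integral>x. frechet_derivative F (at x) (axis j 1) \<partial>lebesgue_on S)
      = (\<integral>x. frechet_derivative F (at x) (axis j 1) \<partial>lebesgue_on (rectangle a d e))"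
  proof (rule integral_lebesgue_on_support[OF S(1)])
    fix x assume "x \<notin> S \<inter> rectangle a d e"
    then have "x \<notin> closure {x. F x \<noteq> 0}" using S(2) CR supp by blast
    then show "frechet_derivative F (at x) (axis j 1) = 0" by (simp add: frechet_derivative_outside)
  qed simp
  then show ?thesis using R' by simp
qed

lemma frechet_derivative_mult:
  fixes f g :: sfield
  assumes "smooth f" "smooth g"
  shows "frechet_derivative (\<lambda>x. f x * g x) (at x) h
    = f x * frechet_derivative g (at x) h + frechet_derivative f (at x) h * g x"
  unfolding frechet_derivative_at[OF has_derivative_mult[OF smooth_has_derivative[OF assms(1), of x]
      smooth_has_derivative[OF assms(2), of x]], symmetric] ..

lemma frechet_derivative_nth:
  assumes "smooth (f :: vfield)"
  shows "frechet_derivative (\<lambda>x. f x $ i) (at x) h = frechet_derivative f (at x) h $ i"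
  unfolding frechet_derivative_at[OF bounded_linear.has_derivative[OF bounded_linear_vec_nth
      smooth_has_derivative[OF assms, of x]], symmetric] ..

lemma in_L2_nth: "in_L2 M (f :: _ \<Rightarrow> real^'n) \<Longrightarrow> in_L2 M (\<lambda>x. f x $ i)"
  by (rule in_L2_linear[OF bounded_linear_vec_nth])

lemma in_L2_nth2: "in_L2 M (f :: _ \<Rightarrow> real^2^2) \<Longrightarrow> in_L2 M (\<lambda>x. f x $ i $ j)"
  by (rule in_L2_linear[OF bounded_linear_compose[OF bounded_linear_vec_nth bounded_linear_vec_nth]])

text \<open>The product of \<psi> and the test function has compact support, so the integral of its
  derivative vanishes although \<psi> itself does not vanish near the boundary.\<close>

lemma integration_by_parts:
  fixes \<psi> :: sfield
  assumes \<psi>: "smooth \<psi>" and \<phi>: "test_function U \<phi>" and U: "open U" "bounded U"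
  shows "(\<integral>x. \<psi> x * frechet_derivative \<phi> (at x) (axis j 1) \<partial>lebesgue_on U)
    = - (\<integral>x. frechet_derivative \<psi> (at x) (axis j 1) * \<phi> x \<partial>lebesgue_on U)"
proof -
  have s\<phi>: "smooth \<phi>" and supp: "compact (closure {x. \<phi> x \<noteq> 0})" "closure {x. \<phi> x \<noteq> 0} \<subseteq> U"
    using \<phi> by (auto simp: test_function_def)
  have "(\<integral>x. frechet_derivative (\<lambda>x. \<psi> x * \<phi> x) (at x) (axis j 1) \<partial>lebesgue_on U) = 0"
    by (rule integral_derivative_compact_support[OF smooth_mult[OF \<psi> s\<phi>] supp(1) _ _ supp(2)])
      (use closure_subset[of "{x. \<phi> x \<noteq> 0}"] U in auto)
  moreover have "integrable (lebesgue_on U) (\<lambda>x. \<psi> x * frechet_derivative \<phi> (at x) (axis j 1))"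
    "integrable (lebesgue_on U) (\<lambda>x. frechet_derivative \<psi> (at x) (axis j 1) * \<phi> x)"
    by (intro in_L2_mult_integrable continuous_in_L2_bounded smooth_continuous_on frechet_derivative_continuous_on \<psi> s\<phi> U; use U in simp)+
  ultimately show ?thesis
    by (simp add: frechet_derivative_mult[OF \<psi> s\<phi>])
qed

section \<open>Weak gradients, Sobolev functions and traces on a bounded open set\<close>

locale domain =
  fixes \<Omega> :: "R2 set"
  assumes open_dom: "open \<Omega>" and bounded_dom: "bounded \<Omega>"
begin

abbreviation "L \<equiv> lebesgue_on \<Omega>"

lemma sets_dom [simp]: "\<Omega> \<in> sets lebesgue"
  using open_dom by simp

lemma smooth_in_L2: "smooth (f :: R2 \<Rightarrow> 'b::euclidean_space) \<Longrightarrow> in_L2 L f"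
  by (intro continuous_in_L2_bounded smooth_continuous_on bounded_dom) auto

lemma derivative_in_L2: "smooth (f :: R2 \<Rightarrow> 'b::euclidean_space) \<Longrightarrow> in_L2 L (\<lambda>x. frechet_derivative f (at x) v)"
  by (intro continuous_in_L2_bounded frechet_derivative_continuous_on bounded_dom) auto

lemma jacobian_in_L2: "smooth (f :: vfield) \<Longrightarrow> in_L2 L (\<lambda>x. jacobian f (at x))"
  by (intro continuous_in_L2_bounded continuous_on_jacobian bounded_dom) auto

text \<open>Test functions supported in \<open>U\<close> see only the values of \<open>u\<close> on
  \<open>U\<close>, where integration by parts for \<psi> applies. This links the abstractly chosen
  weak gradient with the elementwise classical derivatives of finite element functions.\<close>

lemma weak_grad_local:
  assumes G: "has_weak_grad \<Omega> u G" and u: "in_L2 L u" and U: "open U" "U \<subseteq> \<Omega>"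
    and \<psi>: "smooth \<psi>" and ae: "AE x in lebesgue_on U. u x = \<psi> x"
  shows "AE x in lebesgue_on U. G x = jacobian \<psi> (at x)"
proof -
  have bU: "bounded U" using U bounded_dom bounded_subset by blast
  have mU: "U \<in> sets lebesgue" using U by simp
  have GL: "in_L2 L G" using G by (simp add: has_weak_grad_def)
  have GU: "in_L2 (lebesgue_on U) G" by (rule in_L2_subset[OF GL U(2) mU sets_dom])
  have JU: "in_L2 (lebesgue_on U) (\<lambda>x. jacobian \<psi> (at x))"
    by (intro continuous_in_L2_bounded continuous_on_jacobian \<psi> bU mU)
  have "AE x in lebesgue_on U. G x $ i $ j - jacobian \<psi> (at x) $ i $ j = 0" for i j
  proof (rule fundamental_lemma[OF U(1)])
    show "in_L2 (lebesgue_on U) (\<lambda>x. G x $ i $ j - jacobian \<psi> (at x) $ i $ j)"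
      by (intro in_L2_diff in_L2_nth2 GU JU)
    fix \<phi> assume t: "test_function U \<phi>"
    then have t\<Omega>: "test_function \<Omega> \<phi>" using U by (auto simp: test_function_def)
    have s\<phi>: "smooth \<phi>" and supp: "closure {x. \<phi> x \<noteq> 0} \<subseteq> U" using t by (auto simp: test_function_def)
    have \<phi>0: "\<phi> x = 0" "frechet_derivative \<phi> (at x) v = 0" if "x \<notin> U" for x v
    proof -
      have x: "x \<notin> closure {x. \<phi> x \<noteq> 0}" using that supp by blast
      then show "\<phi> x = 0" using closure_subset[of "{x. \<phi> x \<noteq> 0}"] by blast
      show "frechet_derivative \<phi> (at x) v = 0" using frechet_derivative_outside[OF x] by simp
    qed
    have i1: "integrable (lebesgue_on U) (\<lambda>x. G x $ i $ j * \<phi> x)"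
      by (intro in_L2_mult_integrable in_L2_nth2 GU continuous_in_L2_bounded smooth_continuous_on s\<phi> bU mU)
    have i2: "integrable (lebesgue_on U) (\<lambda>x. jacobian \<psi> (at x) $ i $ j * \<phi> x)"
      by (intro in_L2_mult_integrable in_L2_nth2 JU continuous_in_L2_bounded smooth_continuous_on s\<phi> bU mU)
    have "(\<integral>x. G x $ i $ j * \<phi> x \<partial>lebesgue_on U) = (\<integral>x. G x $ i $ j * \<phi> x \<partial>L)"
      by (rule integral_lebesgue_on_support[OF mU sets_dom]) (use \<phi>0 U in auto)
    also have "\<dots> = - (\<integral>x. u x $ i * frechet_derivative \<phi> (at x) (axis j 1) \<partial>L)"
      using G t\<Omega> by (simp add: has_weak_grad_def)
    also have "(\<integral>x. u x $ i * frechet_derivative \<phi> (at x) (axis j 1) \<partial>L)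
        = (\<integral>x. u x $ i * frechet_derivative \<phi> (at x) (axis j 1) \<partial>lebesgue_on U)"
      by (rule integral_lebesgue_on_support[OF sets_dom mU]) (use \<phi>0 U in auto)
    also have "\<dots> = (\<integral>x. \<psi> x $ i * frechet_derivative \<phi> (at x) (axis j 1) \<partial>lebesgue_on U)"
    proof (rule integral_cong_AE)
      have d: "(\<lambda>x. frechet_derivative \<phi> (at x) (axis j 1)) \<in> borel_measurable (lebesgue_on U)"
        by (intro continuous_imp_measurable_on_sets_lebesgue frechet_derivative_continuous_on s\<phi> mU)
      show "(\<lambda>x. u x $ i * frechet_derivative \<phi> (at x) (axis j 1)) \<in> borel_measurable (lebesgue_on U)"
        using d in_L2_measurable[OF in_L2_nth[OF in_L2_subset[OF u U(2) mU sets_dom]]] by measurable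
      show "(\<lambda>x. \<psi> x $ i * frechet_derivative \<phi> (at x) (axis j 1)) \<in> borel_measurable (lebesgue_on U)"
        by (intro continuous_imp_measurable_on_sets_lebesgue continuous_intros smooth_continuous_on[OF \<psi>]
            frechet_derivative_continuous_on s\<phi> mU)
      show "AE x in lebesgue_on U. u x $ i * frechet_derivative \<phi> (at x) (axis j 1)
          = \<psi> x $ i * frechet_derivative \<phi> (at x) (axis j 1)"
        using ae by eventually_elim simp
    qed
    also have "- \<dots> = (\<integral>x. jacobian \<psi> (at x) $ i $ j * \<phi> x \<partial>lebesgue_on U)"
      unfolding integration_by_parts[OF smooth_nth[OF \<psi>] t U(1) bU]
      by (simp add: jacobian_nth frechet_derivative_nth[OF \<psi>])
    finally show "(\<integral>x. (G x $ i $ j - jacobian \<psi> (at x) $ i $ j) * \<phi> x \<partial>lebesgue_on U) = 0"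
      using i1 i2 by (simp add: left_diff_distrib)
  qed
  then have "AE x in lebesgue_on U. \<forall>i\<in>UNIV. \<forall>j\<in>UNIV. G x $ i $ j - jacobian \<psi> (at x) $ i $ j = 0"
    by (intro AE_finite_allI) auto
  then show ?thesis by eventually_elim (simp add: vec_eq_iff)
qed

lemma has_weak_grad_unique:
  assumes G: "has_weak_grad \<Omega> u G" and G': "has_weak_grad \<Omega> u G'"
  shows "AE x in L. G x = G' x"
proof -
  have GL: "in_L2 L G" "in_L2 L G'" using G G' by (simp_all add: has_weak_grad_def)
  have "AE x in L. G x $ i $ j - G' x $ i $ j = 0" for i j
  proof (rule fundamental_lemma[OF open_dom])
    show "in_L2 L (\<lambda>x. G x $ i $ j - G' x $ i $ j)"
      by (intro in_L2_diff in_L2_nth2 GL)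
    fix \<phi> assume t: "test_function \<Omega> \<phi>"
    then have "in_L2 L \<phi>" by (auto simp: test_function_def intro: smooth_in_L2)
    then have "integrable L (\<lambda>x. G x $ i $ j * \<phi> x)" "integrable L (\<lambda>x. G' x $ i $ j * \<phi> x)"
      using GL by (auto intro!: in_L2_mult_integrable in_L2_nth2)
    then show "(\<integral>x. (G x $ i $ j - G' x $ i $ j) * \<phi> x \<partial>L) = 0"
      using G G' t by (simp add: has_weak_grad_def left_diff_distrib)
  qed
  then have "AE x in L. \<forall>i\<in>UNIV. \<forall>j\<in>UNIV. G x $ i $ j - G' x $ i $ j = 0"
    by (intro AE_finite_allI) auto
  then show ?thesis by eventually_elim (simp add: vec_eq_iff)
qed

lemma has_weak_grad_lincomb:
  assumes u: "in_L2 L u" "has_weak_grad \<Omega> u G" and v: "in_L2 L v" "has_weak_grad \<Omega> v H"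
  shows "has_weak_grad \<Omega> (\<lambda>x. u x + c *\<^sub>R v x) (\<lambda>x. G x + c *\<^sub>R H x)"
  unfolding has_weak_grad_def
proof (intro conjI allI impI)
  have GL: "in_L2 L G" "in_L2 L H" using u v by (simp_all add: has_weak_grad_def)
  show "in_L2 L (\<lambda>x. G x + c *\<^sub>R H x)" by (intro in_L2_add in_L2_scaleR GL)
  fix \<phi> i j assume t: "test_function \<Omega> \<phi>"
  then have s\<phi>: "smooth \<phi>" by (simp add: test_function_def)
  have "integrable L (\<lambda>x. u x $ i * frechet_derivative \<phi> (at x) (axis j 1))"
    "integrable L (\<lambda>x. v x $ i * frechet_derivative \<phi> (at x) (axis j 1))"
    "integrable L (\<lambda>x. G x $ i $ j * \<phi> x)" "integrable L (\<lambda>x. H x $ i $ j * \<phi> x)"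
    by (intro in_L2_mult_integrable in_L2_nth in_L2_nth2 u v GL derivative_in_L2 smooth_in_L2 s\<phi>)+
  then show "(\<integral>x. (u x + c *\<^sub>R v x) $ i * frechet_derivative \<phi> (at x) (axis j 1) \<partial>L)
      = - (\<integral>x. (G x + c *\<^sub>R H x) $ i $ j * \<phi> x \<partial>L)"
    using u v t by (simp add: has_weak_grad_def distrib_right mult.assoc)
qed

lemma H1_L2: "u \<in> H1 \<Omega> \<Longrightarrow> in_L2 L u"
  by (simp add: H1_def)

lemma wgrad: "u \<in> H1 \<Omega> \<Longrightarrow> has_weak_grad \<Omega> u (wgrad \<Omega> u)"
  unfolding wgrad_def H1_def by (simp add: someI_ex)

lemma wgrad_L2: "u \<in> H1 \<Omega> \<Longrightarrow> in_L2 L (wgrad \<Omega> u)"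
  using wgrad by (simp add: has_weak_grad_def)

text \<open>\<open>wgrad\<close> is a choice among representatives, so it is linear only almost
  everywhere, by uniqueness of the weak gradient.\<close>

lemma H1_lincomb:
  assumes "u \<in> H1 \<Omega>" "v \<in> H1 \<Omega>"
  shows "(\<lambda>x. u x + c *\<^sub>R v x) \<in> H1 \<Omega>"
    "AE x in L. wgrad \<Omega> (\<lambda>x. u x + c *\<^sub>R v x) x = wgrad \<Omega> u x + c *\<^sub>R wgrad \<Omega> v x"
proof -
  note G = has_weak_grad_lincomb[OF H1_L2[OF assms(1)] wgrad[OF assms(1)] H1_L2[OF assms(2)] wgrad[OF assms(2)], of c]
  show H: "(\<lambda>x. u x + c *\<^sub>R v x) \<in> H1 \<Omega>"
    using G H1_L2 assms by (auto simp: H1_def intro!: in_L2_add in_L2_scaleR)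
  show "AE x in L. wgrad \<Omega> (\<lambda>x. u x + c *\<^sub>R v x) x = wgrad \<Omega> u x + c *\<^sub>R wgrad \<Omega> v x"
    by (rule has_weak_grad_unique[OF wgrad[OF H] G])
qed

lemma H1_diff:
  assumes "u \<in> H1 \<Omega>" "v \<in> H1 \<Omega>"
  shows "(\<lambda>x. u x - v x) \<in> H1 \<Omega>"
    "AE x in L. wgrad \<Omega> (\<lambda>x. u x - v x) x = wgrad \<Omega> u x - wgrad \<Omega> v x"
  using H1_lincomb[OF assms, of "- 1"] by simp_all

lemma wgrad_local:
  assumes u: "u \<in> H1 \<Omega>" and U: "open U" "U \<subseteq> \<Omega>" and \<psi>: "smooth \<psi>" and ae: "AE x in lebesgue_on U. u x = \<psi> x"
  shows "AE x in lebesgue_on U. wgrad \<Omega> u x = jacobian \<psi> (at x)"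
  by (rule weak_grad_local[OF wgrad[OF u] H1_L2[OF u] U \<psi> ae])

lemma smooth_H1:
  assumes "smooth (\<phi> :: vfield)"
  shows "\<phi> \<in> H1 \<Omega>" "AE x in L. wgrad \<Omega> \<phi> x = jacobian \<phi> (at x)"
proof -
  have "has_weak_grad \<Omega> \<phi> (\<lambda>x. jacobian \<phi> (at x))"
    using jacobian_in_L2[OF assms] integration_by_parts[OF smooth_nth[OF assms] _ open_dom bounded_dom]
    by (auto simp: has_weak_grad_def jacobian_nth frechet_derivative_nth[OF assms])
  then show H: "\<phi> \<in> H1 \<Omega>" using smooth_in_L2[OF assms] by (auto simp: H1_def)
  show "AE x in L. wgrad \<Omega> \<phi> x = jacobian \<phi> (at x)"
    by (rule wgrad_local[OF H open_dom order_refl assms]) simp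
qed

lemma L2_le_H1_norm:
  "L2_norm L v \<le> H1_norm \<Omega> v" "L2_norm L (wgrad \<Omega> v) \<le> H1_norm \<Omega> v"
  unfolding H1_norm_def by (simp_all add: real_le_rsqrt)

lemma H1_norm_le: "H1_norm \<Omega> v \<le> L2_norm L v + L2_norm L (wgrad \<Omega> v)"
  unfolding H1_norm_def by (rule sqrt_sum_squares_le_sum) auto

text \<open>The factor 2 comes from estimating the norm by the sum of its two parts; this is enough
  for convergence to 0.\<close>

lemma H1_norm_diff_le:
  assumes "u \<in> H1 \<Omega>" "v \<in> H1 \<Omega>"
  shows "H1_norm \<Omega> (\<lambda>x. u x - v x) \<le> 2 * (H1_norm \<Omega> u + H1_norm \<Omega> v)"
proof -
  have "L2_norm L (wgrad \<Omega> (\<lambda>x. u x - v x)) = L2_norm L (\<lambda>x. wgrad \<Omega> u x - wgrad \<Omega> v x)"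
    by (rule L2_norm_AE[OF sets_dom wgrad_L2[OF H1_diff(1)[OF assms]] H1_diff(2)[OF assms]])
  also have "\<dots> \<le> H1_norm \<Omega> u + H1_norm \<Omega> v"
    using L2_norm_triangle_diff[OF wgrad_L2[OF assms(1)] wgrad_L2[OF assms(2)]] L2_le_H1_norm(2)[of u] L2_le_H1_norm(2)[of v] by linarith
  finally have "L2_norm L (wgrad \<Omega> (\<lambda>x. u x - v x)) \<le> H1_norm \<Omega> u + H1_norm \<Omega> v" .
  moreover have "L2_norm L (\<lambda>x. u x - v x) \<le> H1_norm \<Omega> u + H1_norm \<Omega> v"
    using L2_norm_triangle_diff[OF H1_L2[OF assms(1)] H1_L2[OF assms(2)]] L2_le_H1_norm(1)[of u] L2_le_H1_norm(1)[of v] by linarith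
  ultimately have "H1_norm \<Omega> (\<lambda>x. u x - v x) \<le> (H1_norm \<Omega> u + H1_norm \<Omega> v) + (H1_norm \<Omega> u + H1_norm \<Omega> v)"
    by (intro order_trans[OF H1_norm_le add_mono])
  then show ?thesis by simp
qed

text \<open>The two approximating sequences are subtracted term by term.\<close>

lemma has_trace_diff:
  assumes v: "v \<in> H1 \<Omega>" "has_trace \<Omega> v w" and v': "v' \<in> H1 \<Omega>" "has_trace \<Omega> v' w'"
  shows "has_trace \<Omega> (\<lambda>x. v x - v' x) (\<lambda>x. w x - w' x)"
proof -
  obtain \<phi> where \<phi>: "\<And>n. smooth (\<phi> n)" "(\<lambda>n. H1_norm \<Omega> (\<lambda>x. \<phi> n x - v x)) \<longlonglongrightarrow> 0"
    "\<And>a b. closed_segment a b \<subseteq> frontier \<Omega> \<Longrightarrow> (\<lambda>n. L2_norm (segment_measure a b) (\<lambda>x. \<phi> n x - w x)) \<longlonglongrightarrow> 0"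
    using v(2) unfolding has_trace_def by blast
  obtain \<phi>' where \<phi>': "\<And>n. smooth (\<phi>' n)" "(\<lambda>n. H1_norm \<Omega> (\<lambda>x. \<phi>' n x - v' x)) \<longlonglongrightarrow> 0"
    "\<And>a b. closed_segment a b \<subseteq> frontier \<Omega> \<Longrightarrow> (\<lambda>n. L2_norm (segment_measure a b) (\<lambda>x. \<phi>' n x - w' x)) \<longlonglongrightarrow> 0"
    using v'(2) unfolding has_trace_def by blast
  have w: "in_L2 (segment_measure a b) w" "in_L2 (segment_measure a b) w'" if "closed_segment a b \<subseteq> frontier \<Omega>" for a b
    using v(2) v'(2) that unfolding has_trace_def by blast+
  show ?thesis
    unfolding has_trace_def
  proof (intro conjI allI impI exI[of _ "\<lambda>n x. \<phi> n x - \<phi>' n x"])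
    show "in_L2 (segment_measure a b) (\<lambda>x. w x - w' x)" if "closed_segment a b \<subseteq> frontier \<Omega>" for a b
      using w[OF that] by (rule in_L2_diff)
    show "smooth (\<lambda>x. \<phi> n x - \<phi>' n x)" for n by (intro smooth_diff \<phi> \<phi>')
    show "(\<lambda>n. H1_norm \<Omega> (\<lambda>x. (\<phi> n x - \<phi>' n x) - (v x - v' x))) \<longlonglongrightarrow> 0"
    proof (rule tendsto_sandwich[OF _ _ tendsto_const])
      have "(\<lambda>n. 2 * (H1_norm \<Omega> (\<lambda>x. \<phi> n x - v x) + H1_norm \<Omega> (\<lambda>x. \<phi>' n x - v' x))) \<longlonglongrightarrow> 2 * (0 + 0)"
        by (intro tendsto_intros \<phi> \<phi>')
      then show "(\<lambda>n. 2 * (H1_norm \<Omega> (\<lambda>x. \<phi> n x - v x) + H1_norm \<Omega> (\<lambda>x. \<phi>' n x - v' x))) \<longlonglongrightarrow> 0" by simp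
      have "H1_norm \<Omega> (\<lambda>x. (\<phi> n x - \<phi>' n x) - (v x - v' x)) \<le> 2 * (H1_norm \<Omega> (\<lambda>x. \<phi> n x - v x) + H1_norm \<Omega> (\<lambda>x. \<phi>' n x - v' x))" for n
        using H1_norm_diff_le[OF H1_diff(1)[OF smooth_H1(1)[OF \<phi>(1)] v(1)] H1_diff(1)[OF smooth_H1(1)[OF \<phi>'(1)] v'(1)], of n n]
        by (simp add: algebra_simps)
      then show "\<forall>\<^sub>F n in sequentially. H1_norm \<Omega> (\<lambda>x. (\<phi> n x - \<phi>' n x) - (v x - v' x))
          \<le> 2 * (H1_norm \<Omega> (\<lambda>x. \<phi> n x - v x) + H1_norm \<Omega> (\<lambda>x. \<phi>' n x - v' x))" by simp
    qed (simp add: H1_norm_def)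
    show "(\<lambda>n. L2_norm (segment_measure a b) (\<lambda>x. (\<phi> n x - \<phi>' n x) - (w x - w' x))) \<longlonglongrightarrow> 0"
      if ab: "closed_segment a b \<subseteq> frontier \<Omega>" for a b
    proof (rule tendsto_sandwich[OF _ _ tendsto_const])
      have "(\<lambda>n. L2_norm (segment_measure a b) (\<lambda>x. \<phi> n x - w x) + L2_norm (segment_measure a b) (\<lambda>x. \<phi>' n x - w' x)) \<longlonglongrightarrow> 0 + 0"
        by (intro tendsto_intros \<phi> \<phi>' ab)
      then show "(\<lambda>n. L2_norm (segment_measure a b) (\<lambda>x. \<phi> n x - w x) + L2_norm (segment_measure a b) (\<lambda>x. \<phi>' n x - w' x)) \<longlonglongrightarrow> 0" by simp
      have "L2_norm (segment_measure a b) (\<lambda>x. (\<phi> n x - \<phi>' n x) - (w x - w' x))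
          \<le> L2_norm (segment_measure a b) (\<lambda>x. \<phi> n x - w x) + L2_norm (segment_measure a b) (\<lambda>x. \<phi>' n x - w' x)" for n
      proof -
        have "in_L2 (segment_measure a b) (\<lambda>x. \<phi> n x - w x)" "in_L2 (segment_measure a b) (\<lambda>x. \<phi>' n x - w' x)"
          by (intro in_L2_diff w[OF ab] edge_in_L2(2) smooth_continuous_on \<phi> \<phi>')+
        from L2_norm_triangle_diff[OF this] show ?thesis by (simp add: algebra_simps)
      qed
      then show "\<forall>\<^sub>F n in sequentially. L2_norm (segment_measure a b) (\<lambda>x. (\<phi> n x - \<phi>' n x) - (w x - w' x))
          \<le> L2_norm (segment_measure a b) (\<lambda>x. \<phi> n x - w x) + L2_norm (segment_measure a b) (\<lambda>x. \<phi>' n x - w' x)" by simp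
    qed simp
  qed
qed

text \<open>The inhomogeneous boundary data cancel, which makes the velocity error an admissible
  test function.\<close>

lemma H1_E_diff:
  assumes "u \<in> H1_E \<Omega> \<Gamma> g" "u' \<in> H1_E \<Omega> \<Gamma> g"
  shows "(\<lambda>x. u x - u' x) \<in> H1_E0 \<Omega> \<Gamma>"
proof -
  have H: "u \<in> H1 \<Omega>" "u' \<in> H1 \<Omega>" using assms by (auto simp: H1_E_def)
  obtain w w' where w: "has_trace \<Omega> u w" "has_trace \<Omega> u' w'"
    and ae: "\<And>a b. closed_segment a b \<subseteq> frontier \<Omega> \<Longrightarrow> AE x in segment_measure a b. x \<in> \<Gamma> \<longrightarrow> w x = g x"
      "\<And>a b. closed_segment a b \<subseteq> frontier \<Omega> \<Longrightarrow> AE x in segment_measure a b. x \<in> \<Gamma> \<longrightarrow> w' x = g x"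
    using assms unfolding H1_E_def trace_eq_on_def by blast
  have "AE x in segment_measure a b. x \<in> \<Gamma> \<longrightarrow> w x - w' x = 0" if "closed_segment a b \<subseteq> frontier \<Omega>" for a b
    using ae[OF that] by eventually_elim simp
  then have "trace_eq_on \<Omega> \<Gamma> (\<lambda>x. u x - u' x) (\<lambda>x. 0)"
    unfolding trace_eq_on_def using has_trace_diff[OF H(1) w(1) H(2) w(2)] by blast
  then show ?thesis using H1_diff(1)[OF H] by (simp add: H1_E_def)
qed

end

section \<open>Stresses and elementwise integration by parts\<close>

lemma inner_matrix: "A \<bullet> B = (\<Sum>i\<in>UNIV. \<Sum>j\<in>UNIV. A $ i $ j * B $ i $ j)" for A B :: "real^2^2"
  by (simp add: inner_vec_def)

lemma sym_part_nth: "sym_part A $ i $ j = (A $ i $ j + A $ j $ i) / 2"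
  by (simp add: sym_part_def transpose_def)

text \<open>Symmetric and skew matrices are orthogonal. Thus the strain may be tested with the full
  gradient, as integration by parts requires.\<close>

lemma sym_part_inner: "sym_part A \<bullet> sym_part B = sym_part A \<bullet> B"
  by (simp add: inner_matrix sum_2 sym_part_nth field_simps)

lemma mat_inner: "mat p \<bullet> B = p * trace B" for B :: "real^2^2"
  by (simp add: inner_matrix sum_2 mat_def trace_def algebra_simps)

lemma linear_sym_part: "bounded_linear sym_part"
  unfolding linear_conv_bounded_linear[symmetric]
  by (rule linearI) (simp_all add: vec_eq_iff sym_part_nth field_simps)

lemma linear_mat: "bounded_linear (mat :: real \<Rightarrow> real^2^2)"
  unfolding linear_conv_bounded_linear[symmetric]
  by (rule linearI) (simp_all add: vec_eq_iff mat_def)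

lemma linear_trace: "bounded_linear (trace :: real^2^2 \<Rightarrow> real)"
  unfolding linear_conv_bounded_linear[symmetric]
  by (rule linearI) (simp_all add: trace_def sum.distrib sum_distrib_left)

text \<open>\<open>sym_part\<close> is the orthogonal projection onto the symmetric
  matrices.\<close>

lemma norm_sym_part_le: "norm (sym_part A) \<le> norm A"
proof -
  have "norm (sym_part A) * norm (sym_part A) = sym_part A \<bullet> A"
    using sym_part_inner[of A A] by (simp add: dot_square_norm power2_eq_square)
  also have "\<dots> \<le> norm (sym_part A) * norm A" by (rule norm_cauchy_schwarz)
  finally show ?thesis
    by (cases "norm (sym_part A) = 0") (simp_all add: mult_le_cancel_left)
qed

lemma smooth_jacobian:
  assumes "smooth (P :: vfield)" shows "smooth (\<lambda>x. jacobian P (at x))"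
proof -
  have "(\<lambda>x. jacobian P (at x)) = (\<lambda>x. \<Sum>i\<in>UNIV. \<Sum>j\<in>UNIV. (frechet_derivative P (at x) (axis j 1) $ i) *\<^sub>R axis i (axis j 1))"
  proof
    show "jacobian P (at x) = (\<Sum>i\<in>UNIV. \<Sum>j\<in>UNIV. (frechet_derivative P (at x) (axis j 1) $ i) *\<^sub>R axis i (axis j 1))" for x
      by (simp add: vec_eq_iff forall_2 sum_2 jacobian_nth axis_def)
  qed
  moreover have "smooth (\<lambda>x. frechet_derivative P (at x) (axis j 1) $ i)" for i j
    by (intro smooth_nth smooth_SucD assms) simp
  ultimately show ?thesis by (auto intro!: smooth_sum smooth_scaleR smooth_const)
qed

lemma frechet_derivative_linear_comp:
  assumes "bounded_linear l" "smooth S"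
  shows "frechet_derivative (\<lambda>x. l (S x)) (at x) h = l (frechet_derivative S (at x) h)"
  unfolding frechet_derivative_at[OF bounded_linear.has_derivative[OF assms(1) smooth_has_derivative[OF assms(2), of x]], symmetric] ..

lemma linear_nth2: "bounded_linear (\<lambda>A::real^2^2. A $ i $ j)"
  by (rule bounded_linear_compose[OF bounded_linear_vec_nth bounded_linear_vec_nth])

lemma frechet_derivative_local:
  assumes "open U" "x \<in> U" "\<And>y. y \<in> U \<Longrightarrow> f y = g y" "smooth g"
  shows "frechet_derivative f (at x) = frechet_derivative g (at x)"
proof -
  have "(f has_derivative frechet_derivative g (at x)) (at x)"
    by (rule has_derivative_transform_within_open[OF smooth_has_derivative[OF assms(4)] assms(1,2)]) (simp add: assms(3))
  then show ?thesis by (rule frechet_derivative_at[symmetric])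
qed

lemma cdiv_mat_nth: "cdiv_mat S x $ i = (\<Sum>j\<in>UNIV. frechet_derivative S (at x) (axis j 1) $ i $ j)"
  by (simp add: cdiv_mat_def)

lemma continuous_cdiv_mat:
  assumes "smooth S" shows "continuous_on A (cdiv_mat S)"
  unfolding cdiv_mat_def
  by (intro continuous_on_vec_lambda continuous_on_sum continuous_on_component frechet_derivative_continuous_on assms)

text \<open>The scalar formula is applied to each product of an entry \<open>S x $ i $ j\<close>
  with the component \<open>\<psi> x $ i\<close> in the coordinate direction \<open>j\<close>;
  summation gives the divergence theorem for the matrix field.\<close>

lemma (in rect) Green_matrix:
  fixes S :: mfield and \<psi> :: vfield
  assumes S: "smooth S" and \<psi>: "smooth \<psi>"
  defines "K \<equiv> rectangle a d e"
  shows "(\<integral>x. S x \<bullet> jacobian \<psi> (at x) \<partial>lebesgue_on K) + (\<integral>x. cdiv_mat S x \<bullet> \<psi> x \<partial>lebesgue_on K)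
    = (\<Sum>E | E edge_of K. \<integral>x. (S x *v outward_normal K E) \<bullet> \<psi> x \<partial>edge_measure E)"
proof -
  have sS: "smooth (\<lambda>x. S x $ i $ j)" for i j by (rule smooth_linear_comp[OF linear_nth2 S])
  have s\<psi>: "smooth (\<lambda>x. \<psi> x $ i)" for i by (rule smooth_nth[OF \<psi>])
  have sm: "smooth (\<lambda>x. S x $ i $ j * \<psi> x $ i)" for i j by (intro smooth_mult sS s\<psi>)
  have cK: "compact K" by (simp add: K_def compact_rectangle)
  have edge: "\<exists>p q. E = closed_segment p q" if "E edge_of K" for E
    using that edges unfolding K_def by blast
  have int: "integrable (lebesgue_on K) (\<lambda>x. S x \<bullet> jacobian \<psi> (at x))" "integrable (lebesgue_on K) (\<lambda>x. cdiv_mat S x \<bullet> \<psi> x)"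
    by (intro continuous_integrable_compact cK continuous_intros smooth_continuous_on S \<psi> continuous_on_jacobian continuous_cdiv_mat)+
  have "(\<integral>x. S x \<bullet> jacobian \<psi> (at x) \<partial>lebesgue_on K) + (\<integral>x. cdiv_mat S x \<bullet> \<psi> x \<partial>lebesgue_on K)
      = (\<integral>x. S x \<bullet> jacobian \<psi> (at x) + cdiv_mat S x \<bullet> \<psi> x \<partial>lebesgue_on K)"
    using int by simp
  also have "\<dots> = (\<integral>x. (\<Sum>i\<in>UNIV. \<Sum>j\<in>UNIV. frechet_derivative (\<lambda>x. S x $ i $ j * \<psi> x $ i) (at x) (axis j 1)) \<partial>lebesgue_on K)"
  proof (rule Bochner_Integration.integral_cong[OF refl])
    fix x
    show "S x \<bullet> jacobian \<psi> (at x) + cdiv_mat S x \<bullet> \<psi> x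
      = (\<Sum>i\<in>UNIV. \<Sum>j\<in>UNIV. frechet_derivative (\<lambda>x. S x $ i $ j * \<psi> x $ i) (at x) (axis j 1))"
      unfolding frechet_derivative_mult[OF sS s\<psi>] frechet_derivative_linear_comp[OF linear_nth2 S]
        frechet_derivative_nth[OF \<psi>] inner_matrix inner_R2 jacobian_nth cdiv_mat_nth
      by (simp add: sum_2 algebra_simps)
  qed
  also have "\<dots> = (\<Sum>i\<in>UNIV. \<Sum>j\<in>UNIV. \<integral>x. frechet_derivative (\<lambda>x. S x $ i $ j * \<psi> x $ i) (at x) (axis j 1) \<partial>lebesgue_on K)"
  proof -
    have "integrable (lebesgue_on K) (\<lambda>x. frechet_derivative (\<lambda>x. S x $ i $ j * \<psi> x $ i) (at x) (axis j 1))" for i j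
      by (intro continuous_integrable_compact cK frechet_derivative_continuous_on sm)
    then show ?thesis by (simp add: Bochner_Integration.integral_sum)
  qed
  also have "\<dots> = (\<Sum>i\<in>UNIV. \<Sum>j\<in>UNIV. \<Sum>E | E edge_of K. outward_normal K E $ j * (\<integral>x. S x $ i $ j * \<psi> x $ i \<partial>edge_measure E))"
    unfolding K_def Green[OF sm] by (simp add: inner_axis)
  also have "\<dots> = (\<Sum>E | E edge_of K. \<Sum>i\<in>UNIV. \<Sum>j\<in>UNIV. outward_normal K E $ j * (\<integral>x. S x $ i $ j * \<psi> x $ i \<partial>edge_measure E))"
    by (simp add: sum_2 sum.distrib)
  also have "\<dots> = (\<Sum>E | E edge_of K. \<integral>x. (S x *v outward_normal K E) \<bullet> \<psi> x \<partial>edge_measure E)"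
  proof (rule sum.cong[OF refl])
    fix E assume "E \<in> {E. E edge_of K}"
    then obtain p q where E: "E = closed_segment p q" using edge by blast
    have i: "integrable (edge_measure E) (\<lambda>x. S x $ i $ j * \<psi> x $ i)" for i j
      unfolding E by (intro edge_integrable smooth_continuous_on sm)
    have "(\<integral>x. (S x *v outward_normal K E) \<bullet> \<psi> x \<partial>edge_measure E)
      = (\<integral>x. (\<Sum>i\<in>UNIV. \<Sum>j\<in>UNIV. outward_normal K E $ j * (S x $ i $ j * \<psi> x $ i)) \<partial>edge_measure E)"
      by (intro Bochner_Integration.integral_cong) (simp_all add: inner_R2 matrix_vector_mult_def sum_2 algebra_simps)
    also have "\<dots> = (\<Sum>i\<in>UNIV. \<Sum>j\<in>UNIV. outward_normal K E $ j * (\<integral>x. S x $ i $ j * \<psi> x $ i \<partial>edge_measure E))"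
      using i by (simp add: Bochner_Integration.integral_sum)
    finally show "(\<Sum>i\<in>UNIV. \<Sum>j\<in>UNIV. outward_normal K E $ j * (\<integral>x. S x $ i $ j * \<psi> x $ i \<partial>edge_measure E))
      = (\<integral>x. (S x *v outward_normal K E) \<bullet> \<psi> x \<partial>edge_measure E)" by simp
  qed
  finally show ?thesis .
qed

text \<open>On each open element the function agrees with a smooth function on the whole plane.
  Green's formula and boundary values can then be taken from the extension, whatever the function
  does on the edges.\<close>

definition pw_smooth :: "R2 set set \<Rightarrow> (R2 \<Rightarrow> 'b::real_normed_vector) \<Rightarrow> bool" where
  "pw_smooth T v \<longleftrightarrow> (\<forall>K\<in>T. \<exists>P. smooth P \<and> (\<forall>x\<in>interior K. v x = P x))"

lemma pw_poly_smooth: "pw_poly T k v \<Longrightarrow> pw_smooth T v" for v :: "R2 \<Rightarrow> 'b::real_normed_vector"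
  unfolding pw_poly_def pw_smooth_def using smooth_poly2 by blast

lemma pw_smooth_add:
  assumes "pw_smooth T u" "pw_smooth T v"
  shows "pw_smooth T (\<lambda>x. u x + v x)"
  unfolding pw_smooth_def
proof
  fix K assume "K \<in> T"
  then obtain P Q where "smooth P" "smooth Q" "\<And>x. x \<in> interior K \<Longrightarrow> u x = P x" "\<And>x. x \<in> interior K \<Longrightarrow> v x = Q x"
    using assms unfolding pw_smooth_def by metis
  then show "\<exists>P. smooth P \<and> (\<forall>x\<in>interior K. u x + v x = P x)"
    by (intro exI[of _ "\<lambda>x. P x + Q x"]) (auto intro: smooth_add)
qed

text \<open>The limit from inside the element is the value of the continuous extension; the interior
  must accumulate at \<open>x\<close> for the limit to be determined.\<close>

lemma value_from_eq:
  fixes F G :: "R2 \<Rightarrow> 'b::t2_space"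
  assumes x: "x \<in> closure (interior K)" and eq: "\<And>y. y \<in> interior K \<Longrightarrow> F y = G y" and G: "continuous_on UNIV G"
  shows "value_from K F x = G x"
  unfolding value_from_def
proof (rule tendsto_Lim)
  have "x islimpt interior K"
    using x interior_limit_point[of x "interior K"] by (auto simp: closure_def)
  then show "at x within interior K \<noteq> bot" by (simp add: trivial_limit_within)
  have "(G \<longlongrightarrow> G x) (at x within interior K)"
    using G by (meson UNIV_I continuous_on_def subset_UNIV tendsto_within_subset)
  then show "(F \<longlongrightarrow> G x) (at x within interior K)"
    by (rule Lim_transform_eventually) (auto simp: eventually_at_filter eq)
qed

context mesh
begin

sublocale domain \<Omega>
  by unfold_locales (use open_\<Omega> bounded_\<Omega> in auto)

definition piece :: "(R2 \<Rightarrow> 'b::real_normed_vector) \<Rightarrow> R2 set \<Rightarrow> R2 \<Rightarrow> 'b" where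
  "piece v K = (SOME P. smooth P \<and> (\<forall>x\<in>interior K. v x = P x))"

lemma piece:
  assumes "pw_smooth T v" "K \<in> T"
  shows "smooth (piece v K)" "x \<in> interior K \<Longrightarrow> v x = piece v K x"
proof -
  have ex: "\<exists>P. smooth P \<and> (\<forall>x\<in>interior K. v x = P x)"
    using assms by (simp add: pw_smooth_def)
  have "smooth (piece v K) \<and> (\<forall>x\<in>interior K. v x = piece v K x)"
    unfolding piece_def by (rule someI_ex[OF ex])
  then show "smooth (piece v K)" "x \<in> interior K \<Longrightarrow> v x = piece v K x" by auto
qed

text \<open>The stress of the smooth extension of the discrete solution from one element. Its sign
  is opposite to that in \<open>normal_flux\<close>, so that its divergence enters the element
  residual with a plus.\<close>

definition stress :: "real \<Rightarrow> vfield \<Rightarrow> sfield \<Rightarrow> R2 set \<Rightarrow> mfield" where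
  "stress \<mu> uh ph K x = (2 * \<mu>) *\<^sub>R sym_part (jacobian (piece uh K) (at x)) - mat (piece ph K x)"

lemma smooth_stress:
  assumes "pw_smooth T uh" "pw_smooth T ph" "K \<in> T"
  shows "smooth (stress \<mu> uh ph K)"
proof -
  have "smooth (\<lambda>x. (2 * \<mu>) *\<^sub>R sym_part (jacobian (piece uh K) (at x)))"
    by (rule smooth_linear_comp[OF bounded_linear_scaleR_right smooth_linear_comp[OF linear_sym_part
      smooth_jacobian[OF piece(1)[OF assms(1,3)]]]])
  then show ?thesis
    unfolding stress_def[abs_def] by (intro smooth_diff smooth_linear_comp[OF linear_mat] piece(1)[OF assms(2,3)])
qed

lemma jacobian_piece:
  assumes "pw_smooth T uh" "K \<in> T" "x \<in> interior K"
  shows "jacobian uh (at x) = jacobian (piece uh K) (at x)"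
  unfolding jacobian_def
  by (subst frechet_derivative_local[OF open_interior assms(3) _ piece(1)[OF assms(1,2)]]) (use piece(2)[OF assms(1,2)] in auto)

text \<open>The divergence of \<open>mat\<close> applied to a scalar function is the gradient of
  that function, so the two derivative terms of the residual form one divergence.\<close>

lemma elem_residual_piece:
  assumes u: "pw_smooth T uh" and p: "pw_smooth T ph" and K: "K \<in> T" and x: "x \<in> interior K"
  shows "elem_residual \<mu> fh uh ph x = fh x + cdiv_mat (stress \<mu> uh ph K) x"
proof -
  define G where "G y = (2 * \<mu>) *\<^sub>R sym_part (jacobian (piece uh K) (at y))" for y
  have sG: "smooth G"
    unfolding G_def[abs_def] by (rule smooth_linear_comp[OF bounded_linear_scaleR_right smooth_linear_comp[OF linear_sym_part
      smooth_jacobian[OF piece(1)[OF u K]]]])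
  have sp: "smooth (piece ph K)" by (rule piece(1)[OF p K])
  have "frechet_derivative (\<lambda>y. (2 * \<mu>) *\<^sub>R cstrain uh y) (at x) = frechet_derivative G (at x)"
    by (rule frechet_derivative_local[OF open_interior x _ sG]) (simp add: G_def cstrain_def jacobian_piece[OF u K])
  then have 1: "cdiv_mat (\<lambda>y. (2 * \<mu>) *\<^sub>R cstrain uh y) x = cdiv_mat G x"
    by (simp add: cdiv_mat_def)
  have 2: "cgrad ph x = cgrad (piece ph K) x"
    unfolding cgrad_def by (subst frechet_derivative_local[OF open_interior x _ sp]) (use piece(2)[OF p K] in auto)
  have "frechet_derivative (stress \<mu> uh ph K) (at x) = (\<lambda>h. frechet_derivative G (at x) h - mat (frechet_derivative (piece ph K) (at x) h))"
  proof (rule frechet_derivative_at[symmetric])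
    have "stress \<mu> uh ph K = (\<lambda>x. G x - mat (piece ph K x))" by (auto simp: stress_def G_def)
    then show "(stress \<mu> uh ph K has_derivative (\<lambda>h. frechet_derivative G (at x) h - mat (frechet_derivative (piece ph K) (at x) h))) (at x)"
      using has_derivative_diff[OF smooth_has_derivative[OF sG, of x] bounded_linear.has_derivative[OF linear_mat smooth_has_derivative[OF sp, of x]]] by simp
  qed
  then have "cdiv_mat (stress \<mu> uh ph K) x = cdiv_mat G x - cgrad (piece ph K) x"
    by (simp add: vec_eq_iff forall_2 cdiv_mat_nth cgrad_def sum_2 mat_def)
  then show ?thesis by (simp add: elem_residual_def 1 2)
qed

lemma normal_flux_piece:
  assumes u: "pw_smooth T uh" and p: "pw_smooth T ph" and K: "K \<in> T" and x: "x \<in> K"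
  shows "normal_flux \<mu> uh ph K E x = - (stress \<mu> uh ph K x *v outward_normal K E)"
proof -
  have "value_from K (\<lambda>y. mat (ph y) - (2 * \<mu>) *\<^sub>R cstrain uh y) x = - stress \<mu> uh ph K x"
  proof (rule value_from_eq)
    show "x \<in> closure (interior K)" using closure_interior_K[OF K] x by simp
    show "mat (ph y) - (2 * \<mu>) *\<^sub>R cstrain uh y = - stress \<mu> uh ph K y" if "y \<in> interior K" for y
      using that piece(2)[OF p K that] by (simp add: stress_def cstrain_def jacobian_piece[OF u K])
    show "continuous_on UNIV (\<lambda>x. - stress \<mu> uh ph K x)"
      by (intro continuous_intros smooth_continuous_on smooth_stress u p K)
  qed
  then show ?thesis
    by (simp add: normal_flux_def vec_eq_iff matrix_vector_mult_def sum_negf)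
qed

definition all_edges :: "R2 set set" where "all_edges = (\<Union>K\<in>T. {E. E edge_of K})"

lemma finite_all_edges [simp]: "finite all_edges"
  by (simp add: all_edges_def finite_edges)

text \<open>Outward normals of the two adjacent elements are opposite, so the sum over an interior
  edge is a jump; a boundary edge contributes a single term. Up to a factor of 1/2, 1 or 0 this is
  minus the edge residual.\<close>

definition jump :: "real \<Rightarrow> vfield \<Rightarrow> sfield \<Rightarrow> R2 set \<Rightarrow> vfield" where
  "jump \<mu> uh ph E x = (\<Sum>K\<in>{K\<in>T. E edge_of K}. stress \<mu> uh ph K x *v outward_normal K E)"

lemma continuous_jump:
  assumes "pw_smooth T uh" "pw_smooth T ph"
  shows "continuous_on S (jump \<mu> uh ph E)"
  unfolding jump_def
proof (intro continuous_on_sum)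
  fix K assume "K \<in> {K \<in> T. E edge_of K}"
  then have "continuous_on S (stress \<mu> uh ph K)" by (intro smooth_continuous_on smooth_stress assms) auto
  then show "continuous_on S (\<lambda>x. stress \<mu> uh ph K x *v outward_normal K E)"
    unfolding matrix_vector_mult_def by (intro continuous_on_vec_lambda continuous_intros continuous_on_component) auto
qed

lemma edge_residual_jump:
  assumes u: "pw_smooth T uh" and p: "pw_smooth T ph" and x: "x \<in> E"
  shows "edge_residual \<Omega> \<Gamma>N T \<mu> uh ph E x =
    - (if \<not> E \<subseteq> frontier \<Omega> then 1/2 else if rel_interior E \<subseteq> \<Gamma>N then 1 else 0) *\<^sub>R jump \<mu> uh ph E x"
proof -
  have "(\<Sum>K\<in>{K\<in>T. E edge_of K}. normal_flux \<mu> uh ph K E x) = - jump \<mu> uh ph E x"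
    unfolding jump_def sum_negf[symmetric]
  proof (rule sum.cong[OF refl])
    fix K assume "K \<in> {K \<in> T. E edge_of K}"
    then have "K \<in> T" "x \<in> K" using x face_of_imp_subset by (auto simp: edge_of_def)
    then show "normal_flux \<mu> uh ph K E x = - (stress \<mu> uh ph K x *v outward_normal K E)"
      by (rule normal_flux_piece[OF u p])
  qed
  then show ?thesis by (simp add: edge_residual_def)
qed

end

section \<open>Estimate of the residual\<close>

definition residual :: "R2 set \<Rightarrow> real \<Rightarrow> vfield \<Rightarrow> vfield \<Rightarrow> sfield \<Rightarrow> vfield \<Rightarrow> real" where
  "residual \<Omega> \<mu> f uh ph v = load \<Omega> f v - form_a \<Omega> \<mu> uh v - form_b \<Omega> v ph"

context domain
begin

text \<open>The global counterpart of \<open>stress\<close>, formed with the weak gradient; the two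
  agree almost everywhere on each element.\<close>

definition wstress :: "real \<Rightarrow> vfield \<Rightarrow> sfield \<Rightarrow> mfield" where
  "wstress \<mu> uh ph x = (2 * \<mu>) *\<^sub>R sym_part (wgrad \<Omega> uh x) - mat (ph x)"

context
  fixes f uh :: vfield and ph :: sfield and \<mu> :: real
  assumes f: "in_L2 L f" and uh: "uh \<in> H1 \<Omega>" and ph: "in_L2 L ph"
begin

lemma wstress_L2: "in_L2 L (wstress \<mu> uh ph)"
  unfolding wstress_def[abs_def]
  by (intro in_L2_diff in_L2_scaleR in_L2_linear[OF linear_sym_part] in_L2_linear[OF linear_mat] wgrad_L2 uh ph)

text \<open>\<open>sym_part_inner\<close> and \<open>mat_inner\<close> merge the two bilinear forms
  into one integral of the stress against the gradient of the test function.\<close>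

lemma residual_eq:
  assumes v: "v \<in> H1 \<Omega>"
  shows "residual \<Omega> \<mu> f uh ph v = (\<integral>x. f x \<bullet> v x \<partial>L) - (\<integral>x. wstress \<mu> uh ph x \<bullet> wgrad \<Omega> v x \<partial>L)"
proof -
  have i: "integrable L (\<lambda>x. sym_part (wgrad \<Omega> uh x) \<bullet> wgrad \<Omega> v x)" "integrable L (\<lambda>x. ph x * trace (wgrad \<Omega> v x))"
    by (intro in_L2_inner_integrable in_L2_mult_integrable in_L2_linear[OF linear_sym_part] in_L2_linear[OF linear_trace]
        wgrad_L2 uh v ph)+
  have "(\<integral>x. wstress \<mu> uh ph x \<bullet> wgrad \<Omega> v x \<partial>L)
      = (\<integral>x. (2 * \<mu>) * (sym_part (wgrad \<Omega> uh x) \<bullet> wgrad \<Omega> v x) - ph x * trace (wgrad \<Omega> v x) \<partial>L)"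
    by (simp add: wstress_def inner_diff_left mat_inner)
  also have "\<dots> = form_a \<Omega> \<mu> uh v + form_b \<Omega> v ph"
    using i by (simp add: form_a_def form_b_def strain_def wdiv_def sym_part_inner)
  finally show ?thesis by (simp add: residual_def load_def)
qed

lemma residual_diff:
  assumes v: "v \<in> H1 \<Omega>" and w: "w \<in> H1 \<Omega>"
  shows "residual \<Omega> \<mu> f uh ph (\<lambda>x. v x - w x) = residual \<Omega> \<mu> f uh ph v - residual \<Omega> \<mu> f uh ph w"
proof -
  note d = H1_diff[OF v w]
  have i: "integrable L (\<lambda>x. wstress \<mu> uh ph x \<bullet> wgrad \<Omega> z x)" "integrable L (\<lambda>x. f x \<bullet> z x)" if "z \<in> H1 \<Omega>" for z
    by (intro in_L2_inner_integrable wstress_L2 wgrad_L2 H1_L2 f that)+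
  have "(\<integral>x. wstress \<mu> uh ph x \<bullet> wgrad \<Omega> (\<lambda>x. v x - w x) x \<partial>L)
      = (\<integral>x. wstress \<mu> uh ph x \<bullet> wgrad \<Omega> v x - wstress \<mu> uh ph x \<bullet> wgrad \<Omega> w x \<partial>L)"
  proof (rule integral_cong_AE)
    show "AE x in L. wstress \<mu> uh ph x \<bullet> wgrad \<Omega> (\<lambda>x. v x - w x) x = wstress \<mu> uh ph x \<bullet> wgrad \<Omega> v x - wstress \<mu> uh ph x \<bullet> wgrad \<Omega> w x"
      using d(2) by eventually_elim (simp add: inner_diff_right)
  qed (use i[OF d(1)] i[OF v] i[OF w] in \<open>auto intro: borel_measurable_integrable borel_measurable_diff\<close>)
  then show ?thesis
    using i[OF v] i[OF w] by (simp add: residual_eq v w d(1) inner_diff_right)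
qed

text \<open>A continuity bound whose factor depends on the discrete solution and the coefficients.
  It only serves to pass to the limit and leaves no trace in the final constant.\<close>

lemma residual_bound:
  assumes v: "v \<in> H1 \<Omega>"
  shows "\<bar>residual \<Omega> \<mu> f uh ph v\<bar> \<le> (L2_norm L f + L2_norm L (wstress \<mu> uh ph)) * H1_norm \<Omega> v"
proof -
  have "\<bar>residual \<Omega> \<mu> f uh ph v\<bar> \<le> \<bar>\<integral>x. f x \<bullet> v x \<partial>L\<bar> + \<bar>\<integral>x. wstress \<mu> uh ph x \<bullet> wgrad \<Omega> v x \<partial>L\<bar>"
    unfolding residual_eq[OF v] by (rule abs_triangle_ineq4)
  also have "\<dots> \<le> L2_norm L f * L2_norm L v + L2_norm L (wstress \<mu> uh ph) * L2_norm L (wgrad \<Omega> v)"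
    by (intro add_mono L2_Cauchy_Schwarz f H1_L2 v wstress_L2 wgrad_L2)
  also have "\<dots> \<le> L2_norm L f * H1_norm \<Omega> v + L2_norm L (wstress \<mu> uh ph) * H1_norm \<Omega> v"
    by (intro add_mono mult_left_mono L2_le_H1_norm) auto
  finally show ?thesis by (simp add: distrib_right)
qed

end

end

lemma mult_sum_le_sqrt:
  fixes b s :: "'a \<Rightarrow> real"
  shows "(\<Sum>i\<in>I. b i * s i) \<le> sqrt (\<Sum>i\<in>I. (b i)\<^sup>2) * sqrt (\<Sum>i\<in>I. (s i)\<^sup>2)"
proof -
  have "(\<Sum>i\<in>I. b i * s i)\<^sup>2 \<le> (\<Sum>i\<in>I. (b i)\<^sup>2) * (\<Sum>i\<in>I. (s i)\<^sup>2)"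
    by (rule Cauchy_Schwarz_ineq_sum)
  then show ?thesis
    unfolding real_sqrt_mult[symmetric] by (rule real_le_rsqrt)
qed

context mesh
begin

lemma card_edges:
  assumes "K \<in> T" shows "card {E. E edge_of K} \<le> 4"
proof -
  interpret rect "pa K" "pd K" "pe K" by (rule param(1)[OF assms])
  have "{E. E edge_of K} = {closed_segment (pa K) (pa K + pd K), closed_segment (pa K + pe K) (pa K + pe K + pd K),
     closed_segment (pa K) (pa K + pe K), closed_segment (pa K + pd K) (pa K + pd K + pe K)}"
    using edges param(2)[OF assms] by auto
  then show ?thesis by (simp add: card_insert_if)
qed

context
  fixes f uh fh :: vfield and ph :: sfield and \<mu> :: real
  assumes f: "in_L2 L f" and uh: "uh \<in> H1 \<Omega>" and ph: "in_L2 L ph"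
    and uhp: "pw_smooth T uh" and php: "pw_smooth T ph"
begin

text \<open>On an open element both the stress and the gradient of \<open>z\<close> are known
  classically up to null sets, so Green's formula applies there; the element boundaries are null for
  the area integrals.\<close>

lemma residual_pieces:
  assumes z: "z \<in> H1 \<Omega>" and \<psi>: "\<And>K. K \<in> T \<Longrightarrow> smooth (\<psi> K)"
    and ae: "\<And>K. K \<in> T \<Longrightarrow> AE x in lebesgue_on (interior K). z x = \<psi> K x"
  shows "residual \<Omega> \<mu> f uh ph z =
    (\<Sum>K\<in>T. \<integral>x. (f x + cdiv_mat (stress \<mu> uh ph K) x) \<bullet> \<psi> K x \<partial>lebesgue_on (interior K))
    - (\<Sum>K\<in>T. \<Sum>E | E edge_of K. \<integral>x. (stress \<mu> uh ph K x *v outward_normal K E) \<bullet> \<psi> K x \<partial>edge_measure E)"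
proof -
  let ?W = "wstress \<mu> uh ph"
  note W = wstress_L2[OF f uh ph, of \<mu>]
  have i: "integrable L (\<lambda>x. f x \<bullet> z x)" "integrable L (\<lambda>x. ?W x \<bullet> wgrad \<Omega> z x)"
    by (intro in_L2_inner_integrable f W wgrad_L2 H1_L2 z)+
  have K: "(\<integral>x. f x \<bullet> z x - ?W x \<bullet> wgrad \<Omega> z x \<partial>lebesgue_on (interior K))
    = (\<integral>x. (f x + cdiv_mat (stress \<mu> uh ph K) x) \<bullet> \<psi> K x \<partial>lebesgue_on (interior K))
      - (\<Sum>E | E edge_of K. \<integral>x. (stress \<mu> uh ph K x *v outward_normal K E) \<bullet> \<psi> K x \<partial>edge_measure E)"
    if K: "K \<in> T" for K
  proof -
    let ?I = "interior K" and ?S = "stress \<mu> uh ph K"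
    interpret rect "pa K" "pd K" "pe K" by (rule param(1)[OF K])
    have I: "open ?I" "?I \<subseteq> \<Omega>" "?I \<in> sets lebesgue" "bounded ?I"
      using interior_subset_\<Omega>[OF K] bounded_subset[OF bounded_\<Omega>] by auto
    have sS: "smooth ?S" by (rule smooth_stress[OF uhp php K])
    have fI: "in_L2 (lebesgue_on ?I) f" "in_L2 (lebesgue_on ?I) z" "in_L2 (lebesgue_on ?I) ?W" "in_L2 (lebesgue_on ?I) (wgrad \<Omega> z)"
      by (intro in_L2_subset[OF _ I(2,3) sets_\<Omega>] f W wgrad_L2 H1_L2 z)+
    have sI: "in_L2 (lebesgue_on ?I) (\<psi> K)" "in_L2 (lebesgue_on ?I) ?S" "in_L2 (lebesgue_on ?I) (cdiv_mat ?S)"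
      "in_L2 (lebesgue_on ?I) (\<lambda>x. jacobian (\<psi> K) (at x))"
      by (intro continuous_in_L2_bounded smooth_continuous_on continuous_cdiv_mat continuous_on_jacobian sS \<psi>[OF K] I)+
    have g: "AE x in lebesgue_on ?I. wgrad \<Omega> z x = jacobian (\<psi> K) (at x)"
      by (rule wgrad_local[OF z I(1,2) \<psi>[OF K] ae[OF K]])
    have "AE x in lebesgue_on ?I. wgrad \<Omega> uh x = jacobian (piece uh K) (at x)"
      by (rule wgrad_local[OF uh I(1,2) piece(1)[OF uhp K]]) (auto intro!: AE_I2 piece(2)[OF uhp K])
    then have W': "AE x in lebesgue_on ?I. ?W x = ?S x"
    proof (rule lebesgue_on_mono)
      fix x assume "wgrad \<Omega> uh x = jacobian (piece uh K) (at x)" "x \<in> ?I"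
      then show "?W x = ?S x" using piece(2)[OF php K] by (simp add: wstress_def stress_def)
    qed
    have j: "integrable (lebesgue_on ?I) (\<lambda>x. f x \<bullet> \<psi> K x)" "integrable (lebesgue_on ?I) (\<lambda>x. ?S x \<bullet> jacobian (\<psi> K) (at x))"
      "integrable (lebesgue_on ?I) (\<lambda>x. cdiv_mat ?S x \<bullet> \<psi> K x)"
      by (intro in_L2_inner_integrable fI sI)+
    have "(\<integral>x. f x \<bullet> z x - ?W x \<bullet> wgrad \<Omega> z x \<partial>lebesgue_on ?I)
        = (\<integral>x. f x \<bullet> \<psi> K x - ?S x \<bullet> jacobian (\<psi> K) (at x) \<partial>lebesgue_on ?I)"
    proof (rule integral_cong_AE)
      show "(\<lambda>x. f x \<bullet> z x - ?W x \<bullet> wgrad \<Omega> z x) \<in> borel_measurable (lebesgue_on ?I)"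
        by (intro borel_measurable_diff borel_measurable_integrable in_L2_inner_integrable fI)
      show "(\<lambda>x. f x \<bullet> \<psi> K x - ?S x \<bullet> jacobian (\<psi> K) (at x)) \<in> borel_measurable (lebesgue_on ?I)"
        by (intro borel_measurable_diff borel_measurable_integrable j)
      show "AE x in lebesgue_on ?I. f x \<bullet> z x - ?W x \<bullet> wgrad \<Omega> z x = f x \<bullet> \<psi> K x - ?S x \<bullet> jacobian (\<psi> K) (at x)"
        using g W' ae[OF K] by eventually_elim simp
    qed
    also have "\<dots> = (\<integral>x. (f x + cdiv_mat ?S x) \<bullet> \<psi> K x \<partial>lebesgue_on ?I)
        - ((\<integral>x. ?S x \<bullet> jacobian (\<psi> K) (at x) \<partial>lebesgue_on ?I) + (\<integral>x. cdiv_mat ?S x \<bullet> \<psi> K x \<partial>lebesgue_on ?I))"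
      using j by (simp add: inner_add_left)
    also have "(\<integral>x. ?S x \<bullet> jacobian (\<psi> K) (at x) \<partial>lebesgue_on ?I) + (\<integral>x. cdiv_mat ?S x \<bullet> \<psi> K x \<partial>lebesgue_on ?I)
        = (\<integral>x. ?S x \<bullet> jacobian (\<psi> K) (at x) \<partial>lebesgue_on K) + (\<integral>x. cdiv_mat ?S x \<bullet> \<psi> K x \<partial>lebesgue_on K)"
    proof -
      have "negligible ((?I - K) \<union> (K - ?I))"
        by (rule negligible_subset[OF negligible_frontier_K[OF K]])
          (use interior_subset[of K] closure_subset[of K] in \<open>auto simp: frontier_def\<close>)
      then have "(\<integral>x. F x \<partial>lebesgue_on ?I) = (\<integral>x. F x \<partial>lebesgue_on K)" for F :: sfield
        by (intro integral_lebesgue_on_AE_eq I(3) lebesgue_K[OF K])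
      then show ?thesis by simp
    qed
    also have "\<dots> = (\<Sum>E | E edge_of K. \<integral>x. (?S x *v outward_normal K E) \<bullet> \<psi> K x \<partial>edge_measure E)"
      using Green_matrix[OF sS \<psi>[OF K]] param(2)[OF K] by simp
    finally show ?thesis .
  qed
  have "residual \<Omega> \<mu> f uh ph z = (\<integral>x. f x \<bullet> z x - ?W x \<bullet> wgrad \<Omega> z x \<partial>L)"
    unfolding residual_eq[OF f uh ph z] using i by simp
  also have "\<dots> = (\<Sum>K\<in>T. \<integral>x. f x \<bullet> z x - ?W x \<bullet> wgrad \<Omega> z x \<partial>lebesgue_on (interior K))"
    by (rule integral_\<Omega>) (use i in auto)
  also have "\<dots> = (\<Sum>K\<in>T. (\<integral>x. (f x + cdiv_mat (stress \<mu> uh ph K) x) \<bullet> \<psi> K x \<partial>lebesgue_on (interior K))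
      - (\<Sum>E | E edge_of K. \<integral>x. (stress \<mu> uh ph K x *v outward_normal K E) \<bullet> \<psi> K x \<partial>edge_measure E))"
    by (rule sum.cong[OF refl K])
  finally show ?thesis by (simp add: sum_subtractf)
qed

text \<open>Summation is regrouped from elements to edges. The test function is single valued on an
  edge by \<open>same\<close>, so it can be evaluated through the representative element
  \<open>KE E\<close> and the fluxes add up to the jump.\<close>

lemma edge_sum_jump:
  assumes \<psi>: "\<And>K. K \<in> T \<Longrightarrow> continuous_on UNIV (\<psi> K)"
    and same: "\<And>K K' x. K \<in> T \<Longrightarrow> K' \<in> T \<Longrightarrow> x \<in> K \<Longrightarrow> x \<in> K' \<Longrightarrow> \<psi> K x = \<psi> K' x"
    and KE: "\<And>E. E \<in> all_edges \<Longrightarrow> KE E \<in> T \<and> E edge_of KE E"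
  shows "(\<Sum>K\<in>T. \<Sum>E | E edge_of K. \<integral>x. (stress \<mu> uh ph K x *v outward_normal K E) \<bullet> \<psi> K x \<partial>edge_measure E)
    = (\<Sum>E\<in>all_edges. \<integral>x. jump \<mu> uh ph E x \<bullet> \<psi> (KE E) x \<partial>edge_measure E)"
proof -
  let ?x = "\<lambda>K E. \<integral>x. (stress \<mu> uh ph K x *v outward_normal K E) \<bullet> \<psi> K x \<partial>edge_measure E"
  have "(\<Sum>K\<in>T. \<Sum>E | E edge_of K. ?x K E) = (\<Sum>K\<in>T. \<Sum>E\<in>{E \<in> all_edges. E edge_of K}. ?x K E)"
    by (intro sum.cong) (auto simp: all_edges_def)
  also have "\<dots> = (\<Sum>E\<in>all_edges. \<Sum>K\<in>{K \<in> T. E edge_of K}. ?x K E)"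
    by (rule sum.swap_restrict) auto
  also have "\<dots> = (\<Sum>E\<in>all_edges. \<integral>x. jump \<mu> uh ph E x \<bullet> \<psi> (KE E) x \<partial>edge_measure E)"
  proof (rule sum.cong[OF refl])
    fix E assume E: "E \<in> all_edges"
    note KE = KE[OF E]
    obtain p q where pq: "E = closed_segment p q" using edge_segment KE by metis
    have cont: "continuous_on UNIV (\<lambda>x. (stress \<mu> uh ph K x *v outward_normal K E) \<bullet> \<psi> (KE E) x)" if K: "K \<in> T" for K
      unfolding matrix_vector_mult_def
      by (intro continuous_on_inner continuous_on_vec_lambda continuous_on_sum continuous_on_mult continuous_on_component
          continuous_on_const smooth_continuous_on smooth_stress[OF uhp php K] \<psi>) (use KE in auto)
    have "?x K E = (\<integral>x. (stress \<mu> uh ph K x *v outward_normal K E) \<bullet> \<psi> (KE E) x \<partial>edge_measure E)"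
      if K: "K \<in> {K \<in> T. E edge_of K}" for K
    proof (rule Bochner_Integration.integral_cong[OF refl])
      fix x assume "x \<in> space (edge_measure E)"
      then have "x \<in> E" by (simp add: pq)
      then have "x \<in> K" "x \<in> KE E" using K KE face_of_imp_subset by (auto simp: edge_of_def)
      then have "\<psi> K x = \<psi> (KE E) x" using same K KE by auto
      then show "(stress \<mu> uh ph K x *v outward_normal K E) \<bullet> \<psi> K x = (stress \<mu> uh ph K x *v outward_normal K E) \<bullet> \<psi> (KE E) x" by simp
    qed
    then have "(\<Sum>K\<in>{K \<in> T. E edge_of K}. ?x K E)
        = (\<Sum>K\<in>{K \<in> T. E edge_of K}. \<integral>x. (stress \<mu> uh ph K x *v outward_normal K E) \<bullet> \<psi> (KE E) x \<partial>edge_measure E)"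
      by (rule sum.cong[OF refl])
    also have "\<dots> = (\<integral>x. (\<Sum>K\<in>{K \<in> T. E edge_of K}. (stress \<mu> uh ph K x *v outward_normal K E) \<bullet> \<psi> (KE E) x) \<partial>edge_measure E)"
      by (rule Bochner_Integration.integral_sum[symmetric]) (unfold pq, rule edge_integrable, use cont pq in auto)
    finally show "(\<Sum>K\<in>{K \<in> T. E edge_of K}. ?x K E) = (\<integral>x. jump \<mu> uh ph E x \<bullet> \<psi> (KE E) x \<partial>edge_measure E)"
      by (simp add: jump_def inner_sum_left)
  qed
  finally show ?thesis .
qed

end

end

context mesh
begin

lemma edge_in_frontier:
  assumes "E \<in> all_edges" "E \<subseteq> frontier \<Omega>" shows "E \<in> boundary_edges \<Omega> T"
  using assms by (auto simp: boundary_edges_def all_edges_def)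

lemma boundary_edges_subset: "boundary_edges \<Omega> T \<subseteq> all_edges"
  by (auto simp: boundary_edges_def all_edges_def)

section \<open>Reliability of the estimator for the residuals of a fixed discrete solution\<close>

context
  fixes f uh fh :: vfield and ph :: sfield and \<mu> lam \<kappa> :: real and \<Gamma>D \<Gamma>N :: "R2 set" and X0 :: "vfield set"
  assumes f: "in_L2 L f" and uh: "uh \<in> H1 \<Omega>" and ph: "in_L2 L ph"
    and uhp: "pw_smooth T uh" and php: "pw_smooth T ph" and fhp: "pw_smooth T fh"
    and \<mu>: "0 < \<mu>" and lam: "0 < lam"
    and sh: "shape_regular \<kappa> T" and fit: "boundary_fitted \<Omega> \<Gamma>D \<Gamma>N T"
    and X0: "X0 \<subseteq> H1 \<Omega>"
    and X0_interp: "\<forall>w. continuous_on (closure \<Omega>) w \<and> (\<forall>K\<in>T. bilinear_on_rectangle K w) \<and> (\<forall>x\<in>\<Gamma>D. w x = 0) \<longrightarrow>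
      (\<exists>v\<in>X0. AE x in L. v x = w x)"
    and X0_orth: "\<forall>v\<in>X0. residual \<Omega> \<mu> f uh ph v = 0"
begin

definition dirichlet_edges :: "R2 set set" where
  "dirichlet_edges = {E \<in> boundary_edges \<Omega> T. rel_interior E \<subseteq> \<Gamma>D}"

definition elem_ind :: "R2 set \<Rightarrow> real" where
  "elem_ind K = rho_K \<mu> K * L2_norm (lebesgue_on K) (elem_residual \<mu> fh uh ph)"

definition osc_ind :: "R2 set \<Rightarrow> real" where
  "osc_ind K = rho_K \<mu> K * L2_norm (lebesgue_on K) (\<lambda>x. f x - fh x)"

definition edge_ind :: "R2 set \<Rightarrow> real" where
  "edge_ind E = sqrt (rho_E \<mu> E) * L2_norm (edge_measure E) (edge_residual \<Omega> \<Gamma>N T \<mu> uh ph E)"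

lemma diameter_nonneg: "K \<in> T \<Longrightarrow> 0 \<le> diameter K"
  using compact_K compact_imp_bounded diameter_ge_0 by blast

text \<open>Cauchy-Schwarz together with
  \<open>diameter K = 2 * sqrt (2 * \<mu>) * rho_K \<mu> K\<close>: the mesh size from the
  interpolation error is exchanged for the weight of the estimator.\<close>

lemma element_term:
  assumes K: "K \<in> T" and \<psi>: "smooth \<psi>" and W: "(L2_norm (lebesgue_on K) \<psi>)\<^sup>2 \<le> (diameter K)\<^sup>2 * W" "0 \<le> W"
  shows "\<bar>\<integral>x. (f x + cdiv_mat (stress \<mu> uh ph K) x) \<bullet> \<psi> x \<partial>lebesgue_on (interior K)\<bar>
    \<le> 2 * sqrt (2 * \<mu>) * ((elem_ind K + osc_ind K) * sqrt W)"
proof -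
  let ?I = "interior K" and ?S = "stress \<mu> uh ph K"
  have I: "?I \<subseteq> \<Omega>" "?I \<in> sets lebesgue" "bounded ?I"
    using interior_subset_\<Omega>[OF K] bounded_subset[OF bounded_\<Omega>] by auto
  have sS: "smooth ?S" by (rule smooth_stress[OF uhp php K])
  have l: "in_L2 (lebesgue_on ?I) f" "in_L2 (lebesgue_on ?I) (cdiv_mat ?S)" "in_L2 (lebesgue_on ?I) \<psi>" "in_L2 (lebesgue_on ?I) (piece fh K)"
    by (intro in_L2_subset[OF f I(1,2) sets_\<Omega>] continuous_in_L2_bounded continuous_cdiv_mat smooth_continuous_on sS \<psi> I piece(1)[OF fhp K])+
  have "\<bar>\<integral>x. (f x + cdiv_mat ?S x) \<bullet> \<psi> x \<partial>lebesgue_on ?I\<bar>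
      \<le> L2_norm (lebesgue_on ?I) (\<lambda>x. f x + cdiv_mat ?S x) * L2_norm (lebesgue_on ?I) \<psi>"
    by (intro L2_Cauchy_Schwarz in_L2_add l)
  also have "L2_norm (lebesgue_on ?I) \<psi> = L2_norm (lebesgue_on K) \<psi>"
    by (rule L2_norm_interior[symmetric, OF convex_K[OF K] lebesgue_K[OF K]])
  also have "L2_norm (lebesgue_on ?I) (\<lambda>x. f x + cdiv_mat ?S x)
      = L2_norm (lebesgue_on ?I) (\<lambda>x. (piece fh K x + cdiv_mat ?S x) + (f x - piece fh K x))"
    by (rule L2_norm_cong) (simp add: add.commute)
  also have "\<dots> \<le> L2_norm (lebesgue_on ?I) (\<lambda>x. piece fh K x + cdiv_mat ?S x) + L2_norm (lebesgue_on ?I) (\<lambda>x. f x - piece fh K x)"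
    by (intro L2_norm_triangle in_L2_add in_L2_diff l)
  also have "L2_norm (lebesgue_on ?I) (\<lambda>x. piece fh K x + cdiv_mat ?S x) = L2_norm (lebesgue_on ?I) (elem_residual \<mu> fh uh ph)"
    by (rule L2_norm_cong) (simp add: elem_residual_piece[OF uhp php K] piece(2)[OF fhp K])
  also have "L2_norm (lebesgue_on ?I) (\<lambda>x. f x - piece fh K x) = L2_norm (lebesgue_on ?I) (\<lambda>x. f x - fh x)"
    by (rule L2_norm_cong) (simp add: piece(2)[OF fhp K])
  also have "L2_norm (lebesgue_on ?I) (elem_residual \<mu> fh uh ph) = L2_norm (lebesgue_on K) (elem_residual \<mu> fh uh ph)"
    by (rule L2_norm_interior[symmetric, OF convex_K[OF K] lebesgue_K[OF K]])
  also have "L2_norm (lebesgue_on ?I) (\<lambda>x. f x - fh x) = L2_norm (lebesgue_on K) (\<lambda>x. f x - fh x)"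
    by (rule L2_norm_interior[symmetric, OF convex_K[OF K] lebesgue_K[OF K]])
  finally have 1: "\<bar>\<integral>x. (f x + cdiv_mat ?S x) \<bullet> \<psi> x \<partial>lebesgue_on ?I\<bar>
      \<le> (L2_norm (lebesgue_on K) (elem_residual \<mu> fh uh ph) + L2_norm (lebesgue_on K) (\<lambda>x. f x - fh x)) * L2_norm (lebesgue_on K) \<psi>"
    by (simp add: mult_right_mono)
  have "L2_norm (lebesgue_on K) \<psi> \<le> sqrt ((diameter K)\<^sup>2 * W)"
    using W(1) by (rule real_le_rsqrt)
  also have "\<dots> = diameter K * sqrt W"
    using diameter_nonneg[OF K] by (simp add: real_sqrt_mult)
  finally have 2: "L2_norm (lebesgue_on K) \<psi> \<le> diameter K * sqrt W" .
  have d: "diameter K = 2 * sqrt (2 * \<mu>) * rho_K \<mu> K"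
    using \<mu> by (simp add: rho_K_def)
  note 1
  also have "(L2_norm (lebesgue_on K) (elem_residual \<mu> fh uh ph) + L2_norm (lebesgue_on K) (\<lambda>x. f x - fh x)) * L2_norm (lebesgue_on K) \<psi>
      \<le> (L2_norm (lebesgue_on K) (elem_residual \<mu> fh uh ph) + L2_norm (lebesgue_on K) (\<lambda>x. f x - fh x)) * (diameter K * sqrt W)"
    by (intro mult_left_mono 2) simp
  also have "\<dots> = 2 * sqrt (2 * \<mu>) * ((elem_ind K + osc_ind K) * sqrt W)"
    unfolding d elem_ind_def osc_ind_def by (simp add: algebra_simps)
  finally show ?thesis .
qed

text \<open>One factor 2 arises from exchanging the root of the edge length for the root of
  \<open>rho_E\<close>, the other because the edge residual may carry only half of the jump.\<close>

lemma edge_term: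
  assumes E: "E \<in> all_edges" "E \<notin> dirichlet_edges" and \<psi>: "smooth \<psi>"
    and W: "(L2_norm (edge_measure E) \<psi>)\<^sup>2 \<le> diameter E * W" "0 \<le> W"
  shows "\<bar>\<integral>x. jump \<mu> uh ph E x \<bullet> \<psi> x \<partial>edge_measure E\<bar> \<le> 4 * sqrt (2 * \<mu>) * (edge_ind E * sqrt W)"
proof -
  obtain K where K: "K \<in> T" "E edge_of K" using E by (auto simp: all_edges_def)
  obtain p q where pq: "E = closed_segment p q" using edge_segment[OF K] by metis
  define c :: real where "c = (if \<not> E \<subseteq> frontier \<Omega> then 1/2 else if rel_interior E \<subseteq> \<Gamma>N then 1 else 0)"
  \<comment> \<open>The weight 0 occurs for boundary edges outside \<Gamma>N, and since the mesh
    fits the boundary these are Dirichlet edges.\<close>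
  have c: "1/2 \<le> c"
  proof (cases "E \<subseteq> frontier \<Omega>")
    case True
    then have "E \<in> boundary_edges \<Omega> T" using E(1) by (rule edge_in_frontier[rotated])
    then have "rel_interior E \<subseteq> \<Gamma>N" using E(2) fit by (auto simp: dirichlet_edges_def boundary_fitted_def)
    then show ?thesis by (simp add: c_def)
  qed (simp add: c_def)
  have cj: "continuous_on UNIV (jump \<mu> uh ph E)" by (rule continuous_jump[OF uhp php])
  have "L2_norm (edge_measure E) (edge_residual \<Omega> \<Gamma>N T \<mu> uh ph E) = L2_norm (edge_measure E) (\<lambda>x. (- c) *\<^sub>R jump \<mu> uh ph E x)"
    by (rule L2_norm_cong) (simp add: pq edge_residual_jump[OF uhp php] c_def)
  also have "\<dots> = c * L2_norm (edge_measure E) (jump \<mu> uh ph E)"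
    unfolding L2_norm_scaleR using c by simp
  finally have R: "L2_norm (edge_measure E) (edge_residual \<Omega> \<Gamma>N T \<mu> uh ph E) = c * L2_norm (edge_measure E) (jump \<mu> uh ph E)" .
  have "1/2 * L2_norm (edge_measure E) (jump \<mu> uh ph E) \<le> c * L2_norm (edge_measure E) (jump \<mu> uh ph E)"
    using c by (rule mult_right_mono) simp
  then have J: "L2_norm (edge_measure E) (jump \<mu> uh ph E) \<le> 2 * L2_norm (edge_measure E) (edge_residual \<Omega> \<Gamma>N T \<mu> uh ph E)"
    unfolding R by simp
  have dE: "0 \<le> diameter E"
    unfolding pq by (intro diameter_ge_0 compact_imp_bounded compact_segment)
  have "sqrt (diameter E) \<le> sqrt ((2 * sqrt (2 * \<mu>))\<^sup>2 * rho_E \<mu> E)"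
    using \<mu> dE by (simp add: rho_E_def power_mult_distrib)
  also have "\<dots> = 2 * sqrt (2 * \<mu>) * sqrt (rho_E \<mu> E)"
    using \<mu> by (simp add: real_sqrt_mult)
  finally have d: "sqrt (diameter E) \<le> 2 * sqrt (2 * \<mu>) * sqrt (rho_E \<mu> E)" .
  have "L2_norm (edge_measure E) \<psi> \<le> sqrt (diameter E * W)"
    using W(1) by (rule real_le_rsqrt)
  also have "\<dots> = sqrt (diameter E) * sqrt W" by (rule real_sqrt_mult)
  also have "\<dots> \<le> 2 * sqrt (2 * \<mu>) * sqrt (rho_E \<mu> E) * sqrt W"
    by (rule mult_right_mono[OF d]) (simp add: W(2))
  finally have P: "L2_norm (edge_measure E) \<psi> \<le> 2 * sqrt (2 * \<mu>) * sqrt (rho_E \<mu> E) * sqrt W" .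
  have "\<bar>\<integral>x. jump \<mu> uh ph E x \<bullet> \<psi> x \<partial>edge_measure E\<bar> \<le> L2_norm (edge_measure E) (jump \<mu> uh ph E) * L2_norm (edge_measure E) \<psi>"
    unfolding pq by (intro L2_Cauchy_Schwarz edge_in_L2(1) cj[unfolded pq] smooth_continuous_on[OF \<psi>])
  also have "\<dots> \<le> (2 * L2_norm (edge_measure E) (edge_residual \<Omega> \<Gamma>N T \<mu> uh ph E)) * (2 * sqrt (2 * \<mu>) * sqrt (rho_E \<mu> E) * sqrt W)"
    by (rule mult_mono[OF J P]) auto
  also have "\<dots> = 4 * sqrt (2 * \<mu>) * (edge_ind E * sqrt W)"
    by (simp add: edge_ind_def algebra_simps)
  finally show ?thesis .
qed

text \<open>The square of three summands costs 3, the factor 2 in front of the edge sum costs 4, and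
  the at most four edges cost another 4. The product 48 is rounded up to 49 to have the root
  7.\<close>

lemma indicator_sum:
  "sqrt (\<Sum>K\<in>T. (elem_ind K + osc_ind K + 2 * (\<Sum>E | E edge_of K. edge_ind E))\<^sup>2)
    \<le> 7 * (eta \<Omega> \<Gamma>N T \<mu> lam fh uh ph + Theta T \<mu> f fh)"
proof -
  have rE: "0 \<le> rho_E \<mu> E" if E: "E edge_of K" and K: "K \<in> T" for E K
  proof -
    obtain p q where "E = closed_segment p q" using edge_segment[OF K E] by metis
    then have "0 \<le> diameter E" by (auto intro!: diameter_ge_0 compact_imp_bounded compact_segment)
    then show ?thesis using \<mu> by (simp add: rho_E_def)
  qed
  have e0: "0 \<le> eta_K_sq \<Omega> \<Gamma>N T \<mu> lam fh uh ph K" "0 \<le> Theta_K_sq \<mu> f fh K" if "K \<in> T" for K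
  proof -
    have "0 \<le> rho_d \<mu> lam" using \<mu> lam by (simp add: rho_d_def)
    then show "0 \<le> eta_K_sq \<Omega> \<Gamma>N T \<mu> lam fh uh ph K"
      unfolding eta_K_sq_def using rE that by (intro add_nonneg_nonneg sum_nonneg mult_nonneg_nonneg) auto
    show "0 \<le> Theta_K_sq \<mu> f fh K" by (simp add: Theta_K_sq_def)
  qed
  have K: "(elem_ind K + osc_ind K + 2 * (\<Sum>E | E edge_of K. edge_ind E))\<^sup>2
      \<le> 49 * (eta_K_sq \<Omega> \<Gamma>N T \<mu> lam fh uh ph K + Theta_K_sq \<mu> f fh K)" if K: "K \<in> T" for K
  proof -
    define r where "r = (\<Sum>E | E edge_of K. edge_ind E)"
    define r2 where "r2 = (\<Sum>E | E edge_of K. (edge_ind E)\<^sup>2)"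
    have "r\<^sup>2 \<le> r2 * card {E. E edge_of K}"
      unfolding r_def r2_def by (rule sum_squared_le_sum_of_squares)
    also have "\<dots> \<le> r2 * 4"
      using card_edges[OF K] by (intro mult_left_mono) (auto simp: r2_def sum_nonneg)
    finally have r: "r\<^sup>2 \<le> 4 * r2" by simp
    have r2: "r2 = (\<Sum>E\<in>{E. E edge_of K}. rho_E \<mu> E * (L2_norm (edge_measure E) (edge_residual \<Omega> \<Gamma>N T \<mu> uh ph E))\<^sup>2)"
      unfolding r2_def edge_ind_def using rE[OF _ K] by (intro sum.cong) (auto simp: power_mult_distrib)
    have d0: "0 \<le> rho_d \<mu> lam * (L2_norm (lebesgue_on K) (div_residual lam uh ph))\<^sup>2"
      using \<mu> lam by (simp add: rho_d_def)
    have eta: "(elem_ind K)\<^sup>2 + r2 \<le> eta_K_sq \<Omega> \<Gamma>N T \<mu> lam fh uh ph K"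
      unfolding eta_K_sq_def r2 elem_ind_def power_mult_distrib using d0 by simp
    have osc: "(osc_ind K)\<^sup>2 = Theta_K_sq \<mu> f fh K"
      by (simp add: osc_ind_def Theta_K_sq_def power_mult_distrib)
    have three: "(x + y + z)\<^sup>2 \<le> 3 * (x\<^sup>2 + y\<^sup>2 + z\<^sup>2)" for x y z :: real
      using norm_sum3_sq[of x y z] by simp
    have "(elem_ind K + osc_ind K + 2 * r)\<^sup>2 \<le> 3 * ((elem_ind K)\<^sup>2 + (osc_ind K)\<^sup>2 + (2 * r)\<^sup>2)"
      by (rule three)
    also have "\<dots> \<le> 48 * ((elem_ind K)\<^sup>2 + r2) + 48 * (osc_ind K)\<^sup>2"
    proof -
      have "(2 * r)\<^sup>2 = 4 * r\<^sup>2" by (simp add: power_mult_distrib)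
      then show ?thesis
        using r zero_le_power2[of "elem_ind K"] zero_le_power2[of "osc_ind K"] by (simp only: distrib_left)
    qed
    also have "\<dots> \<le> 48 * eta_K_sq \<Omega> \<Gamma>N T \<mu> lam fh uh ph K + 48 * Theta_K_sq \<mu> f fh K"
      using eta osc by simp
    also have "\<dots> \<le> 49 * (eta_K_sq \<Omega> \<Gamma>N T \<mu> lam fh uh ph K + Theta_K_sq \<mu> f fh K)"
      using e0[OF K] by simp
    finally show ?thesis by (simp add: r_def)
  qed
  have "sqrt (\<Sum>K\<in>T. (elem_ind K + osc_ind K + 2 * (\<Sum>E | E edge_of K. edge_ind E))\<^sup>2)
      \<le> sqrt (\<Sum>K\<in>T. 49 * (eta_K_sq \<Omega> \<Gamma>N T \<mu> lam fh uh ph K + Theta_K_sq \<mu> f fh K))"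
    by (intro real_sqrt_le_mono sum_mono K)
  also have "\<dots> = 7 * sqrt ((\<Sum>K\<in>T. eta_K_sq \<Omega> \<Gamma>N T \<mu> lam fh uh ph K) + (\<Sum>K\<in>T. Theta_K_sq \<mu> f fh K))"
  proof -
    have sq: "sqrt (49 * x) = 7 * sqrt x" for x :: real
      using real_sqrt_mult[of "7\<^sup>2" x] by simp
    show ?thesis by (simp only: sum_distrib_left[symmetric] sum.distrib sq)
  qed
  also have "\<dots> \<le> 7 * (eta \<Omega> \<Gamma>N T \<mu> lam fh uh ph + Theta T \<mu> f fh)"
    unfolding eta_def Theta_def using e0 by (intro mult_left_mono sqrt_add_le_add_sqrt sum_nonneg) auto
  finally show ?thesis .
qed

text \<open>For a smooth field \<open>\<phi>\<close> with small edge means on \<open>\<Gamma>D\<close>; the Dirichlet edges carry no residual in \<open>eta\<close>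
  and therefore contribute the last sum, which vanishes when \<open>\<phi>\<close> tends to a function that is zero on \<open>\<Gamma>D\<close>.\<close>

lemma residual_smooth:
  fixes \<delta> :: real
  assumes \<phi>: "smooth \<phi>" and \<delta>: "0 \<le> \<delta>"
    and mean: "\<And>p q. closed_segment p q \<in> dirichlet_edges \<Longrightarrow> norm (I01 (\<lambda>s. \<phi> (p + s *\<^sub>R (q - p)))) \<le> \<delta>"
  shows "\<bar>residual \<Omega> \<mu> f uh ph \<phi>\<bar> \<le>
    14 * sqrt (2 * \<mu>) * (eta \<Omega> \<Gamma>N T \<mu> lam fh uh ph + Theta T \<mu> f fh)
      * sqrt (interp_const \<kappa> * (L2_norm L (\<lambda>x. jacobian \<phi> (at x)))\<^sup>2 + 4 * real (card T) * \<delta>\<^sup>2)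
    + (\<Sum>E\<in>dirichlet_edges. L2_norm (edge_measure E) (jump \<mu> uh ph E) * L2_norm (edge_measure E) \<phi>)"
proof -
  define VD where "VD = {z. \<exists>q. closed_segment z q \<in> dirichlet_edges \<and> z \<noteq> q}"
  have DE: "E \<in> all_edges" "E \<subseteq> frontier \<Omega>" if "E \<in> dirichlet_edges" for E
    using that boundary_edges_subset by (auto simp: dirichlet_edges_def boundary_edges_def)
  have VDp: "\<exists>K p q. K \<in> patch z \<and> closed_segment p q edge_of K \<and> norm (I01 (\<lambda>s. \<phi> (p + s *\<^sub>R (q - p)))) \<le> \<delta>"
    if z: "z \<in> VD" for z
  proof -
    obtain q where E: "closed_segment z q \<in> dirichlet_edges" using z by (auto simp: VD_def)
    then obtain K where K: "K \<in> T" "closed_segment z q edge_of K" using DE(1)[OF E] by (auto simp: all_edges_def)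
    then obtain p' q' where "closed_segment z q = closed_segment p' q'" "p' \<in> verts K" "q' \<in> verts K"
      using edge_segment by metis
    then have "z \<in> verts K" by (auto simp: doubleton_eq_iff)
    then have "K \<in> patch z" using K by (simp add: patch_def)
    then show ?thesis using K mean[OF E] by blast
  qed
  obtain c W where c: "\<And>z. z \<in> VD \<Longrightarrow> c z = 0" and W0: "\<And>K. K \<in> T \<Longrightarrow> 0 \<le> W K"
    and WK: "\<And>K. K \<in> T \<Longrightarrow> (L2_norm (lebesgue_on K) (\<lambda>x. \<phi> x - bilin (pa K) (pd K) (pe K) c x))\<^sup>2 \<le> (diameter K)\<^sup>2 * W K"
    and WE: "\<And>K E. K \<in> T \<Longrightarrow> E edge_of K \<Longrightarrow>
      (L2_norm (edge_measure E) (\<lambda>x. \<phi> x - bilin (pa K) (pd K) (pe K) c x))\<^sup>2 \<le> diameter E * W K"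
    and WT: "(\<Sum>K\<in>T. W K) \<le> interp_const \<kappa> * (\<Sum>K\<in>T. (L2_norm (lebesgue_on K) (\<lambda>x. jacobian \<phi> (at x)))\<^sup>2) + 4 * real (card T) * \<delta>\<^sup>2"
  proof (rule quasi_interpolation[OF sh \<phi> \<delta>, of VD])
    show "\<exists>K p q. K \<in> patch z \<and> closed_segment p q edge_of K \<and> norm (I01 (\<lambda>s. \<phi> (p + s *\<^sub>R (q - p)))) \<le> \<delta>"
      if "z \<in> VD" for z using that by (rule VDp)
  qed (rule that)
  have cE: "c p = 0 \<and> c q = 0" if "closed_segment p q \<in> dirichlet_edges" "p \<noteq> q" for p q
  proof -
    have "closed_segment q p \<in> dirichlet_edges" using that(1) by (simp only: closed_segment_commute[of q p])
    then have "p \<in> VD" "q \<in> VD" using that unfolding VD_def by auto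
    then show ?thesis using c by blast
  qed
  have DEzero: "bilin (pa K) (pd K) (pe K) c x = 0" if E: "E \<in> dirichlet_edges" and K: "K \<in> T" "E edge_of K" and x: "x \<in> E" for E K x
  proof -
    obtain p q where pq: "E = closed_segment p q" "p \<noteq> q" using edge_segment[OF K] by metis
    have "x \<in> K" using x K face_of_imp_subset by (auto simp: edge_of_def)
    then show ?thesis
      using interp_edge_zero[of K p q c x] interp_eq[OF K(1)] cE[of p q] E K x pq by auto
  qed
  define \<psi> where "\<psi> K x = \<phi> x - bilin (pa K) (pd K) (pe K) c x" for K x
  have s\<psi>: "smooth (\<psi> K)" for K
    unfolding \<psi>_def[abs_def] by (intro smooth_diff \<phi> smooth_bilin)
  \<comment> \<open>The interpolant vanishes on \<Gamma>D because every point of it lies on a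
    Dirichlet edge, both of whose ends carry the nodal value 0.\<close>
  have "\<exists>v\<in>X0. AE x in L. v x = interp c x"
  proof (rule X0_interp[rule_format], intro conjI ballI continuous_interp bilinear_interp)
    fix x assume "x \<in> \<Gamma>D"
    then obtain E where E: "E \<in> dirichlet_edges" "x \<in> E"
      using fit by (auto simp: boundary_fitted_def dirichlet_edges_def)
    then obtain K where K: "K \<in> T" "E edge_of K" using DE(1)[OF E(1)] by (auto simp: all_edges_def)
    then have "x \<in> K" using E face_of_imp_subset by (auto simp: edge_of_def)
    then show "interp c x = 0" using DEzero[OF E(1) K E(2)] interp_eq[OF K(1)] by simp
  qed
  then obtain v where v: "v \<in> X0" "AE x in L. v x = interp c x" by blast
  have vH: "v \<in> H1 \<Omega>" using v X0 by blast
  note \<phi>H = smooth_H1[OF \<phi>]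
  have zH: "(\<lambda>x. \<phi> x - v x) \<in> H1 \<Omega>" by (rule H1_diff(1)[OF \<phi>H(1) vH])
  have ae: "AE x in lebesgue_on (interior K). \<phi> x - v x = \<psi> K x" if K: "K \<in> T" for K
  proof -
    have "AE x in lebesgue_on (interior K). v x = interp c x"
      by (rule AE_lebesgue_on_subset[OF v(2) interior_subset_\<Omega>[OF K] _ sets_\<Omega>]) simp
    then show ?thesis
    proof (rule lebesgue_on_mono)
      fix x assume "v x = interp c x" "x \<in> interior K"
      then show "\<phi> x - v x = \<psi> K x"
        using interp_eq[OF K, of x c] interior_subset[of K] by (auto simp: \<psi>_def)
    qed
  qed
  define KE where "KE E = (SOME K. K \<in> T \<and> E edge_of K)" for E
  have KE: "KE E \<in> T \<and> E edge_of KE E" if "E \<in> all_edges" for E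
  proof -
    have "\<exists>K. K \<in> T \<and> E edge_of K" using that by (auto simp: all_edges_def)
    then show ?thesis unfolding KE_def by (rule someI_ex)
  qed
  have same: "\<psi> K x = \<psi> K' x" if "K \<in> T" "K' \<in> T" "x \<in> K" "x \<in> K'" for K K' x
    using bilin_consistent[of K x K' c] that by (simp add: \<psi>_def)
  let ?m = "sqrt (2 * \<mu>)"
  let ?A = "\<lambda>K. \<integral>x. (f x + cdiv_mat (stress \<mu> uh ph K) x) \<bullet> \<psi> K x \<partial>lebesgue_on (interior K)"
  let ?B = "\<lambda>E. \<integral>x. jump \<mu> uh ph E x \<bullet> \<psi> (KE E) x \<partial>edge_measure E"
  \<comment> \<open>Galerkin orthogonality; \<open>v\<close> is the representative of the
    interpolant that belongs to \<open>X0\<close>.\<close>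
  have "residual \<Omega> \<mu> f uh ph \<phi> = residual \<Omega> \<mu> f uh ph (\<lambda>x. \<phi> x - v x)"
    using residual_diff[OF f uh ph \<phi>H(1) vH] bspec[OF X0_orth v(1)] by simp
  also have "\<dots> = (\<Sum>K\<in>T. ?A K) - (\<Sum>E\<in>all_edges. ?B E)"
  proof -
    have "(\<Sum>K\<in>T. \<Sum>E | E edge_of K. \<integral>x. (stress \<mu> uh ph K x *v outward_normal K E) \<bullet> \<psi> K x \<partial>edge_measure E)
        = (\<Sum>E\<in>all_edges. ?B E)"
    proof (rule edge_sum_jump[OF f uh ph uhp php])
      show "continuous_on UNIV (\<psi> K)" for K by (rule smooth_continuous_on[OF s\<psi>])
      show "\<psi> K x = \<psi> K' x" if "K \<in> T" "K' \<in> T" "x \<in> K" "x \<in> K'" for K K' x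
        using that by (rule same)
      show "KE E \<in> T \<and> E edge_of KE E" if "E \<in> all_edges" for E using that by (rule KE)
    qed
    moreover have "residual \<Omega> \<mu> f uh ph (\<lambda>x. \<phi> x - v x) = (\<Sum>K\<in>T. ?A K)
        - (\<Sum>K\<in>T. \<Sum>E | E edge_of K. \<integral>x. (stress \<mu> uh ph K x *v outward_normal K E) \<bullet> \<psi> K x \<partial>edge_measure E)"
      by (rule residual_pieces[OF f uh ph uhp php zH]) (use s\<psi> ae in auto)
    ultimately show ?thesis by simp
  qed
  finally have res: "residual \<Omega> \<mu> f uh ph \<phi> = (\<Sum>K\<in>T. ?A K) - (\<Sum>E\<in>all_edges. ?B E)" .
  have A: "\<bar>?A K\<bar> \<le> 2 * ?m * ((elem_ind K + osc_ind K) * sqrt (W K))" if "K \<in> T" for K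
    by (rule element_term[OF that s\<psi> _ W0[OF that]]) (use WK[OF that] in \<open>simp add: \<psi>_def[abs_def]\<close>)
  have ei: "0 \<le> edge_ind E" if E: "E \<in> all_edges" for E
  proof -
    obtain K where K: "K \<in> T" "E edge_of K" using E by (auto simp: all_edges_def)
    obtain p q where "E = closed_segment p q" using edge_segment[OF K] by metis
    then have "0 \<le> diameter E" by (auto intro!: diameter_ge_0 compact_imp_bounded compact_segment)
    then show ?thesis using \<mu> by (simp add: edge_ind_def rho_E_def)
  qed
  let ?J = "\<lambda>E. if E \<in> dirichlet_edges then L2_norm (edge_measure E) (jump \<mu> uh ph E) * L2_norm (edge_measure E) \<phi> else 0"
  \<comment> \<open>The bound through the single element \<open>KE E\<close> is enlarged to a sum
    over all elements at the edge, so that it can be regrouped by elements afterwards. On a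
    Dirichlet edge the interpolant vanishes and \<phi> itself remains.\<close>
  have B: "\<bar>?B E\<bar> \<le> (\<Sum>K\<in>{K \<in> T. E edge_of K}. 4 * ?m * (edge_ind E * sqrt (W K))) + ?J E" if E: "E \<in> all_edges" for E
  proof (cases "E \<in> dirichlet_edges")
    case True
    obtain p q where pq: "E = closed_segment p q" using edge_segment KE[OF E] by metis
    have "?B E = (\<integral>x. jump \<mu> uh ph E x \<bullet> \<phi> x \<partial>edge_measure E)"
    proof (rule Bochner_Integration.integral_cong[OF refl])
      fix x assume "x \<in> space (edge_measure E)"
      then have "x \<in> E" by (simp add: pq)
      then have "\<psi> (KE E) x = \<phi> x" using DEzero[OF True] KE[OF E] by (simp add: \<psi>_def)
      then show "jump \<mu> uh ph E x \<bullet> \<psi> (KE E) x = jump \<mu> uh ph E x \<bullet> \<phi> x" by simp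
    qed
    then have "\<bar>?B E\<bar> \<le> L2_norm (edge_measure E) (jump \<mu> uh ph E) * L2_norm (edge_measure E) \<phi>"
      unfolding pq by (auto intro!: L2_Cauchy_Schwarz edge_in_L2(1) continuous_jump[OF uhp php] smooth_continuous_on[OF \<phi>])
    moreover have "0 \<le> (\<Sum>K\<in>{K \<in> T. E edge_of K}. 4 * ?m * (edge_ind E * sqrt (W K)))"
      using ei[OF E] W0 \<mu> by (intro sum_nonneg mult_nonneg_nonneg) auto
    ultimately show ?thesis using True by simp
  next
    case False
    have "\<bar>?B E\<bar> \<le> 4 * ?m * (edge_ind E * sqrt (W (KE E)))"
      using WE[of "KE E" E] KE[OF E] W0 by (intro edge_term[OF E False s\<psi>]) (auto simp: \<psi>_def[abs_def])
    also have "\<dots> \<le> (\<Sum>K\<in>{K \<in> T. E edge_of K}. 4 * ?m * (edge_ind E * sqrt (W K)))"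
      by (rule member_le_sum) (use KE[OF E] ei[OF E] W0 \<mu> in \<open>auto intro!: mult_nonneg_nonneg\<close>)
    finally show ?thesis using False by simp
  qed
  have sumJ: "(\<Sum>E\<in>all_edges. ?J E) = (\<Sum>E\<in>dirichlet_edges. L2_norm (edge_measure E) (jump \<mu> uh ph E) * L2_norm (edge_measure E) \<phi>)"
    using DE(1) by (subst sum.inter_restrict[symmetric]) (auto intro!: sum.cong)
  have "\<bar>\<Sum>E\<in>all_edges. ?B E\<bar> \<le> (\<Sum>E\<in>all_edges. \<bar>?B E\<bar>)" by (rule sum_abs)
  also have "\<dots> \<le> (\<Sum>E\<in>all_edges. (\<Sum>K\<in>{K \<in> T. E edge_of K}. 4 * ?m * (edge_ind E * sqrt (W K))) + ?J E)"
    by (rule sum_mono[OF B])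
  also have "\<dots> = (\<Sum>E\<in>all_edges. \<Sum>K\<in>{K \<in> T. E edge_of K}. 4 * ?m * (edge_ind E * sqrt (W K))) + (\<Sum>E\<in>all_edges. ?J E)"
    by (rule sum.distrib)
  also have "(\<Sum>E\<in>all_edges. \<Sum>K\<in>{K \<in> T. E edge_of K}. 4 * ?m * (edge_ind E * sqrt (W K)))
      = (\<Sum>K\<in>T. \<Sum>E\<in>{E \<in> all_edges. E edge_of K}. 4 * ?m * (edge_ind E * sqrt (W K)))"
    by (rule sum.swap_restrict) auto
  also have "\<dots> = (\<Sum>K\<in>T. 2 * ?m * ((2 * (\<Sum>E | E edge_of K. edge_ind E)) * sqrt (W K)))"
  proof (rule sum.cong[OF refl])
    fix K assume "K \<in> T"
    then have eq: "{E \<in> all_edges. E edge_of K} = {E. E edge_of K}" by (auto simp: all_edges_def)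
    show "(\<Sum>E\<in>{E \<in> all_edges. E edge_of K}. 4 * ?m * (edge_ind E * sqrt (W K))) = 2 * ?m * ((2 * (\<Sum>E | E edge_of K. edge_ind E)) * sqrt (W K))"
      unfolding eq by (simp add: sum_distrib_left sum_distrib_right mult_ac)
  qed
  finally have Bsum: "\<bar>\<Sum>E\<in>all_edges. ?B E\<bar> \<le> (\<Sum>K\<in>T. 2 * ?m * ((2 * (\<Sum>E | E edge_of K. edge_ind E)) * sqrt (W K))) + (\<Sum>E\<in>all_edges. ?J E)" .
  have Asum: "\<bar>\<Sum>K\<in>T. ?A K\<bar> \<le> (\<Sum>K\<in>T. 2 * ?m * ((elem_ind K + osc_ind K) * sqrt (W K)))"
    by (rule order_trans[OF sum_abs sum_mono[OF A]])
  define b where "b K = elem_ind K + osc_ind K + 2 * (\<Sum>E | E edge_of K. edge_ind E)" for K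
  have "\<bar>residual \<Omega> \<mu> f uh ph \<phi>\<bar> \<le> \<bar>\<Sum>K\<in>T. ?A K\<bar> + \<bar>\<Sum>E\<in>all_edges. ?B E\<bar>"
    unfolding res by (rule abs_triangle_ineq4)
  also have "\<dots> \<le> (\<Sum>K\<in>T. 2 * ?m * ((elem_ind K + osc_ind K) * sqrt (W K)))
      + ((\<Sum>K\<in>T. 2 * ?m * ((2 * (\<Sum>E | E edge_of K. edge_ind E)) * sqrt (W K))) + (\<Sum>E\<in>all_edges. ?J E))"
    by (rule add_mono[OF Asum Bsum])
  also have "\<dots> = 2 * ?m * (\<Sum>K\<in>T. b K * sqrt (W K)) + (\<Sum>E\<in>all_edges. ?J E)"
    by (simp add: b_def sum_distrib_left sum.distrib[symmetric] algebra_simps)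
  also have "\<dots> \<le> 2 * ?m * (sqrt (\<Sum>K\<in>T. (b K)\<^sup>2) * sqrt (\<Sum>K\<in>T. (sqrt (W K))\<^sup>2)) + (\<Sum>E\<in>all_edges. ?J E)"
    using \<mu> by (intro add_right_mono mult_left_mono mult_sum_le_sqrt) auto
  also have "(\<Sum>K\<in>T. (sqrt (W K))\<^sup>2) = (\<Sum>K\<in>T. W K)" using W0 by (intro sum.cong) auto
  \<comment> \<open>The final 14 is the 2 of the element and edge terms times the 7 of
    \<open>indicator_sum\<close>.\<close>
  also have "2 * ?m * (sqrt (\<Sum>K\<in>T. (b K)\<^sup>2) * sqrt (\<Sum>K\<in>T. W K))
      \<le> 2 * ?m * ((7 * (eta \<Omega> \<Gamma>N T \<mu> lam fh uh ph + Theta T \<mu> f fh))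
        * sqrt (interp_const \<kappa> * (L2_norm L (\<lambda>x. jacobian \<phi> (at x)))\<^sup>2 + 4 * real (card T) * \<delta>\<^sup>2))"
  proof (intro mult_left_mono mult_mono)
    show "sqrt (\<Sum>K\<in>T. (b K)\<^sup>2) \<le> 7 * (eta \<Omega> \<Gamma>N T \<mu> lam fh uh ph + Theta T \<mu> f fh)"
      unfolding b_def by (rule indicator_sum)
    then show "0 \<le> 7 * (eta \<Omega> \<Gamma>N T \<mu> lam fh uh ph + Theta T \<mu> f fh)"
      by (rule order_trans[rotated]) (simp add: sum_nonneg)
    have "(\<Sum>K\<in>T. (L2_norm (lebesgue_on K) (\<lambda>x. jacobian \<phi> (at x)))\<^sup>2) = (L2_norm L (\<lambda>x. jacobian \<phi> (at x)))\<^sup>2"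
      unfolding L2_norm_sq[of L] integral_\<Omega>[OF in_L2_integrable[OF jacobian_in_L2[OF \<phi>]]]
      by (intro sum.cong refl) (simp add: L2_norm_interior[OF convex_K lebesgue_K] L2_norm_sq)
    then show "sqrt (\<Sum>K\<in>T. W K) \<le> sqrt (interp_const \<kappa> * (L2_norm L (\<lambda>x. jacobian \<phi> (at x)))\<^sup>2 + 4 * real (card T) * \<delta>\<^sup>2)"
      using WT by simp
  qed (use \<mu> W0 in \<open>auto simp: sum_nonneg\<close>)
  finally show ?thesis by (simp add: sumJ algebra_simps)
qed

lemma \<kappa>_pos: "0 < \<kappa>"
proof -
  have "\<Omega> \<noteq> {}" using lipschitz by (simp add: lipschitz_domain_def)
  then have "closure \<Omega> \<noteq> {}" by simp
  then have "T \<noteq> {}" unfolding Union_T[symmetric] by auto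
  then obtain K where "K \<in> T" by blast
  then show ?thesis using aspect(3)[OF sh _ param(1) param(2)[symmetric]] by blast
qed

text \<open>Fitting of the mesh speaks of relative interiors; for a nondegenerate segment this is
  the open segment.\<close>

lemma dirichlet_segment:
  assumes "closed_segment p q \<in> dirichlet_edges"
  shows "p \<noteq> q" "closed_segment p q \<subseteq> frontier \<Omega>" "open_segment p q \<subseteq> \<Gamma>D"
proof -
  have b: "closed_segment p q \<in> boundary_edges \<Omega> T" "rel_interior (closed_segment p q) \<subseteq> \<Gamma>D"
    using assms by (auto simp: dirichlet_edges_def)
  then show "closed_segment p q \<subseteq> frontier \<Omega>" by (simp add: boundary_edges_def)
  obtain K where "K \<in> T" "closed_segment p q edge_of K" using b(1) by (auto simp: boundary_edges_def)
  then obtain p' q' where "closed_segment p q = closed_segment p' q'" "p' \<noteq> q'" using edge_segment by metis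
  then show "p \<noteq> q" by auto
  then show "open_segment p q \<subseteq> \<Gamma>D" using b(2) by (simp add: rel_interior_closed_segment)
qed

text \<open>The mesh stays fixed while the smooth approximations vary. On Dirichlet edges their
  norms tend to 0, because there the trace of \<open>v\<close> vanishes almost everywhere, and the
  distance to \<open>v\<close> enters through the continuity bound.\<close>

lemma residual_estimate:
  assumes v: "v \<in> H1_E0 \<Omega> \<Gamma>D"
  shows "\<bar>residual \<Omega> \<mu> f uh ph v\<bar> \<le>
    14 * sqrt (interp_const \<kappa>) * sqrt (2 * \<mu>) * (eta \<Omega> \<Gamma>N T \<mu> lam fh uh ph + Theta T \<mu> f fh) * L2_norm L (wgrad \<Omega> v)"
proof -
  have vH: "v \<in> H1 \<Omega>" using v by (simp add: H1_E_def)
  obtain w where tr: "has_trace \<Omega> v w"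
    and w0: "\<And>a b. closed_segment a b \<subseteq> frontier \<Omega> \<Longrightarrow> AE x in segment_measure a b. x \<in> \<Gamma>D \<longrightarrow> w x = 0"
    using v unfolding H1_E_def trace_eq_on_def by blast
  obtain \<phi> where \<phi>: "\<And>n. smooth (\<phi> n)" and lim: "(\<lambda>n. H1_norm \<Omega> (\<lambda>x. \<phi> n x - v x)) \<longlonglongrightarrow> 0"
    and seg: "\<And>a b. closed_segment a b \<subseteq> frontier \<Omega> \<Longrightarrow> (\<lambda>n. L2_norm (segment_measure a b) (\<lambda>x. \<phi> n x - w x)) \<longlonglongrightarrow> 0"
    using tr unfolding has_trace_def by blast
  define h where "h n = H1_norm \<Omega> (\<lambda>x. \<phi> n x - v x)" for n
  have h: "h \<longlonglongrightarrow> 0" using lim by (simp add: h_def[abs_def])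
  have DE: "E \<in> all_edges" if "E \<in> dirichlet_edges" for E
    using that boundary_edges_subset by (auto simp: dirichlet_edges_def)
  have DE_seg: "\<exists>p q. E = closed_segment p q" if E: "E \<in> dirichlet_edges" for E
  proof -
    obtain K where "K \<in> T" "E edge_of K" using DE[OF E] by (auto simp: all_edges_def)
    then show ?thesis using edge_segment by metis
  qed
  have \<phi>0: "(\<lambda>n. L2_norm (edge_measure E) (\<phi> n)) \<longlonglongrightarrow> 0" if E: "E \<in> dirichlet_edges" for E
  proof -
    obtain p q where pq: "E = closed_segment p q" using DE_seg[OF E] by blast
    note d = dirichlet_segment[OF E[unfolded pq]]
    have wL: "in_L2 (segment_measure p q) w" using tr d(2) unfolding has_trace_def by blast
    have ae: "AE x in segment_measure p q. w x = 0"
      using w0[OF d(2)] AE_segment_open[OF d(1)] by eventually_elim (use d(3) in auto)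
    have "L2_norm (edge_measure E) (\<phi> n) = L2_norm (segment_measure p q) (\<lambda>x. \<phi> n x - w x)" for n
    proof -
      have l: "in_L2 (segment_measure p q) (\<phi> n)" by (intro edge_in_L2(2) smooth_continuous_on \<phi>)
      have "L2_norm (edge_measure E) (\<phi> n) = L2_norm (segment_measure p q) (\<phi> n)"
        unfolding pq by (rule edge_L2_sq(2)[symmetric, OF d(1) smooth_continuous_on[OF \<phi>]])
      also have "\<dots> = L2_norm (segment_measure p q) (\<lambda>x. \<phi> n x - w x)"
      proof (rule L2_norm_cong_AE[OF in_L2_measurable[OF l] in_L2_measurable[OF in_L2_diff[OF l wL]]])
        show "AE x in segment_measure p q. \<phi> n x = \<phi> n x - w x" using ae by eventually_elim simp
      qed
      finally show ?thesis .
    qed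
    then show ?thesis using seg[OF d(2)] by simp
  qed
  have fDE: "finite dirichlet_edges" by (rule finite_subset[OF _ finite_all_edges]) (use DE in blast)
  \<comment> \<open>The edge length, written as an integral so that no endpoints have to be chosen.
    By Jensen's inequality an edge mean is at most the edge norm divided by the root of the length;
    summing over all Dirichlet edges gives one \<delta> for all of them.\<close>
  define len where "len E = (\<integral>x. (1::real) \<partial>edge_measure E)" for E
  define \<delta> where "\<delta> n = (\<Sum>E\<in>dirichlet_edges. L2_norm (edge_measure E) (\<phi> n) / sqrt (len E))" for n
  have \<delta>: "\<delta> \<longlonglongrightarrow> 0"
  proof -
    have "\<delta> \<longlonglongrightarrow> (\<Sum>E\<in>dirichlet_edges. 0 / sqrt (len E))"
      unfolding \<delta>_def[abs_def] divide_inverse by (intro tendsto_sum tendsto_mult tendsto_const \<phi>0)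
    then show ?thesis by simp
  qed
  have len0: "0 \<le> len E" for E by (simp add: len_def)
  have \<delta>0: "0 \<le> \<delta> n" for n unfolding \<delta>_def using len0 by (intro sum_nonneg divide_nonneg_nonneg) auto
  have mean: "norm (I01 (\<lambda>s. \<phi> n (p + s *\<^sub>R (q - p)))) \<le> \<delta> n" if E: "closed_segment p q \<in> dirichlet_edges" for p q n
  proof -
    let ?E = "closed_segment p q"
    note d = dirichlet_segment[OF E]
    have len: "len ?E = dist p q" unfolding len_def using edge_integral[OF d(1) continuous_on_const, of "1::real"] by simp
    have c: "continuous_on UNIV (\<lambda>s. \<phi> n (p + s *\<^sub>R (q - p)))"
      by (rule continuous_on_compose2[OF smooth_continuous_on[OF \<phi>, of UNIV]]) (auto intro!: continuous_intros)
    have "(norm (I01 (\<lambda>s. \<phi> n (p + s *\<^sub>R (q - p)))))\<^sup>2 \<le> I01 (\<lambda>s. (norm (\<phi> n (p + s *\<^sub>R (q - p))))\<^sup>2)"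
      by (rule I01_norm_sq_le[OF c])
    also have "\<dots> = (L2_norm (edge_measure ?E) (\<phi> n) / sqrt (len ?E))\<^sup>2"
      using edge_L2_sq(1)[OF d(1) smooth_continuous_on[OF \<phi>], of n] d(1) by (simp add: len power_divide)
    finally have "norm (I01 (\<lambda>s. \<phi> n (p + s *\<^sub>R (q - p)))) \<le> L2_norm (edge_measure ?E) (\<phi> n) / sqrt (len ?E)"
      by (rule power2_le_imp_le) (simp add: len0)
    also have "\<dots> \<le> \<delta> n"
      unfolding \<delta>_def by (rule member_le_sum[OF E _ fDE]) (simp add: len0)
    finally show ?thesis .
  qed
  let ?N = "eta \<Omega> \<Gamma>N T \<mu> lam fh uh ph + Theta T \<mu> f fh"
  define c0 where "c0 = L2_norm L f + L2_norm L (wstress \<mu> uh ph)"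
  define G where "G = L2_norm L (wgrad \<Omega> v)"
  define Z where "Z n = (\<Sum>E\<in>dirichlet_edges. L2_norm (edge_measure E) (jump \<mu> uh ph E) * L2_norm (edge_measure E) (\<phi> n))" for n
  have Z: "Z \<longlonglongrightarrow> 0"
  proof -
    have "Z \<longlonglongrightarrow> (\<Sum>E\<in>dirichlet_edges. L2_norm (edge_measure E) (jump \<mu> uh ph E) * 0)"
      unfolding Z_def[abs_def] by (intro tendsto_sum tendsto_mult tendsto_const \<phi>0)
    then show ?thesis by simp
  qed
  have ic: "0 \<le> interp_const \<kappa>" using \<kappa>_pos by (simp add: interp_const_def)
  have "0 \<le> 7 * ?N"
    using indicator_sum by (rule order_trans[rotated]) (simp add: sum_nonneg)
  then have N0: "0 \<le> ?N" by simp
  have jac: "L2_norm L (\<lambda>x. jacobian (\<phi> n) (at x)) \<le> G + h n" for n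
  proof -
    note H = smooth_H1[OF \<phi>[of n]]
    note d = H1_diff[OF H(1) vH]
    have "L2_norm L (\<lambda>x. jacobian (\<phi> n) (at x)) = L2_norm L (wgrad \<Omega> (\<phi> n))"
      by (rule L2_norm_AE[OF sets_dom wgrad_L2[OF H(1)] H(2), symmetric])
    also have "\<dots> = L2_norm L (\<lambda>x. wgrad \<Omega> v x + (wgrad \<Omega> (\<phi> n) x - wgrad \<Omega> v x))"
      by (rule L2_norm_cong) simp
    also have "\<dots> \<le> G + L2_norm L (\<lambda>x. wgrad \<Omega> (\<phi> n) x - wgrad \<Omega> v x)"
      unfolding G_def by (intro L2_norm_triangle in_L2_diff wgrad_L2 vH H(1))
    also have "L2_norm L (\<lambda>x. wgrad \<Omega> (\<phi> n) x - wgrad \<Omega> v x) = L2_norm L (wgrad \<Omega> (\<lambda>x. \<phi> n x - v x))"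
      by (rule L2_norm_AE[OF sets_dom wgrad_L2[OF d(1)] d(2), symmetric])
    also have "\<dots> \<le> h n" unfolding h_def by (rule L2_le_H1_norm(2))
    finally show ?thesis by simp
  qed
  \<comment> \<open>Everything that depends on the size of the mesh is multiplied here by
    \<open>h n\<close> or \<open>\<delta> n\<close> or is contained in \<open>Z n\<close>, and these
    tend to 0.\<close>
  define B where "B n = 14 * sqrt (2 * \<mu>) * ?N * sqrt (interp_const \<kappa> * (G + h n)\<^sup>2 + 4 * real (card T) * (\<delta> n)\<^sup>2) + Z n + c0 * h n" for n
  have "\<bar>residual \<Omega> \<mu> f uh ph v\<bar> \<le> B n" for n
  proof -
    note H = smooth_H1(1)[OF \<phi>[of n]]
    have "\<bar>residual \<Omega> \<mu> f uh ph v\<bar> \<le> \<bar>residual \<Omega> \<mu> f uh ph (\<phi> n)\<bar> + \<bar>residual \<Omega> \<mu> f uh ph (\<lambda>x. \<phi> n x - v x)\<bar>"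
      unfolding residual_diff[OF f uh ph H vH] by linarith
    also have "\<bar>residual \<Omega> \<mu> f uh ph (\<lambda>x. \<phi> n x - v x)\<bar> \<le> c0 * h n"
      unfolding c0_def h_def by (rule residual_bound[OF f uh ph H1_diff(1)[OF H vH]])
    also have "\<bar>residual \<Omega> \<mu> f uh ph (\<phi> n)\<bar> \<le> 14 * sqrt (2 * \<mu>) * ?N
      * sqrt (interp_const \<kappa> * (L2_norm L (\<lambda>x. jacobian (\<phi> n) (at x)))\<^sup>2 + 4 * real (card T) * (\<delta> n)\<^sup>2) + Z n"
      unfolding Z_def by (rule residual_smooth[OF \<phi> \<delta>0 mean])
    also have "\<dots> \<le> 14 * sqrt (2 * \<mu>) * ?N * sqrt (interp_const \<kappa> * (G + h n)\<^sup>2 + 4 * real (card T) * (\<delta> n)\<^sup>2) + Z n"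
      using \<mu> N0 jac[of n] ic
      by (intro add_right_mono mult_left_mono real_sqrt_le_mono power_mono mult_nonneg_nonneg) auto
    finally show ?thesis by (simp add: B_def)
  qed
  moreover have "B \<longlonglongrightarrow> 14 * sqrt (2 * \<mu>) * ?N * sqrt (interp_const \<kappa> * (G + 0)\<^sup>2 + 4 * real (card T) * 0\<^sup>2) + 0 + c0 * 0"
    unfolding B_def[abs_def] by (intro tendsto_intros h \<delta> Z)
  ultimately have "\<bar>residual \<Omega> \<mu> f uh ph v\<bar> \<le> 14 * sqrt (2 * \<mu>) * ?N * sqrt (interp_const \<kappa> * (G + 0)\<^sup>2 + 4 * real (card T) * 0\<^sup>2) + 0 + c0 * 0"
    by (intro LIMSEQ_le_const[of B]) auto
  also have "\<dots> = 14 * sqrt (interp_const \<kappa>) * sqrt (2 * \<mu>) * ?N * G"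
    by (simp add: real_sqrt_mult G_def)
  finally show ?thesis by (simp add: G_def)
qed

text \<open>No interpolation enters: weak and classical divergence agree almost everywhere on each
  element, and the global norm is the sum of the elementwise parts of the estimator.\<close>

lemma div_residual_estimate:
  "in_L2 L (\<lambda>x. wdiv \<Omega> uh x + (1 / lam) * ph x)"
  "sqrt (rho_d \<mu> lam) * L2_norm L (\<lambda>x. wdiv \<Omega> uh x + (1 / lam) * ph x) \<le> eta \<Omega> \<Gamma>N T \<mu> lam fh uh ph"
proof -
  let ?R = "\<lambda>x. wdiv \<Omega> uh x + (1 / lam) * ph x"
  have rd: "0 \<le> rho_d \<mu> lam" using \<mu> lam by (simp add: rho_d_def)
  show R: "in_L2 L ?R"
    unfolding wdiv_def using in_L2_add[OF in_L2_linear[OF linear_trace wgrad_L2[OF uh]] in_L2_scaleR[OF ph, of "1 / lam"]] by simp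
  have K: "L2_norm (lebesgue_on (interior K)) ?R = L2_norm (lebesgue_on K) (div_residual lam uh ph)" if K: "K \<in> T" for K
  proof -
    have I: "open (interior K)" "interior K \<subseteq> \<Omega>" "interior K \<in> sets lebesgue"
      using interior_subset_\<Omega>[OF K] by auto
    have "AE x in lebesgue_on (interior K). wgrad \<Omega> uh x = jacobian (piece uh K) (at x)"
      by (rule wgrad_local[OF uh I(1,2) piece(1)[OF uhp K]]) (auto intro!: AE_I2 piece(2)[OF uhp K])
    then have "AE x in lebesgue_on (interior K). ?R x = div_residual lam uh ph x"
    proof (rule lebesgue_on_mono)
      fix x assume "wgrad \<Omega> uh x = jacobian (piece uh K) (at x)" "x \<in> interior K"
      then show "?R x = div_residual lam uh ph x"
        by (simp add: wdiv_def div_residual_def cdiv_def jacobian_piece[OF uhp K])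
    qed
    then have "L2_norm (lebesgue_on (interior K)) ?R = L2_norm (lebesgue_on (interior K)) (div_residual lam uh ph)"
      by (rule L2_norm_AE[OF I(3) in_L2_subset[OF R I(2,3) sets_\<Omega>]])
    then show ?thesis by (simp add: L2_norm_interior[OF convex_K[OF K] lebesgue_K[OF K]])
  qed
  have "rho_d \<mu> lam * (L2_norm L ?R)\<^sup>2 = (\<Sum>K\<in>T. rho_d \<mu> lam * (L2_norm (lebesgue_on K) (div_residual lam uh ph))\<^sup>2)"
    unfolding L2_norm_sq[of L] integral_\<Omega>[OF in_L2_integrable[OF R]] sum_distrib_left
    by (intro sum.cong refl) (simp add: K[symmetric] L2_norm_sq)
  also have "\<dots> \<le> (\<Sum>K\<in>T. eta_K_sq \<Omega> \<Gamma>N T \<mu> lam fh uh ph K)"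
  proof (rule sum_mono)
    fix K assume K: "K \<in> T"
    have "0 \<le> rho_E \<mu> E" if E: "E edge_of K" for E
    proof -
      obtain p q where "E = closed_segment p q" using edge_segment[OF K E] by metis
      then have "0 \<le> diameter E" by (auto intro!: diameter_ge_0 compact_imp_bounded compact_segment)
      then show ?thesis using \<mu> by (simp add: rho_E_def)
    qed
    then have "0 \<le> (\<Sum>E\<in>{E. E edge_of K}. rho_E \<mu> E * (L2_norm (edge_measure E) (edge_residual \<Omega> \<Gamma>N T \<mu> uh ph E))\<^sup>2)"
      by (intro sum_nonneg mult_nonneg_nonneg) auto
    then show "rho_d \<mu> lam * (L2_norm (lebesgue_on K) (div_residual lam uh ph))\<^sup>2 \<le> eta_K_sq \<Omega> \<Gamma>N T \<mu> lam fh uh ph K"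
      by (simp add: eta_K_sq_def)
  qed
  finally have "sqrt (rho_d \<mu> lam * (L2_norm L ?R)\<^sup>2) \<le> eta \<Omega> \<Gamma>N T \<mu> lam fh uh ph"
    unfolding eta_def by (rule real_sqrt_le_mono)
  then show "sqrt (rho_d \<mu> lam) * L2_norm L ?R \<le> eta \<Omega> \<Gamma>N T \<mu> lam fh uh ph"
    by (simp add: real_sqrt_mult)
qed

end

end

section \<open>Stability of the mixed formulation\<close>

text \<open>\<open>D\<close> is the coefficient in
  \<open>\<alpha> * X\<^sup>2 / 2 + Z\<^sup>2 / 2 \<le> D * E\<^sup>2\<close>. The three summands
  bound \<open>(1 + k) * X\<close>, the remaining part of \<open>Y\<close>, and \<open>Z\<close>,
  each relative to \<open>E\<close>.\<close>

definition stability_const :: "real \<Rightarrow> real \<Rightarrow> real \<Rightarrow> real" where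
  "stability_const \<alpha> k c = (let D = (c + k)\<^sup>2 / (2 * \<alpha>) + k * c + 1 / 2 in
     sqrt (2 * D / \<alpha>) * (1 + k) + k * c + sqrt (2 * D))"

lemma stability_const_pos:
  assumes "0 < \<alpha>" "0 \<le> k" "0 \<le> c" shows "0 < stability_const \<alpha> k c"
proof -
  define D where "D = (c + k)\<^sup>2 / (2 * \<alpha>) + k * c + 1 / 2"
  have "0 < D" unfolding D_def using assms by (intro add_nonneg_pos add_nonneg_nonneg) auto
  then have "0 \<le> sqrt (2 * D / \<alpha>) * (1 + k)" "0 < sqrt (2 * D)" using assms by auto
  then show ?thesis using assms unfolding stability_const_def D_def[symmetric] Let_def
    by (intro add_nonneg_pos add_nonneg_nonneg) auto
qed

text \<open>\<open>X\<close>, \<open>Y\<close>, \<open>Z\<close> are the three parts of the energy norm of the error; \<open>en\<close> comes from testing with the error and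
  Korn's inequality, \<open>Y\<close> from the inf-sup condition.\<close>

lemma absorb_by_Young:
  fixes X Y Z E :: real
  assumes \<alpha>: "0 < \<alpha>" and k: "0 \<le> k" and c: "0 \<le> c" and E: "0 \<le> E" and X: "0 \<le> X" and Z: "0 \<le> Z"
    and en: "\<alpha> * X\<^sup>2 + Z\<^sup>2 \<le> c * E * X + (Y + Z) * E" and Y: "Y \<le> k * (c * E + X)"
  shows "X + Y + Z \<le> stability_const \<alpha> k c * E"
proof -
  define D where "D = (c + k)\<^sup>2 / (2 * \<alpha>) + k * c + 1 / 2"
  have D0: "0 \<le> D" unfolding D_def using assms by (intro add_nonneg_nonneg) auto
  \<comment> \<open>Young's inequality with the weight for which half of the Korn term absorbs the
    mixed term.\<close>
  have "0 \<le> (\<alpha> * X - (c + k) * E)\<^sup>2 / (2 * \<alpha>)" using \<alpha> by simp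
  also have "\<dots> = \<alpha> * X\<^sup>2 / 2 - (c + k) * E * X + (c + k)\<^sup>2 / (2 * \<alpha>) * E\<^sup>2"
    using \<alpha> by (simp add: field_simps power2_eq_square)
  finally have y1: "(c + k) * E * X \<le> \<alpha> * X\<^sup>2 / 2 + (c + k)\<^sup>2 / (2 * \<alpha>) * E\<^sup>2" by simp
  have y2: "Z * E \<le> Z\<^sup>2 / 2 + E\<^sup>2 / 2"
    using zero_le_power2[of "Z - E"] by (simp add: power2_diff)
  \<comment> \<open>The left side of \<open>en\<close> contains no \<open>Y\<close> that could
    absorb this term; the inf-sup bound converts it into terms in \<open>X\<close> and
    \<open>E\<close>.\<close>
  have "Y * E \<le> k * (c * E + X) * E" by (rule mult_right_mono[OF Y E])
  then have "\<alpha> * X\<^sup>2 + Z\<^sup>2 \<le> (c + k) * E * X + k * c * E\<^sup>2 + Z * E"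
    using en by (simp add: algebra_simps power2_eq_square)
  then have en': "\<alpha> * X\<^sup>2 / 2 + Z\<^sup>2 / 2 \<le> D * E\<^sup>2"
    using y1 y2 by (simp add: D_def distrib_right)
  have "\<alpha> * X\<^sup>2 \<le> 2 * D * E\<^sup>2" using en' zero_le_power2[of Z] unfolding mult.assoc by linarith
  then have "X\<^sup>2 \<le> (2 * D / \<alpha>) * E\<^sup>2" using \<alpha> by (simp add: field_simps)
  then have "X \<le> sqrt ((2 * D / \<alpha>) * E\<^sup>2)" by (rule real_le_rsqrt)
  then have X': "X \<le> sqrt (2 * D / \<alpha>) * E" using E by (simp only: real_sqrt_mult real_sqrt_abs abs_of_nonneg)
  have "Z\<^sup>2 \<le> (2 * D) * E\<^sup>2" using en' mult_nonneg_nonneg[OF less_imp_le[OF \<alpha>] zero_le_power2[of X]] unfolding mult.assoc by linarith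
  then have "Z \<le> sqrt ((2 * D) * E\<^sup>2)" by (rule real_le_rsqrt)
  then have Z': "Z \<le> sqrt (2 * D) * E" using E by (simp only: real_sqrt_mult real_sqrt_abs abs_of_nonneg)
  have "X + Y + Z \<le> (1 + k) * X + k * c * E + Z" using Y by (simp add: algebra_simps)
  also have "\<dots> \<le> (1 + k) * (sqrt (2 * D / \<alpha>) * E) + k * c * E + sqrt (2 * D) * E"
    using k by (intro add_mono mult_left_mono X' Z' order_refl) auto
  also have "\<dots> = stability_const \<alpha> k c * E"
    unfolding stability_const_def D_def[symmetric] Let_def by (simp add: algebra_simps)
  finally show ?thesis .
qed

lemma sqrt_sum_3_squares_le:
  fixes x y z :: real
  assumes "0 \<le> x" "0 \<le> y" "0 \<le> z"
  shows "sqrt (x\<^sup>2 + y\<^sup>2 + z\<^sup>2) \<le> x + y + z"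
proof (rule real_le_lsqrt)
  have "(x + y + z)\<^sup>2 = x\<^sup>2 + y\<^sup>2 + z\<^sup>2 + 2 * (x * y + x * z + y * z)"
    by (simp add: power2_eq_square algebra_simps)
  then show "x\<^sup>2 + y\<^sup>2 + z\<^sup>2 \<le> (x + y + z)\<^sup>2" using assms by simp
qed (use assms in simp_all)

lemma energy_norm_le:
  assumes \<mu>: "0 < \<mu>" and lam: "0 < lam"
  shows "energy_norm \<Omega> \<mu> lam u p \<le> sqrt (2 * \<mu>) * L2_norm (lebesgue_on \<Omega>) (wgrad \<Omega> u)
    + L2_norm (lebesgue_on \<Omega>) p / sqrt (2 * \<mu>) + L2_norm (lebesgue_on \<Omega>) p / sqrt lam"
proof -
  have "(sqrt (2 * \<mu>) * x)\<^sup>2 = 2 * \<mu> * x\<^sup>2" for x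
    unfolding power_mult_distrib using \<mu> by simp
  moreover have "(y / sqrt r)\<^sup>2 = inverse r * y\<^sup>2" if "0 < r" for r y :: real
    unfolding power_divide using that by (simp add: divide_inverse)
  ultimately have "energy_norm \<Omega> \<mu> lam u p = sqrt ((sqrt (2 * \<mu>) * L2_norm (lebesgue_on \<Omega>) (wgrad \<Omega> u))\<^sup>2
    + (L2_norm (lebesgue_on \<Omega>) p / sqrt (2 * \<mu>))\<^sup>2 + (L2_norm (lebesgue_on \<Omega>) p / sqrt lam)\<^sup>2)"
    unfolding energy_norm_def using \<mu> lam by (simp only: mult_pos_pos zero_less_numeral)
  then show ?thesis
    by (simp only:) (rule sqrt_sum_3_squares_le, use \<mu> lam in auto)
qed

context domain
begin

lemma form_a_bound:
  assumes u: "u \<in> H1 \<Omega>" and v: "v \<in> H1 \<Omega>" and \<mu>: "0 \<le> \<mu>"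
  shows "\<bar>form_a \<Omega> \<mu> u v\<bar> \<le> 2 * \<mu> * (L2_norm L (wgrad \<Omega> u) * L2_norm L (wgrad \<Omega> v))"
proof -
  have s: "in_L2 L (strain \<Omega> w)" "L2_norm L (strain \<Omega> w) \<le> L2_norm L (wgrad \<Omega> w)" if w: "w \<in> H1 \<Omega>" for w
  proof -
    show "in_L2 L (strain \<Omega> w)" unfolding strain_def by (rule in_L2_linear[OF linear_sym_part wgrad_L2[OF w]])
    show "L2_norm L (strain \<Omega> w) \<le> L2_norm L (wgrad \<Omega> w)"
      using L2_norm_dominated[OF wgrad_L2[OF w], of 1 "strain \<Omega> w"] by (simp add: strain_def norm_sym_part_le)
  qed
  have "\<bar>\<integral>x. strain \<Omega> u x \<bullet> strain \<Omega> v x \<partial>L\<bar> \<le> L2_norm L (strain \<Omega> u) * L2_norm L (strain \<Omega> v)"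
    by (rule L2_Cauchy_Schwarz[OF s(1)[OF u] s(1)[OF v]])
  also have "\<dots> \<le> L2_norm L (wgrad \<Omega> u) * L2_norm L (wgrad \<Omega> v)"
    by (intro mult_mono s(2) u v) auto
  finally show ?thesis
    unfolding form_a_def abs_mult using \<mu> by (simp add: mult_left_mono)
qed

text \<open>The supremum need not be attained, but some field exceeds half of \<open>C\<close>; this
  is the origin of the 2 in \<open>2 / C\<close>.\<close>

lemma inf_sup_pressure:
  assumes C: "0 < C" "inf_sup_estimate \<Omega> \<Gamma> C" and q: "in_L2 L q"
    and A: "\<And>v. v \<in> H1_E0 \<Omega> \<Gamma> \<Longrightarrow> form_b \<Omega> v q \<le> A * L2_norm L (wgrad \<Omega> v)" and A0: "0 \<le> A"
  shows "L2_norm L q \<le> 2 / C * A"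
proof (cases "L2_norm L q = 0")
  case True
  then show ?thesis using C A0 by simp
next
  case False
  let ?q = "\<lambda>v. form_b \<Omega> v q / (L2_norm L (wgrad \<Omega> v) * L2_norm L q)"
  have "ereal (C / 2) < ereal C" using C by simp
  also have "\<dots> \<le> (SUP v \<in> {v \<in> H1_E0 \<Omega> \<Gamma>. L2_norm L v \<noteq> 0}. ereal (?q v))"
    using C(2) unfolding inf_sup_estimate_def
    by (rule order_trans) (rule INF_lower, use q False in simp)
  finally obtain v where v: "v \<in> H1_E0 \<Omega> \<Gamma>" "C / 2 < ?q v"
    unfolding less_SUP_iff by auto
  \<comment> \<open>With a vanishing gradient the quotient is 0 by the convention for division,
    which contradicts \<open>C / 2 < ?q v\<close>.\<close>
  have g: "0 < L2_norm L (wgrad \<Omega> v)"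
  proof (rule ccontr)
    assume "\<not> 0 < L2_norm L (wgrad \<Omega> v)"
    then have "L2_norm L (wgrad \<Omega> v) = 0" by (simp add: order_antisym)
    then show False using v(2) C by simp
  qed
  have p: "0 < L2_norm L q" using False by (simp add: order_le_neq_trans)
  have "C / 2 * (L2_norm L (wgrad \<Omega> v) * L2_norm L q) \<le> form_b \<Omega> v q"
    using v(2) g p by (simp add: pos_less_divide_eq less_imp_le)
  also have "\<dots> \<le> A * L2_norm L (wgrad \<Omega> v)" by (rule A[OF v(1)])
  finally have "L2_norm L (wgrad \<Omega> v) * (C / 2 * L2_norm L q) \<le> L2_norm L (wgrad \<Omega> v) * A"
    by (simp add: mult_ac)
  then have "C / 2 * L2_norm L q \<le> A" using g by (simp only: mult_le_cancel_left_pos)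
  then show ?thesis using C by (simp add: field_simps)
qed

text \<open>The momentum estimate is used twice: with an arbitrary field it bounds the pressure
  error by the inf-sup condition, with the error itself it gives the Korn term. In the latter the
  coupling term is replaced by \<open>mass\<close>, which supplies the square of the
  \<lambda>-weighted pressure error with the right sign.\<close>

lemma stability:
  assumes \<alpha>: "0 < \<alpha>" "korn_estimate \<Omega> \<Gamma> \<alpha>" and \<beta>: "0 < \<beta>" "inf_sup_estimate \<Omega> \<Gamma> \<beta>"
    and \<mu>: "0 < \<mu>" and lam: "0 < lam" and c: "0 \<le> c" and E: "0 \<le> E"
    and e: "e \<in> H1_E0 \<Omega> \<Gamma>" and \<epsilon>: "in_L2 L \<epsilon>" and R: "in_L2 L R" "sqrt (rho_d \<mu> lam) * L2_norm L R \<le> E"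
    and momentum: "\<And>v. v \<in> H1_E0 \<Omega> \<Gamma> \<Longrightarrow>
      \<bar>form_a \<Omega> \<mu> e v + form_b \<Omega> v \<epsilon>\<bar> \<le> c * E * sqrt (2 * \<mu>) * L2_norm L (wgrad \<Omega> v)"
    and mass: "form_b \<Omega> e \<epsilon> = (\<integral>x. \<epsilon> x * \<epsilon> x \<partial>L) / lam + (\<integral>x. \<epsilon> x * R x \<partial>L)"
  shows "energy_norm \<Omega> \<mu> lam e \<epsilon> \<le> stability_const \<alpha> (2 / \<beta>) c * E"
proof -
  define m where "m = sqrt (2 * \<mu>)"
  define X Y Z where "X = m * L2_norm L (wgrad \<Omega> e)" and "Y = L2_norm L \<epsilon> / m" and "Z = L2_norm L \<epsilon> / sqrt lam"
  have m: "0 < m" "m\<^sup>2 = 2 * \<mu>" using \<mu> by (auto simp: m_def)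
  have eH: "e \<in> H1 \<Omega>" using e by (simp add: H1_E_def)
  have X0: "0 \<le> X" and Y0: "0 \<le> Y" and Z0: "0 \<le> Z" using m lam by (auto simp: X_def Y_def Z_def)
  have press: "L2_norm L \<epsilon> \<le> 2 / \<beta> * (m * (c * E + X))"
  proof (rule inf_sup_pressure[OF \<beta> \<epsilon>])
    fix v assume v: "v \<in> H1_E0 \<Omega> \<Gamma>"
    have vH: "v \<in> H1 \<Omega>" using v by (simp add: H1_E_def)
    have "form_b \<Omega> v \<epsilon> \<le> c * E * m * L2_norm L (wgrad \<Omega> v) + m\<^sup>2 * (L2_norm L (wgrad \<Omega> e) * L2_norm L (wgrad \<Omega> v))"
      using momentum[OF v] form_a_bound[OF eH vH less_imp_le[OF \<mu>]] unfolding m_def[symmetric] m(2) by linarith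
    then show "form_b \<Omega> v \<epsilon> \<le> m * (c * E + X) * L2_norm L (wgrad \<Omega> v)"
      by (simp add: X_def algebra_simps power2_eq_square)
  qed (use m c E X0 in simp)
  have Y: "Y \<le> 2 / \<beta> * (c * E + X)"
    unfolding Y_def using press m(1) by (simp add: pos_divide_le_eq mult_ac)
  have "\<bar>\<integral>x. \<epsilon> x * R x \<partial>L\<bar> \<le> L2_norm L \<epsilon> * L2_norm L R"
    using L2_Cauchy_Schwarz[OF \<epsilon> R(1)] by simp
  also have "\<dots> \<le> (Y + Z) * E"
  proof -
    \<comment> \<open>\<open>s\<close> is the inverse of \<open>rho_d\<close>. Its root is at most
      the sum of the two pressure weights, so the product of pressure error and divergence residual
      splits into \<open>(Y + Z) * E\<close> without any loss in \<mu> or \<lambda>.\<close>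
    define s where "s = inverse lam + inverse (2 * \<mu>)"
    have s: "0 < s" using \<mu> lam by (simp add: s_def add_pos_pos)
    have "sqrt s \<le> inverse (sqrt lam) + inverse m"
      unfolding s_def m_def real_sqrt_inverse[symmetric] using \<mu> lam by (intro sqrt_add_le_add_sqrt) auto
    then have 1: "L2_norm L \<epsilon> * sqrt s \<le> Y + Z"
      unfolding Y_def Z_def divide_inverse distrib_left[symmetric] by (intro mult_left_mono) auto
    have 2: "L2_norm L R / sqrt s \<le> E"
      using R(2) unfolding rho_d_def s_def[symmetric] by (simp add: real_sqrt_inverse divide_inverse mult.commute)
    have "L2_norm L \<epsilon> * L2_norm L R = (L2_norm L \<epsilon> * sqrt s) * (L2_norm L R / sqrt s)"
      using s by simp
    also have "\<dots> \<le> (Y + Z) * E"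
      using 1 2 Y0 Z0 s by (intro mult_mono) auto
    finally show ?thesis .
  qed
  finally have R': "- ((Y + Z) * E) \<le> (\<integral>x. \<epsilon> x * R x \<partial>L)" by linarith
  have sq: "(\<integral>x. \<epsilon> x * \<epsilon> x \<partial>L) / lam = Z\<^sup>2"
    using lam L2_norm_sq[of L \<epsilon>] by (simp add: Z_def power_divide power2_eq_square)
  have korn: "\<alpha> * X\<^sup>2 \<le> form_a \<Omega> \<mu> e e"
    using \<alpha>(2) \<mu> e unfolding korn_estimate_def X_def power_mult_distrib m(2) by (simp add: mult.assoc)
  have "form_a \<Omega> \<mu> e e + form_b \<Omega> e \<epsilon> \<le> c * E * X"
    using momentum[OF e] unfolding m_def[symmetric] X_def by (simp add: mult.assoc)
  then have "\<alpha> * X\<^sup>2 + Z\<^sup>2 \<le> c * E * X + (Y + Z) * E"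
    using korn R' unfolding mass sq by linarith
  then have "X + Y + Z \<le> stability_const \<alpha> (2 / \<beta>) c * E"
    using \<beta>(1) by (intro absorb_by_Young[OF \<alpha>(1) _ c E X0 Z0 _ Y]) simp_all
  then show ?thesis
    using energy_norm_le[OF \<mu> lam, of \<Omega> e \<epsilon>] unfolding X_def Y_def Z_def m_def by linarith
qed

text \<open>The error equation for the momentum balance: the load is eliminated with the exact
  solution.\<close>

lemma residual_weak_solution:
  assumes u: "u \<in> H1 \<Omega>" and uh: "uh \<in> H1 \<Omega>" and v: "v \<in> H1 \<Omega>" and p: "in_L2 L p" and ph: "in_L2 L ph"
    and sol: "form_a \<Omega> \<mu> u v + form_b \<Omega> v p = load \<Omega> f v"
  shows "form_a \<Omega> \<mu> (\<lambda>x. u x - uh x) v + form_b \<Omega> v (\<lambda>x. p x - ph x) = residual \<Omega> \<mu> f uh ph v"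
proof -
  have st: "in_L2 L (strain \<Omega> w)" if w: "w \<in> H1 \<Omega>" for w
    unfolding strain_def by (rule in_L2_linear[OF linear_sym_part wgrad_L2[OF w]])
  have dv: "in_L2 L (wdiv \<Omega> v)" unfolding wdiv_def by (rule in_L2_linear[OF linear_trace wgrad_L2[OF v]])
  note d = H1_diff[OF u uh]
  have i: "integrable L (\<lambda>x. strain \<Omega> w x \<bullet> strain \<Omega> v x)" if w: "w \<in> H1 \<Omega>" for w
    by (rule in_L2_inner_integrable[OF st[OF w] st[OF v]])
  have j: "integrable L (\<lambda>x. q x * wdiv \<Omega> v x)" if "in_L2 L q" for q
    by (rule in_L2_mult_integrable[OF that dv])
  have "(\<integral>x. strain \<Omega> (\<lambda>x. u x - uh x) x \<bullet> strain \<Omega> v x \<partial>L)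
      = (\<integral>x. strain \<Omega> u x \<bullet> strain \<Omega> v x - strain \<Omega> uh x \<bullet> strain \<Omega> v x \<partial>L)"
  proof (rule integral_cong_AE)
    show "AE x in L. strain \<Omega> (\<lambda>x. u x - uh x) x \<bullet> strain \<Omega> v x = strain \<Omega> u x \<bullet> strain \<Omega> v x - strain \<Omega> uh x \<bullet> strain \<Omega> v x"
      using d(2) by eventually_elim
        (simp add: strain_def linear_diff[OF bounded_linear.linear[OF linear_sym_part]] inner_diff_left)
  qed (use i[OF d(1)] i[OF u] i[OF uh] in \<open>auto intro: borel_measurable_integrable borel_measurable_diff\<close>)
  then have "form_a \<Omega> \<mu> (\<lambda>x. u x - uh x) v = form_a \<Omega> \<mu> u v - form_a \<Omega> \<mu> uh v"
    using i[OF u] i[OF uh] by (simp add: form_a_def right_diff_distrib)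
  moreover have "form_b \<Omega> v (\<lambda>x. p x - ph x) = form_b \<Omega> v p - form_b \<Omega> v ph"
    using j[OF p] j[OF ph] by (simp add: form_b_def left_diff_distrib)
  ultimately show ?thesis using sol by (simp add: residual_def)
qed

text \<open>The exact mass equation is tested with the pressure error itself, which may be any
  square-integrable function. Writing \<open>p\<close> as the error plus \<open>ph\<close> separates
  the square from the divergence residual.\<close>

lemma form_b_mass:
  assumes u: "u \<in> H1 \<Omega>" and uh: "uh \<in> H1 \<Omega>" and p: "in_L2 L p" and ph: "in_L2 L ph"
    and sol: "\<And>q. in_L2 L q \<Longrightarrow> form_b \<Omega> u q - form_c \<Omega> lam p q = 0"
  defines "\<epsilon> \<equiv> \<lambda>x. p x - ph x"
  shows "form_b \<Omega> (\<lambda>x. u x - uh x) \<epsilon>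
    = (\<integral>x. \<epsilon> x * \<epsilon> x \<partial>L) / lam + (\<integral>x. \<epsilon> x * (wdiv \<Omega> uh x + (1 / lam) * ph x) \<partial>L)"
proof -
  have \<epsilon>: "in_L2 L \<epsilon>" unfolding \<epsilon>_def by (rule in_L2_diff[OF p ph])
  have dv: "in_L2 L (wdiv \<Omega> w)" if "w \<in> H1 \<Omega>" for w
    unfolding wdiv_def by (rule in_L2_linear[OF linear_trace wgrad_L2[OF that]])
  note d = H1_diff[OF u uh]
  note i = in_L2_mult_integrable[OF \<epsilon> dv[OF u]] in_L2_mult_integrable[OF \<epsilon> dv[OF uh]]
    in_L2_mult_integrable[OF \<epsilon> ph] in_L2_mult_integrable[OF \<epsilon> p] in_L2_mult_integrable[OF \<epsilon> \<epsilon>]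
  have "(\<integral>x. \<epsilon> x * wdiv \<Omega> (\<lambda>x. u x - uh x) x \<partial>L) = (\<integral>x. \<epsilon> x * wdiv \<Omega> u x - \<epsilon> x * wdiv \<Omega> uh x \<partial>L)"
  proof (rule integral_cong_AE)
    show "AE x in L. \<epsilon> x * wdiv \<Omega> (\<lambda>x. u x - uh x) x = \<epsilon> x * wdiv \<Omega> u x - \<epsilon> x * wdiv \<Omega> uh x"
      using d(2) by eventually_elim (simp add: wdiv_def linear_diff[OF bounded_linear.linear[OF linear_trace]] right_diff_distrib)
  qed (use i in_L2_mult_integrable[OF \<epsilon> dv[OF d(1)]] in \<open>auto intro: borel_measurable_integrable borel_measurable_diff\<close>)
  then have "form_b \<Omega> (\<lambda>x. u x - uh x) \<epsilon> = form_b \<Omega> u \<epsilon> + (\<integral>x. \<epsilon> x * wdiv \<Omega> uh x \<partial>L)"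
    using i by (simp add: form_b_def)
  also have "form_b \<Omega> u \<epsilon> = (\<integral>x. p x * \<epsilon> x \<partial>L) / lam"
    using sol[OF \<epsilon>] by (simp add: form_c_def)
  also have "(\<integral>x. p x * \<epsilon> x \<partial>L) = (\<integral>x. \<epsilon> x * \<epsilon> x + \<epsilon> x * ph x \<partial>L)"
    by (rule Bochner_Integration.integral_cong) (simp_all add: \<epsilon>_def algebra_simps)
  also have "\<dots> = (\<integral>x. \<epsilon> x * \<epsilon> x \<partial>L) + (\<integral>x. \<epsilon> x * ph x \<partial>L)" using i by simp
  also have "(\<integral>x. \<epsilon> x * (wdiv \<Omega> uh x + (1 / lam) * ph x) \<partial>L) = (\<integral>x. \<epsilon> x * wdiv \<Omega> uh x + (1 / lam) * (\<epsilon> x * ph x) \<partial>L)"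
    by (rule Bochner_Integration.integral_cong) (simp_all add: algebra_simps)
  then have "(\<integral>x. \<epsilon> x * (wdiv \<Omega> uh x + (1 / lam) * ph x) \<partial>L) = (\<integral>x. \<epsilon> x * wdiv \<Omega> uh x \<partial>L) + (\<integral>x. \<epsilon> x * ph x \<partial>L) / lam"
    using i by simp
  ultimately show ?thesis by (simp add: add_divide_distrib)
qed

end

theorem theorem3p1:
  fixes \<Omega> \<Gamma>D \<Gamma>N :: "(real^2) set" and CK C\<Omega> \<kappa> :: real and kX kM kf :: nat
  assumes "bounded_lipschitz_polygon \<Omega>"
    and "\<Gamma>D \<union> \<Gamma>N = frontier \<Omega>" and "\<Gamma>D \<inter> \<Gamma>N = {}"
    and "CK > 0" and "korn_estimate \<Omega> \<Gamma>D CK"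
    and "C\<Omega> > 0" and "inf_sup_estimate \<Omega> \<Gamma>D C\<Omega>"
  shows "\<exists>C>0. \<forall>\<mu>1 \<mu>2 \<mu> lam :: real. \<forall>f g u uh fh :: real^2 \<Rightarrow> real^2. \<forall>p ph :: real^2 \<Rightarrow> real.
           \<forall>T XE X0 Mh.
      0 < \<mu>1 \<and> \<mu>1 < \<mu> \<and> \<mu> < \<mu>2 \<and> 0 < lam \<and>
      in_L2 (lebesgue_on \<Omega>) f \<and> boundary_datum \<Omega> \<Gamma>D g \<and>
      conforming_mesh \<Omega> T \<and> shape_regular \<kappa> T \<and> boundary_fitted \<Omega> \<Gamma>D \<Gamma>N T \<and>
      fe_spaces \<Omega> \<Gamma>D T kX kM g XE X0 Mh \<and> pw_poly T kf fh \<and>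
      weak_solution \<Omega> \<Gamma>D \<mu> lam f g u p \<and>
      mixed_approximation \<Omega> \<mu> lam f XE X0 Mh uh ph
      \<longrightarrow> energy_norm \<Omega> \<mu> lam (\<lambda>x. u x - uh x) (\<lambda>x. p x - ph x)
            \<le> C * (eta \<Omega> \<Gamma>N T \<mu> lam fh uh ph + Theta T \<mu> f fh)"
proof -
  \<comment> \<open>The constant is fixed before any mesh is given, at a stage where \<kappa> is an
    arbitrary real; the absolute value makes it nonnegative without using the sign of
    \<kappa>.\<close>
  define c where "c = \<bar>14 * sqrt (interp_const \<kappa>)\<bar>"
  show ?thesis
  proof (intro exI[of _ "stability_const CK (2 / C\<Omega>) c"] conjI allI impI; (elim conjE)?)
    show "0 < stability_const CK (2 / C\<Omega>) c"
      using assms(4,6) by (intro stability_const_pos) (simp_all add: c_def)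
    fix \<mu>1 \<mu>2 \<mu> lam :: real and f g u uh fh :: "real^2 \<Rightarrow> real^2" and p ph :: "real^2 \<Rightarrow> real" and T XE X0 Mh
    assume \<mu>1: "0 < \<mu>1" "\<mu>1 < \<mu>" and lam: "0 < lam" and f: "in_L2 (lebesgue_on \<Omega>) f"
      and conf: "conforming_mesh \<Omega> T" and sh: "shape_regular \<kappa> T" and fit: "boundary_fitted \<Omega> \<Gamma>D \<Gamma>N T"
      and fe: "fe_spaces \<Omega> \<Gamma>D T kX kM g XE X0 Mh" and fhp: "pw_poly T kf fh"
      and sol: "weak_solution \<Omega> \<Gamma>D \<mu> lam f g u p" and app: "mixed_approximation \<Omega> \<mu> lam f XE X0 Mh uh ph"
    interpret mesh \<Omega> T by unfold_locales (fact assms(1), fact conf)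
    have \<mu>: "0 < \<mu>" using \<mu>1 by simp
    have uE: "u \<in> H1_E \<Omega> \<Gamma>D g" and p: "in_L2 L p"
      and mom: "\<And>v. v \<in> H1_E0 \<Omega> \<Gamma>D \<Longrightarrow> form_a \<Omega> \<mu> u v + form_b \<Omega> v p = load \<Omega> f v"
      and mass: "\<And>q. in_L2 L q \<Longrightarrow> form_b \<Omega> u q - form_c \<Omega> lam p q = 0"
      using sol unfolding weak_solution_def by blast+
    have uhE: "uh \<in> H1_E \<Omega> \<Gamma>D g" and phM: "ph \<in> Mh"
      and gal: "\<And>v. v \<in> X0 \<Longrightarrow> form_a \<Omega> \<mu> uh v + form_b \<Omega> v ph = load \<Omega> f v"
      using app fe unfolding mixed_approximation_def fe_spaces_def by blast+
    have X0E: "X0 \<subseteq> H1_E0 \<Omega> \<Gamma>D" and X0p: "\<And>v. v \<in> X0 \<Longrightarrow> pw_poly T kX v"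
      and Mp: "in_L2 L ph" "pw_poly T kM ph"
      using fe phM unfolding fe_spaces_def by blast+
    obtain gh where gh: "pw_poly T kX gh" "XE = (\<lambda>v x. gh x + v x) ` X0"
      using fe unfolding fe_spaces_def by blast
    then obtain v0 where v0: "v0 \<in> X0" "uh = (\<lambda>x. gh x + v0 x)"
      using app unfolding mixed_approximation_def by blast
    have uhp: "pw_smooth T uh"
      unfolding v0(2) by (rule pw_smooth_add[OF pw_poly_smooth[OF gh(1)] pw_poly_smooth[OF X0p[OF v0(1)]]])
    have H: "u \<in> H1 \<Omega>" "uh \<in> H1 \<Omega>" using uE uhE by (auto simp: H1_E_def)
    have X0H: "X0 \<subseteq> H1 \<Omega>" using X0E by (auto simp: H1_E_def)
    have interp: "\<forall>w. continuous_on (closure \<Omega>) w \<and> (\<forall>K\<in>T. bilinear_on_rectangle K w) \<and> (\<forall>x\<in>\<Gamma>D. w x = 0) \<longrightarrow>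
        (\<exists>v\<in>X0. AE x in L. v x = w x)"
      using fe unfolding fe_spaces_def by (elim conjE)
    \<comment> \<open>The discrete momentum equation is exactly the vanishing of the residual on
      \<open>X0\<close>.\<close>
    have orth: "\<forall>v\<in>X0. residual \<Omega> \<mu> f uh ph v = 0"
      by (simp add: residual_def flip: gal)
    note est = residual_estimate[OF f H(2) Mp(1) uhp pw_poly_smooth[OF Mp(2)] pw_poly_smooth[OF fhp] \<mu> lam sh fit X0H interp orth]
    note div = div_residual_estimate[OF f H(2) Mp(1) uhp pw_poly_smooth[OF Mp(2)] pw_poly_smooth[OF fhp] \<mu> lam sh fit X0H interp orth]
    let ?E = "eta \<Omega> \<Gamma>N T \<mu> lam fh uh ph + Theta T \<mu> f fh"
    have "0 \<le> Theta T \<mu> f fh" unfolding Theta_def Theta_K_sq_def by (intro real_sqrt_ge_zero sum_nonneg mult_nonneg_nonneg) auto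
    then have div': "sqrt (rho_d \<mu> lam) * L2_norm L (\<lambda>x. wdiv \<Omega> uh x + (1 / lam) * ph x) \<le> ?E"
      using div(2) by linarith
    have "0 \<le> sqrt (rho_d \<mu> lam) * L2_norm L (\<lambda>x. wdiv \<Omega> uh x + (1 / lam) * ph x)"
      using \<mu> lam by (simp add: rho_d_def)
    then have E0: "0 \<le> ?E" using div' by linarith
    show "energy_norm \<Omega> \<mu> lam (\<lambda>x. u x - uh x) (\<lambda>x. p x - ph x) \<le> stability_const CK (2 / C\<Omega>) c * ?E"
    proof (rule stability[OF assms(4-7) \<mu> lam _ E0 H1_E_diff[OF uE uhE] in_L2_diff[OF p Mp(1)] div(1) div' _
          form_b_mass[OF H p Mp(1) mass]])
      show "0 \<le> c" by (simp add: c_def)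
      fix v assume v: "v \<in> H1_E0 \<Omega> \<Gamma>D"
      then have vH: "v \<in> H1 \<Omega>" by (simp add: H1_E_def)
      have "\<bar>residual \<Omega> \<mu> f uh ph v\<bar> \<le> 14 * sqrt (interp_const \<kappa>) * (sqrt (2 * \<mu>) * ?E * L2_norm L (wgrad \<Omega> v))"
        using est[OF v] by (simp add: mult.assoc)
      also have "\<dots> \<le> c * (sqrt (2 * \<mu>) * ?E * L2_norm L (wgrad \<Omega> v))"
        unfolding c_def using E0 \<mu> by (intro mult_right_mono mult_nonneg_nonneg) auto
      finally show "\<bar>form_a \<Omega> \<mu> (\<lambda>x. u x - uh x) v + form_b \<Omega> v (\<lambda>x. p x - ph x)\<bar> \<le> c * ?E * sqrt (2 * \<mu>) * L2_norm L (wgrad \<Omega> v)"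
        unfolding residual_weak_solution[OF H vH p Mp(1) mom[OF v]] by (simp add: mult_ac)
    qed
  qed
qed

end
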